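(* Let $p$ be a prime number and let $q=p$ or $q=p^2$. Let $\mathbb{Q}^{[q]}$ be the compositum of all totally real Galois extensions of $\mathbb{Q}$ of degree exactly $q$. Then for every field $K$ with $\mathbb{Q}\subseteq K\subseteq \mathbb{Q}^{[q]}$ and $[K:\mathbb{Q}]=\infty$, there are no universal quadratic lattices over $K$.
   Context: An algebraic number is totally real (resp. totally positive) if all its conjugates, i.e. all roots of its minimal polynomial over $\mathbb{Q}$, are real (resp. positive real). A totally real field is an algebraic extension of $\mathbb{Q}$ (of finite or infinite degree) all of whose elements are totally real. For an algebraic extension $K/\mathbb{Q}$, $\mathcal{O}_K$ is the ring of elements of $K$ integral over $\mathbb{Z}$. Let $K$ be a totally real field. An $\mathcal{O}_K$-lattice is a finitely generated $\mathcal{O}_K$-module $\Lambda\subseteq V$, where $V$ is a finite-dimensional $K$-vector space. A quadratic map on $V$ is a map $Q:V\to K$ with $Q(av)=a^2Q(v)$ for all $a\in K$, $v\in V$, such that $B_Q(v,w)=\frac12(Q(v+w)-Q(v)-Q(w))$ is bilinear. A quadratic lattice over $K$ (quadratic $\mathcal{O}_K$-lattice) is a pair $(\Lambda,Q)$ of an $\mathcal{O}_K$-lattice and the restriction of a quadratic map to $\Lambda$. It is integral if $Q(\Lambda)\subseteq\mathcal{O}_K$; an integral quadratic lattice is positive definite if $Q(v)$ is totally positive for every $0\neq v\in\Lambda$, and universal if it is positive definite and for every totally positive $d\in\mathcal{O}_K$ there is $v\in\Lambda$ with $Q(v)=d$. *)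

theory Defs
  imports
    "HOL-Computational_Algebra.Computational_Algebra"
    "HOL-Algebra.Algebra"
    "Jordan_Normal_Form.VS_Connect"
begin

text \<open>All algebraic extensions of \<open>\<rat>\<close> are taken inside the complex numbers, as sets of complex
  numbers. \<open>complex_ring_on A\<close> is the ring with carrier \<open>A\<close> and the operations of the complex
  numbers.\<close>

abbreviation complex_ring :: "complex ring" where
  "complex_ring \<equiv> class_ring"

abbreviation complex_ring_on :: "complex set \<Rightarrow> complex ring" where
  "complex_ring_on A \<equiv> complex_ring\<lparr>carrier := A\<rparr>"

text \<open>Polynomials of HOL-Algebra are coefficient lists; \<open>ring.Irr\<close> is the monic irreducible
  polynomial, and it is meaningful only for algebraic arguments.\<close>

abbreviation minpoly :: "complex \<Rightarrow> complex list" where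
  "minpoly x \<equiv> ring.Irr complex_ring \<rat> x"

definition conjugates :: "complex \<Rightarrow> complex set" where
  "conjugates x = {y. ring.eval complex_ring (minpoly x) y = 0}"

definition totally_real :: "complex \<Rightarrow> bool" where
  "totally_real x \<longleftrightarrow> algebraic x \<and> conjugates x \<subseteq> \<real>"

definition totally_positive :: "complex \<Rightarrow> bool" where
  "totally_positive x \<longleftrightarrow> algebraic x \<and> (\<forall>y\<in>conjugates x. y \<in> \<real> \<and> 0 < Re y)"

definition totally_real_field :: "complex set \<Rightarrow> bool" where
  "totally_real_field K \<longleftrightarrow> subfield K complex_ring \<and> (\<forall>x\<in>K. totally_real x)"

definition normal_extension :: "complex set \<Rightarrow> bool" where
  "normal_extension F \<longleftrightarrow>
     (\<forall>x\<in>F. algebraic x \<and> ring.splitted (complex_ring_on F) (minpoly x))"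

definition separable_extension :: "complex set \<Rightarrow> bool" where
  "separable_extension F \<longleftrightarrow>
     (\<forall>x\<in>F. algebraic x \<and> (\<forall>y. ring.alg_mult complex_ring (minpoly x) y \<le> 1))"

definition galois_extension :: "complex set \<Rightarrow> bool" where
  "galois_extension F \<longleftrightarrow>
     subfield F complex_ring \<and> normal_extension F \<and> separable_extension F"

text \<open>\<open>ring.dimension\<close> is the exact degree \<open>[F : \<rat>] = q\<close>.\<close>

definition totally_real_galois_compositum :: "nat \<Rightarrow> complex set" where
  "totally_real_galois_compositum q = generate_field complex_ring
     (\<Union>{F. totally_real_field F \<and> galois_extension F \<and> ring.dimension complex_ring q \<rat> F})"

definition ring_of_integers :: "complex set \<Rightarrow> complex set" where
  "ring_of_integers K = {x \<in> K. algebraic_int x}"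

definition polar_form :: "(complex, 'v) module \<Rightarrow> ('v \<Rightarrow> complex) \<Rightarrow> 'v \<Rightarrow> 'v \<Rightarrow> complex" where
  "polar_form V Q v w = (Q (v \<oplus>\<^bsub>V\<^esub> w) - Q v - Q w) / 2"

definition bilinear_form ::
    "complex set \<Rightarrow> (complex, 'v) module \<Rightarrow> ('v \<Rightarrow> 'v \<Rightarrow> complex) \<Rightarrow> bool" where
  "bilinear_form K V B \<longleftrightarrow>
     (\<forall>u\<in>carrier V. \<forall>v\<in>carrier V. \<forall>w\<in>carrier V.
        B (u \<oplus>\<^bsub>V\<^esub> v) w = B u w + B v w \<and> B w (u \<oplus>\<^bsub>V\<^esub> v) = B w u + B w v) \<and>
     (\<forall>a\<in>K. \<forall>v\<in>carrier V. \<forall>w\<in>carrier V.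
        B (a \<odot>\<^bsub>V\<^esub> v) w = a * B v w \<and> B v (a \<odot>\<^bsub>V\<^esub> w) = a * B v w)"

definition quadratic_map ::
    "complex set \<Rightarrow> (complex, 'v) module \<Rightarrow> ('v \<Rightarrow> complex) \<Rightarrow> bool" where
  "quadratic_map K V Q \<longleftrightarrow>
     Q \<in> carrier V \<rightarrow> K \<and>
     (\<forall>a\<in>K. \<forall>v\<in>carrier V. Q (a \<odot>\<^bsub>V\<^esub> v) = a\<^sup>2 * Q v) \<and>
     bilinear_form K V (polar_form V Q)"

text \<open>\<open>submodule\<close> and \<open>module.span\<close> are used with \<open>V\<close> regarded as a module over the ring of
  integers of \<open>K\<close> by restriction of scalars.\<close>

definition integer_lattice ::
    "complex set \<Rightarrow> (complex, 'v) module \<Rightarrow> 'v set \<Rightarrow> bool" where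
  "integer_lattice K V \<Lambda> \<longleftrightarrow>
     vectorspace (complex_ring_on K) V \<and> vectorspace.fin_dim (complex_ring_on K) V \<and>
     LinearCombinations.submodule (complex_ring_on (ring_of_integers K)) \<Lambda> V \<and>
     (\<exists>S. finite S \<and> S \<subseteq> \<Lambda> \<and>
        \<Lambda> = LinearCombinations.module.span (complex_ring_on (ring_of_integers K)) V S)"

text \<open>The quadratic map is kept on all of \<open>V\<close>; only its values on \<open>\<Lambda>\<close> enter below.\<close>

definition quadratic_lattice ::
    "complex set \<Rightarrow> (complex, 'v) module \<Rightarrow> 'v set \<Rightarrow> ('v \<Rightarrow> complex) \<Rightarrow> bool" where
  "quadratic_lattice K V \<Lambda> Q \<longleftrightarrow> integer_lattice K V \<Lambda> \<and> quadratic_map K V Q"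

definition integral_lattice ::
    "complex set \<Rightarrow> (complex, 'v) module \<Rightarrow> 'v set \<Rightarrow> ('v \<Rightarrow> complex) \<Rightarrow> bool" where
  "integral_lattice K V \<Lambda> Q \<longleftrightarrow>
     quadratic_lattice K V \<Lambda> Q \<and> Q ` \<Lambda> \<subseteq> ring_of_integers K"

definition positive_definite_lattice ::
    "complex set \<Rightarrow> (complex, 'v) module \<Rightarrow> 'v set \<Rightarrow> ('v \<Rightarrow> complex) \<Rightarrow> bool" where
  "positive_definite_lattice K V \<Lambda> Q \<longleftrightarrow>
     integral_lattice K V \<Lambda> Q \<and> (\<forall>v\<in>\<Lambda>. v \<noteq> \<zero>\<^bsub>V\<^esub> \<longrightarrow> totally_positive (Q v))"

definition universal_lattice ::
    "complex set \<Rightarrow> (complex, 'v) module \<Rightarrow> 'v set \<Rightarrow> ('v \<Rightarrow> complex) \<Rightarrow> bool" where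
  "universal_lattice K V \<Lambda> Q \<longleftrightarrow>
     positive_definite_lattice K V \<Lambda> Q \<and>
     (\<forall>d\<in>ring_of_integers K. totally_positive d \<longrightarrow> (\<exists>v\<in>\<Lambda>. Q v = d))"

end

theory Submission
  imports Defs "Jordan_Normal_Form.Char_Poly" "HOL-Number_Theory.Cong"
begin

text \<open>Let \<open>P\<close> be a prime over \<open>l\<close> in the ring of all algebraic integers and let \<open>U\<close> be the part of
  the compositum on which the inertia group of \<open>P\<close> acts trivially. An algebraic integer outside
  \<open>U\<close> is moved by a tame inertia element, which forces a conjugate of absolute value about
  \<open>l ^ (1 / q)\<close>. On the other hand, \<open>K\<close> is not contained in \<open>U\<close> for arbitrarily large \<open>l\<close>: the
  extensions involved are abelian of exponent \<open>q\<close>, so an infinite extension with boundedly many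
  ramified primes would contradict a finiteness theorem of Hermite type, which is obtained here
  from a transference bound for trace forms.

  Now take \<open>l\<close> large in terms of the Gram matrix of generators of a universal lattice, and a totally
  positive integer \<open>\<alpha>\<close> of \<open>K\<close> outside \<open>U\<close> whose conjugates are nearly as small as possible. If
  \<open>\<alpha> = Q v\<close>, then the inner products of \<open>v\<close> with the generators are much smaller than \<open>\<alpha>\<close>, hence lie
  in \<open>U\<close>, and so do the entries of the Gram matrix. Inertia then fixes \<open>Q v\<close>, even though it may
  move the coordinates of \<open>v\<close>: a contradiction.\<close>

section \<open>Algebraic numbers and algebraic integers\<close>

text \<open>Three obstacles shape the argument. The generators may be dependent and the coordinates
  of a vector may have large conjugates, so coordinates are out of control; inner products with the
  generators are bounded by positivity instead. The degrees of the subfields of \<open>K\<close> are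
  unbounded, so finiteness in one fixed degree is not enough: the argument cuts down to subfields of
  degree at most \<open>q * q\<close>, where bounds depend only on \<open>q\<close> and the ramified
  primes, and shows that the finitely many integers found there separate all automorphisms. Finally,
  conjugates are estimated at every embedding while inertia belongs to one prime. Here the shape of
  \<open>q\<close> enters: a group of order p or p^2 is commutative, so inertia commutes with
  conjugation on the fields in question, and a congruence at the single prime \<open>P\<close>
  informs about all primes over \<open>l\<close>. The exponent 1 / q comes from Lagrange resolvents,
  which need the \<open>q\<close>-th roots of unity; these are adjoined to the real fields for that
  purpose, while positivity of the trace form is used on real fields only.\<close>

lemma algebraic_int_eigenvalueI:
  fixes z :: complex and b :: "nat \<Rightarrow> complex" and A :: "nat \<Rightarrow> nat \<Rightarrow> int"
  assumes eq: "\<And>i. i < n \<Longrightarrow> z * b i = (\<Sum>j<n. of_int (A i j) * b j)"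
    and nz: "k < n" "b k \<noteq> 0"
  shows "algebraic_int z"
proof -
  define M where "M = mat n n (\<lambda>(i,j). A i j)"
  define M' where "M' = map_mat complex_of_int M"
  define v where "v = vec n b"
  have M: "M \<in> carrier_mat n n" "M' \<in> carrier_mat n n" by (auto simp: M_def M'_def)
  have "M' *\<^sub>v v = z \<cdot>\<^sub>v v"
    by (intro eq_vecI)
       (auto simp: M'_def M_def v_def eq scalar_prod_def atLeast0LessThan)
  moreover have "v \<noteq> 0\<^sub>v n" using nz by (metis v_def index_vec index_zero_vec(1))
  ultimately have "eigenvalue M' z"
    unfolding eigenvalue_def eigenvector_def using M by (intro exI[of _ v]) (auto simp: v_def)
  hence "poly (char_poly M') z = 0" using eigenvalue_root_char_poly[OF M(2)] by simp
  moreover have "char_poly M' = map_poly of_int (char_poly M)"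
    unfolding M'_def by (rule of_int_hom.char_poly_hom[OF M(1)])
  moreover have "Polynomial.lead_coeff (char_poly M) = 1" using degree_monic_char_poly[OF M(1)] by simp
  ultimately show ?thesis by (auto simp: algebraic_int_altdef_ipoly)
qed

definition zspan :: "complex set \<Rightarrow> complex set" where
  "zspan B = {\<Sum>b\<in>B. of_int (c b) * b | c. True}"

lemma zspanI: "(\<Sum>b\<in>B. of_int (c b) * b) \<in> zspan B" by (auto simp: zspan_def)

lemma zspan_base: assumes "finite B" "b \<in> B" shows "b \<in> zspan B"
proof -
  have "(\<Sum>x\<in>B. of_int (if x = b then 1 else 0) * x) = (\<Sum>x\<in>B. if x = b then x else 0)"
    by (intro sum.cong) auto
  also have "\<dots> = b" using assms by simp
  finally show ?thesis by (metis zspanI)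
qed

lemma zspan_add: assumes "x \<in> zspan B" "y \<in> zspan B" shows "x + y \<in> zspan B"
proof -
  obtain c d where "x = (\<Sum>b\<in>B. of_int (c b) * b)" "y = (\<Sum>b\<in>B. of_int (d b) * b)"
    using assms by (auto simp: zspan_def)
  hence "x + y = (\<Sum>b\<in>B. of_int (c b + d b) * b)" by (simp add: sum.distrib distrib_right)
  thus ?thesis by (simp only: zspanI)
qed

lemma zspan_scale: assumes "x \<in> zspan B" shows "of_int k * x \<in> zspan B"
proof -
  obtain c where "x = (\<Sum>b\<in>B. of_int (c b) * b)" using assms by (auto simp: zspan_def)
  hence "of_int k * x = (\<Sum>b\<in>B. of_int (k * c b) * b)" by (simp add: sum_distrib_left mult.assoc)
  thus ?thesis by (simp only: zspanI)
qed

lemma zspan_0: "0 \<in> zspan B"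
  using zspanI[of "\<lambda>_. 0" B] by simp

lemma zspan_sum: "(\<And>i. i \<in> I \<Longrightarrow> f i \<in> zspan B) \<Longrightarrow> sum f I \<in> zspan B"
  by (induction I rule: infinite_finite_induct) (auto intro: zspan_add zspan_0)

lemma zspan_mult:
  assumes "\<And>b. b \<in> B \<Longrightarrow> z * b \<in> zspan B" "x \<in> zspan B"
  shows "z * x \<in> zspan B"
proof -
  obtain c where x: "x = (\<Sum>b\<in>B. of_int (c b) * b)" using assms(2) by (auto simp: zspan_def)
  have "z * x = (\<Sum>b\<in>B. of_int (c b) * (z * b))" by (simp add: x sum_distrib_left algebra_simps)
  thus ?thesis using assms(1) by (auto intro!: zspan_sum zspan_scale)
qed

text \<open>The determinant trick: multiplication by \<open>z\<close> preserves a finitely generated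
  group of numbers, so \<open>z\<close> is an eigenvalue of an integer matrix. The elements of
  \<open>B\<close> themselves form the eigenvector, and \<open>b0\<close> makes it nonzero;
  relations among them do no harm.\<close>

lemma algebraic_int_zspanI:
  assumes fin: "finite B" and ne: "b0 \<in> B" "b0 \<noteq> 0"
    and cl: "\<And>b. b \<in> B \<Longrightarrow> z * b \<in> zspan B"
  shows "algebraic_int z"
proof -
  obtain f where f: "bij_betw f {..<card B} B"
    using ex_bij_betw_nat_finite[OF fin] by (auto simp: atLeast0LessThan)
  have "\<exists>c. \<forall>b\<in>B. z * b = (\<Sum>b'\<in>B. of_int (c b b') * b')"
    using cl unfolding zspan_def by (intro bchoice) blast
  then obtain c where c: "\<And>b. b \<in> B \<Longrightarrow> z * b = (\<Sum>b'\<in>B. of_int (c b b') * b')" by blast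
  obtain k where k: "k < card B" "f k = b0" using f ne by (metis bij_betw_iff_bijections lessThan_iff)
  show ?thesis
  proof (rule algebraic_int_eigenvalueI[of "card B" z f "\<lambda>i j. c (f i) (f j)"])
    fix i assume "i < card B"
    hence "f i \<in> B" using f by (auto simp: bij_betw_def)
    thus "z * f i = (\<Sum>j<card B. of_int (c (f i) (f j)) * f j)"
      using c sum.reindex_bij_betw[OF f, of "\<lambda>b'. of_int (c (f i) b') * b'"] by simp
  qed (use k ne in auto)
qed

lemma algebraic_int_powE:
  fixes x :: complex
  assumes "algebraic_int x"
  obtains n c where "n > 0" "x ^ n = (\<Sum>i<n. of_int (c i) * x ^ i)"
proof -
  obtain p where p: "poly (map_poly of_int p) x = 0" "Polynomial.lead_coeff p = (1::int)"
    using assms by (auto simp: algebraic_int_altdef_ipoly)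
  define n where "n = Polynomial.degree p"
  have n: "n > 0"
  proof (rule Nat.gr0I)
    assume "n = 0"
    then obtain a where "p = [:a:]" unfolding n_def by (auto elim: degree_eq_zeroE)
    thus False using p by simp
  qed
  have "0 = (\<Sum>i\<le>n. of_int (Polynomial.coeff p i) * x ^ i)"
    using p by (simp add: poly_altdef n_def)
  also have "\<dots> = x ^ n + (\<Sum>i<n. of_int (Polynomial.coeff p i) * x ^ i)"
    using p(2) by (simp add: n_def flip: lessThan_Suc_atMost)
  finally have "x ^ n = - (\<Sum>i<n. of_int (Polynomial.coeff p i) * x ^ i)"
    by (simp only: eq_neg_iff_add_eq_0)
  also have "\<dots> = (\<Sum>i<n. of_int (- Polynomial.coeff p i) * x ^ i)"
    by (simp add: sum_negf)
  finally have "x ^ n = (\<Sum>i<n. of_int (- Polynomial.coeff p i) * x ^ i)" .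
  with n show ?thesis by (rule that)
qed

lemma algebraic_int_powI:
  fixes x :: complex
  assumes "x ^ n = (\<Sum>i<n. of_int (c i) * x ^ i)"
  shows "algebraic_int x"
proof -
  define q where "q = (\<Sum>i<n. Polynomial.monom (c i) i)"
  define p where "p = Polynomial.monom 1 n - q"
  have dq: "Polynomial.coeff q i = (if i < n then c i else 0)" for i
    by (simp add: q_def coeff_sum)
  have cp: "Polynomial.coeff p n = 1" by (simp add: p_def dq)
  have "Polynomial.degree p \<le> n" by (intro degree_le) (auto simp: p_def dq)
  moreover have "Polynomial.degree p \<ge> n" using cp by (intro le_degree) auto
  ultimately have "Polynomial.lead_coeff p = 1" using cp by simp
  moreover have "poly (map_poly of_int p) x = 0"
  proof -
    have "poly (map_poly of_int p) x = (\<Sum>i\<le>n. of_int (Polynomial.coeff p i) * x ^ i)"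
      using \<open>Polynomial.degree p \<le> n\<close> \<open>Polynomial.degree p \<ge> n\<close> by (simp add: poly_altdef)
    also have "\<dots> = x ^ n + (\<Sum>i<n. of_int (Polynomial.coeff p i) * x ^ i)"
      using cp by (simp flip: lessThan_Suc_atMost)
    also have "(\<Sum>i<n. of_int (Polynomial.coeff p i) * x ^ i) = (\<Sum>i<n. - (of_int (c i) * x ^ i))"
      by (intro sum.cong) (auto simp: p_def dq)
    finally show ?thesis using assms by (simp add: sum_negf)
  qed
  ultimately show ?thesis by (auto simp: algebraic_int_altdef_ipoly)
qed

text \<open>The monomials \<open>x ^ i * y ^ j\<close> below the two degrees span a group that is
  stable under \<open>x\<close> and \<open>y\<close>, and the determinant trick applies to
  it.\<close>

lemma algebraic_int_add_mult:
  fixes x y :: complex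
  assumes "algebraic_int x" "algebraic_int y"
  shows "algebraic_int (x + y)" "algebraic_int (x * y)"
proof -
  obtain m c where m: "m > 0" "x ^ m = (\<Sum>i<m. of_int (c i) * x ^ i)"
    using algebraic_int_powE[OF assms(1)] by blast
  obtain n d where n: "n > 0" "y ^ n = (\<Sum>i<n. of_int (d i) * y ^ i)"
    using algebraic_int_powE[OF assms(2)] by blast
  define B where "B = (\<lambda>(i,j). x ^ i * y ^ j) ` ({..<m} \<times> {..<n})"
  have fin: "finite B" by (simp add: B_def)
  have B: "x ^ i * y ^ j \<in> zspan B" if "i < m" "j < n" for i j
    using that fin by (intro zspan_base) (auto simp: B_def)
  have X: "x * b \<in> zspan B" if b: "b \<in> B" for b
  proof -
    obtain i j where ij: "i < m" "j < n" "b = x ^ i * y ^ j" using b by (auto simp: B_def)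
    show ?thesis
    proof (cases "Suc i < m")
      case True
      thus ?thesis using B[of "Suc i" j] ij by (simp add: mult.assoc)
    next
      case False
      hence "x * b = x ^ m * y ^ j" using ij
        by (metis Suc_lessI mult.assoc power_Suc)
      also have "\<dots> = (\<Sum>k<m. of_int (c k) * (x ^ k * y ^ j))"
        by (simp add: m sum_distrib_right mult.assoc)
      finally show ?thesis using B ij by (auto intro!: zspan_sum zspan_scale)
    qed
  qed
  have Y: "y * b \<in> zspan B" if b: "b \<in> B" for b
  proof -
    obtain i j where ij: "i < m" "j < n" "b = x ^ i * y ^ j" using b by (auto simp: B_def)
    show ?thesis
    proof (cases "Suc j < n")
      case True
      thus ?thesis using B[of i "Suc j"] ij by (simp add: mult_ac)
    next
      case False
      hence "y * b = y ^ n * x ^ i" using ij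
        by (metis Suc_lessI mult.assoc mult.commute power_Suc)
      also have "\<dots> = (\<Sum>k<n. of_int (d k) * (x ^ i * y ^ k))"
        by (simp add: n sum_distrib_left mult_ac)
      finally show ?thesis using B ij by (auto intro!: zspan_sum zspan_scale)
    qed
  qed
  have one: "1 \<in> B" using m(1) n(1) unfolding B_def by (intro image_eqI[of _ _ "(0,0)"]) auto
  show "algebraic_int (x + y)"
    by (rule algebraic_int_zspanI[OF fin one]) (auto simp: distrib_right intro!: zspan_add X Y)
  show "algebraic_int (x * y)"
    by (rule algebraic_int_zspanI[OF fin one]) (auto simp: mult.assoc intro!: zspan_mult[OF X] Y)
qed

lemmas algebraic_int_add [intro] = algebraic_int_add_mult(1)
lemmas algebraic_int_mult [intro] = algebraic_int_add_mult(2)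

lemma algebraic_int_diff [intro]: "algebraic_int (x::complex) \<Longrightarrow> algebraic_int y \<Longrightarrow> algebraic_int (x - y)"
  using algebraic_int_add[of x "-y"] by simp

lemma algebraic_int_sum [intro]: "(\<And>i. i \<in> I \<Longrightarrow> algebraic_int (f i :: complex)) \<Longrightarrow> algebraic_int (sum f I)"
  by (induction I rule: infinite_finite_induct) auto

lemma algebraic_int_prod [intro]: "(\<And>i. i \<in> I \<Longrightarrow> algebraic_int (f i :: complex)) \<Longrightarrow> algebraic_int (prod f I)"
  by (induction I rule: infinite_finite_induct) auto

lemma algebraic_int_power [intro]: "algebraic_int (x::complex) \<Longrightarrow> algebraic_int (x ^ n)"
  by (induction n) auto

lemma algebraic_int_powerD:
  fixes x :: complex
  assumes "algebraic_int (x ^ n)" "n > 0"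
  shows "algebraic_int x"
  by (rule algebraic_int_root[OF assms(1), of "Polynomial.monom 1 n"])
     (use assms in \<open>auto simp: poly_monom degree_monom_eq\<close>)

text \<open>The leading coefficient \<open>a\<close> of an integer equation serves as denominator:
  after multiplication by \<open>a ^ (n - 1)\<close> the equation is monic in
  \<open>a * x\<close>.\<close>

lemma algebraic_imp_multiple_algebraic_int:
  fixes x :: complex
  assumes "algebraic x"
  obtains m :: nat where "m > 0" "algebraic_int (of_nat m * x)"
proof -
  obtain p where p: "p \<noteq> 0" "poly (map_poly of_int p) x = 0" using assms by (erule algebraicE')
  define n where "n = Polynomial.degree p"
  define a where "a = Polynomial.coeff p n"
  have a: "a \<noteq> 0" using p by (simp add: a_def n_def)
  have "algebraic_int (of_int a * x)"
  proof (rule algebraic_int_powI[of _ n "\<lambda>i. - Polynomial.coeff p i * a ^ (n - 1 - i)"])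
    have "0 = (\<Sum>i\<le>n. of_int (Polynomial.coeff p i) * x ^ i)"
      using p by (simp add: poly_altdef n_def)
    also have "\<dots> = of_int a * x ^ n + (\<Sum>i<n. of_int (Polynomial.coeff p i) * x ^ i)"
      by (simp add: a_def flip: lessThan_Suc_atMost)
    finally have e: "of_int a * x ^ n = - (\<Sum>i<n. of_int (Polynomial.coeff p i) * x ^ i)"
      by (simp only: eq_neg_iff_add_eq_0)
    show "(of_int a * x) ^ n = (\<Sum>i<n. of_int (- Polynomial.coeff p i * a ^ (n - 1 - i)) * (of_int a * x) ^ i)"
    proof (cases "n = 0")
      case True
      thus ?thesis using e a by simp
    next
      case False
      have "(of_int a * x) ^ n = of_int a ^ (n - 1) * (of_int a * x ^ n)"
        using False by (cases n) (simp_all add: power_mult_distrib mult_ac)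
      also have "\<dots> = (\<Sum>i<n. of_int (- Polynomial.coeff p i) * (of_int a ^ (n - 1) * x ^ i))"
        by (simp add: e sum_distrib_left sum_negf mult_ac)
      also have "\<dots> = (\<Sum>i<n. of_int (- Polynomial.coeff p i * a ^ (n - 1 - i)) * (of_int a * x) ^ i)"
      proof (rule sum.cong)
        fix i assume "i \<in> {..<n}"
        hence "of_int a ^ (n - 1) = (of_int a ^ (n - 1 - i) * of_int a ^ i :: complex)"
          by (simp flip: power_add)
        thus "of_int (- Polynomial.coeff p i) * (of_int a ^ (n - 1) * x ^ i) =
              of_int (- Polynomial.coeff p i * a ^ (n - 1 - i)) * (of_int a * x) ^ i"
          by (simp add: power_mult_distrib)
      qed simp
      finally show ?thesis .
    qed
  qed
  hence "algebraic_int (of_int \<bar>a\<bar> * x)" by (cases "a \<ge> 0") (auto simp: abs_if)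
  hence "algebraic_int (of_nat (nat \<bar>a\<bar>) * x)" by (simp add: of_nat_nat)
  with a show ?thesis by (intro that[of "nat \<bar>a\<bar>"]) auto
qed

lemma algebraic_divide_nat:
  fixes y :: complex
  assumes "algebraic_int y" "m > (0::nat)"
  shows "algebraic (y / of_nat m)"
proof -
  obtain p where p: "poly (map_poly of_int p) y = 0" "Polynomial.lead_coeff p = (1::int)"
    using assms by (auto simp: algebraic_int_altdef_ipoly)
  define q :: "complex poly" where "q = pcompose (map_poly of_int p) [:0, of_nat m:]"
  show ?thesis
  proof (rule algebraicI)
    show "Polynomial.coeff q i \<in> \<int>" for i
      unfolding q_def by (intro coeff_pcompose_semiring_closed) (auto simp: coeff_map_poly coeff_pCons split: nat.splits)
    have "map_poly of_int p \<noteq> (0 :: complex poly)" using p by auto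
    thus "q \<noteq> 0" using assms unfolding q_def by (subst pcompose_eq_0_iff) auto
    show "poly q (y / of_nat m) = 0" using p assms by (simp add: q_def poly_pcompose)
  qed
qed

lemma algebraic_add_mult:
  fixes x y :: complex
  assumes "algebraic x" "algebraic y"
  shows "algebraic (x + y)" "algebraic (x * y)"
proof -
  obtain m where m: "m > 0" "algebraic_int (of_nat m * x)"
    using algebraic_imp_multiple_algebraic_int[OF assms(1)] by blast
  obtain n where n: "n > 0" "algebraic_int (of_nat n * y)"
    using algebraic_imp_multiple_algebraic_int[OF assms(2)] by blast
  have "algebraic_int (of_nat n * (of_nat m * x) + of_nat m * (of_nat n * y))" using m n by auto
  from algebraic_divide_nat[OF this, of "m * n"]
  have "algebraic ((of_nat n * (of_nat m * x) + of_nat m * (of_nat n * y)) / of_nat (m * n))"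
    using m n by simp
  also have "(of_nat n * (of_nat m * x) + of_nat m * (of_nat n * y)) / of_nat (m * n) = x + y"
    using m n by (simp add: divide_simps) (simp add: algebra_simps)
  finally show "algebraic (x + y)" .
  have "algebraic_int ((of_nat m * x) * (of_nat n * y))" using m n by auto
  from algebraic_divide_nat[OF this, of "m * n"]
  have "algebraic (((of_nat m * x) * (of_nat n * y)) / of_nat (m * n))"
    using m n by simp
  also have "((of_nat m * x) * (of_nat n * y)) / of_nat (m * n) = x * y"
    using m n by (simp add: divide_simps)
  finally show "algebraic (x * y)" .
qed

lemmas algebraic_add [intro] = algebraic_add_mult(1)
lemmas algebraic_mult [intro] = algebraic_add_mult(2)

lemma algebraic_diff [intro]: "algebraic (x::complex) \<Longrightarrow> algebraic y \<Longrightarrow> algebraic (x - y)"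
  using algebraic_add[of x "-y"] by simp

lemma algebraic_divide [intro]: "algebraic (x::complex) \<Longrightarrow> algebraic y \<Longrightarrow> algebraic (x / y)"
  by (simp add: divide_inverse algebraic_mult algebraic_inverse)

lemma algebraic_sum [intro]: "(\<And>i. i \<in> I \<Longrightarrow> algebraic (f i :: complex)) \<Longrightarrow> algebraic (sum f I)"
  by (induction I rule: infinite_finite_induct) auto

lemma algebraic_prod [intro]: "(\<And>i. i \<in> I \<Longrightarrow> algebraic (f i :: complex)) \<Longrightarrow> algebraic (prod f I)"
  by (induction I rule: infinite_finite_induct) auto

lemma algebraic_power [intro]: "algebraic (x::complex) \<Longrightarrow> algebraic (x ^ n)"
  by (induction n) auto

section \<open>Automorphisms of the algebraic numbers\<close>

text \<open>The values at transcendental arguments are arbitrary; elements are only ever compared on sets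
  of algebraic numbers.\<close>

definition AbsGal :: "(complex \<Rightarrow> complex) set" where
  "AbsGal = {\<phi>. \<phi> 1 = 1 \<and> (\<forall>x y. algebraic x \<longrightarrow> algebraic y \<longrightarrow>
                 \<phi> (x + y) = \<phi> x + \<phi> y \<and> \<phi> (x * y) = \<phi> x * \<phi> y)}"

lemma AbsGal_id: "(\<lambda>x. x) \<in> AbsGal" by (simp add: AbsGal_def)

lemma AbsGal_cnj: "cnj \<in> AbsGal" by (simp add: AbsGal_def)

context
  fixes \<phi> assumes \<phi>: "\<phi> \<in> AbsGal"
begin

lemma AbsGal_1: "\<phi> 1 = 1" using \<phi> by (simp add: AbsGal_def)

lemma AbsGal_add: "algebraic x \<Longrightarrow> algebraic y \<Longrightarrow> \<phi> (x + y) = \<phi> x + \<phi> y"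
  using \<phi> by (simp add: AbsGal_def)

lemma AbsGal_mult: "algebraic x \<Longrightarrow> algebraic y \<Longrightarrow> \<phi> (x * y) = \<phi> x * \<phi> y"
  using \<phi> by (simp add: AbsGal_def)

lemma AbsGal_0: "\<phi> 0 = 0"
  using AbsGal_add[of 0 0] by simp

lemma AbsGal_minus: "algebraic x \<Longrightarrow> \<phi> (- x) = - \<phi> x"
  using AbsGal_add[of x "-x"] AbsGal_0 by (simp add: eq_neg_iff_add_eq_0 add.commute)

lemma AbsGal_diff: "algebraic x \<Longrightarrow> algebraic y \<Longrightarrow> \<phi> (x - y) = \<phi> x - \<phi> y"
  using AbsGal_add[of x "-y"] AbsGal_minus[of y] by simp

lemma AbsGal_power: "algebraic x \<Longrightarrow> \<phi> (x ^ n) = \<phi> x ^ n"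
  by (induction n) (auto simp: AbsGal_1 AbsGal_mult algebraic_power)

lemma AbsGal_of_nat: "\<phi> (of_nat n) = of_nat n"
  by (induction n) (auto simp: AbsGal_0 AbsGal_1 AbsGal_add)

lemma AbsGal_of_int: "\<phi> (of_int n) = of_int n"
  by (cases n rule: int_cases2) (auto simp: AbsGal_of_nat AbsGal_minus)

lemma AbsGal_sum: "(\<And>i. i \<in> I \<Longrightarrow> algebraic (f i)) \<Longrightarrow> \<phi> (sum f I) = (\<Sum>i\<in>I. \<phi> (f i))"
  by (induction I rule: infinite_finite_induct) (auto simp: AbsGal_0 AbsGal_add algebraic_sum)

lemma AbsGal_prod: "(\<And>i. i \<in> I \<Longrightarrow> algebraic (f i)) \<Longrightarrow> \<phi> (prod f I) = (\<Prod>i\<in>I. \<phi> (f i))"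
  by (induction I rule: infinite_finite_induct) (auto simp: AbsGal_1 AbsGal_mult algebraic_prod)

lemma AbsGal_inverse: "algebraic x \<Longrightarrow> \<phi> (inverse x) = inverse (\<phi> x)"
proof (cases "x = 0")
  case False
  assume x: "algebraic x"
  have "\<phi> x * \<phi> (inverse x) = 1"
    using AbsGal_mult[of x "inverse x"] x False AbsGal_1 algebraic_inverse[OF x] by simp
  thus ?thesis by (metis inverse_unique)
qed (simp add: AbsGal_0)

lemma AbsGal_divide: "algebraic x \<Longrightarrow> algebraic y \<Longrightarrow> \<phi> (x / y) = \<phi> x / \<phi> y"
  by (simp add: divide_inverse AbsGal_mult AbsGal_inverse algebraic_inverse)

lemma AbsGal_eq_0_iff: "algebraic x \<Longrightarrow> \<phi> x = 0 \<longleftrightarrow> x = 0"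
  using AbsGal_mult[of x "inverse x"] algebraic_inverse[of x]
  by (cases "x = 0") (auto simp: AbsGal_0 AbsGal_1)

lemma AbsGal_eq_iff: "algebraic x \<Longrightarrow> algebraic y \<Longrightarrow> \<phi> x = \<phi> y \<longleftrightarrow> x = y"
  using AbsGal_eq_0_iff[of "x - y"] AbsGal_diff[of x y] by (auto intro: algebraic_diff)

lemma AbsGal_Rats: "x \<in> \<rat> \<Longrightarrow> \<phi> x = x"
  by (auto elim!: Rats_cases' simp: AbsGal_divide AbsGal_of_int)

lemma AbsGal_poly:
  assumes "\<And>i. Polynomial.coeff p i \<in> \<rat>" "algebraic x"
  shows "\<phi> (poly p x) = poly p (\<phi> x)"
proof -
  have a: "algebraic (Polynomial.coeff p i)" for i using assms rat_imp_algebraic by blast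
  have "\<phi> (poly p x) = (\<Sum>i\<le>Polynomial.degree p. \<phi> (Polynomial.coeff p i * x ^ i))"
    unfolding poly_altdef using a assms by (intro AbsGal_sum) auto
  also have "\<dots> = poly p (\<phi> x)"
    unfolding poly_altdef using a assms
    by (intro sum.cong) (auto simp: AbsGal_mult AbsGal_power AbsGal_Rats algebraic_power)
  finally show ?thesis .
qed

lemma AbsGal_algebraic: assumes "algebraic x" shows "algebraic (\<phi> x)"
proof -
  obtain p where p: "p \<noteq> 0" "poly (map_poly of_int p) x = 0" using assms by (erule algebraicE')
  hence "poly (map_poly of_int p) (\<phi> x) = 0"
    using AbsGal_poly[of "map_poly of_int p" x] assms by (auto simp: coeff_map_poly AbsGal_0)
  moreover have "map_poly of_int p \<noteq> (0::complex poly)" using p by simp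
  ultimately show ?thesis by (intro algebraicI[of "map_poly of_int p"]) (auto simp: coeff_map_poly)
qed

lemma AbsGal_algebraic_int: assumes "algebraic_int x" shows "algebraic_int (\<phi> x)"
proof -
  obtain p where p: "poly (map_poly of_int p) x = 0" "Polynomial.lead_coeff p = (1::int)"
    using assms by (auto simp: algebraic_int_altdef_ipoly)
  hence "poly (map_poly of_int p) (\<phi> x) = 0"
    using AbsGal_poly[of "map_poly of_int p" x] assms by (auto simp: coeff_map_poly AbsGal_0)
  thus ?thesis using p by (auto simp: algebraic_int_altdef_ipoly)
qed

end

lemma AbsGal_comp:
  assumes "\<phi> \<in> AbsGal" "\<psi> \<in> AbsGal"
  shows "(\<lambda>x. \<phi> (\<psi> x)) \<in> AbsGal"
  unfolding AbsGal_def mem_Collect_eq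
  using AbsGal_1[OF assms(1)] AbsGal_1[OF assms(2)] AbsGal_add[OF assms(1)] AbsGal_add[OF assms(2)]
    AbsGal_mult[OF assms(1)] AbsGal_mult[OF assms(2)] AbsGal_algebraic[OF assms(2)] by simp

lemma AbsGal_funpow: "\<phi> \<in> AbsGal \<Longrightarrow> (\<phi> ^^ n) \<in> AbsGal"
proof (induction n)
  case 0
  thus ?case using AbsGal_id by (simp add: id_def)
next
  case (Suc n)
  thus ?case using AbsGal_comp[of \<phi> "\<phi> ^^ n"] by (simp add: o_def)
qed

section \<open>Extension of embeddings to all algebraic numbers\<close>

text \<open>The graph of a homomorphism defined on a ring of algebraic numbers, kept as a relation
  so that extension is inclusion and the union of a chain is again such a graph. The last clause
  encodes single-valuedness: the difference of two values at one point is a value at 0.\<close>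

definition partial_hom :: "(complex \<times> complex) set \<Rightarrow> bool" where
  "partial_hom R \<longleftrightarrow> (\<forall>r\<in>\<rat>. (r, r) \<in> R) \<and>
     (\<forall>a b c d. (a, b) \<in> R \<longrightarrow> (c, d) \<in> R \<longrightarrow> (a + c, b + d) \<in> R \<and> (a * c, b * d) \<in> R) \<and>
     (\<forall>a b. (a, b) \<in> R \<longrightarrow> algebraic a \<and> (a = 0 \<longrightarrow> b = 0))"

context
  fixes R assumes R: "partial_hom R"
begin

lemma ph_rat: "r \<in> \<rat> \<Longrightarrow> (r, r) \<in> R"
  and ph_add: "(a, b) \<in> R \<Longrightarrow> (c, d) \<in> R \<Longrightarrow> (a + c, b + d) \<in> R"
  and ph_mult: "(a, b) \<in> R \<Longrightarrow> (c, d) \<in> R \<Longrightarrow> (a * c, b * d) \<in> R"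
  and ph_alg: "(a, b) \<in> R \<Longrightarrow> algebraic a"
  and ph_0: "(0, b) \<in> R \<Longrightarrow> b = 0"
  using R unfolding partial_hom_def by auto

lemma ph_uminus: "(a, b) \<in> R \<Longrightarrow> (- a, - b) \<in> R"
  using ph_mult[of "-1" "-1" a b] ph_rat[of "-1"] by simp

lemma ph_diff: "(a, b) \<in> R \<Longrightarrow> (c, d) \<in> R \<Longrightarrow> (a - c, b - d) \<in> R"
  using ph_add[of a b "-c" "-d"] ph_uminus[of c d] by simp

lemma ph_unique: "(a, b) \<in> R \<Longrightarrow> (a, c) \<in> R \<Longrightarrow> b = c"
  using ph_diff[of a b a c] ph_0[of "b - c"] by simp

lemma ph_sum: "(\<And>i. i \<in> I \<Longrightarrow> (f i, g i) \<in> R) \<Longrightarrow> (sum f I, sum g I) \<in> R"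
  by (induction I rule: infinite_finite_induct) (auto intro: ph_add ph_rat)

lemma ph_power: "(a, b) \<in> R \<Longrightarrow> (a ^ n, b ^ n) \<in> R"
  by (induction n) (auto intro: ph_mult ph_rat)

text \<open>An equation with nonzero constant term exhibits the inverse of \<open>a\<close> as a
  polynomial in \<open>a\<close>, up to a rational factor. So the domain, defined as a ring, is a
  field.\<close>

lemma ph_inverse:
  assumes "(a, b) \<in> R" "a \<noteq> 0"
  shows "\<exists>c. (inverse a, c) \<in> R"
proof -
  obtain p where p: "Polynomial.coeff p 0 \<noteq> 0" "poly (map_poly of_int p) a = 0"
    using algebraicE'_nonzero[OF ph_alg[OF assms(1)] assms(2)] by blast
  define n where "n = Polynomial.degree p"
  define s where "s = (\<Sum>i<n. of_int (Polynomial.coeff p (Suc i)) * a ^ i)"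
  have "0 = (\<Sum>i\<le>n. of_int (Polynomial.coeff p i) * a ^ i)"
    using p by (simp add: poly_altdef n_def)
  also have "\<dots> = of_int (Polynomial.coeff p 0) + (\<Sum>i<n. of_int (Polynomial.coeff p (Suc i)) * a ^ Suc i)"
    by (simp add: sum.atMost_shift)
  also have "(\<Sum>i<n. of_int (Polynomial.coeff p (Suc i)) * a ^ Suc i) = a * s"
    by (simp add: s_def sum_distrib_left mult_ac)
  finally have e: "a * s = - of_int (Polynomial.coeff p 0)"
    by (simp add: eq_neg_iff_add_eq_0 add.commute)
  have "(s, \<Sum>i<n. of_int (Polynomial.coeff p (Suc i)) * b ^ i) \<in> R"
    unfolding s_def by (intro ph_sum ph_mult ph_power ph_rat assms) auto
  moreover have "(inverse (- of_int (Polynomial.coeff p 0)), inverse (- of_int (Polynomial.coeff p 0))) \<in> R"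
    by (intro ph_rat) auto
  ultimately have "\<exists>c. (inverse (- of_int (Polynomial.coeff p 0)) * s, c) \<in> R"
    using ph_mult by blast
  moreover have "inverse (- of_int (Polynomial.coeff p 0)) * s = inverse a"
    using e p(1) assms(2) by (simp add: field_simps)
  ultimately show ?thesis by simp
qed

definition ph_fun :: "complex \<Rightarrow> complex" where
  "ph_fun a = (if a \<in> Domain R then SOME b. (a, b) \<in> R else 0)"

lemma ph_fun: "a \<in> Domain R \<Longrightarrow> (a, ph_fun a) \<in> R"
  unfolding ph_fun_def by (auto intro: someI)

lemma ph_fun_eq: "(a, b) \<in> R \<Longrightarrow> ph_fun a = b"
  using ph_fun[of a] ph_unique by blast

lemma ph_fun_0: "ph_fun 0 = 0" using ph_fun_eq[of 0 0] ph_rat[of 0] by simp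

definition ph_poly :: "complex poly set" where
  "ph_poly = {f. \<forall>i. Polynomial.coeff f i \<in> Domain R}"

lemma ph_fun_add: "a \<in> Domain R \<Longrightarrow> b \<in> Domain R \<Longrightarrow> a + b \<in> Domain R \<and> ph_fun (a + b) = ph_fun a + ph_fun b"
  using ph_add ph_fun ph_fun_eq by (metis Domain.DomainI)

lemma ph_fun_mult: "a \<in> Domain R \<Longrightarrow> b \<in> Domain R \<Longrightarrow> a * b \<in> Domain R \<and> ph_fun (a * b) = ph_fun a * ph_fun b"
  using ph_mult ph_fun ph_fun_eq by (metis Domain.DomainI)

lemma ph_fun_sum: "(\<And>i. i \<in> I \<Longrightarrow> f i \<in> Domain R) \<Longrightarrow> sum f I \<in> Domain R \<and> ph_fun (sum f I) = (\<Sum>i\<in>I. ph_fun (f i))"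
  using ph_sum[of I f "\<lambda>i. ph_fun (f i)"] ph_fun ph_fun_eq by (metis (no_types, lifting) Domain.DomainI)

lemma ph_poly_add: "f \<in> ph_poly \<Longrightarrow> g \<in> ph_poly \<Longrightarrow>
    f + g \<in> ph_poly \<and> map_poly ph_fun (f + g) = map_poly ph_fun f + map_poly ph_fun g"
  by (auto simp: ph_poly_def ph_fun_add poly_eq_iff coeff_map_poly ph_fun_0)

lemma ph_poly_mult: "f \<in> ph_poly \<Longrightarrow> g \<in> ph_poly \<Longrightarrow>
    f * g \<in> ph_poly \<and> map_poly ph_fun (f * g) = map_poly ph_fun f * map_poly ph_fun g"
  by (simp add: ph_poly_def ph_fun_mult poly_eq_iff coeff_map_poly ph_fun_0 coeff_mult ph_fun_sum)

lemma ph_poly_monom: "a \<in> Domain R \<Longrightarrow> Polynomial.monom a n \<in> ph_poly"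
  using ph_rat[of 0] by (auto simp: ph_poly_def)

lemma ph_poly_uminus: "f \<in> ph_poly \<Longrightarrow> - f \<in> ph_poly"
  using ph_uminus unfolding ph_poly_def Domain_iff by fastforce

text \<open>Adjunction of one root. The minimal polynomial of \<open>a\<close>, transported by the
  homomorphism, has a complex root \<open>b\<close>, and f(a) is sent to the value at
  \<open>b\<close> of the transported f. This is well defined because the minimal polynomial divides
  every f that vanishes at \<open>a\<close>.\<close>

lemma ph_extend:
  assumes "algebraic a"
  shows "\<exists>R'. partial_hom R' \<and> R \<subseteq> R' \<and> a \<in> Domain R'"
proof -
  define Q where "Q = (\<lambda>n. \<exists>f\<in>ph_poly. poly f a = 0 \<and> Polynomial.lead_coeff f = 1 \<and> Polynomial.degree f = n)"
  have monic: "Q (Polynomial.degree f)" if f: "f \<in> ph_poly" "poly f a = 0" "f \<noteq> 0" for f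
  proof -
    define c where "c = inverse (Polynomial.lead_coeff f)"
    obtain b where "(Polynomial.lead_coeff f, b) \<in> R" using f by (auto simp: ph_poly_def)
    with f have c: "c \<in> Domain R" using ph_inverse unfolding c_def by (metis Domain.DomainI leading_coeff_0_iff)
    have "Polynomial.smult c f \<in> ph_poly" using c f ph_fun_mult by (auto simp: ph_poly_def)
    moreover have "c \<noteq> 0" using f by (simp add: c_def)
    ultimately show ?thesis using f unfolding Q_def
      by (intro bexI[of _ "Polynomial.smult c f"]) (auto simp: c_def)
  qed
  obtain p where p: "p \<noteq> 0" "poly (map_poly of_int p) a = 0" using assms by (erule algebraicE')
  have "map_poly of_int p \<in> ph_poly" unfolding ph_poly_def using ph_rat[OF Rats_of_int] by (auto simp: coeff_map_poly)
  moreover have "map_poly of_int p \<noteq> (0::complex poly)" using p by simp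
  ultimately have "\<exists>n. Q n" using monic p by blast
  define n where "n = (LEAST n. Q n)"
  have "Q n" unfolding n_def using \<open>\<exists>n. Q n\<close> by (rule LeastI_ex)
  then obtain m where m: "m \<in> ph_poly" "poly m a = 0" "Polynomial.lead_coeff m = 1" "Polynomial.degree m = n"
    by (auto simp: Q_def)
  have min: "n \<le> Polynomial.degree f" if "f \<in> ph_poly" "poly f a = 0" "f \<noteq> 0" for f
    using monic[OF that] by (auto simp: n_def intro: Least_le)
  have dvd: "\<exists>g\<in>ph_poly. f = m * g" if "f \<in> ph_poly" "poly f a = 0" for f
    using that
  \<comment> \<open>The zero polynomial gets a measure below that of the nonzero constants, so that
    a vanishing remainder counts as progress even in degree 0.\<close>
  proof (induction "if f = 0 then 0 else Suc (Polynomial.degree f)" arbitrary: f rule: less_induct)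
    case less
    show ?case
    proof (cases "f = 0")
      case True
      thus ?thesis using ph_poly_monom[of 0 0] ph_rat[of 0] by (intro bexI[of _ 0]) auto
    next
      case False
      define d where "d = Polynomial.degree f"
      have d: "n \<le> d" using min[of f] less False by (simp add: d_def)
      define h where "h = Polynomial.monom (Polynomial.lead_coeff f) (d - n)"
      have h: "h \<in> ph_poly" unfolding h_def using less by (intro ph_poly_monom) (auto simp: ph_poly_def)
      define f' where "f' = f - m * h"
      have f': "f' \<in> ph_poly" "poly f' a = 0"
        using ph_poly_add[of f "- (m * h)"] ph_poly_mult[OF m(1) h] ph_poly_uminus less m by (auto simp: f'_def)
      have dh: "Polynomial.degree (m * h) = d" "Polynomial.coeff (m * h) d = Polynomial.lead_coeff f"
      proof -
        have "m \<noteq> 0" "h \<noteq> 0" using m False by (auto simp: h_def)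
        thus "Polynomial.degree (m * h) = d" using d m(4) False
          by (simp add: degree_mult_eq h_def degree_monom_eq)
        thus "Polynomial.coeff (m * h) d = Polynomial.lead_coeff f"
          using lead_coeff_mult[of m h] m(3) False by (simp add: h_def degree_monom_eq)
      qed
      have "f' = 0 \<or> Polynomial.degree f' < d"
      proof (cases "d = 0")
        case True
        hence "Polynomial.degree f' = 0" using degree_diff_le[of f d "m * h"] dh by (simp add: f'_def d_def)
        moreover have "Polynomial.coeff f' 0 = 0" using dh True by (simp add: f'_def d_def)
        ultimately show ?thesis by (metis leading_coeff_0_iff)
      next
        case False
        have "Polynomial.degree f' \<le> d" using degree_diff_le[of f d "m * h"] dh by (simp add: f'_def d_def)
        moreover have "Polynomial.coeff f' d = 0" using dh by (simp add: f'_def d_def)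
        ultimately show ?thesis using eq_zero_or_degree_less by blast
      qed
      then obtain g where g: "g \<in> ph_poly" "f' = m * g"
        using less(1)[of f'] f' False by (cases "f' = 0") (auto simp: d_def)
      have "f = m * (g + h)" using g by (simp add: f'_def algebra_simps)
      thus ?thesis using g h ph_poly_add by blast
    qed
  qed
  have "n > 0"
  proof (rule Nat.gr0I)
    assume "n = 0"
    then obtain c where "m = [:c:]" using m by (auto elim: degree_eq_zeroE)
    thus False using m by auto
  qed
  have dm: "Polynomial.degree (map_poly ph_fun m) = n"
    using m ph_fun_eq[of 1 1] ph_rat[of 1] by (subst degree_map_poly) auto
  obtain b where b: "poly (map_poly ph_fun m) b = 0"
    using dm \<open>n > 0\<close> fundamental_theorem_of_algebra[of "map_poly ph_fun m"] constant_degree[of "map_poly ph_fun m"] by auto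
  define R' where "R' = {(poly f a, poly (map_poly ph_fun f) b) | f. f \<in> ph_poly}"
  have I: "(poly f a, poly (map_poly ph_fun f) b) \<in> R'" if "f \<in> ph_poly" for f using that by (auto simp: R'_def)
  have sub: "(c, d) \<in> R'" if "(c, d) \<in> R" for c d
  proof -
    have "[:c:] \<in> ph_poly" using ph_poly_monom[of c 0] that by (auto simp: monom_0)
    moreover have "map_poly ph_fun [:c:] = [:ph_fun c:]"
      by (simp add: poly_eq_iff coeff_map_poly ph_fun_0 coeff_pCons split: nat.split)
    ultimately show ?thesis using I[of "[:c:]"] ph_fun_eq[OF that] by simp
  qed
  have "partial_hom R'"
    unfolding partial_hom_def
  proof (intro conjI ballI allI impI)
    fix r :: complex assume "r \<in> \<rat>"
    thus "(r, r) \<in> R'" using sub ph_rat by blast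
  next
    fix x y z w assume "(x, y) \<in> R'" "(z, w) \<in> R'"
    then obtain f g where fg: "f \<in> ph_poly" "g \<in> ph_poly" "x = poly f a" "y = poly (map_poly ph_fun f) b"
      "z = poly g a" "w = poly (map_poly ph_fun g) b" by (auto simp: R'_def)
    show "(x + z, y + w) \<in> R'" using I[of "f + g"] ph_poly_add[of f g] fg by simp
    show "(x * z, y * w) \<in> R'" using I[of "f * g"] ph_poly_mult[of f g] fg by simp
  next
    fix x y assume "(x, y) \<in> R'"
    then obtain f where f: "f \<in> ph_poly" "x = poly f a" "y = poly (map_poly ph_fun f) b" by (auto simp: R'_def)
    show "algebraic x" unfolding f(2) poly_altdef using f(1) ph_alg assms
      by (auto intro!: algebraic_sum algebraic_mult algebraic_power simp: ph_poly_def Domain_iff)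
    show "y = 0" if "x = 0"
    proof -
      obtain g where "g \<in> ph_poly" "f = m * g" using dvd f \<open>x = 0\<close> by auto
      thus ?thesis using f b ph_poly_mult[OF m(1)] by auto
    qed
  qed
  moreover have "a \<in> Domain R'"
  proof -
    have "[:0,1:] \<in> ph_poly" using ph_poly_monom[of 1 1] ph_rat[of 1] by (auto simp: monom_altdef)
    from I[OF this] show ?thesis by auto
  qed
  ultimately show ?thesis using sub by auto
qed

end

text \<open>Conjugate numbers are joined by an automorphism. By \<open>xy\<close>, the rule p(x) ->
  p(y) is a partial homomorphism; a maximal extension of it has every algebraic number in its
  domain, since any other could still be adjoined.\<close>

theorem AbsGal_extend:
  assumes x: "algebraic x"
    and xy: "\<And>p. (\<And>i. Polynomial.coeff p i \<in> \<rat>) \<Longrightarrow> poly p x = 0 \<Longrightarrow> poly p y = 0"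
  shows "\<exists>\<phi>\<in>AbsGal. \<phi> x = y"
proof -
  define QP where "QP = {p :: complex poly. \<forall>i. Polynomial.coeff p i \<in> \<rat>}"
  define R0 where "R0 = {(poly p x, poly p y) | p. p \<in> QP}"
  have I: "(poly p x, poly p y) \<in> R0" if "p \<in> QP" for p using that by (auto simp: R0_def)
  have R0: "partial_hom R0"
    unfolding partial_hom_def
  proof (intro conjI ballI allI impI)
    fix r :: complex assume "r \<in> \<rat>"
    thus "(r, r) \<in> R0" using I[of "[:r:]"] by (auto simp: QP_def coeff_pCons split: nat.splits)
  next
    fix a b c d assume "(a, b) \<in> R0" "(c, d) \<in> R0"
    then obtain f g where fg: "f \<in> QP" "g \<in> QP" "a = poly f x" "b = poly f y" "c = poly g x" "d = poly g y"
      by (auto simp: R0_def)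
    have "f + g \<in> QP" "f * g \<in> QP" using fg by (auto simp: QP_def coeff_mult intro!: Rats_sum)
    thus "(a + c, b + d) \<in> R0" "(a * c, b * d) \<in> R0" using I[of "f + g"] I[of "f * g"] fg by auto
  next
    fix a b assume "(a, b) \<in> R0"
    then obtain f where f: "f \<in> QP" "a = poly f x" "b = poly f y" by (auto simp: R0_def)
    show "algebraic a" unfolding f(2) poly_altdef using f(1) x
      by (intro algebraic_sum algebraic_mult algebraic_power) (auto simp: QP_def intro: rat_imp_algebraic)
    show "b = 0" if "a = 0" using that f xy by (auto simp: QP_def)
  qed
  define A where "A = {R. partial_hom R \<and> R0 \<subseteq> R}"
  have "\<exists>Y\<in>A. (\<forall>Z\<in>A. Y \<subseteq> Z \<longrightarrow> Z = Y)"
  proof (rule subset_Zorn_nonempty)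
    show "A \<noteq> {}" using R0 by (auto simp: A_def)
    fix C assume C: "C \<noteq> {}" "subset.chain A C"
    have CA: "C \<subseteq> A" and tot: "\<And>Z Z'. Z \<in> C \<Longrightarrow> Z' \<in> C \<Longrightarrow> Z \<subseteq> Z' \<or> Z' \<subseteq> Z"
      using C by (auto simp: subset.chain_def)
    have ph: "partial_hom Z" if "Z \<in> C" for Z using that CA by (auto simp: A_def)
    have "partial_hom (\<Union>C)"
      unfolding partial_hom_def
    proof (intro conjI ballI allI impI)
      fix r :: complex assume "r \<in> \<rat>"
      thus "(r, r) \<in> \<Union>C" using C ph ph_rat by blast
    next
      fix a b c d assume "(a, b) \<in> \<Union>C" "(c, d) \<in> \<Union>C"
      then obtain Z where Z: "Z \<in> C" "(a, b) \<in> Z" "(c, d) \<in> Z" using tot by blast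
      thus "(a + c, b + d) \<in> \<Union>C" "(a * c, b * d) \<in> \<Union>C" using ph_add[OF ph] ph_mult[OF ph] by blast+
    next
      fix a b assume "(a, b) \<in> \<Union>C"
      then obtain Z where Z: "Z \<in> C" "(a, b) \<in> Z" by blast
      show "algebraic a" using ph_alg[OF ph] Z by blast
      show "b = 0" if "a = 0" using ph_0[OF ph] Z that by blast
    qed
    moreover have "R0 \<subseteq> \<Union>C" using C CA by (auto simp: A_def)
    ultimately show "\<Union>C \<in> A" by (simp add: A_def)
  qed
  then obtain M where M: "partial_hom M" "R0 \<subseteq> M" and max: "\<And>Z. partial_hom Z \<Longrightarrow> M \<subseteq> Z \<Longrightarrow> Z = M"
    by (auto simp: A_def)
  have dom: "a \<in> Domain M" if "algebraic a" for a
    using ph_extend[OF M(1) that] max by blast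
  have "ph_fun M \<in> AbsGal"
    unfolding AbsGal_def
    using ph_fun_add[OF M(1)] ph_fun_mult[OF M(1)] dom ph_fun_eq[OF M(1), of 1 1] ph_rat[OF M(1), of 1] by auto
  moreover have "ph_fun M x = y"
  proof (rule ph_fun_eq[OF M(1)])
    have "[:0,1:] \<in> QP" by (auto simp: QP_def coeff_pCons split: nat.splits)
    from I[OF this] show "(x, y) \<in> M" using M(2) by auto
  qed
  ultimately show ?thesis by blast
qed

section \<open>Minimal polynomials, and conjugates as orbits of automorphisms\<close>

lemma complex_ring_field: "field complex_ring" by (rule class_field)

lemma complex_ring_domain: "domain complex_ring" and complex_ring_ring: "ring complex_ring"
  and complex_ring_cring: "cring complex_ring"
  using complex_ring_field by (auto simp: field_def domain_def cring_def)

text \<open>Coefficient lists start with the leading coefficient, whence the reversal.\<close>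

lemma complex_ring_eval: "ring.eval complex_ring p x = poly (Poly (rev p)) x"
proof (induction p)
  case Nil
  thus ?case by (simp add: ring.eval.simps[OF complex_ring_ring] class_ring_simps)
next
  case (Cons a p)
  thus ?case
    by (simp add: ring.eval.simps[OF complex_ring_ring] class_ring_simps Poly_append poly_monom algebra_simps)
qed

lemma subfield_closed:
  assumes "subfield K complex_ring"
  shows "0 \<in> K" "1 \<in> K" "x \<in> K \<Longrightarrow> y \<in> K \<Longrightarrow> x + y \<in> K" "x \<in> K \<Longrightarrow> y \<in> K \<Longrightarrow> x * y \<in> K"
    "x \<in> K \<Longrightarrow> - x \<in> K" "x \<in> K \<Longrightarrow> y \<in> K \<Longrightarrow> x - y \<in> K" "x \<in> K \<Longrightarrow> inverse x \<in> K"
proof -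
  have s: "subring K complex_ring" using subfieldE(1)[OF assms] .
  note e = subringE[OF s, unfolded class_ring_simps]
  show "0 \<in> K" using subringE(2)[OF s] by (simp add: class_ring_simps)
  show "1 \<in> K" using subringE(3)[OF s] by (simp add: class_ring_simps)
  show add: "x \<in> K \<Longrightarrow> y \<in> K \<Longrightarrow> x + y \<in> K" for x y using subringE(7)[OF s] by (simp add: class_ring_simps)
  show "x \<in> K \<Longrightarrow> y \<in> K \<Longrightarrow> x * y \<in> K" using subringE(6)[OF s] by (simp add: class_ring_simps)
  show min: "x \<in> K \<Longrightarrow> - x \<in> K" for x using subringE(5)[OF s] by (simp add: class_ring_simps)
  show "x \<in> K \<Longrightarrow> y \<in> K \<Longrightarrow> x - y \<in> K" using add[of x "-y"] min[of y] by simp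
  show "x \<in> K \<Longrightarrow> inverse x \<in> K"
  proof (cases "x = 0")
    case False
    assume "x \<in> K"
    with False have "m_inv complex_ring x \<in> K - {\<zero>\<^bsub>complex_ring\<^esub>}"
      by (intro ring.subfield_m_inv(1)[OF complex_ring_ring assms]) (simp add: class_ring_simps)
    thus ?thesis using False by (simp add: class_ring_simps)
  qed simp
qed

lemma subfield_Rats: "subfield \<rat> complex_ring"
proof (rule field.subfieldI'[OF complex_ring_field])
  show "subring \<rat> complex_ring"
    by (rule ring.subringI[OF complex_ring_ring]) (auto simp: class_ring_simps)
qed (auto simp: class_ring_simps)

lemma subfield_of_nat: "subfield K complex_ring \<Longrightarrow> of_nat n \<in> K"
  by (induction n) (auto simp: subfield_closed)

lemma subfield_of_int: "subfield K complex_ring \<Longrightarrow> of_int n \<in> K"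
  by (cases n rule: int_cases2) (auto simp: subfield_of_nat subfield_closed)

lemma Rats_subset_subfield: assumes "subfield K complex_ring" shows "\<rat> \<subseteq> K"
proof
  fix x :: complex assume "x \<in> \<rat>"
  then obtain a b where "x = of_int a / of_int b" by (auto elim: Rats_cases')
  thus "x \<in> K" using subfield_of_int[OF assms] subfield_closed[OF assms] by (simp add: divide_inverse)
qed

lemma carrier_univ_poly_complex:
  "p \<in> carrier (univ_poly complex_ring K) \<longleftrightarrow> p = [] \<or> (set p \<subseteq> K \<and> hd p \<noteq> 0)"
  by (simp add: univ_poly_def polynomial_def class_ring_simps)

lemma rev_coeffs_carrier:
  assumes "\<And>i. Polynomial.coeff f i \<in> K"
  shows "rev (coeffs f) \<in> carrier (univ_poly complex_ring K)"
proof (cases "f = 0")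
  case False
  have "set (coeffs f) \<subseteq> K" using assms by (auto simp: coeffs_def)
  thus ?thesis using False unfolding carrier_univ_poly_complex
    by (auto simp: hd_rev last_coeffs_eq_coeff_degree)
qed (simp add: carrier_univ_poly_complex)

lemma Poly_rev_coeff:
  assumes "p \<in> carrier (univ_poly complex_ring K)" "0 \<in> K"
  shows "Polynomial.coeff (Poly (rev p)) i \<in> K"
  using assms unfolding carrier_univ_poly_complex
  by (auto simp: coeff_Poly_eq nth_default_def rev_nth)

lemma algebraic_complex_ring:
  assumes "algebraic x" "subfield K complex_ring"
  shows "(ring.algebraic complex_ring over K) x"
proof -
  obtain f where f: "\<And>i. Polynomial.coeff f i \<in> \<int>" "f \<noteq> 0" "poly f x = 0"
    using assms(1) by (elim algebraicE) auto
  have "Polynomial.coeff f i \<in> K" for i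
    using f(1)[of i] subfield_of_int[OF assms(2)] by (auto elim!: Ints_cases)
  hence "rev (coeffs f) \<in> carrier (univ_poly complex_ring K)" by (rule rev_coeffs_carrier)
  thus ?thesis
    by (rule ring.algebraicI[OF complex_ring_ring])
       (use f in \<open>auto simp: complex_ring_eval class_ring_simps\<close>)
qed

lemmas complex_IrrE = domain.IrrE[OF complex_ring_domain _ _ algebraic_complex_ring]

lemma conjugates_altdef:
  assumes "algebraic x"
  shows "conjugates x = {y. \<forall>f. (\<forall>i. Polynomial.coeff f i \<in> \<rat>) \<longrightarrow> poly f x = 0 \<longrightarrow> poly f y = 0}"
proof (intro equalityI subsetI CollectI allI impI)
  have xc: "x \<in> carrier complex_ring" for x by (simp add: class_ring_simps)
  note I = complex_IrrE[OF subfield_Rats xc assms subfield_Rats]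
  {
    fix y f assume y: "y \<in> conjugates x" and f: "\<forall>i. Polynomial.coeff f i \<in> \<rat>" "poly f x = 0"
    have rc: "rev (coeffs f) \<in> carrier (univ_poly complex_ring \<rat>)"
      using f by (intro rev_coeffs_carrier) auto
    have "(minpoly x) pdivides\<^bsub>complex_ring\<^esub> (rev (coeffs f))"
      by (rule domain.Irr_minimal[OF complex_ring_domain subfield_Rats xc algebraic_complex_ring[OF assms subfield_Rats] rc])
         (use f in \<open>simp add: complex_ring_eval class_ring_simps\<close>)
    moreover have "minpoly x \<in> carrier (poly_ring complex_ring)"
      using I(1) by (auto simp: carrier_univ_poly_complex class_ring_simps)
    moreover have "ring.eval complex_ring (minpoly x) y = \<zero>\<^bsub>complex_ring\<^esub>"
      using y by (simp add: conjugates_def class_ring_simps)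
    ultimately have "ring.eval complex_ring (rev (coeffs f)) y = \<zero>\<^bsub>complex_ring\<^esub>"
      using domain.pdivides_imp_root_sharing[OF complex_ring_domain _ _ xc] by blast
    thus "poly f y = 0" by (simp add: complex_ring_eval class_ring_simps)
  next
    fix y assume y: "y \<in> {y. \<forall>f. (\<forall>i. Polynomial.coeff f i \<in> \<rat>) \<longrightarrow> poly f x = 0 \<longrightarrow> poly f y = 0}"
    have "Polynomial.coeff (Poly (rev (minpoly x))) i \<in> \<rat>" for i
      using I(1) by (intro Poly_rev_coeff) auto
    moreover have "poly (Poly (rev (minpoly x))) x = 0"
      using I(4) by (simp add: complex_ring_eval class_ring_simps)
    ultimately have "poly (Poly (rev (minpoly x))) y = 0" using y by blast
    thus "y \<in> conjugates x" by (simp add: conjugates_def complex_ring_eval)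
  }
qed

text \<open>Turns total reality and total positivity into conditions on the values of all
  automorphisms. The inclusion of the conjugates in the orbit is the extension theorem.\<close>

lemma conjugates_eq_orbit:
  assumes "algebraic x"
  shows "conjugates x = (\<lambda>\<phi>. \<phi> x) ` AbsGal"
proof (intro equalityI subsetI)
  fix y assume "y \<in> conjugates x"
  hence "\<exists>\<phi>\<in>AbsGal. \<phi> x = y" using assms by (intro AbsGal_extend) (auto simp: conjugates_altdef)
  thus "y \<in> (\<lambda>\<phi>. \<phi> x) ` AbsGal" by auto
next
  fix y assume "y \<in> (\<lambda>\<phi>. \<phi> x) ` AbsGal"
  then obtain \<phi> where "\<phi> \<in> AbsGal" "y = \<phi> x" by auto
  thus "y \<in> conjugates x" using assms AbsGal_poly[of \<phi> _ x] AbsGal_0[of \<phi>]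
    by (auto simp: conjugates_altdef) metis
qed

lemma AbsGal_in_conjugates: "algebraic x \<Longrightarrow> \<phi> \<in> AbsGal \<Longrightarrow> \<phi> x \<in> conjugates x"
  by (simp add: conjugates_eq_orbit)

lemma finite_conjugates:
  assumes "algebraic x"
  shows "finite (conjugates x)"
proof -
  obtain f where f: "\<And>i. Polynomial.coeff f i \<in> \<int>" "f \<noteq> 0" "poly f x = 0"
    using assms(1) by (elim algebraicE) auto
  have "Polynomial.coeff f i \<in> \<rat>" for i using f(1)[of i] Ints_subset_Rats by blast
  hence "conjugates x \<subseteq> {y. poly f y = 0}" using f(3) by (auto simp: conjugates_altdef[OF assms])
  thus ?thesis using poly_roots_finite[OF f(2)] by (rule finite_subset)
qed

text \<open>The only conjugate of \<open>x\<close> is \<open>x\<close>, so the minimal polynomial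
  has a single root. The derivative has smaller degree and cannot vanish there, so the root is
  simple and the polynomial is linear.\<close>

lemma AbsGal_fixed_imp_Rats:
  assumes "algebraic x" "\<And>\<phi>. \<phi> \<in> AbsGal \<Longrightarrow> \<phi> x = x"
  shows "x \<in> \<rat>"
proof -
  have xc: "x \<in> carrier complex_ring" for x by (simp add: class_ring_simps)
  note I = complex_IrrE[OF subfield_Rats xc assms(1) subfield_Rats]
  define m where "m = Poly (rev (minpoly x))"
  have ne: "minpoly x \<noteq> []" using I(4) I(3) domain.pirreducibleE(1)[OF complex_ring_domain subfieldE(1)[OF subfield_Rats] I(1,2)] by simp
  have m: "Polynomial.coeff m i \<in> \<rat>" for i
    unfolding m_def using I(1) by (intro Poly_rev_coeff) auto
  have conj: "conjugates x = {x}" using assms AbsGal_id by (auto simp: conjugates_eq_orbit)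
  hence root: "poly m y = 0 \<longleftrightarrow> y = x" for y
    unfolding conjugates_def m_def complex_ring_eval by blast
  have dm: "Polynomial.lead_coeff m = 1" "Polynomial.degree m = length (minpoly x) - 1"
  proof -
    have h: "hd (minpoly x) = 1" using I(3) by (simp add: class_ring_simps)
    have c: "coeffs m = rev (minpoly x)"
      unfolding m_def using ne h by (intro coeffs_Poly[THEN trans]) (cases "minpoly x"; simp add: strip_while_def)
    show "Polynomial.degree m = length (minpoly x) - 1" using c by (simp add: degree_eq_length_coeffs)
    show "Polynomial.lead_coeff m = 1"
      using c h ne by (metis coeffs_eq_Nil last_coeffs_eq_coeff_degree last_rev rev_is_Nil_conv)
  qed
  have m0: "m \<noteq> 0" using dm by auto
  have xr: "poly m x = 0" using root by simp
  have "poly (pderiv m) x \<noteq> 0"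
  proof
    assume d: "poly (pderiv m) x = 0"
    have "pderiv m \<noteq> 0"
    proof
      assume "pderiv m = 0"
      then obtain c where "m = [:c:]" using pderiv_iszero[of m] by auto
      thus False using xr m0 by auto
    qed
    have dr: "Polynomial.coeff (pderiv m) i \<in> \<rat>" for i using m by (auto simp: coeff_pderiv)
    hence rc: "rev (coeffs (pderiv m)) \<in> carrier (univ_poly complex_ring \<rat>)" by (rule rev_coeffs_carrier)
    have "(minpoly x) pdivides\<^bsub>complex_ring\<^esub> (rev (coeffs (pderiv m)))"
      by (rule domain.Irr_minimal[OF complex_ring_domain subfield_Rats xc algebraic_complex_ring[OF assms(1) subfield_Rats] rc])
         (use d in \<open>simp add: complex_ring_eval class_ring_simps\<close>)
    hence "length (minpoly x) - 1 \<le> length (rev (coeffs (pderiv m))) - 1"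
      using domain.pdivides_imp_degree_le[OF complex_ring_domain subfieldE(1)[OF subfield_Rats] I(1) rc] \<open>pderiv m \<noteq> 0\<close> by simp
    hence "Polynomial.degree m \<le> Polynomial.degree (pderiv m)"
      using dm by (simp add: degree_eq_length_coeffs)
    thus False using \<open>pderiv m \<noteq> 0\<close> by (metis degree_pderiv diff_le_self le_antisym not_less_eq_eq pderiv_eq_0_iff zero_less_iff_neq_zero diff_less less_numeral_extra(1) not_le)
  qed
  then have o: "Polynomial.order x m = 1"
    using order_pderiv[of m x] xr m0 by (metis One_nat_def order_0I order_root pderiv_0 poly_0)
  have "Polynomial.degree m \<le> 1"
  proof -
    obtain g where g: "m = [:-x,1:] ^ 1 * g" "\<not> [:-x,1:] dvd g" using order_decomp[OF m0, of x] o by auto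
    have "poly g y \<noteq> 0" for y
    proof
      assume "poly g y = 0"
      hence "poly m y = 0" using g by simp
      hence "y = x" using root by simp
      with \<open>poly g y = 0\<close> g(2) show False by (simp add: poly_eq_0_iff_dvd)
    qed
    hence "constant (poly g)" using fundamental_theorem_of_algebra by blast
    hence "Polynomial.degree g = 0" by (simp add: constant_degree)
    moreover have "g \<noteq> 0" using m0 g by auto
    ultimately show ?thesis using g(1) degree_mult_eq[of "[:-x,1:]" g] by simp
  qed
  then obtain a b where ab: "m = [:a, b:]" by (metis degree1_coeffs le_add1 add_0 degree_eq_zeroE le_neq_implies_less less_one pCons_0_0)
  have "b \<noteq> 0"
  proof
    assume "b = 0" thus False using xr m0 ab by simp
  qed
  moreover have "a + x * b = 0" using xr ab by simp
  ultimately have "x = - a / b" by (simp add: field_simps eq_neg_iff_add_eq_0)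
  moreover have "a \<in> \<rat>" "b \<in> \<rat>" using m[of 0] m[of 1] ab by auto
  ultimately show ?thesis by auto
qed

text \<open>The minimal polynomial over \<open>F\<close> of a conjugate divides the one of
  \<open>x\<close> over the rationals, which splits over \<open>F\<close>. Being irreducible, it is
  linear, and so the conjugate lies in \<open>F\<close>.\<close>

lemma normal_extension_conjugates:
  assumes F: "subfield F complex_ring" and n: "normal_extension F" and x: "x \<in> F"
  shows "conjugates x \<subseteq> F"
proof
  fix y assume y: "y \<in> conjugates x"
  have xc: "x \<in> carrier complex_ring" for x by (simp add: class_ring_simps)
  have ax: "algebraic x" and sp: "ring.splitted (complex_ring_on F) (minpoly x)"
    using n x by (auto simp: normal_extension_def)
  have ay: "algebraic y" using y ax by (auto simp: conjugates_eq_orbit AbsGal_algebraic)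
  note I = complex_IrrE[OF subfield_Rats xc ax subfield_Rats]
  note J = complex_IrrE[OF F xc ay F]
  let ?F = "complex_ring_on F"
  have car: "carrier ?F = F" by simp
  have fF: "field ?F" using ring.subfield_iff(2)[OF complex_ring_ring F] .
  have up: "univ_poly ?F = univ_poly complex_ring"
    using ring.univ_poly_consistent[OF complex_ring_ring subfieldE(1)[OF F]] .
  have mF: "minpoly x \<in> carrier (univ_poly complex_ring F)"
    using I(1) Rats_subset_subfield[OF F] by (auto simp: carrier_univ_poly_complex)
  have ne: "minpoly x \<noteq> []" using domain.pirreducibleE(1)[OF complex_ring_domain subfieldE(1)[OF subfield_Rats] I(1,2)] by simp
  define q where "q = ring.Irr complex_ring F y"
  have "q pdivides\<^bsub>complex_ring\<^esub> (minpoly x)"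
    unfolding q_def
    by (rule domain.Irr_minimal[OF complex_ring_domain F xc algebraic_complex_ring[OF ay F] mF])
       (use y in \<open>simp add: conjugates_def class_ring_simps\<close>)
  hence "q divides\<^bsub>univ_poly complex_ring F\<^esub> minpoly x"
    using domain.pdivides_iff_shell[OF complex_ring_domain F J(1) mF] by (simp add: q_def)
  hence div: "q pdivides\<^bsub>?F\<^esub> (minpoly x)"
    unfolding pdivides_def car up .
  have "length q - 1 = 1"
    by (rule field.splitted_imp_trivial_factors[OF fF _ ne sp _ _ div])
       (use mF J(1) J(2) in \<open>simp_all only: car up q_def\<close>)
  hence "length q = 2" by simp
  then obtain a b where q: "q = [a, b]" by (auto simp: length_Suc_conv numeral_2_eq_2)
  have "a = 1" using J(3) q by (simp add: q_def class_ring_simps)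
  moreover have "b \<in> F" using J(1) q by (auto simp: q_def[symmetric] carrier_univ_poly_complex)
  moreover have "y + b = 0"
    using J(4) q \<open>a = 1\<close> by (simp add: q_def[symmetric] complex_ring_eval class_ring_simps add.commute)
  ultimately have "y = - b" by (simp add: eq_neg_iff_add_eq_0)
  thus "y \<in> F" using \<open>b \<in> F\<close> subfield_closed[OF F] by simp
qed

section \<open>Rational independence and degree\<close>

lemma complex_combine:
  assumes "length Ks = length Us"
  shows "ring.combine complex_ring Ks Us = (\<Sum>i<length Us. Ks ! i * Us ! i)"
  using assms
  by (induction Ks Us rule: list_induct2)
     (simp_all add: ring.combine.simps[OF complex_ring_ring] class_ring_simps sum.lessThan_Suc_shift del: sum.lessThan_Suc)

definition rat_independent :: "nat \<Rightarrow> (nat \<Rightarrow> complex) \<Rightarrow> bool" where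
  "rat_independent n u \<longleftrightarrow>
     (\<forall>c. (\<forall>i<n. c i \<in> \<rat>) \<longrightarrow> (\<Sum>i<n. c i * u i) = 0 \<longrightarrow> (\<forall>i<n. c i = 0))"

lemma independent_imp_rat_independent:
  assumes "ring.independent complex_ring \<rat> Us"
  shows "rat_independent (length Us) (\<lambda>i. Us ! i)"
  unfolding rat_independent_def
proof (intro allI impI)
  fix c :: "nat \<Rightarrow> complex" and i
  assume c: "\<forall>i<length Us. c i \<in> \<rat>" "(\<Sum>i<length Us. c i * Us ! i) = 0" and i: "i < length Us"
  define Ks where "Ks = map c [0..<length Us]"
  have "set Ks \<subseteq> \<rat>" using c by (auto simp: Ks_def)
  moreover have "ring.combine complex_ring Ks Us = \<zero>\<^bsub>complex_ring\<^esub>"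
    using c by (subst complex_combine) (auto simp: Ks_def class_ring_simps)
  ultimately have "set (take (length Us) Ks) \<subseteq> {\<zero>\<^bsub>complex_ring\<^esub>}"
    using ring.independent_imp_trivial_combine[OF complex_ring_ring subfield_Rats assms] by blast
  hence "set Ks \<subseteq> {0}" by (simp add: Ks_def class_ring_simps)
  thus "c i = 0" using i by (auto simp: Ks_def image_subset_iff)
qed

lemma dimension_basis:
  assumes "ring.dimension complex_ring n \<rat> F"
  obtains u where "rat_independent n u" "\<And>i. i < n \<Longrightarrow> u i \<in> F"
    "\<And>x. x \<in> F \<Longrightarrow> \<exists>c. (\<forall>i<n. c i \<in> \<rat>) \<and> x = (\<Sum>i<n. c i * u i)"
proof -
  obtain Vs where Vs: "set Vs \<subseteq> carrier complex_ring" "ring.independent complex_ring \<rat> Vs" "length Vs = n"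
    "ring.Span complex_ring \<rat> Vs = F"
    using ring.exists_base[OF complex_ring_ring subfield_Rats assms] by blast
  show thesis
  proof (rule that[of "\<lambda>i. Vs ! i"])
    show "rat_independent n ((!) Vs)" using independent_imp_rat_independent[OF Vs(2)] Vs(3) by simp
    show "Vs ! i \<in> F" if "i < n" for i
      using ring.Span_base_incl[OF complex_ring_ring subfield_Rats Vs(1)] Vs(3,4) that by auto
    fix x assume "x \<in> F"
    then obtain Ks where Ks: "set Ks \<subseteq> \<rat>" "length Ks = length Vs" "x = ring.combine complex_ring Ks Vs"
      using ring.Span_mem_iff_length_version[OF complex_ring_ring subfield_Rats Vs(1)] Vs(4) by blast
    hence "x = (\<Sum>i<n. Ks ! i * Vs ! i)" using complex_combine Vs(3) by simp
    moreover have "\<forall>i<n. Ks ! i \<in> \<rat>" using Ks Vs(3) by (metis nth_mem subsetD)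
    ultimately show "\<exists>c. (\<forall>i<n. c i \<in> \<rat>) \<and> x = (\<Sum>i<n. c i * Vs ! i)" by blast
  qed
qed

text \<open>The form in which infinite degree enters the proof: the span of finitely many elements
  is never all of \<open>K\<close>, so a further independent element can always be added.\<close>

lemma infinite_dimension_independent:
  assumes K: "subfield K complex_ring" and inf: "\<not> ring.finite_dimension complex_ring \<rat> K"
  shows "\<exists>u. rat_independent n u \<and> (\<forall>i<n. u i \<in> K)"
proof -
  have "\<exists>Us. length Us = n \<and> ring.independent complex_ring \<rat> Us \<and> set Us \<subseteq> K"
  proof (induction n)
    case 0
    show ?case using ring.li_Nil[OF complex_ring_ring] by (intro exI[of _ "[]"]) auto
  next
    case (Suc n)
    then obtain Us where Us: "length Us = n" "ring.independent complex_ring \<rat> Us" "set Us \<subseteq> K" by blast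
    have "ring.Span complex_ring \<rat> Us \<subseteq> K"
    proof
      fix x assume "x \<in> ring.Span complex_ring \<rat> Us"
      then obtain Ks where Ks: "set Ks \<subseteq> \<rat>" "length Ks = length Us" "x = ring.combine complex_ring Ks Us"
        using ring.Span_mem_iff_length_version[OF complex_ring_ring subfield_Rats, of Us x] by (auto simp: class_ring_simps)
      have x: "x = (\<Sum>i<length Us. Ks ! i * Us ! i)" using Ks complex_combine by simp
      have "(\<Sum>i\<in>I. Ks ! i * Us ! i) \<in> K" if "finite I" "I \<subseteq> {..<length Us}" for I
        using that
      proof (induction I rule: finite_induct)
        case (insert i I)
        have "i < length Us" using insert.prems by auto
        hence "Ks ! i \<in> K" "Us ! i \<in> K"
          using \<open>i < length Us\<close> Ks(1,2) Us(3) Rats_subset_subfield[OF K] by (metis nth_mem subsetD)+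
        thus ?case using insert subfield_closed[OF K] by simp
      qed (simp add: subfield_closed[OF K])
      thus "x \<in> K" using x by simp
    qed
    moreover have "ring.Span complex_ring \<rat> Us \<noteq> K"
      using inf ring.Span_finite_dimension[OF complex_ring_ring subfield_Rats, of Us] by (auto simp: class_ring_simps)
    ultimately obtain u where u: "u \<in> K" "u \<notin> ring.Span complex_ring \<rat> Us" by blast
    have "ring.independent complex_ring \<rat> (u # Us)"
      by (rule ring.li_Cons[OF complex_ring_ring]) (use u Us in \<open>auto simp: class_ring_simps\<close>)
    thus ?case using Us u by (intro exI[of _ "u # Us"]) auto
  qed
  thus ?thesis using independent_imp_rat_independent by (metis nth_mem subsetD)
qed

section \<open>Fields generated by algebraic numbers\<close>

text \<open>The Galois correspondence serves as the definition of the field generated by \<open>A\<close>.\<close>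

definition qfield :: "complex set \<Rightarrow> complex set" where
  "qfield A = {x. algebraic x \<and>
     (\<forall>\<phi>\<in>AbsGal. \<forall>\<psi>\<in>AbsGal. (\<forall>y\<in>A. \<phi> y = \<psi> y) \<longrightarrow> \<phi> x = \<psi> x)}"

lemma qfieldI:
  "algebraic x \<Longrightarrow> (\<And>\<phi> \<psi>. \<phi> \<in> AbsGal \<Longrightarrow> \<psi> \<in> AbsGal \<Longrightarrow> (\<And>y. y \<in> A \<Longrightarrow> \<phi> y = \<psi> y) \<Longrightarrow> \<phi> x = \<psi> x)
    \<Longrightarrow> x \<in> qfield A"
  by (auto simp: qfield_def)

lemma qfieldD: "x \<in> qfield A \<Longrightarrow> \<phi> \<in> AbsGal \<Longrightarrow> \<psi> \<in> AbsGal \<Longrightarrow> (\<And>y. y \<in> A \<Longrightarrow> \<phi> y = \<psi> y) \<Longrightarrow> \<phi> x = \<psi> x"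
  by (auto simp: qfield_def)

lemma qfield_algebraic: "x \<in> qfield A \<Longrightarrow> algebraic x"
  by (auto simp: qfield_def)

lemma qfield_base: "x \<in> A \<Longrightarrow> algebraic x \<Longrightarrow> x \<in> qfield A"
  by (auto simp: qfield_def)

lemma qfield_mono:
  assumes "A \<subseteq> B"
  shows "qfield A \<subseteq> qfield B"
proof
  fix x assume x: "x \<in> qfield A"
  show "x \<in> qfield B"
    by (rule qfieldI[OF qfield_algebraic[OF x]], rule qfieldD[OF x]) (use assms in auto)
qed

lemma qfield_least:
  assumes "A \<subseteq> qfield B"
  shows "qfield A \<subseteq> qfield B"
proof
  fix x assume x: "x \<in> qfield A"
  show "x \<in> qfield B"
  proof (rule qfieldI[OF qfield_algebraic[OF x]], rule qfieldD[OF x])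
    fix \<phi> \<psi> y assume h: "\<phi> \<in> AbsGal" "\<psi> \<in> AbsGal" "\<And>y. y \<in> B \<Longrightarrow> \<phi> y = \<psi> y" "y \<in> A"
    thus "\<phi> y = \<psi> y" using assms by (intro qfieldD[of y B \<phi> \<psi>]) auto
  qed
qed

lemma qfield_idem: "(\<And>x. x \<in> A \<Longrightarrow> algebraic x) \<Longrightarrow> qfield (qfield A) = qfield A"
  using qfield_least[of "qfield A" A] qfield_mono[of A "qfield A"] qfield_base[of _ A] by (simp add: subset_antisym subsetI)

lemma qfield_Rats: "x \<in> \<rat> \<Longrightarrow> x \<in> qfield A"
  by (auto intro!: qfieldI rat_imp_algebraic simp: AbsGal_Rats)

lemma qfield_of_nat: "of_nat n \<in> qfield A" and qfield_of_int: "of_int k \<in> qfield A"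
  and qfield_1: "1 \<in> qfield A" and qfield_0: "0 \<in> qfield A"
  by (auto intro!: qfield_Rats)

lemma qfieldI2:
  assumes "x \<in> qfield A" "y \<in> qfield A" "algebraic z"
    and z: "\<And>\<phi> \<psi>. \<phi> \<in> AbsGal \<Longrightarrow> \<psi> \<in> AbsGal \<Longrightarrow> \<phi> x = \<psi> x \<Longrightarrow> \<phi> y = \<psi> y \<Longrightarrow> \<phi> z = \<psi> z"
  shows "z \<in> qfield A"
proof (rule qfieldI[OF assms(3)])
  fix \<phi> \<psi> assume h: "\<phi> \<in> AbsGal" "\<psi> \<in> AbsGal" "\<And>y. y \<in> A \<Longrightarrow> \<phi> y = \<psi> y"
  show "\<phi> z = \<psi> z"
    by (rule z[OF h(1,2) qfieldD[OF assms(1) h] qfieldD[OF assms(2) h]])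
qed

lemma qfield_closed:
  assumes "x \<in> qfield A" "y \<in> qfield A"
  shows "x + y \<in> qfield A" "x * y \<in> qfield A" "x - y \<in> qfield A" "x / y \<in> qfield A"
proof -
  note a = assms[THEN qfield_algebraic]
  show "x + y \<in> qfield A" by (rule qfieldI2[OF assms]) (use a in \<open>auto simp: AbsGal_add\<close>)
  show "x * y \<in> qfield A" by (rule qfieldI2[OF assms]) (use a in \<open>auto simp: AbsGal_mult\<close>)
  show "x - y \<in> qfield A" by (rule qfieldI2[OF assms]) (use a in \<open>auto simp: AbsGal_diff\<close>)
  show "x / y \<in> qfield A" by (rule qfieldI2[OF assms]) (use a in \<open>auto simp: AbsGal_divide\<close>)
qed

lemma qfield_uminus: "x \<in> qfield A \<Longrightarrow> - x \<in> qfield A"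
  using qfield_closed(3)[OF qfield_0, of x A] by simp

lemma qfield_inverse: "x \<in> qfield A \<Longrightarrow> inverse x \<in> qfield A"
  using qfield_closed(4)[OF qfield_1, of x A] by (simp add: divide_inverse)

lemma qfield_sum: "(\<And>i. i \<in> I \<Longrightarrow> f i \<in> qfield A) \<Longrightarrow> sum f I \<in> qfield A"
  by (induction I rule: infinite_finite_induct) (auto intro: qfield_0 qfield_closed)

lemma qfield_prod: "(\<And>i. i \<in> I \<Longrightarrow> f i \<in> qfield A) \<Longrightarrow> prod f I \<in> qfield A"
  by (induction I rule: infinite_finite_induct) (auto intro: qfield_1 qfield_closed)

lemma qfield_power: "x \<in> qfield A \<Longrightarrow> x ^ n \<in> qfield A"
  by (induction n) (auto intro: qfield_1 qfield_closed)

section \<open>Embeddings and their linear independence\<close>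

text \<open>The embeddings of the field generated by \<open>E\<close>, as restrictions so that there
  can be finitely many of them. Their number replaces the degree in what follows.\<close>

definition GalG :: "complex set \<Rightarrow> (complex \<Rightarrow> complex) set" where
  "GalG E = (\<lambda>\<phi>. restrict \<phi> E) ` AbsGal"

lemma GalGE:
  assumes "\<sigma> \<in> GalG E"
  obtains \<phi> where "\<phi> \<in> AbsGal" "\<sigma> = restrict \<phi> E"
  using assms by (auto simp: GalG_def)

lemma GalGI: "\<phi> \<in> AbsGal \<Longrightarrow> restrict \<phi> E \<in> GalG E" by (auto simp: GalG_def)

lemma GalG_eqI:
  assumes "\<sigma> \<in> GalG E" "\<tau> \<in> GalG E" "\<And>x. x \<in> E \<Longrightarrow> \<sigma> x = \<tau> x"
  shows "\<sigma> = \<tau>"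
  using assms by (auto elim!: GalGE intro!: restrict_ext)

lemma GalG_algebraic: "\<sigma> \<in> GalG E \<Longrightarrow> x \<in> E \<Longrightarrow> algebraic x \<Longrightarrow> algebraic (\<sigma> x)"
  by (auto elim!: GalGE simp: AbsGal_algebraic)

lemma GalG_algebraic_int: "\<sigma> \<in> GalG E \<Longrightarrow> x \<in> E \<Longrightarrow> algebraic_int x \<Longrightarrow> algebraic_int (\<sigma> x)"
  by (auto elim!: GalGE simp: AbsGal_algebraic_int)

lemma GalG_subset_card:
  assumes "A \<subseteq> B" "finite (GalG B)"
  shows "finite (GalG A) \<and> card (GalG A) \<le> card (GalG B)"
proof -
  have "restrict (restrict \<phi> B) A = restrict \<phi> A" for \<phi> :: "complex \<Rightarrow> complex"
    using assms(1) by (auto simp: restrict_def fun_eq_iff)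
  hence "GalG A = (\<lambda>\<sigma>. restrict \<sigma> A) ` GalG B" unfolding GalG_def image_image by simp
  thus ?thesis using assms(2) card_image_le by auto
qed

text \<open>Surjectivity is no part of the definition of \<open>AbsGal\<close>. Composition with an
  automorphism is injective on the finite set \<open>GalG A\<close>, hence a permutation of it, and
  inverses are obtained from this.\<close>

lemma GalG_bij:
  assumes alg: "\<And>x. x \<in> A \<Longrightarrow> algebraic x" and fin: "finite (GalG A)" and \<phi>: "\<phi> \<in> AbsGal"
  shows "bij_betw (\<lambda>\<sigma>. restrict (\<lambda>x. \<phi> (\<sigma> x)) A) (GalG A) (GalG A)"
proof -
  have inj: "inj_on (\<lambda>\<sigma>. restrict (\<lambda>x. \<phi> (\<sigma> x)) A) (GalG A)"
  proof (rule inj_onI)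
    fix \<sigma> \<tau> assume st: "\<sigma> \<in> GalG A" "\<tau> \<in> GalG A"
      and e: "restrict (\<lambda>x. \<phi> (\<sigma> x)) A = restrict (\<lambda>x. \<phi> (\<tau> x)) A"
    show "\<sigma> = \<tau>"
    proof (rule GalG_eqI[OF st])
      fix x assume x: "x \<in> A"
      hence "\<phi> (\<sigma> x) = \<phi> (\<tau> x)" using fun_cong[OF e, of x] by simp
      thus "\<sigma> x = \<tau> x" using AbsGal_eq_iff[OF \<phi>] GalG_algebraic[OF st(1) x] GalG_algebraic[OF st(2) x] alg[OF x] by simp
    qed
  qed
  have sub: "(\<lambda>\<sigma>. restrict (\<lambda>x. \<phi> (\<sigma> x)) A) ` GalG A \<subseteq> GalG A"
  proof
    fix \<tau> assume "\<tau> \<in> (\<lambda>\<sigma>. restrict (\<lambda>x. \<phi> (\<sigma> x)) A) ` GalG A"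
    then obtain \<psi> where "\<psi> \<in> AbsGal" "\<tau> = restrict (\<lambda>x. \<phi> (restrict \<psi> A x)) A" by (auto elim!: GalGE)
    moreover have "restrict (\<lambda>x. \<phi> (restrict \<psi> A x)) A = restrict (\<lambda>x. \<phi> (\<psi> x)) A"
      by (auto simp: restrict_def)
    ultimately show "\<tau> \<in> GalG A" using AbsGal_comp[OF \<phi>] GalGI by metis
  qed
  show ?thesis using inj sub endo_inj_surj[OF fin sub inj] by (simp add: bij_betw_def)
qed

lemma GalG_sum_shift:
  assumes alg: "\<And>x. x \<in> A \<Longrightarrow> algebraic x" and fin: "finite (GalG A)" and \<phi>: "\<phi> \<in> AbsGal"
  shows "(\<Sum>\<sigma>\<in>GalG A. f (restrict (\<lambda>x. \<phi> (\<sigma> x)) A)) = sum f (GalG A)"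
  using sum.reindex_bij_betw[OF GalG_bij[OF assms], of f] by simp

text \<open>More unknowns than equations, by elimination. The solution is kept among the algebraic
  numbers because automorphisms respect sums and products only there.\<close>

lemma algebraic_linear_system:
  assumes "finite I" "finite J" "card I < card J"
    and "\<And>i j. i \<in> I \<Longrightarrow> j \<in> J \<Longrightarrow> algebraic (a i j :: complex)"
  shows "\<exists>c. (\<forall>j\<in>J. algebraic (c j)) \<and> (\<exists>j\<in>J. c j \<noteq> 0) \<and> (\<forall>i\<in>I. (\<Sum>j\<in>J. a i j * c j) = 0)"
  using assms
proof (induction I arbitrary: J a rule: finite_induct)
  case empty
  then obtain j where "j \<in> J" by fastforce
  thus ?case by (intro exI[of _ "\<lambda>_. 1"]) auto
next
  case (insert i0 I)
  show ?case
  proof (cases "\<forall>j\<in>J. a i0 j = 0")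
    case True
    obtain c where "\<forall>j\<in>J. algebraic (c j)" "\<exists>j\<in>J. c j \<noteq> 0" "\<forall>i\<in>I. (\<Sum>j\<in>J. a i j * c j) = 0"
      using insert.IH[of J a] insert.prems insert.hyps by auto
    thus ?thesis using True by (intro exI[of _ c]) auto
  next
    case False
    then obtain j0 where j0: "j0 \<in> J" "a i0 j0 \<noteq> 0" by blast
    define J' where "J' = J - {j0}"
    define a' where "a' = (\<lambda>i j. a i j - a i j0 * (a i0 j / a i0 j0))"
    have J: "J = insert j0 J'" "j0 \<notin> J'" "finite J'" using j0 insert.prems by (auto simp: J'_def)
    have "card I < card J'" using insert J by auto
    moreover have "algebraic (a' i j)" if "i \<in> I" "j \<in> J'" for i j
      unfolding a'_def using that insert.prems J by (auto intro!: algebraic_diff algebraic_mult algebraic_divide)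
    ultimately obtain c where c: "\<forall>j\<in>J'. algebraic (c j)" "\<exists>j\<in>J'. c j \<noteq> 0" "\<forall>i\<in>I. (\<Sum>j\<in>J'. a' i j * c j) = 0"
      using insert.IH[of J' a'] J by auto
    define s where "s = - (\<Sum>j\<in>J'. a i0 j * c j) / a i0 j0"
    define c' where "c' = (\<lambda>j. if j = j0 then s else c j)"
    have sumc: "(\<Sum>j\<in>J. a i j * c' j) = a i j0 * s + (\<Sum>j\<in>J'. a i j * c j)" for i
    proof -
      have "(\<Sum>j\<in>J'. a i j * c' j) = (\<Sum>j\<in>J'. a i j * c j)" using J by (intro sum.cong) (auto simp: c'_def)
      thus ?thesis using J by (simp add: c'_def)
    qed
    have "algebraic s" unfolding s_def using c insert.prems J
      by (intro algebraic_divide algebraic_minus algebraic_sum algebraic_mult) auto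
    hence "\<forall>j\<in>J. algebraic (c' j)" using c J by (auto simp: c'_def)
    moreover have "\<exists>j\<in>J. c' j \<noteq> 0" using c J by (auto simp: c'_def)
    moreover have "(\<Sum>j\<in>J. a i0 j * c' j) = 0" unfolding sumc using j0 by (simp add: s_def)
    moreover have "(\<Sum>j\<in>J. a i j * c' j) = 0" if "i \<in> I" for i
    proof -
      have "0 = (\<Sum>j\<in>J'. a' i j * c j)" using c that by simp
      also have "\<dots> = (\<Sum>j\<in>J'. a i j * c j - a i j0 / a i0 j0 * (a i0 j * c j))"
        by (intro sum.cong) (auto simp: a'_def algebra_simps)
      also have "\<dots> = (\<Sum>j\<in>J'. a i j * c j) + a i j0 * s"
        by (simp add: sum_subtractf s_def sum_distrib_left sum_divide_distrib)
      finally show ?thesis unfolding sumc by (simp add: add.commute)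
    qed
    ultimately show ?thesis by (intro exI[of _ c']) auto
  qed
qed

text \<open>Artin's argument. More independent elements than embeddings would give a nontrivial
  solution of the linear system with coefficients \<open>\<sigma> (u j)\<close>. Take one with
  fewest nonzero entries, scaled to have an entry 1. An automorphism permutes the equations, and the
  difference of the solution and its image has smaller support; so the solution is fixed, hence
  rational, against the independence of \<open>u\<close>.\<close>

lemma artin_bound:
  assumes alg: "\<And>x. x \<in> A \<Longrightarrow> algebraic x" and fin: "finite (GalG A)"
    and u: "rat_independent n u" "\<And>i. i < n \<Longrightarrow> u i \<in> A"
  shows "n \<le> card (GalG A)"
proof (rule ccontr)
  assume "\<not> n \<le> card (GalG A)"
  define S where "S = {c. (\<forall>j<n. algebraic (c j)) \<and> (\<exists>j<n. c j \<noteq> 0) \<and> (\<forall>\<sigma>\<in>GalG A. (\<Sum>j<n. \<sigma> (u j) * c j) = 0)}"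
  have ua: "algebraic (u j)" if "j < n" for j using u(2)[OF that] alg by blast
  have "\<exists>c. (\<forall>j\<in>{..<n}. algebraic (c j)) \<and> (\<exists>j\<in>{..<n}. c j \<noteq> 0) \<and> (\<forall>\<sigma>\<in>GalG A. (\<Sum>j\<in>{..<n}. \<sigma> (u j) * c j) = 0)"
  proof (rule algebraic_linear_system[OF fin])
    show "algebraic (\<sigma> (u j))" if "\<sigma> \<in> GalG A" "j \<in> {..<n}" for \<sigma> j
      using GalG_algebraic[OF that(1) u(2) ua] that(2) by simp
  qed (use \<open>\<not> n \<le> _\<close> in auto)
  hence "\<exists>c. c \<in> S" unfolding S_def by blast
  define N where "N = (\<lambda>c :: nat \<Rightarrow> complex. card {j. j < n \<and> c j \<noteq> 0})"
  obtain c where c: "c \<in> S" and min: "\<And>d. d \<in> S \<Longrightarrow> N c \<le> N d"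
    using \<open>\<exists>c. c \<in> S\<close> ex_has_least_nat[of "\<lambda>c. c \<in> S" _ N] by auto
  obtain k where k: "k < n" "c k \<noteq> 0" using c by (auto simp: S_def)
  define d where "d = (\<lambda>j. c j / c k)"
  have d: "algebraic (d j)" if "j < n" for j using that c k by (auto simp: S_def d_def intro!: algebraic_divide)
  have dsum: "(\<Sum>j<n. \<sigma> (u j) * d j) = 0" if "\<sigma> \<in> GalG A" for \<sigma>
  proof -
    have "(\<Sum>j<n. \<sigma> (u j) * d j) = (\<Sum>j<n. \<sigma> (u j) * c j) / c k" by (simp add: d_def sum_divide_distrib)
    thus ?thesis using c that by (simp add: S_def)
  qed
  have "d j \<in> \<rat>" if j: "j < n" for j
  proof (rule AbsGal_fixed_imp_Rats[OF d[OF j]])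
    fix \<phi> assume \<phi>: "\<phi> \<in> AbsGal"
    define e where "e = (\<lambda>j. \<phi> (d j) - d j)"
    have "e \<notin> S"
    proof
      assume "e \<in> S"
      have "c j \<noteq> 0" if "e j \<noteq> 0" for j using that AbsGal_0[OF \<phi>] by (auto simp: e_def d_def)
      moreover have "e k = 0" using k(2) AbsGal_1[OF \<phi>] by (simp add: e_def d_def)
      ultimately have "{j. j < n \<and> e j \<noteq> 0} \<subset> {j. j < n \<and> c j \<noteq> 0}" using k by blast
      hence "N e < N c" unfolding N_def by (intro psubset_card_mono) auto
      thus False using min[OF \<open>e \<in> S\<close>] by simp
    qed
    moreover have "\<forall>j<n. algebraic (e j)" using d AbsGal_algebraic[OF \<phi>] by (auto simp: e_def)
    moreover have "(\<Sum>j<n. \<tau> (u j) * e j) = 0" if \<tau>: "\<tau> \<in> GalG A" for \<tau>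
    proof -
      obtain \<sigma> where s: "\<sigma> \<in> GalG A" "\<tau> = restrict (\<lambda>x. \<phi> (\<sigma> x)) A"
        using bij_betw_imp_surj_on[OF GalG_bij[OF alg fin \<phi>]] \<tau> by blast
      have a: "algebraic (\<sigma> (u j))" if "j < n" for j
        using GalG_algebraic[OF s(1) u(2)[OF that] ua[OF that]] .
      have "(\<Sum>j<n. \<tau> (u j) * \<phi> (d j)) = (\<Sum>j<n. \<phi> (\<sigma> (u j) * d j))"
        using u(2) a d by (intro sum.cong) (auto simp: s(2) AbsGal_mult[OF \<phi>])
      also have "\<dots> = \<phi> (\<Sum>j<n. \<sigma> (u j) * d j)"
        using a d by (intro AbsGal_sum[OF \<phi>, symmetric]) auto
      also have "\<dots> = 0" using dsum[OF s(1)] AbsGal_0[OF \<phi>] by simp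
      finally show ?thesis using dsum[OF \<tau>] by (simp add: e_def algebra_simps sum_subtractf)
    qed
    ultimately have "\<forall>j<n. e j = 0" unfolding S_def by blast
    thus "\<phi> (d j) = d j" using j by (simp add: e_def)
  qed
  moreover have "(\<Sum>j<n. d j * u j) = 0"
    using dsum[OF GalGI[OF AbsGal_id]] u(2) by (simp add: mult.commute)
  ultimately have "d k = 0" using u(1) k unfolding rat_independent_def by blast
  thus False using k by (simp add: d_def)
qed

text \<open>The relation at \<open>z * y\<close> minus \<open>\<tau> z\<close> times the relation at
  \<open>y\<close> no longer involves \<open>\<tau>\<close>, and \<open>z\<close> can be chosen to
  separate \<open>\<tau>\<close> from any given other embedding.\<close>

lemma dedekind_independence:
  assumes E: "1 \<in> E" "\<And>x y. x \<in> E \<Longrightarrow> y \<in> E \<Longrightarrow> x * y \<in> E" "\<And>x. x \<in> E \<Longrightarrow> algebraic x"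
    and A: "finite A" "A \<subseteq> GalG E"
    and sum0: "\<And>y. y \<in> E \<Longrightarrow> (\<Sum>\<sigma>\<in>A. c \<sigma> * \<sigma> y) = 0"
    and \<sigma>: "\<sigma> \<in> A"
  shows "c \<sigma> = 0"
  using A sum0 \<sigma>
proof (induction A arbitrary: c \<sigma> rule: finite_induct)
  case (insert \<tau> A)
  have mult: "\<rho> (x * y) = \<rho> x * \<rho> y" if "\<rho> \<in> GalG E" "x \<in> E" "y \<in> E" for \<rho> x y
    using that E by (auto elim!: GalGE simp: AbsGal_mult)
  have one: "\<rho> 1 = 1" if "\<rho> \<in> GalG E" for \<rho>
    using that E by (auto elim!: GalGE simp: AbsGal_1)
  have cA: "c \<rho> = 0" if \<rho>: "\<rho> \<in> A" for \<rho>
  proof -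
    have "\<rho> \<noteq> \<tau>" using \<rho> insert.hyps by auto
    then obtain z where z: "z \<in> E" "\<rho> z \<noteq> \<tau> z" using GalG_eqI[of \<rho> E \<tau>] insert.prems \<rho> by blast
    have "(\<Sum>\<sigma>\<in>A. (c \<sigma> * (\<sigma> z - \<tau> z)) * \<sigma> y) = 0" if y: "y \<in> E" for y
    proof -
      have "(\<Sum>\<sigma>\<in>A. (c \<sigma> * (\<sigma> z - \<tau> z)) * \<sigma> y) = (\<Sum>\<sigma>\<in>insert \<tau> A. (c \<sigma> * (\<sigma> z - \<tau> z)) * \<sigma> y)"
        using insert.hyps by simp
      also have "\<dots> = (\<Sum>\<sigma>\<in>insert \<tau> A. c \<sigma> * \<sigma> (z * y) - \<tau> z * (c \<sigma> * \<sigma> y))"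
      proof (rule sum.cong[OF refl])
        fix \<sigma> assume "\<sigma> \<in> insert \<tau> A"
        hence "\<sigma> (z * y) = \<sigma> z * \<sigma> y" using mult[of \<sigma> z y] insert.prems(1) z(1) y by blast
        thus "(c \<sigma> * (\<sigma> z - \<tau> z)) * \<sigma> y = c \<sigma> * \<sigma> (z * y) - \<tau> z * (c \<sigma> * \<sigma> y)"
          by (simp add: algebra_simps)
      qed
      also have "\<dots> = (\<Sum>\<sigma>\<in>insert \<tau> A. c \<sigma> * \<sigma> (z * y)) - \<tau> z * (\<Sum>\<sigma>\<in>insert \<tau> A. c \<sigma> * \<sigma> y)"
        by (simp only: sum_subtractf sum_distrib_left)
      also have "\<dots> = 0" using insert.prems(2)[OF E(2)[OF z(1) y]] insert.prems(2)[OF y] by simp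
      finally show ?thesis .
    qed
    hence "c \<rho> * (\<rho> z - \<tau> z) = 0"
      using insert.IH[of "\<lambda>\<sigma>. c \<sigma> * (\<sigma> z - \<tau> z)" \<rho>] insert.prems(1) \<rho> by simp
    thus ?thesis using z by simp
  qed
  have c\<tau>: "c \<tau> = 0"
    using insert.prems(2)[OF E(1)] insert.hyps insert.prems(1) one[of \<tau>] cA by simp
  show ?case
  proof (cases "\<sigma> = \<tau>")
    case False
    hence "\<sigma> \<in> A" using insert.prems(3) by simp
    thus ?thesis by (rule cA)
  qed (simp add: c\<tau>)
qed auto

text \<open>The converse of \<open>artin_bound\<close>: more than \<open>n\<close> embeddings would
  satisfy a linear relation at the \<open>n\<close> spanning elements, hence on all of
  \<open>E\<close>, against Dedekind's independence.\<close>

lemma GalG_card_le_span: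
  assumes E: "1 \<in> E" "\<And>x y. x \<in> E \<Longrightarrow> y \<in> E \<Longrightarrow> x * y \<in> E" "\<And>x. x \<in> E \<Longrightarrow> algebraic x"
    and u: "\<And>i. i < n \<Longrightarrow> u i \<in> E"
    and span: "\<And>x. x \<in> E \<Longrightarrow> \<exists>c. (\<forall>i<n. c i \<in> \<rat>) \<and> x = (\<Sum>i<n. c i * u i)"
  shows "finite (GalG E) \<and> card (GalG E) \<le> n"
proof (rule finite_if_finite_subsets_card_bdd, rule ccontr)
  fix A assume A: "A \<subseteq> GalG E" "finite A" and "\<not> card A \<le> n"
  have alg: "algebraic (\<sigma> (u j))" if "\<sigma> \<in> A" "j < n" for \<sigma> j
    by (rule GalG_algebraic[OF subsetD[OF A(1) that(1)] u[OF that(2)] E(3)[OF u[OF that(2)]]])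
  have "\<exists>c. (\<forall>\<sigma>\<in>A. algebraic (c \<sigma>)) \<and> (\<exists>\<sigma>\<in>A. c \<sigma> \<noteq> 0) \<and> (\<forall>j\<in>{..<n}. (\<Sum>\<sigma>\<in>A. \<sigma> (u j) * c \<sigma>) = 0)"
    by (rule algebraic_linear_system) (use \<open>\<not> card A \<le> n\<close> A(2) alg in auto)
  then obtain c where c: "\<exists>\<sigma>\<in>A. c \<sigma> \<noteq> 0" "\<forall>j\<in>{..<n}. (\<Sum>\<sigma>\<in>A. \<sigma> (u j) * c \<sigma>) = 0"
    by blast
  have "(\<Sum>\<sigma>\<in>A. c \<sigma> * \<sigma> y) = 0" if y: "y \<in> E" for y
  proof -
    obtain d where d: "\<forall>i<n. d i \<in> \<rat>" "y = (\<Sum>i<n. d i * u i)" using span[OF y] by blast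
    have eq: "\<sigma> y = (\<Sum>i<n. d i * \<sigma> (u i))" if \<sigma>: "\<sigma> \<in> A" for \<sigma>
    proof -
      obtain \<phi> where \<phi>: "\<phi> \<in> AbsGal" "\<sigma> = restrict \<phi> E" using A \<sigma> by (auto elim: GalGE)
      have a: "algebraic (d i)" "algebraic (u i)" if "i < n" for i
        using d(1) u[OF that] E(3) that rat_imp_algebraic by blast+
      have "\<phi> y = (\<Sum>i<n. \<phi> (d i * u i))" unfolding d(2)
        using a by (intro AbsGal_sum[OF \<phi>(1)] algebraic_mult) auto
      also have "\<dots> = (\<Sum>i<n. d i * \<phi> (u i))"
        using a d(1) by (intro sum.cong refl) (simp add: AbsGal_mult[OF \<phi>(1)] AbsGal_Rats[OF \<phi>(1)])
      finally show ?thesis using \<phi>(2) y u by simp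
    qed
    have "(\<Sum>\<sigma>\<in>A. c \<sigma> * \<sigma> y) = (\<Sum>\<sigma>\<in>A. \<Sum>i<n. d i * (\<sigma> (u i) * c \<sigma>))"
    proof (rule sum.cong[OF refl])
      fix \<sigma> assume "\<sigma> \<in> A"
      show "c \<sigma> * \<sigma> y = (\<Sum>i<n. d i * (\<sigma> (u i) * c \<sigma>))"
        unfolding eq[OF \<open>\<sigma> \<in> A\<close>] by (simp add: sum_distrib_left mult_ac)
    qed
    also have "\<dots> = (\<Sum>i<n. d i * (\<Sum>\<sigma>\<in>A. \<sigma> (u i) * c \<sigma>))"
      by (subst sum.swap) (simp add: sum_distrib_left)
    also have "\<dots> = 0" using c by simp
    finally show ?thesis .
  qed
  note sum0 = this
  have "c \<sigma> = 0" if "\<sigma> \<in> A" for \<sigma>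
    by (rule dedekind_independence[OF E A(2,1) sum0 that])
  thus False using c(1) by simp
qed

section \<open>Groups of order p or p^2 are commutative\<close>

context group
begin

lemma nat_pow_prime_order_generator:
  assumes x: "x \<in> carrier G" "ord x = p" and p: "Factorial_Ring.prime p"
    and ne: "x [^] (i::nat) \<noteq> \<one>"
  shows "\<exists>k::nat. x = (x [^] i) [^] k"
proof -
  have "\<not> p dvd i" using ne pow_eq_id[OF x(1)] x(2) by auto
  hence "Rings.coprime i p" using p by (metis coprime_commute prime_imp_coprime)
  then obtain k where k: "[i * k = 1] (mod p)" using cong_solve_coprime_nat by auto
  have "int p dvd (int 1 - int (i * k))"
    using cong_sym[OF k] cong_iff_dvd_diff cong_int_iff by blast
  hence "x [^] int (i * k) = x [^] int 1" using int_pow_eq[OF x(1)] x(2) by simp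
  hence "x [^] (i * k) = x" using x(1) by (simp only: int_pow_int nat_pow_eone)
  thus ?thesis using x(1) by (intro exI[of _ k]) (simp add: nat_pow_pow)
qed

text \<open>Without a generator of the whole group, every nontrivial element has order
  \<open>p\<close>, and it generates every cyclic subgroup \<open>P z\<close> that contains it. All
  \<open>P z\<close> are normal, so the commutator of \<open>x\<close> and \<open>y\<close> lies in
  \<open>P x\<close> and in \<open>P y\<close>; were it nontrivial, \<open>y\<close> would be a
  power of it and lie in \<open>P x\<close>.\<close>

lemma order_prime_square_comm:
  assumes p: "Factorial_Ring.prime p" and o: "order G = p \<or> order G = p\<^sup>2"
    and x: "x \<in> carrier G" and y: "y \<in> carrier G"
  shows "x \<otimes> y = y \<otimes> x"
proof -
  have p0: "p > 1" "p > 0" using p prime_gt_1_nat prime_gt_0_nat by blast+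
  have fin: "finite (carrier G)" using o p0 by (auto simp: order_gt_0_iff_finite[symmetric])
  have ordp: "ord z \<in> {1, p, p\<^sup>2}" if "z \<in> carrier G" for z
  proof -
    have "ord z dvd p\<^sup>2" using ord_dvd_group_order[OF that] o by (auto intro: dvd_trans)
    then obtain i where "i \<le> 2" "ord z = p ^ i" using divides_primepow_nat[OF p] by auto
    thus ?thesis by (cases "i = 0"; cases "i = 1"; cases "i = 2") auto
  qed
  have cyc: ?thesis if z: "z \<in> carrier G" "ord z = order G" for z
  proof -
    have "ord z - 1 + 1 = card (carrier G)" using z ord_ge_1[OF fin z(1)] by (simp add: order_def)
    hence "(\<lambda>i. z [^] i) ` {0..ord z - 1} = carrier G"
      using ord_inj[OF z(1)] z fin
      by (intro card_subset_eq) (auto simp: card_image)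
    moreover have "card (carrier G) = order G" by (simp add: order_def)
    ultimately obtain i j :: nat where "x = z [^] i" "y = z [^] j" using x y by (metis (no_types, lifting) imageE)
    thus ?thesis using z by (simp add: nat_pow_mult add.commute)
  qed
  show ?thesis
  proof (cases "\<exists>z\<in>carrier G. ord z = order G")
    case True thus ?thesis using cyc by blast
  next
    case False
    have o2: "order G = p\<^sup>2"
    proof (rule ccontr)
      assume "order G \<noteq> p\<^sup>2"
      hence op: "order G = p" using o by blast
      have "card (carrier G) \<noteq> card {\<one>}" using op p0 by (simp add: order_def)
      then obtain z where z: "z \<in> carrier G" "z \<noteq> \<one>" by (metis one_closed is_singletonI' is_singleton_altdef card.empty card_1_singleton_iff One_nat_def empty_iff)
      have "ord z dvd p" using ord_dvd_group_order[OF z(1)] op by simp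
      hence "ord z = p" using ord_eq_1[OF z(1)] z p by (metis prime_nat_iff)
      thus False using False z op by auto
    qed
    have op: "ord z = p" if "z \<in> carrier G" "z \<noteq> \<one>" for z
      using ordp[OF that(1)] False o2 ord_eq_1[OF that(1)] that by auto
    define P where "P = (\<lambda>z. range (\<lambda>i::nat. z [^] i))"
    have PI: "z [^] (i::nat) \<in> P z" for z i by (auto simp: P_def)
    have Pc: "P z \<subseteq> carrier G" if "z \<in> carrier G" for z using that by (auto simp: P_def)
    have Pm: "a \<otimes> b \<in> P z" if "z \<in> carrier G" "a \<in> P z" "b \<in> P z" for a b z
      using that by (auto simp: P_def nat_pow_mult)
    have Ppow: "a [^] (k::nat) \<in> P z" if "z \<in> carrier G" "a \<in> P z" for a k z
      using that by (auto simp: P_def nat_pow_pow)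
    have Pinv: "inv a \<in> P z" if "z \<in> carrier G" "a \<in> P z" for a z
    proof -
      have a: "a \<in> carrier G" using that Pc by blast
      have "a [^] (order G - 1) \<otimes> a = \<one>"
        using pow_order_eq_1[OF a] o2 p0 a nat_pow_Suc[of a "order G - 1"] by simp
      hence "inv a = a [^] (order G - 1)" using a inv_equality by simp
      thus ?thesis using Ppow that by simp
    qed
    have Pgen: "z \<in> P w" if z: "z \<in> carrier G" "w \<in> P z" "w \<noteq> \<one>" for z w
    proof -
      obtain i :: nat where i: "w = z [^] i" using z by (auto simp: P_def)
      have "z \<noteq> \<one>" using z i by auto
      then obtain k :: nat where "z = w [^] k"
        using nat_pow_prime_order_generator[OF z(1) op[OF z(1)] p, of i] z(3) i by auto
      thus ?thesis using PI[of w k] by simp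
    qed
    have normal: "b \<otimes> a \<otimes> inv b \<in> P a" if a: "a \<in> carrier G" and b: "b \<in> carrier G" for a b
    proof (rule ccontr)
      define z where "z = b \<otimes> a \<otimes> inv b"
      assume "b \<otimes> a \<otimes> inv b \<notin> P a"
      hence zP: "z \<notin> P a" by (simp add: z_def)
      have z: "z \<in> carrier G" using a b by (simp add: z_def)
      have z1: "z \<noteq> \<one>" using zP PI[of a 0] by auto
      have a1: "a \<noteq> \<one>" using z1 a b by (auto simp: z_def)
      have canc: "inv b \<otimes> (b \<otimes> c) = c" if "c \<in> carrier G" for c
        using that b by (simp add: m_assoc[symmetric])
      have zpow: "z [^] (j::nat) = b \<otimes> a [^] j \<otimes> inv b" for j
      proof (induction j)
        case (Suc j)
        have "z [^] Suc j = (b \<otimes> a [^] j \<otimes> inv b) \<otimes> (b \<otimes> a \<otimes> inv b)"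
          using Suc by (simp add: z_def[symmetric])
        also have "\<dots> = b \<otimes> a [^] j \<otimes> (inv b \<otimes> b) \<otimes> (a \<otimes> inv b)" using a b by (simp add: m_assoc canc)
        finally show ?case using a b by (simp add: m_assoc)
      qed (use b in simp)
      \<comment> \<open>If the conjugate \<open>z\<close> of \<open>a\<close> lies outside
        \<open>P a\<close>, these p^2 products are distinct and exhaust the group. Writing the
        inverse of \<open>b\<close> as such a product and cancelling puts \<open>b\<close>, and then
        \<open>z\<close>, into \<open>P a\<close> after all.\<close>
      have inj: "inj_on (\<lambda>(i,j). a [^] i \<otimes> z [^] j) ({..<p} \<times> {..<p})"
      proof -
        have key: False if e: "a [^] (i::nat) \<otimes> z [^] j = a [^] (i'::nat) \<otimes> z [^] j'" and lt: "j < j'" "j' < p" for i i' j j'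
        proof -
          have "z [^] j' = z [^] (j' - j) \<otimes> z [^] j" using lt z by (simp add: nat_pow_mult)
          hence "a [^] i \<otimes> z [^] j = (a [^] i' \<otimes> z [^] (j' - j)) \<otimes> z [^] j" using e a z by (simp add: m_assoc)
          hence "a [^] i = a [^] i' \<otimes> z [^] (j' - j)" using a z by simp
          hence "z [^] (j' - j) = inv (a [^] i') \<otimes> a [^] i" using a z by (simp add: inv_solve_left)
          hence "z [^] (j' - j) \<in> P a" using Pm[OF a] Pinv[OF a] PI by simp
          moreover have "z [^] (j' - j) \<noteq> \<one>"
            using pow_eq_id[OF z, of "j' - j"] op[OF z z1] lt by (auto dest: dvd_imp_le)
          ultimately have "z [^] (j' - j) \<in> P a" "z \<in> P (z [^] (j' - j))" using Pgen[OF z PI] by auto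
          hence "z \<in> P a" using Ppow[OF a] unfolding P_def by auto
          thus False using zP by simp
        qed
        have key2: False if e: "a [^] (i::nat) = a [^] (i'::nat)" and lt: "i < i'" "i' < p" for i i'
        proof -
          have "a [^] i' = a [^] (i' - i) \<otimes> a [^] i" using lt a by (simp add: nat_pow_mult)
          hence "a [^] (i' - i) = \<one>" using e a by (simp add: l_cancel_one')
          thus False using pow_eq_id[OF a, of "i' - i"] op[OF a a1] lt by (auto dest: dvd_imp_le)
        qed
        show ?thesis
        proof (rule inj_onI, clarsimp)
          fix i j i' j' assume lt: "i < p" "j < p" "i' < p" "j' < p"
            and e: "a [^] i \<otimes> z [^] j = a [^] i' \<otimes> z [^] j'"
          have "j = j'" using key[OF e] key[OF e[symmetric]] lt by (meson linorder_neqE_nat)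
          moreover from this have "a [^] i = a [^] i'" using e a z by simp
          hence "i = i'" using key2[of i i'] key2[of i' i] lt by (metis linorder_neqE_nat)
          ultimately show "i = i' \<and> j = j'" by simp
        qed
      qed
      have "(\<lambda>(i,j). a [^] i \<otimes> z [^] j) ` ({..<p} \<times> {..<p}) = carrier G"
        using fin a z card_image[OF inj] o2
        by (intro card_subset_eq) (auto simp: order_def power2_eq_square)
      then obtain i j where ij: "inv b = a [^] (i::nat) \<otimes> z [^] (j::nat)"
        using b inv_closed[OF b] by (metis (no_types, lifting) imageE case_prod_beta)
      hence "inv b = (a [^] i \<otimes> b \<otimes> a [^] j) \<otimes> inv b" using a b by (simp add: zpow m_assoc)
      hence "a [^] i \<otimes> b \<otimes> a [^] j = \<one>" using a b by (simp add: r_cancel_one')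
      hence "b = inv (a [^] i) \<otimes> inv (a [^] j)"
        using a b by (metis inv_closed inv_equality inv_inv m_assoc m_closed nat_pow_closed inv_solve_left r_one)
      hence bP: "b \<in> P a" using Pm[OF a] Pinv[OF a] PI by simp
      hence "z \<in> P a" unfolding z_def using Pm[OF a] Pinv[OF a] PI[of a 1] a by simp
      thus False using zP by simp
    qed
    show ?thesis
    proof (cases "y \<in> P x")
      case True
      then obtain i :: nat where "y = x [^] i" by (auto simp: P_def)
      thus ?thesis using x pow_mult_distrib by (metis nat_pow_comm nat_pow_eone)
    next
      case False
      define w where "w = y \<otimes> x \<otimes> inv y \<otimes> inv x"
      have wc: "w \<in> carrier G" using x y by (simp add: w_def)
      have "w \<in> P x" unfolding w_def using Pm[OF x] normal[OF x y] Pinv[OF x] PI[of x 1] x by simp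
      moreover have "w \<in> P y"
      proof -
        have "w = y \<otimes> (x \<otimes> inv y \<otimes> inv x)" using x y by (simp add: w_def m_assoc)
        moreover have "x \<otimes> inv y \<otimes> inv x = inv (x \<otimes> y \<otimes> inv x)" using x y by (simp add: inv_mult_group m_assoc)
        ultimately show ?thesis using Pm[OF y] normal[OF y x] Pinv[OF y] PI[of y 1] y by simp
      qed
      ultimately have "w = \<one>"
      proof -
        have "y \<in> P x" if "w \<noteq> \<one>"
        proof -
          have "y \<in> P w" using Pgen[OF y \<open>w \<in> P y\<close> that] .
          thus ?thesis using Ppow[OF x \<open>w \<in> P x\<close>] unfolding P_def by auto
        qed
        thus ?thesis using False by blast
      qed
      hence "y \<otimes> x \<otimes> inv y = x" using x y unfolding w_def by (metis inv_closed inv_equality inv_inv m_closed)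
      thus ?thesis using x y by (metis inv_solve_right m_closed)
    qed
  qed
qed

end

text \<open>The restrictions to the stable set \<open>F\<close> form a group of order
  \<open>q\<close> under composition; Lagrange's theorem gives the exponent.\<close>

lemma GalG_prime_square:
  assumes alg: "\<And>x. x \<in> F \<Longrightarrow> algebraic x" and st: "\<And>\<phi> x. \<phi> \<in> AbsGal \<Longrightarrow> x \<in> F \<Longrightarrow> \<phi> x \<in> F"
    and fin: "finite (GalG F)" and p: "Factorial_Ring.prime p" and q: "card (GalG F) = q" "q = p \<or> q = p\<^sup>2"
    and \<phi>: "\<phi> \<in> AbsGal" and x: "x \<in> F"
  shows "(\<phi> ^^ q) x = x" "\<psi> \<in> AbsGal \<Longrightarrow> \<phi> (\<psi> x) = \<psi> (\<phi> x)"
proof -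
  define G where "G = \<lparr>carrier = GalG F, monoid.mult = (\<lambda>\<sigma> \<tau>. restrict (\<lambda>x. \<sigma> (\<tau> x)) F), one = restrict (\<lambda>x. x) F\<rparr>"
  have stG: "\<sigma> x \<in> F" if "\<sigma> \<in> GalG F" "x \<in> F" for \<sigma> x using that st by (auto elim!: GalGE)
  have comp: "restrict (\<lambda>x. restrict \<phi> F (restrict \<psi> F x)) F = restrict (\<lambda>x. \<phi> (\<psi> x)) F"
    if "\<psi> \<in> AbsGal" for \<phi> \<psi> using st[OF that] by (auto intro!: restrict_ext)
  have mcl: "restrict (\<lambda>x. \<sigma> (\<tau> x)) F \<in> GalG F" if "\<sigma> \<in> GalG F" "\<tau> \<in> GalG F" for \<sigma> \<tau>
  proof -
    obtain \<phi> \<psi> where h: "\<phi> \<in> AbsGal" "\<sigma> = restrict \<phi> F" "\<psi> \<in> AbsGal" "\<tau> = restrict \<psi> F"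
      using \<open>\<sigma> \<in> GalG F\<close> \<open>\<tau> \<in> GalG F\<close> by (metis GalGE)
    show ?thesis unfolding h(2,4) comp[OF h(3)] by (rule GalGI[OF AbsGal_comp[OF h(1,3)]])
  qed
  have one: "restrict (\<lambda>x. x) F \<in> GalG F" using GalGI[OF AbsGal_id] .
  have rid: "restrict (\<lambda>x. \<sigma> (restrict (\<lambda>x. x) F x)) F = \<sigma>" if "\<sigma> \<in> GalG F" for \<sigma>
    using that by (auto elim!: GalGE intro!: restrict_ext)
  have lid: "restrict (\<lambda>x. restrict (\<lambda>x. x) F (\<sigma> x)) F = \<sigma>" if "\<sigma> \<in> GalG F" for \<sigma>
    using that stG[OF that] by (auto elim!: GalGE intro!: restrict_ext)
  have assoc: "restrict (\<lambda>x. restrict (\<lambda>x. \<sigma> (\<tau> x)) F (\<rho> x)) F = restrict (\<lambda>x. \<sigma> (restrict (\<lambda>x. \<tau> (\<rho> x)) F x)) F"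
    if "\<rho> \<in> GalG F" for \<sigma> \<tau> \<rho> using stG[OF that] by (auto intro!: restrict_ext)
  have rinv: "\<exists>\<tau>\<in>GalG F. restrict (\<lambda>x. \<sigma> (\<tau> x)) F = restrict (\<lambda>x. x) F" if "\<sigma> \<in> GalG F" for \<sigma>
  proof -
    obtain \<psi> where \<psi>: "\<psi> \<in> AbsGal" "\<sigma> = restrict \<psi> F" using \<open>\<sigma> \<in> GalG F\<close> by (auto elim: GalGE)
    obtain \<tau> where \<tau>: "\<tau> \<in> GalG F" "restrict (\<lambda>x. x) F = restrict (\<lambda>x. \<psi> (\<tau> x)) F"
      using bij_betw_imp_surj_on[OF GalG_bij[OF alg fin \<psi>(1)]] one by (metis (no_types, lifting) imageE)
    have "restrict (\<lambda>x. \<sigma> (\<tau> x)) F = restrict (\<lambda>x. \<psi> (\<tau> x)) F"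
      using stG[OF \<tau>(1)] by (auto simp: \<psi>(2) intro!: restrict_ext)
    thus ?thesis using \<tau> by auto
  qed
  interpret G: group G
  proof (rule groupI)
    fix \<sigma> assume s: "\<sigma> \<in> carrier G"
    then obtain \<tau> where t: "\<tau> \<in> GalG F" "restrict (\<lambda>x. \<sigma> (\<tau> x)) F = restrict (\<lambda>x. x) F"
      using rinv by (auto simp: G_def)
    obtain \<rho> where r: "\<rho> \<in> GalG F" "restrict (\<lambda>x. \<tau> (\<rho> x)) F = restrict (\<lambda>x. x) F" using rinv[OF t(1)] by blast
    have "\<rho> = restrict (\<lambda>x. restrict (\<lambda>x. \<sigma> (\<tau> x)) F (\<rho> x)) F" using lid[OF r(1)] t(2) by simp
    also have "\<dots> = \<sigma>" unfolding assoc[OF r(1)] r(2) using rid s by (simp add: G_def)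
    finally have "\<rho> = \<sigma>" .
    thus "\<exists>\<tau>\<in>carrier G. \<tau> \<otimes>\<^bsub>G\<^esub> \<sigma> = \<one>\<^bsub>G\<^esub>" using t(1) r(2) by (auto simp: G_def)
  qed (use mcl one assoc lid in \<open>auto simp: G_def\<close>)
  have o: "order G = q" using q by (simp add: order_def G_def)
  have c: "restrict \<phi> F \<in> carrier G" if "\<phi> \<in> AbsGal" for \<phi> using GalGI[OF that] by (simp add: G_def)
  have m: "restrict \<phi> F \<otimes>\<^bsub>G\<^esub> restrict \<psi> F = restrict (\<lambda>x. \<phi> (\<psi> x)) F" if "\<psi> \<in> AbsGal" for \<phi> \<psi>
    using comp[OF that] by (simp add: G_def del: restrict_apply)
  show "\<phi> (\<psi> x) = \<psi> (\<phi> x)" if \<psi>: "\<psi> \<in> AbsGal"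
  proof -
    have "restrict (\<lambda>x. \<phi> (\<psi> x)) F = restrict (\<lambda>x. \<psi> (\<phi> x)) F"
      using G.order_prime_square_comm[OF p _ c[OF \<phi>] c[OF \<psi>]] o q(2) m \<phi> \<psi> by simp
    from fun_cong[OF this, of x] show ?thesis using x by simp
  qed
  have pw: "restrict \<phi> F [^]\<^bsub>G\<^esub> n = restrict (\<phi> ^^ n) F" for n :: nat
  proof (induction n)
    case 0
    show ?case by (simp add: G_def id_def)
  next
    case (Suc n)
    have "restrict \<phi> F [^]\<^bsub>G\<^esub> Suc n = restrict (\<lambda>x. (\<phi> ^^ n) (\<phi> x)) F"
      using Suc m[OF \<phi>, of "\<phi> ^^ n"] by (simp del: restrict_apply)
    also have "(\<lambda>x. (\<phi> ^^ n) (\<phi> x)) = \<phi> ^^ Suc n" by (simp add: fun_eq_iff funpow_swap1)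
    finally show ?case .
  qed
  have "restrict \<phi> F [^]\<^bsub>G\<^esub> q = restrict (\<lambda>x. x) F"
    using G.pow_order_eq_1[OF c[OF \<phi>]] o by (simp add: G_def)
  from fun_cong[OF this[unfolded pw], of x] show "(\<phi> ^^ q) x = x" using x by simp
qed

section \<open>Abelian extensions of the rationals\<close>

text \<open>Finite abelian Galois extensions of the rationals: \<open>qfield E = E\<close> makes
  \<open>E\<close> a field of algebraic numbers, and finiteness of \<open>GalG E\<close> makes its
  degree finite.\<close>

definition abelian_field :: "complex set \<Rightarrow> bool" where
  "abelian_field E \<longleftrightarrow> qfield E = E \<and> (\<forall>\<phi>\<in>AbsGal. \<forall>x\<in>E. \<phi> x \<in> E) \<and>
     (\<forall>\<phi>\<in>AbsGal. \<forall>\<psi>\<in>AbsGal. \<forall>x\<in>E. \<phi> (\<psi> x) = \<psi> (\<phi> x)) \<and> finite (GalG E)"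

lemma GalG_qfield:
  assumes "finite (GalG A)" "\<And>x. x \<in> A \<Longrightarrow> algebraic x"
  shows "finite (GalG (qfield A))"
proof (rule finite_imageD)
  have sub: "A \<subseteq> qfield A" using assms(2) qfield_base by blast
  have r: "restrict (restrict \<phi> (qfield A)) A = restrict \<phi> A" for \<phi> :: "complex \<Rightarrow> complex"
    using sub by (auto simp: restrict_def fun_eq_iff)
  show "inj_on (\<lambda>\<sigma>. restrict \<sigma> A) (GalG (qfield A))"
  proof (rule inj_onI)
    fix \<sigma> \<tau> assume st: "\<sigma> \<in> GalG (qfield A)" "\<tau> \<in> GalG (qfield A)" and e: "restrict \<sigma> A = restrict \<tau> A"
    obtain \<phi> where p: "\<phi> \<in> AbsGal" "\<sigma> = restrict \<phi> (qfield A)" using GalGE[OF st(1)] by blast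
    obtain \<psi> where s: "\<psi> \<in> AbsGal" "\<tau> = restrict \<psi> (qfield A)" using GalGE[OF st(2)] by blast
    have e': "restrict \<phi> A = restrict \<psi> A" using e unfolding p(2) s(2) r .
    have "\<phi> y = \<psi> y" if "y \<in> A" for y using fun_cong[OF e', of y] that by simp
    hence "\<phi> x = \<psi> x" if "x \<in> qfield A" for x using qfieldD[OF that p(1) s(1)] by blast
    thus "\<sigma> = \<tau>" unfolding p(2) s(2) by (intro restrict_ext)
  qed
  have "(\<lambda>\<sigma>. restrict \<sigma> A) ` GalG (qfield A) = GalG A" unfolding GalG_def image_image r ..
  thus "finite ((\<lambda>\<sigma>. restrict \<sigma> A) ` GalG (qfield A))" using assms(1) by simp
qed

lemma abelian_field_qfield:
  assumes alg: "\<And>x. x \<in> A \<Longrightarrow> algebraic x" and fin: "finite (GalG A)"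
    and st: "\<And>\<phi> x. \<phi> \<in> AbsGal \<Longrightarrow> x \<in> A \<Longrightarrow> \<phi> x \<in> qfield A"
    and comm: "\<And>\<phi> \<psi> x. \<phi> \<in> AbsGal \<Longrightarrow> \<psi> \<in> AbsGal \<Longrightarrow> x \<in> A \<Longrightarrow> \<phi> (\<psi> x) = \<psi> (\<phi> x)"
  shows "abelian_field (qfield A)"
  unfolding abelian_field_def
proof (intro conjI ballI)
  show "qfield (qfield A) = qfield A" using qfield_idem alg .
  show "finite (GalG (qfield A))" using GalG_qfield fin alg .
next
  fix \<phi> x assume \<phi>: "\<phi> \<in> AbsGal" and x: "x \<in> qfield A"
  show "\<phi> x \<in> qfield A"
  proof (rule qfieldI)
    show "algebraic (\<phi> x)" using AbsGal_algebraic[OF \<phi> qfield_algebraic[OF x]] .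
    fix \<psi> \<rho> assume h: "\<psi> \<in> AbsGal" "\<rho> \<in> AbsGal" "\<And>y. y \<in> A \<Longrightarrow> \<psi> y = \<rho> y"
    show "\<psi> (\<phi> x) = \<rho> (\<phi> x)"
    proof (rule qfieldD[OF x AbsGal_comp[OF h(1) \<phi>] AbsGal_comp[OF h(2) \<phi>]])
      fix y assume "y \<in> A"
      show "\<psi> (\<phi> y) = \<rho> (\<phi> y)" by (rule qfieldD[OF st[OF \<phi> \<open>y \<in> A\<close>] h])
    qed
  qed
next
  fix \<phi> \<psi> x assume h: "\<phi> \<in> AbsGal" "\<psi> \<in> AbsGal" and x: "x \<in> qfield A"
  show "\<phi> (\<psi> x) = \<psi> (\<phi> x)"
    by (rule qfieldD[OF x AbsGal_comp[OF h] AbsGal_comp[OF h(2,1)]]) (rule comm[OF h])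
qed

lemma GalG_Un_finite:
  assumes "finite (GalG A)" "finite (GalG B)"
  shows "finite (GalG (A \<union> B))"
proof (rule finite_imageD)
  have r: "restrict (restrict \<phi> (A \<union> B)) A = restrict \<phi> A" "restrict (restrict \<phi> (A \<union> B)) B = restrict \<phi> B"
    for \<phi> :: "complex \<Rightarrow> complex" by (auto simp: restrict_def fun_eq_iff)
  show "inj_on (\<lambda>\<sigma>. (restrict \<sigma> A, restrict \<sigma> B)) (GalG (A \<union> B))"
  proof (rule inj_onI)
    fix \<sigma> \<tau> assume st: "\<sigma> \<in> GalG (A \<union> B)" "\<tau> \<in> GalG (A \<union> B)"
      and e: "(restrict \<sigma> A, restrict \<sigma> B) = (restrict \<tau> A, restrict \<tau> B)"
    show "\<sigma> = \<tau>"
    proof (rule GalG_eqI[OF st])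
      fix x assume "x \<in> A \<union> B"
      have "restrict \<sigma> A x = restrict \<tau> A x" "restrict \<sigma> B x = restrict \<tau> B x" using e by simp_all
      thus "\<sigma> x = \<tau> x" using \<open>x \<in> A \<union> B\<close> by (auto split: if_splits)
    qed
  qed
  have "(\<lambda>\<sigma>. (restrict \<sigma> A, restrict \<sigma> B)) ` GalG (A \<union> B) \<subseteq> GalG A \<times> GalG B"
    unfolding GalG_def image_image r by auto
  thus "finite ((\<lambda>\<sigma>. (restrict \<sigma> A, restrict \<sigma> B)) ` GalG (A \<union> B))"
    using assms finite_subset by blast
qed

lemma GalG_Union_finite:
  assumes "finite S" "\<And>A. A \<in> S \<Longrightarrow> finite (GalG A)"
  shows "finite (GalG (\<Union>S))"
  using assms
proof (induction S rule: finite_induct)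
  case empty
  have "GalG {} \<subseteq> {\<lambda>x. undefined}" by (auto simp: GalG_def restrict_def)
  thus ?case using finite_subset by auto
next
  case (insert A S)
  thus ?case using GalG_Un_finite[of A "\<Union>S"] by simp
qed

lemma GalG_finite_set:
  assumes "finite A" "\<And>x. x \<in> A \<Longrightarrow> algebraic x"
  shows "finite (GalG A)"
proof (rule finite_subset)
  show "GalG A \<subseteq> PiE A conjugates"
    using assms(2) AbsGal_in_conjugates by (auto simp: GalG_def)
  show "finite (PiE A conjugates)" using assms finite_conjugates by (intro finite_PiE) auto
qed

context
  fixes E assumes E: "abelian_field E"
begin

lemma af_qfield: "qfield E = E" and af_stable: "\<phi> \<in> AbsGal \<Longrightarrow> x \<in> E \<Longrightarrow> \<phi> x \<in> E"
  and af_comm: "\<phi> \<in> AbsGal \<Longrightarrow> \<psi> \<in> AbsGal \<Longrightarrow> x \<in> E \<Longrightarrow> \<phi> (\<psi> x) = \<psi> (\<phi> x)"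
  and af_finite: "finite (GalG E)"
  using E by (auto simp: abelian_field_def)

lemma af_algebraic: "x \<in> E \<Longrightarrow> algebraic x"
  using qfield_algebraic[of x E] af_qfield by simp

lemma af_mult: "x \<in> E \<Longrightarrow> y \<in> E \<Longrightarrow> x * y \<in> E"
  and af_add: "x \<in> E \<Longrightarrow> y \<in> E \<Longrightarrow> x + y \<in> E"
  and af_diff: "x \<in> E \<Longrightarrow> y \<in> E \<Longrightarrow> x - y \<in> E"
  and af_divide: "x \<in> E \<Longrightarrow> y \<in> E \<Longrightarrow> x / y \<in> E"
  using qfield_closed[of x E y] af_qfield by auto

lemma af_1: "1 \<in> E" and af_0: "0 \<in> E" and af_of_int: "of_int k \<in> E" and af_of_nat: "of_nat n \<in> E"
  using qfield_1[of E] qfield_0[of E] qfield_of_int[of k E] qfield_of_nat[of n E] af_qfield by auto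

lemma af_Rats: "x \<in> \<rat> \<Longrightarrow> x \<in> E" using qfield_Rats[of x E] af_qfield by auto

lemma af_sum: "(\<And>i. i \<in> I \<Longrightarrow> f i \<in> E) \<Longrightarrow> sum f I \<in> E"
  and af_prod: "(\<And>i. i \<in> I \<Longrightarrow> f i \<in> E) \<Longrightarrow> prod f I \<in> E"
  and af_power: "x \<in> E \<Longrightarrow> x ^ n \<in> E"
  using qfield_sum[of I f E] qfield_prod[of I f E] qfield_power[of x E n] af_qfield by auto

lemma af_GalG_mem: "\<sigma> \<in> GalG E \<Longrightarrow> x \<in> E \<Longrightarrow> \<sigma> x \<in> E"
  by (auto elim!: GalGE simp: af_stable)

lemma af_bij:
  assumes "\<phi> \<in> AbsGal"
  shows "bij_betw (\<lambda>\<sigma>. restrict (\<lambda>x. \<phi> (\<sigma> x)) E) (GalG E) (GalG E)"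
  using GalG_bij[OF af_algebraic af_finite assms] by blast

lemma af_inverse:
  assumes \<phi>: "\<phi> \<in> AbsGal"
  obtains \<psi> where "\<psi> \<in> AbsGal" "\<And>x. x \<in> E \<Longrightarrow> \<phi> (\<psi> x) = x" "\<And>x. x \<in> E \<Longrightarrow> \<psi> (\<phi> x) = x"
proof -
  have "restrict (\<lambda>x. x) E \<in> (\<lambda>\<sigma>. restrict (\<lambda>x. \<phi> (\<sigma> x)) E) ` GalG E"
    using bij_betw_imp_surj_on[OF af_bij[OF \<phi>]] GalGI[OF AbsGal_id] by simp
  then obtain \<sigma> where s: "\<sigma> \<in> GalG E" "restrict (\<lambda>x. x) E = restrict (\<lambda>x. \<phi> (\<sigma> x)) E" by blast
  obtain \<psi> where \<psi>: "\<psi> \<in> AbsGal" "\<sigma> = restrict \<psi> E" using GalGE[OF s(1)] by blast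
  have "\<phi> (\<psi> x) = x" if "x \<in> E" for x
    using fun_cong[OF s(2), of x] that by (simp add: \<psi>(2))
  with \<psi>(1) af_comm[OF \<phi> \<psi>(1)] show thesis by (intro that[of \<psi>]) auto
qed

definition tr :: "complex \<Rightarrow> complex" where "tr x = (\<Sum>\<sigma>\<in>GalG E. \<sigma> x)"

lemma AbsGal_tr:
  assumes \<phi>: "\<phi> \<in> AbsGal" and x: "x \<in> E"
  shows "\<phi> (tr x) = tr x"
proof -
  have "\<phi> (tr x) = (\<Sum>\<sigma>\<in>GalG E. \<phi> (\<sigma> x))"
    unfolding tr_def using GalG_algebraic[OF _ x af_algebraic[OF x]] by (intro AbsGal_sum[OF \<phi>]) auto
  also have "\<dots> = (\<Sum>\<sigma>\<in>GalG E. restrict (\<lambda>x. \<phi> (\<sigma> x)) E x)" using x by simp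
  also have "\<dots> = tr x"
    unfolding tr_def by (rule GalG_sum_shift[OF af_algebraic af_finite \<phi>])
  finally show ?thesis .
qed

lemma tr_mem: "x \<in> E \<Longrightarrow> tr x \<in> E"
  unfolding tr_def by (rule af_sum, rule af_GalG_mem)

lemma tr_Rats: assumes "x \<in> E" shows "tr x \<in> \<rat>"
  using AbsGal_fixed_imp_Rats[OF af_algebraic[OF tr_mem[OF assms]]] AbsGal_tr assms by blast

lemma tr_algebraic_int: "x \<in> E \<Longrightarrow> algebraic_int x \<Longrightarrow> algebraic_int (tr x)"
  unfolding tr_def by (rule algebraic_int_sum) (rule GalG_algebraic_int)

lemma tr_Ints: "x \<in> E \<Longrightarrow> algebraic_int x \<Longrightarrow> tr x \<in> \<int>"
  by (simp add: rational_algebraic_int_is_int tr_algebraic_int tr_Rats)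

lemma tr_AbsGal:
  assumes \<phi>: "\<phi> \<in> AbsGal" and x: "x \<in> E"
  shows "tr (\<phi> x) = tr x"
proof -
  have "tr (\<phi> x) = (\<Sum>\<sigma>\<in>GalG E. \<phi> (\<sigma> x))"
    unfolding tr_def
  proof (rule sum.cong[OF refl])
    fix \<sigma> assume "\<sigma> \<in> GalG E"
    then obtain \<psi> where "\<psi> \<in> AbsGal" "\<sigma> = restrict \<psi> E" by (rule GalGE)
    thus "\<sigma> (\<phi> x) = \<phi> (\<sigma> x)" using x af_stable[OF \<phi> x] af_comm[OF \<phi>] by simp
  qed
  also have "\<dots> = \<phi> (tr x)"
    unfolding tr_def using GalG_algebraic[OF _ x af_algebraic[OF x]] by (intro AbsGal_sum[OF \<phi>, symmetric]) auto
  finally show ?thesis using AbsGal_tr[OF \<phi> x] by simp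
qed

lemma GalG_hom:
  assumes "\<sigma> \<in> GalG E" "x \<in> E" "y \<in> E"
  shows "\<sigma> (x + y) = \<sigma> x + \<sigma> y" "\<sigma> (x * y) = \<sigma> x * \<sigma> y" "\<sigma> (x - y) = \<sigma> x - \<sigma> y"
  using assms by (auto elim!: GalGE simp: af_add af_mult af_diff AbsGal_add AbsGal_mult AbsGal_diff af_algebraic)

lemma GalG_Rats: "\<sigma> \<in> GalG E \<Longrightarrow> x \<in> \<rat> \<Longrightarrow> \<sigma> x = x"
  by (auto elim!: GalGE simp: AbsGal_Rats af_Rats)

lemma tr_add: "x \<in> E \<Longrightarrow> y \<in> E \<Longrightarrow> tr (x + y) = tr x + tr y"
  and tr_diff: "x \<in> E \<Longrightarrow> y \<in> E \<Longrightarrow> tr (x - y) = tr x - tr y"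
  by (simp_all add: tr_def GalG_hom sum.distrib sum_subtractf)

lemma tr_scale: "r \<in> \<rat> \<Longrightarrow> x \<in> E \<Longrightarrow> tr (r * x) = r * tr x"
  by (simp add: tr_def GalG_hom af_Rats GalG_Rats sum_distrib_left)

lemma tr_0: "tr 0 = 0"
  using tr_add[OF af_0 af_0] by simp

lemma tr_sum: "(\<And>i. i \<in> I \<Longrightarrow> f i \<in> E) \<Longrightarrow> tr (sum f I) = (\<Sum>i\<in>I. tr (f i))"
  by (induction I rule: infinite_finite_induct) (auto simp: tr_add af_sum tr_0)

section \<open>Symmetric functions of conjugates\<close>

text \<open>Up to sign, the coefficients of a characteristic polynomial of \<open>x\<close>: over
  the rationals when \<open>R\<close> is the full group, over the inertia field when
  \<open>R\<close> is the inertia group.\<close>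

definition esym :: "(complex \<Rightarrow> complex) set \<Rightarrow> nat \<Rightarrow> complex \<Rightarrow> complex" where
  "esym R k x = (\<Sum>A | A \<subseteq> R \<and> card A = k. \<Prod>\<sigma>\<in>A. \<sigma> x)"

lemma esym_mem: "R \<subseteq> GalG E \<Longrightarrow> x \<in> E \<Longrightarrow> esym R k x \<in> E"
  unfolding esym_def by (rule af_sum, rule af_prod, rule af_GalG_mem) auto

lemma esym_algebraic_int: "R \<subseteq> GalG E \<Longrightarrow> x \<in> E \<Longrightarrow> algebraic_int x \<Longrightarrow> algebraic_int (esym R k x)"
  unfolding esym_def by (rule algebraic_int_sum, rule algebraic_int_prod, rule GalG_algebraic_int) auto

text \<open>Composition with \<open>\<phi>\<close> permutes the \<open>k\<close>-element subsets of
  \<open>R\<close>, and thereby the terms of the sum.\<close>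

lemma AbsGal_esym:
  assumes R: "R \<subseteq> GalG E" and \<phi>: "\<phi> \<in> AbsGal" and x: "x \<in> E"
    and bij: "bij_betw (\<lambda>\<sigma>. restrict (\<lambda>x. \<phi> (\<sigma> x)) E) R R"
  shows "\<phi> (esym R k x) = esym R k x"
proof -
  define L where "L = (\<lambda>\<sigma>. restrict (\<lambda>x. \<phi> (\<sigma> x)) E)"
  have fin: "finite R" using R af_finite finite_subset by blast
  have injR: "inj_on L R" and LR: "L ` R = R" using bij by (auto simp: bij_betw_def L_def)
  have a: "algebraic (\<sigma> x)" if "\<sigma> \<in> R" for \<sigma> using GalG_algebraic[OF _ x af_algebraic[OF x]] R that by blast
  have bP: "bij_betw (\<lambda>A. L ` A) {A. A \<subseteq> R \<and> card A = k} {A. A \<subseteq> R \<and> card A = k}"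
  proof -
    have inj: "inj_on (\<lambda>A. L ` A) {A. A \<subseteq> R \<and> card A = k}"
      using inj_on_image_Pow[OF injR] by (rule inj_on_subset) auto
    have "(\<lambda>A. L ` A) ` {A. A \<subseteq> R \<and> card A = k} \<subseteq> {A. A \<subseteq> R \<and> card A = k}"
    proof clarify
      fix A assume "A \<subseteq> R"
      thus "L ` A \<subseteq> R \<and> card (L ` A) = card A"
        using LR card_image[OF inj_on_subset[OF injR \<open>A \<subseteq> R\<close>]] by blast
    qed
    from endo_inj_surj[OF _ this inj] inj fin show ?thesis by (simp add: bij_betw_def)
  qed
  have "\<phi> (esym R k x) = (\<Sum>A | A \<subseteq> R \<and> card A = k. \<phi> (\<Prod>\<sigma>\<in>A. \<sigma> x))"
    unfolding esym_def using a by (intro AbsGal_sum[OF \<phi>] algebraic_prod) auto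
  also have "\<dots> = (\<Sum>A | A \<subseteq> R \<and> card A = k. \<Prod>\<sigma>\<in>L ` A. \<sigma> x)"
  proof (rule sum.cong[OF refl], clarify)
    fix A assume A: "A \<subseteq> R"
    have "\<phi> (\<Prod>\<sigma>\<in>A. \<sigma> x) = (\<Prod>\<sigma>\<in>A. \<phi> (\<sigma> x))" using a A by (intro AbsGal_prod[OF \<phi>]) auto
    also have "\<dots> = (\<Prod>\<sigma>\<in>A. L \<sigma> x)" using x by (simp add: L_def)
    also have "\<dots> = (\<Prod>\<sigma>\<in>L ` A. \<sigma> x)"
      using prod.reindex[OF inj_on_subset[OF injR A], of "\<lambda>\<sigma>. \<sigma> x"] by simp
    finally show "\<phi> (\<Prod>\<sigma>\<in>A. \<sigma> x) = (\<Prod>\<sigma>\<in>L ` A. \<sigma> x)" .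
  qed
  also have "\<dots> = esym R k x"
    unfolding esym_def by (rule sum.reindex_bij_betw[OF bP, of "\<lambda>A. \<Prod>\<sigma>\<in>A. \<sigma> x"])
  finally show ?thesis .
qed

lemma prod_diff_esym:
  assumes "finite R"
  shows "(\<Prod>\<sigma>\<in>R. y - \<sigma> x) = (\<Sum>k\<le>card R. (-1) ^ k * esym R k x * y ^ (card R - k))"
proof -
  have "(\<Prod>\<sigma>\<in>R. y - \<sigma> x) = (\<Sum>A\<in>Pow R. (-1) ^ card A * (\<Prod>\<sigma>\<in>A. \<sigma> x) * (\<Prod>\<sigma>\<in>R - A. y))"
    using prod_diff_conv_sum[OF assms, of "\<lambda>_. y" "\<lambda>\<sigma>. \<sigma> x"] by simp
  also have "\<dots> = (\<Sum>A\<in>Pow R. (-1) ^ card A * (\<Prod>\<sigma>\<in>A. \<sigma> x) * y ^ (card R - card A))"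
    using assms by (intro sum.cong refl) (auto simp: card_Diff_subset finite_subset)
  also have "\<dots> = (\<Sum>k\<le>card R. \<Sum>A\<in>{A\<in>Pow R. card A = k}. (-1) ^ card A * (\<Prod>\<sigma>\<in>A. \<sigma> x) * y ^ (card R - card A))"
    using assms by (intro sum.group[symmetric]) (auto intro!: card_mono)
  also have "\<dots> = (\<Sum>k\<le>card R. (-1) ^ k * esym R k x * y ^ (card R - k))"
    unfolding esym_def sum_distrib_left sum_distrib_right by (intro sum.cong) auto
  finally show ?thesis .
qed

end

text \<open>Intermediate fields of an abelian extension are stable: two automorphisms that agree at
  \<open>x\<close> agree at \<open>\<phi> x\<close>, because \<open>\<phi>\<close> can be moved past
  them.\<close>

lemma abelian_field_sub:
  assumes E: "abelian_field E" and A: "A \<subseteq> E"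
  shows "abelian_field (qfield A)" "qfield A \<subseteq> E"
proof -
  have alg: "algebraic x" if "x \<in> A" for x using af_algebraic[OF E] A that by blast
  show "qfield A \<subseteq> E" using qfield_mono[OF A] af_qfield[OF E] by simp
  have comm: "\<phi> (\<psi> x) = \<psi> (\<phi> x)" if "\<phi> \<in> AbsGal" "\<psi> \<in> AbsGal" "x \<in> A" for \<phi> \<psi> x
    using af_comm[OF E that(1,2)] that(3) A by blast
  show "abelian_field (qfield A)"
  proof (rule abelian_field_qfield)
    show "finite (GalG A)" using GalG_subset_card[OF A af_finite[OF E]] by blast
    show "algebraic x" if "x \<in> A" for x using alg[OF that] .
    show "\<phi> (\<psi> x) = \<psi> (\<phi> x)" if "\<phi> \<in> AbsGal" "\<psi> \<in> AbsGal" "x \<in> A" for \<phi> \<psi> x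
      using comm[OF that] .
    fix \<phi> x assume h: "\<phi> \<in> AbsGal" "x \<in> A"
    show "\<phi> x \<in> qfield A"
    proof (rule qfieldI[OF AbsGal_algebraic[OF h(1) alg[OF h(2)]]])
      fix \<psi> \<rho> assume g: "\<psi> \<in> AbsGal" "\<rho> \<in> AbsGal" "\<And>y. y \<in> A \<Longrightarrow> \<psi> y = \<rho> y"
      show "\<psi> (\<phi> x) = \<rho> (\<phi> x)" using comm[OF g(1) h] comm[OF g(2) h] g(3)[OF h(2)] by simp
    qed
  qed
qed

section \<open>Subfields of the compositum\<close>

definition mu :: "nat \<Rightarrow> complex set" where "mu q = {z. z ^ q = 1}"

context
  fixes q :: nat assumes q: "q > 0"
begin

lemma mu_algebraic_int: "z \<in> mu q \<Longrightarrow> algebraic_int z"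
  using algebraic_int_powerD[of z q] q by (simp add: mu_def)

lemma mu_finite: "finite (mu q)"
  unfolding mu_def using q by (intro finite_roots_unity) auto

lemma AbsGal_mu: "\<phi> \<in> AbsGal \<Longrightarrow> z \<in> mu q \<Longrightarrow> \<phi> z \<in> mu q"
  using AbsGal_power[of \<phi> z q] mu_algebraic_int[of z] by (auto simp: mu_def AbsGal_1)

lemma mu_eq_powers: obtains \<zeta> where "\<zeta> \<in> mu q" "bij_betw (\<lambda>k. \<zeta> ^ k) {..<q} (mu q)"
proof -
  define \<zeta> where "\<zeta> = cis (2 * pi / real q)"
  have "cis (2 * pi * real k / real q) = \<zeta> ^ k" for k
    by (simp add: \<zeta>_def DeMoivre field_simps)
  hence "bij_betw (\<lambda>k. \<zeta> ^ k) {..<q} (mu q)"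
    using bij_betw_roots_unity[OF q] by (simp add: mu_def)
  moreover have "\<zeta> \<in> mu q" using q by (simp add: mu_def \<zeta>_def DeMoivre)
  ultimately show thesis using that by blast
qed

lemma mu_comm:
  assumes \<phi>: "\<phi> \<in> AbsGal" and \<psi>: "\<psi> \<in> AbsGal" and z: "z \<in> mu q"
  shows "\<phi> (\<psi> z) = \<psi> (\<phi> z)"
proof -
  obtain \<zeta> where \<zeta>: "\<zeta> \<in> mu q" "bij_betw (\<lambda>k. \<zeta> ^ k) {..<q} (mu q)" by (rule mu_eq_powers)
  have pw: "\<exists>k. w = \<zeta> ^ k" if "w \<in> mu q" for w using bij_betw_imp_surj_on[OF \<zeta>(2)] that by blast
  obtain i where i: "\<phi> \<zeta> = \<zeta> ^ i" using pw[OF AbsGal_mu[OF \<phi> \<zeta>(1)]] by blast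
  obtain j where j: "\<psi> \<zeta> = \<zeta> ^ j" using pw[OF AbsGal_mu[OF \<psi> \<zeta>(1)]] by blast
  obtain k where k: "z = \<zeta> ^ k" using pw[OF z] by blast
  have a: "algebraic \<zeta>" using mu_algebraic_int[OF \<zeta>(1)] by blast
  show ?thesis
    by (simp add: k i j AbsGal_power[OF \<phi>] AbsGal_power[OF \<psi>] a algebraic_power flip: power_mult)
       (simp add: mult_ac)
qed

lemma mu_geometric: assumes "z \<in> mu q" "z \<noteq> 1" shows "(\<Sum>k<q. z ^ k) = 0"
  using assms geometric_sum[of z q] by (simp add: mu_def)

text \<open>Orthogonality of characters, by which a number is recovered from its Lagrange
  resolvents.\<close>

lemma mu_sum_power: assumes "0 < k" "k < q" shows "(\<Sum>w\<in>mu q. w ^ k) = 0"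
proof -
  obtain \<zeta> where \<zeta>: "\<zeta> \<in> mu q" "bij_betw (\<lambda>k. \<zeta> ^ k) {..<q} (mu q)" by (rule mu_eq_powers)
  have "\<zeta> ^ k \<noteq> \<zeta> ^ 0"
    using inj_onD[OF bij_betw_imp_inj_on[OF \<zeta>(2)], of k 0] assms by auto
  moreover have "\<zeta> ^ k \<in> mu q" using \<zeta>(1) by (simp add: mu_def flip: power_mult) (metis mult.commute power_mult power_one)
  ultimately have "(\<Sum>i<q. (\<zeta> ^ k) ^ i) = 0" using mu_geometric by simp
  moreover have "(\<Sum>w\<in>mu q. w ^ k) = (\<Sum>i<q. (\<zeta> ^ k) ^ i)"
    using sum.reindex_bij_betw[OF \<zeta>(2), of "\<lambda>w. w ^ k"] by (simp add: mult.commute flip: power_mult)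
  ultimately show ?thesis by simp
qed

lemma mu_card: "card (mu q) = q"
  unfolding mu_def using card_roots_unity_eq[OF q] .

end

section \<open>Totally real Galois fields of degree q and their finite composita\<close>

definition TRG :: "nat \<Rightarrow> complex set set" where
  "TRG q = {F. totally_real_field F \<and> galois_extension F \<and> ring.dimension complex_ring q \<rat> F}"

context
  fixes p q :: nat
  assumes p: "Factorial_Ring.prime p" and q: "q = p \<or> q = p\<^sup>2"
begin

lemma q_pos: "q > 0" using p q prime_gt_0_nat by auto

context
  fixes F assumes F: "F \<in> TRG q"
begin

lemma TRG_algebraic: "x \<in> F \<Longrightarrow> algebraic x"
  using F by (auto simp: TRG_def totally_real_field_def totally_real_def)

lemma TRG_conj: "x \<in> F \<Longrightarrow> conjugates x \<subseteq> F \<inter> \<real>"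
  using F normal_extension_conjugates[of F x]
  by (auto simp: TRG_def totally_real_field_def totally_real_def galois_extension_def)

lemma TRG_stable: "\<phi> \<in> AbsGal \<Longrightarrow> x \<in> F \<Longrightarrow> \<phi> x \<in> F"
  using TRG_conj AbsGal_in_conjugates TRG_algebraic by blast

lemma TRG_real: "x \<in> F \<Longrightarrow> x \<in> \<real>"
  using TRG_conj[of x] AbsGal_in_conjugates[OF TRG_algebraic AbsGal_id, of x] by blast

lemma TRG_GalG: "finite (GalG F)" "card (GalG F) = q"
proof -
  have sf: "subfield F complex_ring" and d: "ring.dimension complex_ring q \<rat> F"
    using F by (auto simp: TRG_def totally_real_field_def)
  obtain u where u: "rat_independent q u" "\<And>i. i < q \<Longrightarrow> u i \<in> F"
    "\<And>x. x \<in> F \<Longrightarrow> \<exists>c. (\<forall>i<q. c i \<in> \<rat>) \<and> x = (\<Sum>i<q. c i * u i)"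
    using dimension_basis[OF d] by blast
  have le: "finite (GalG F) \<and> card (GalG F) \<le> q"
    by (rule GalG_card_le_span[where u = u]) (use u sf TRG_algebraic in \<open>auto simp: subfield_closed\<close>)
  moreover have "q \<le> card (GalG F)"
    by (rule artin_bound[where u = u]) (use u le TRG_algebraic in auto)
  ultimately show "finite (GalG F)" "card (GalG F) = q" by auto
qed

lemma TRG_exponent_comm:
  assumes "\<phi> \<in> AbsGal" "x \<in> F"
  shows TRG_exponent: "(\<phi> ^^ q) x = x"
    and TRG_comm: "\<psi> \<in> AbsGal \<Longrightarrow> \<phi> (\<psi> x) = \<psi> (\<phi> x)"
proof -
  have alg: "algebraic x" if "x \<in> F" for x using TRG_algebraic[OF that] .
  have st: "\<phi> x \<in> F" if "\<phi> \<in> AbsGal" "x \<in> F" for \<phi> x using TRG_stable[OF that] .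
  show "(\<phi> ^^ q) x = x"
    by (rule GalG_prime_square(1)[where F = F and p = p])
       (rule alg st TRG_GalG p q assms; assumption?)+
  show "\<phi> (\<psi> x) = \<psi> (\<phi> x)" if "\<psi> \<in> AbsGal"
    by (rule GalG_prime_square(2)[where F = F and p = p and q = q])
       (rule alg st TRG_GalG p q assms that; assumption?)+
qed

end

text \<open>The roots of unity are adjoined for the resolvents in \<open>tame_aux\<close>. They
  destroy reality, so the real field \<open>qfield (\<Union>S)\<close> is kept beside this
  one.\<close>

definition comp_field :: "complex set set \<Rightarrow> complex set" where
  "comp_field S = qfield (\<Union>S \<union> mu q)"

lemma comp_field_mono: "S \<subseteq> T \<Longrightarrow> comp_field S \<subseteq> comp_field T"
  unfolding comp_field_def by (intro qfield_mono) auto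

context
  fixes S assumes S: "finite S" "S \<subseteq> TRG q"
begin

lemma comp_gen_algebraic: "x \<in> \<Union>S \<union> mu q \<Longrightarrow> algebraic x"
  using S TRG_algebraic mu_algebraic_int[OF q_pos] algebraic_int_imp_algebraic by blast

lemma comp_field_abelian: "abelian_field (comp_field S)"
  unfolding comp_field_def
proof (rule abelian_field_qfield)
  show "algebraic x" if "x \<in> \<Union>S \<union> mu q" for x using comp_gen_algebraic[OF that] .
  have "finite (GalG (mu q))"
    by (rule GalG_finite_set[OF mu_finite[OF q_pos]]) (use mu_algebraic_int[OF q_pos] in blast)
  moreover have "finite (GalG (\<Union>S))"
    by (rule GalG_Union_finite[OF S(1)]) (use S TRG_GalG in blast)
  ultimately show "finite (GalG (\<Union>S \<union> mu q))" by (rule GalG_Un_finite[rotated])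
next
  fix \<phi> x assume \<phi>: "\<phi> \<in> AbsGal" and x: "x \<in> \<Union>S \<union> mu q"
  have "\<phi> x \<in> \<Union>S \<union> mu q"
  proof (cases "x \<in> mu q")
    case False
    then obtain F where F: "F \<in> S" "x \<in> F" using x by blast
    have "\<phi> x \<in> F" by (rule TRG_stable[OF subsetD[OF S(2) F(1)] \<phi> F(2)])
    thus ?thesis using F(1) by auto
  next
    case True
    thus ?thesis using AbsGal_mu[OF q_pos \<phi> True] by simp
  qed
  from qfield_base[OF this comp_gen_algebraic[OF this]] show "\<phi> x \<in> qfield (\<Union>S \<union> mu q)" .
next
  fix \<phi> \<psi> x assume h: "\<phi> \<in> AbsGal" "\<psi> \<in> AbsGal" and x: "x \<in> \<Union>S \<union> mu q"
  show "\<phi> (\<psi> x) = \<psi> (\<phi> x)"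
  proof (cases "x \<in> mu q")
    case False
    then obtain F where F: "F \<in> S" "x \<in> F" using x by blast
    thus ?thesis using TRG_comm[of F \<phi> x \<psi>] S(2) h by blast
  next
    case True
    thus ?thesis using mu_comm[OF q_pos h] by simp
  qed
qed

lemma comp_field_mu: "mu q \<subseteq> comp_field S"
  unfolding comp_field_def using qfield_base comp_gen_algebraic by blast

text \<open>An automorphism may act on the roots of unity with an order that does not divide
  \<open>q\<close>, whence the condition \<open>fx\<close>; elements of inertia satisfy it by
  \<open>inertia_fixes_mu\<close>.\<close>

lemma comp_field_exponent:
  assumes \<phi>: "\<phi> \<in> AbsGal" and fx: "\<And>z. z \<in> mu q \<Longrightarrow> \<phi> z = z" and x: "x \<in> comp_field S"
  shows "(\<phi> ^^ q) x = x"
proof (rule qfieldD[OF x[unfolded comp_field_def] AbsGal_funpow[OF \<phi>] AbsGal_id])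
  fix y assume y: "y \<in> \<Union>S \<union> mu q"
  show "(\<phi> ^^ q) y = y"
  proof (cases "y \<in> mu q")
    case True
    have "(\<phi> ^^ n) y = y" for n using True fx by (induction n) auto
    thus ?thesis by simp
  next
    case False
    then obtain F where F: "F \<in> S" "y \<in> F" using y by blast
    thus ?thesis using TRG_exponent[of F \<phi> y] S(2) \<phi> by blast
  qed
qed

lemma Union_field_real: "x \<in> qfield (\<Union>S) \<Longrightarrow> x \<in> \<real>"
proof -
  assume x: "x \<in> qfield (\<Union>S)"
  have "cnj x = x"
  proof (rule qfieldD[OF x AbsGal_cnj AbsGal_id])
    fix y assume "y \<in> \<Union>S"
    hence "y \<in> \<real>" using S(2) TRG_real by blast
    thus "cnj y = y" by (simp add: Reals_cnj_iff)
  qed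
  thus "x \<in> \<real>" by (simp add: Reals_cnj_iff)
qed

lemma Union_field_subset: "qfield (\<Union>S) \<subseteq> comp_field S"
  unfolding comp_field_def by (intro qfield_mono) auto

end

lemma compositum_cover:
  assumes "x \<in> totally_real_galois_compositum q"
  shows "\<exists>S. finite S \<and> S \<subseteq> TRG q \<and> x \<in> qfield (\<Union>S)"
proof -
  have "x \<in> generate_field complex_ring (\<Union>(TRG q))"
    using assms by (simp add: totally_real_galois_compositum_def TRG_def)
  thus ?thesis
  proof (induction rule: generate_field.induct)
    case one
    show ?case using qfield_1[of "\<Union>{}"] by (intro exI[of _ "{}"]) (simp add: class_ring_simps)
  next
    case (incl h)
    then obtain F where F: "F \<in> TRG q" "h \<in> F" by blast
    have "h \<in> qfield (\<Union>{F})" using F TRG_algebraic[OF F] by (intro qfield_base) auto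
    thus ?case using F by (intro exI[of _ "{F}"]) auto
  next
    case (a_inv h)
    then obtain S where S: "finite S" "S \<subseteq> TRG q" "h \<in> qfield (\<Union>S)" by blast
    thus ?case using qfield_uminus[OF S(3)] by (intro exI[of _ S]) (simp add: class_ring_simps)
  next
    case (m_inv h)
    then obtain S where S: "finite S" "S \<subseteq> TRG q" "h \<in> qfield (\<Union>S)" by blast
    have "h \<noteq> 0" using m_inv by (simp add: class_ring_simps)
    thus ?case using S qfield_inverse[OF S(3)] by (intro exI[of _ S]) (simp add: class_ring_simps)
  next
    case (eng_add h1 h2)
    then obtain S T where S: "finite S" "S \<subseteq> TRG q" "h1 \<in> qfield (\<Union>S)"
      and T: "finite T" "T \<subseteq> TRG q" "h2 \<in> qfield (\<Union>T)" by blast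
    have "h1 \<in> qfield (\<Union>(S \<union> T))" "h2 \<in> qfield (\<Union>(S \<union> T))"
      using S(3) T(3) qfield_mono[of "\<Union>S" "\<Union>(S \<union> T)"] qfield_mono[of "\<Union>T" "\<Union>(S \<union> T)"] by auto
    from qfield_closed(1)[OF this] show ?case using S T by (intro exI[of _ "S \<union> T"]) (simp add: class_ring_simps)
  next
    case (eng_mult h1 h2)
    then obtain S T where S: "finite S" "S \<subseteq> TRG q" "h1 \<in> qfield (\<Union>S)"
      and T: "finite T" "T \<subseteq> TRG q" "h2 \<in> qfield (\<Union>T)" by blast
    have "h1 \<in> qfield (\<Union>(S \<union> T))" "h2 \<in> qfield (\<Union>(S \<union> T))"
      using S(3) T(3) qfield_mono[of "\<Union>S" "\<Union>(S \<union> T)"] qfield_mono[of "\<Union>T" "\<Union>(S \<union> T)"] by auto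
    from qfield_closed(2)[OF this] show ?case using S T by (intro exI[of _ "S \<union> T"]) (simp add: class_ring_simps)
  qed
qed

lemma compositum_cover_finite:
  assumes "finite A" "A \<subseteq> totally_real_galois_compositum q"
  shows "\<exists>S. finite S \<and> S \<subseteq> TRG q \<and> A \<subseteq> qfield (\<Union>S)"
  using assms
proof (induction A rule: finite_induct)
  case (insert x A)
  then obtain S where S: "finite S" "S \<subseteq> TRG q" "A \<subseteq> qfield (\<Union>S)" by auto
  obtain T where T: "finite T" "T \<subseteq> TRG q" "x \<in> qfield (\<Union>T)" using compositum_cover insert.prems by blast
  have "insert x A \<subseteq> qfield (\<Union>(S \<union> T))"
    using S(3) T(3) qfield_mono[of "\<Union>S" "\<Union>(S \<union> T)"] qfield_mono[of "\<Union>T" "\<Union>(S \<union> T)"] by auto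
  thus ?case using S T by (intro exI[of _ "S \<union> T"]) auto
qed auto

end

section \<open>Primes of the ring of all algebraic integers\<close>

text \<open>A prime ideal of the ring of all algebraic integers. One choice induces compatible
  primes in all number fields, so inertia is compared between fields without extending
  primes.\<close>

definition alg_prime :: "complex set \<Rightarrow> bool" where
  "alg_prime P \<longleftrightarrow> (\<forall>x\<in>P. algebraic_int x) \<and> 0 \<in> P \<and> 1 \<notin> P \<and>
     (\<forall>x\<in>P. \<forall>y\<in>P. x + y \<in> P) \<and> (\<forall>x\<in>P. \<forall>a. algebraic_int a \<longrightarrow> a * x \<in> P) \<and>
     (\<forall>x y. algebraic_int x \<longrightarrow> algebraic_int y \<longrightarrow> x * y \<in> P \<longrightarrow> x \<in> P \<or> y \<in> P)"

text \<open>The multiples of \<open>l\<close> form a proper ideal because 1 / l is not an algebraic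
  integer. A maximal ideal above it exists by Zorn's lemma and is prime.\<close>

lemma alg_prime_exists:
  assumes l: "l > (1::nat)"
  shows "\<exists>P. alg_prime P \<and> of_nat l \<in> P"
proof -
  define ideal where "ideal = (\<lambda>P::complex set. (\<forall>x\<in>P. algebraic_int x) \<and> of_nat l \<in> P \<and> 1 \<notin> P \<and>
     (\<forall>x\<in>P. \<forall>y\<in>P. x + y \<in> P) \<and> (\<forall>x\<in>P. \<forall>a. algebraic_int a \<longrightarrow> a * x \<in> P))"
  define I0 where "I0 = {of_nat l * x | x. algebraic_int (x :: complex)}"
  have "1 \<notin> I0"
  proof
    assume "1 \<in> I0"
    then obtain x where x: "algebraic_int x" "of_nat l * x = (1::complex)" by (auto simp: I0_def)
    hence "x = 1 / of_nat l" using l by (simp add: field_simps)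
    hence "x \<in> \<int>" using x(1) by (intro rational_algebraic_int_is_int) auto
    then obtain k where k: "x = of_int k" by (auto elim: Ints_cases)
    have "of_int (int l * k) = (of_int 1 :: complex)" using x(2) k by simp
    hence "int l * k = 1" by (simp only: of_int_eq_iff)
    thus False using l by (auto simp: zmult_eq_1_iff)
  qed
  moreover have "of_nat l \<in> I0" unfolding I0_def using algebraic_int_1 by (metis (mono_tags, lifting) mem_Collect_eq mult.right_neutral)
  moreover have "x + y \<in> I0" if "x \<in> I0" "y \<in> I0" for x y
    using that unfolding I0_def by (auto simp flip: distrib_left)
  moreover have "a * x \<in> I0" if ax: "x \<in> I0" "algebraic_int a" for a x
  proof -
    obtain y where y: "x = of_nat l * y" "algebraic_int y" using ax by (auto simp: I0_def)
    have "a * x = of_nat l * (a * y)" by (simp add: y mult_ac)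
    thus ?thesis using algebraic_int_mult[OF ax(2) y(2)] unfolding I0_def by blast
  qed
  ultimately have I0: "ideal I0" unfolding ideal_def by (auto simp: I0_def)
  have "\<exists>M\<in>Collect ideal. \<forall>Z\<in>Collect ideal. M \<subseteq> Z \<longrightarrow> Z = M"
  proof (rule subset_Zorn_nonempty)
    show "Collect ideal \<noteq> {}" using I0 by auto
    fix C assume C: "C \<noteq> {}" "subset.chain (Collect ideal) C"
    have id: "\<And>Z. Z \<in> C \<Longrightarrow> ideal Z" and tot: "\<And>Z Y. Z \<in> C \<Longrightarrow> Y \<in> C \<Longrightarrow> Z \<subseteq> Y \<or> Y \<subseteq> Z"
      using C by (auto simp: subset.chain_def)
    have "x + y \<in> \<Union>C" if xy: "x \<in> \<Union>C" "y \<in> \<Union>C" for x y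
    proof -
      obtain Z where "Z \<in> C" "x \<in> Z" "y \<in> Z" using xy tot by blast
      thus ?thesis using id[of Z] by (auto simp: ideal_def)
    qed
    moreover have "of_nat l \<in> \<Union>C" using C(1) id by (auto simp: ideal_def)
    moreover have "1 \<notin> \<Union>C" "\<forall>x\<in>\<Union>C. algebraic_int x"
      using id unfolding ideal_def by blast+
    moreover have "a * x \<in> \<Union>C" if ax: "x \<in> \<Union>C" "algebraic_int a" for a x
    proof -
      obtain Z where Z: "Z \<in> C" "x \<in> Z" using ax by blast
      hence "a * x \<in> Z" using id[OF Z(1)] ax(2) unfolding ideal_def by simp
      thus ?thesis using Z(1) by blast
    qed
    ultimately show "\<Union>C \<in> Collect ideal" unfolding ideal_def by blast
  qed
  then obtain M where M: "ideal M" and max: "\<And>Z. ideal Z \<Longrightarrow> M \<subseteq> Z \<Longrightarrow> Z = M" by auto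
  have Mi: "\<And>x. x \<in> M \<Longrightarrow> algebraic_int x" "of_nat l \<in> M" "1 \<notin> M" "\<And>x y. x \<in> M \<Longrightarrow> y \<in> M \<Longrightarrow> x + y \<in> M"
    "\<And>a x. x \<in> M \<Longrightarrow> algebraic_int a \<Longrightarrow> a * x \<in> M"
    using M unfolding ideal_def by auto
  have prime: "y \<in> M" if xy: "algebraic_int x" "algebraic_int y" "x * y \<in> M" "x \<notin> M" for x y
  proof -
    define N where "N = {m + x * a | m a. m \<in> M \<and> algebraic_int a}"
    have NI: "m + x * a \<in> N" if "m \<in> M" "algebraic_int a" for m a using that by (auto simp: N_def)
    have z: "0 \<in> M" using Mi(5)[OF Mi(2), of 0] by simp
    have "x \<in> N" using NI[OF z algebraic_int_1] by simp
    have MN: "M \<subseteq> N" using NI[of _ 0] by auto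
    have "\<not> ideal N" using max[OF _ MN] \<open>x \<in> N\<close> xy(4) by blast
    moreover have "u + v \<in> N" if uv: "u \<in> N" "v \<in> N" for u v
    proof -
      obtain m a m' a' where "u = m + x * a" "v = m' + x * a'" "m \<in> M" "m' \<in> M" "algebraic_int a" "algebraic_int a'"
        using uv by (auto simp: N_def)
      thus ?thesis using NI[of "m + m'" "a + a'"] Mi(4) by (auto simp: algebra_simps)
    qed
    moreover have "c * u \<in> N" if cu: "u \<in> N" "algebraic_int c" for u c
    proof -
      obtain m a where "u = m + x * a" "m \<in> M" "algebraic_int a" using cu by (auto simp: N_def)
      thus ?thesis using NI[of "c * m" "c * a"] Mi(5)[of m c] cu by (auto simp: algebra_simps)
    qed
    moreover have "\<forall>u\<in>N. algebraic_int u" using Mi(1) xy(1) by (auto simp: N_def)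
    ultimately have "1 \<in> N" using MN Mi(2) unfolding ideal_def by blast
    then obtain m a where m: "1 = m + x * a" "m \<in> M" "algebraic_int a" by (auto simp: N_def)
    have "y = y * m + a * (x * y)" using m(1) by (metis distrib_left mult.commute mult.left_commute mult_1)
    moreover have "y * m + a * (x * y) \<in> M" using Mi(4)[OF Mi(5)[OF m(2) xy(2)] Mi(5)[OF xy(3) m(3)]] .
    ultimately show ?thesis by simp
  qed
  have "0 \<in> M" using Mi(5)[OF Mi(2), of 0] by simp
  have "alg_prime M"
    unfolding alg_prime_def
  proof (intro conjI ballI allI impI)
    fix x y assume xy: "algebraic_int x" "algebraic_int y" "x * y \<in> M"
    show "x \<in> M \<or> y \<in> M" using prime[OF xy] by (cases "x \<in> M") auto
  qed (fact Mi(1) | fact Mi(3) | fact Mi(4) | fact Mi(5) | fact \<open>0 \<in> M\<close>)+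
  thus ?thesis using Mi(2) by blast
qed

section \<open>Inertia\<close>

definition divides_int :: "nat \<Rightarrow> complex \<Rightarrow> bool" (infix \<open>intdvd\<close> 50) where
  "l intdvd x \<longleftrightarrow> algebraic_int (x / of_nat l)"

lemma intdvd_0: "l intdvd 0" by (simp add: divides_int_def)

lemma intdvd_add: "l intdvd x \<Longrightarrow> l intdvd y \<Longrightarrow> l intdvd (x + y)"
  by (simp add: divides_int_def add_divide_distrib algebraic_int_add)

lemma intdvd_diff: "l intdvd x \<Longrightarrow> l intdvd y \<Longrightarrow> l intdvd (x - y)"
  by (simp add: divides_int_def diff_divide_distrib algebraic_int_diff)

lemma intdvd_mult: "algebraic_int a \<Longrightarrow> l intdvd x \<Longrightarrow> l intdvd (a * x)"
  using algebraic_int_mult[of a "x / of_nat l"] by (simp add: divides_int_def)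

lemma intdvd_sum: "(\<And>i. i \<in> I \<Longrightarrow> l intdvd f i) \<Longrightarrow> l intdvd (sum f I)"
  by (induction I rule: infinite_finite_induct) (auto simp: intdvd_0 intdvd_add)

lemma intdvd_AbsGal:
  assumes "\<phi> \<in> AbsGal" "l intdvd x" "algebraic x"
  shows "l intdvd (\<phi> x)"
  using AbsGal_algebraic_int[OF assms(1), of "x / of_nat l"] assms
  by (simp add: divides_int_def AbsGal_divide[OF assms(1)] AbsGal_of_nat[OF assms(1)])

lemma intdvd_of_int: "int l dvd k \<Longrightarrow> l intdvd (of_int k)"
  by (cases "l = 0") (auto simp: divides_int_def elim!: dvdE)

lemma intdvd_coprime:
  assumes "Rings.coprime k (int l)" "algebraic_int x" "l intdvd (of_int k * x)" "l > 0"
  shows "l intdvd x"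
proof -
  obtain a b where ab: "a * k + b * int l = 1"
    using assms(1) bezout_int[of k "int l"] by (metis coprime_iff_gcd_eq_1)
  have "x / of_nat l = of_int (a * k + b * int l) * x / of_nat l" by (simp add: ab)
  also have "\<dots> = of_int a * ((of_int k * x) / of_nat l) + of_int b * x"
    using assms(4) by (simp add: field_simps)
  also have "algebraic_int \<dots>"
    by (rule algebraic_int_add[OF algebraic_int_mult[OF algebraic_int_of_int assms(3)[unfolded divides_int_def]]
          algebraic_int_mult[OF algebraic_int_of_int assms(2)]])
  finally show ?thesis unfolding divides_int_def .
qed

context
  fixes l :: nat and P :: "complex set"
  assumes l: "Factorial_Ring.prime l" and P: "alg_prime P" and lP: "of_nat l \<in> P"
begin

lemma P_algebraic_int: "x \<in> P \<Longrightarrow> algebraic_int x" and P_0: "0 \<in> P" and P_1: "1 \<notin> P"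
  and P_add: "x \<in> P \<Longrightarrow> y \<in> P \<Longrightarrow> x + y \<in> P" and P_mult: "algebraic_int a \<Longrightarrow> x \<in> P \<Longrightarrow> a * x \<in> P"
  and P_prime: "algebraic_int x \<Longrightarrow> algebraic_int y \<Longrightarrow> x * y \<in> P \<Longrightarrow> x \<in> P \<or> y \<in> P"
  using P unfolding alg_prime_def by blast+

lemma P_diff: "x \<in> P \<Longrightarrow> y \<in> P \<Longrightarrow> x - y \<in> P"
  using P_add[of x "-y"] P_mult[of "-1" y] by simp

lemma P_sum: "(\<And>i. i \<in> I \<Longrightarrow> f i \<in> P) \<Longrightarrow> sum f I \<in> P"
  by (induction I rule: infinite_finite_induct) (auto simp: P_0 P_add)

lemma P_prod:
  assumes "finite I" "\<And>i. i \<in> I \<Longrightarrow> algebraic_int (f i)" "prod f I \<in> P"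
  shows "\<exists>i\<in>I. f i \<in> P"
  using assms
proof (induction I rule: finite_induct)
  case empty
  thus ?case using P_1 by simp
next
  case (insert i I)
  have "algebraic_int (prod f I)" using insert.prems by (intro algebraic_int_prod) auto
  hence "f i \<in> P \<or> prod f I \<in> P" using insert P_prime by simp
  thus ?case using insert by auto
qed

lemma P_power: "algebraic_int x \<Longrightarrow> x ^ n \<in> P \<Longrightarrow> x \<in> P"
  by (induction n) (auto simp: P_1 dest: P_prime algebraic_int_power)

lemma P_prod_cong:
  assumes "\<And>i. i \<in> I \<Longrightarrow> algebraic_int (f i)" "\<And>i. i \<in> I \<Longrightarrow> algebraic_int (g i)"
    "\<And>i. i \<in> I \<Longrightarrow> f i - g i \<in> P"
  shows "prod f I - prod g I \<in> P"
  using assms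
proof (induction I rule: infinite_finite_induct)
  case (insert i I)
  have "prod f (insert i I) - prod g (insert i I) = prod f I * (f i - g i) + g i * (prod f I - prod g I)"
    using insert by (simp add: algebra_simps)
  moreover have "algebraic_int (prod f I)" using insert.prems by (intro algebraic_int_prod) auto
  ultimately show ?case using insert P_add P_mult by auto
qed (auto simp: P_0)

lemma P_of_int: "of_int k \<in> P \<longleftrightarrow> int l dvd k"
proof
  assume k: "of_int k \<in> P"
  show "int l dvd k"
  proof (rule ccontr)
    assume "\<not> int l dvd k"
    hence "Rings.coprime (int l) k" using l by (intro prime_imp_coprime) auto
    then obtain a b where ab: "a * int l + b * k = 1"
      using bezout_int[of "int l" k] by (metis coprime_iff_gcd_eq_1)
    have "of_int a * of_nat l + of_int b * of_int k \<in> P"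
      using P_mult[OF algebraic_int_of_int lP] P_mult[OF algebraic_int_of_int k] by (intro P_add)
    moreover have "of_int a * of_nat l + of_int b * of_int k = (of_int (a * int l + b * k) :: complex)" by simp
    ultimately show False using ab P_1 by simp
  qed
next
  assume "int l dvd k"
  then obtain m where "k = int l * m" by (elim dvdE)
  thus "of_int k \<in> P" using P_mult[OF algebraic_int_of_int lP, of m] by (simp add: mult.commute)
qed

lemma P_intdvd: assumes "l intdvd x" shows "x \<in> P"
proof -
  have "l > 0" using l prime_gt_0_nat by blast
  thus ?thesis using P_mult[OF assms[unfolded divides_int_def] lP] by simp
qed

text \<open>The elements are automorphisms of all algebraic numbers, so inertia for different
  \<open>E\<close> can be compared directly: a larger \<open>E\<close> has a smaller inertia
  set.\<close>

definition inertia :: "complex set \<Rightarrow> (complex \<Rightarrow> complex) set" where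
  "inertia E = {\<phi>\<in>AbsGal. \<forall>x\<in>E. algebraic_int x \<longrightarrow> \<phi> x - x \<in> P}"

lemma inertia_mono: "E \<subseteq> E' \<Longrightarrow> inertia E' \<subseteq> inertia E"
  by (auto simp: inertia_def)

context
  fixes E assumes E: "abelian_field E"
begin

lemma inertia_comp: "\<phi> \<in> inertia E \<Longrightarrow> \<psi> \<in> inertia E \<Longrightarrow> (\<lambda>x. \<phi> (\<psi> x)) \<in> inertia E"
proof -
  assume h: "\<phi> \<in> inertia E" "\<psi> \<in> inertia E"
  hence g: "\<phi> \<in> AbsGal" "\<psi> \<in> AbsGal" by (auto simp: inertia_def)
  have "\<phi> (\<psi> x) - x \<in> P" if x: "x \<in> E" "algebraic_int x" for x
  proof -
    have "\<phi> (\<psi> x) - \<psi> x \<in> P" using h(1) af_stable[OF E g(2) x(1)] AbsGal_algebraic_int[OF g(2) x(2)]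
      by (auto simp: inertia_def)
    moreover have "\<psi> x - x \<in> P" using h(2) x by (auto simp: inertia_def)
    ultimately show ?thesis using P_add by fastforce
  qed
  thus ?thesis using AbsGal_comp[OF g] by (auto simp: inertia_def)
qed

definition RI :: "(complex \<Rightarrow> complex) set" where "RI = (\<lambda>\<phi>. restrict \<phi> E) ` inertia E"

lemma RI_sub: "RI \<subseteq> GalG E"
  by (auto simp: RI_def inertia_def GalGI)

lemma RI_finite: "finite RI" using RI_sub af_finite[OF E] finite_subset by blast

lemma inertia_id: "(\<lambda>x. x) \<in> inertia E"
  by (simp add: inertia_def AbsGal_id P_0)

lemma RI_bij:
  assumes \<phi>: "\<phi> \<in> inertia E"
  shows "bij_betw (\<lambda>\<sigma>. restrict (\<lambda>x. \<phi> (\<sigma> x)) E) RI RI"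
proof -
  have \<phi>': "\<phi> \<in> AbsGal" using \<phi> by (simp add: inertia_def)
  have inj: "inj_on (\<lambda>\<sigma>. restrict (\<lambda>x. \<phi> (\<sigma> x)) E) RI"
    using bij_betw_imp_inj_on[OF af_bij[OF E \<phi>']] RI_sub by (rule inj_on_subset)
  have "(\<lambda>\<sigma>. restrict (\<lambda>x. \<phi> (\<sigma> x)) E) ` RI \<subseteq> RI"
  proof clarify
    fix \<sigma> assume "\<sigma> \<in> RI"
    then obtain \<psi> where \<psi>: "\<psi> \<in> inertia E" "\<sigma> = restrict \<psi> E" by (auto simp: RI_def)
    have "restrict (\<lambda>x. \<phi> (\<sigma> x)) E = restrict (\<lambda>x. \<phi> (\<psi> x)) E" by (auto simp: \<psi>(2) intro!: restrict_ext)
    thus "restrict (\<lambda>x. \<phi> (\<sigma> x)) E \<in> RI" using inertia_comp[OF \<phi> \<psi>(1)] by (auto simp: RI_def)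
  qed
  from endo_inj_surj[OF RI_finite this inj] inj show ?thesis by (simp add: bij_betw_def)
qed

definition fixI :: "complex set" where "fixI = {x\<in>E. \<forall>\<phi>\<in>inertia E. \<phi> x = x}"

lemma fixI_sub: "fixI \<subseteq> E" by (auto simp: fixI_def)

lemma fixI_qfield: "qfield fixI = fixI"
proof
  show "fixI \<subseteq> qfield fixI" using af_algebraic[OF E] fixI_sub qfield_base by blast
  show "qfield fixI \<subseteq> fixI"
  proof
    fix x assume x: "x \<in> qfield fixI"
    have "x \<in> E" using abelian_field_sub(2)[OF E fixI_sub] x by blast
    moreover have "\<phi> x = x" if "\<phi> \<in> inertia E" for \<phi>
    proof (rule qfieldD[OF x _ AbsGal_id])
      show "\<phi> \<in> AbsGal" using that by (simp add: inertia_def)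
      show "\<phi> y = y" if "y \<in> fixI" for y using that \<open>\<phi> \<in> inertia E\<close> by (simp add: fixI_def)
    qed
    ultimately show "x \<in> fixI" by (simp add: fixI_def)
  qed
qed

lemma fixI_abelian: "abelian_field fixI"
  using abelian_field_sub(1)[OF E fixI_sub] fixI_qfield by simp

text \<open>Suppose \<open>\<tau>\<close> were trivial modulo \<open>P\<close> on the integers of
  the inertia field. The characteristic polynomial over that field of an integer \<open>x\<close> of
  \<open>E\<close> is congruent to (Y - x)^r modulo \<open>P\<close>, with r the order of inertia,
  and \<open>\<tau>\<close> does not change its coefficients modulo \<open>P\<close>. So
  \<open>\<tau> x\<close> is a root of it modulo \<open>P\<close>, whence
  \<open>\<tau> x - x\<close> lies in \<open>P\<close>. Then \<open>\<tau>\<close> would be in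
  inertia and fix the inertia field.\<close>

lemma fixI_moved:
  assumes \<tau>: "\<tau> \<in> AbsGal" and ne: "x0 \<in> fixI" "\<tau> x0 \<noteq> x0"
  shows "\<exists>a\<in>fixI. algebraic_int a \<and> \<tau> a - a \<notin> P"
proof (rule ccontr)
  assume "\<not> ?thesis"
  hence triv: "\<tau> a - a \<in> P" if "a \<in> fixI" "algebraic_int a" for a using that by blast
  have "\<tau> \<in> inertia E"
    unfolding inertia_def
  proof (intro CollectI conjI ballI impI)
    fix x assume x: "x \<in> E" "algebraic_int x"
    define n where "n = card RI"
    have ints: "algebraic_int (\<sigma> x)" "\<sigma> x \<in> E" if "\<sigma> \<in> RI" for \<sigma>
      using GalG_algebraic_int[OF subsetD[OF RI_sub that] x] af_GalG_mem[OF E subsetD[OF RI_sub that] x(1)] by auto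
    have ti: "algebraic_int (\<tau> x)" by (rule AbsGal_algebraic_int[OF \<tau> x(2)])
    define e where "e = (\<lambda>k. esym RI k x)"
    have e_int: "algebraic_int (e k)" for k unfolding e_def by (rule esym_algebraic_int[OF E RI_sub x])
    have e_fix: "e k \<in> fixI" for k
      unfolding fixI_def e_def
    proof (intro CollectI conjI ballI)
      show "esym RI k x \<in> E" by (rule esym_mem[OF E RI_sub x(1)])
      fix \<phi> assume \<phi>: "\<phi> \<in> inertia E"
      hence "\<phi> \<in> AbsGal" by (simp add: inertia_def)
      thus "\<phi> (esym RI k x) = esym RI k x" by (rule AbsGal_esym[OF E RI_sub _ x(1) RI_bij[OF \<phi>]])
    qed
    have te: "\<tau> (e k) - e k \<in> P" for k by (rule triv[OF e_fix e_int])
    define y where "y = \<tau> x"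
    have expand: "(\<Prod>\<sigma>\<in>RI. z - \<sigma> x) = (\<Sum>k\<le>n. (-1) ^ k * e k * z ^ (n - k))" for z
      unfolding n_def e_def by (rule prod_diff_esym[OF E RI_finite])
    have "(\<Prod>\<sigma>\<in>RI. x - \<sigma> x) = 0"
    proof (rule prod_zero[OF RI_finite])
      have "restrict (\<lambda>x. x) E \<in> RI" using inertia_id by (auto simp: RI_def)
      thus "\<exists>\<sigma>\<in>RI. x - \<sigma> x = 0" using x(1) by (intro bexI[of _ "restrict (\<lambda>x. x) E"]) auto
    qed
    hence "\<tau> (\<Sum>k\<le>n. (-1) ^ k * e k * x ^ (n - k)) = 0" using expand AbsGal_0[OF \<tau>] by simp
    also have "\<tau> (\<Sum>k\<le>n. (-1) ^ k * e k * x ^ (n - k)) = (\<Sum>k\<le>n. \<tau> ((-1) ^ k * e k * x ^ (n - k)))"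
    proof (rule AbsGal_sum[OF \<tau>])
      have "algebraic_int ((-1) ^ k * e k * x ^ (n - k))" for k
        using e_int x(2) by (intro algebraic_int_mult algebraic_int_power) auto
      thus "algebraic ((-1) ^ k * e k * x ^ (n - k))" for k by blast
    qed
    also have "\<dots> = (\<Sum>k\<le>n. (-1) ^ k * \<tau> (e k) * y ^ (n - k))"
    proof (rule sum.cong[OF refl])
      fix k
      have a: "algebraic (e k)" "algebraic x" "algebraic ((-1::complex) ^ k)" "algebraic ((-1) ^ k * e k)" "algebraic (x ^ (n - k))"
        using e_int[of k] x(2) by (auto intro!: algebraic_mult algebraic_power)
      show "\<tau> ((-1) ^ k * e k * x ^ (n - k)) = (-1) ^ k * \<tau> (e k) * y ^ (n - k)"
        using a AbsGal_power[OF \<tau>, of "-1"] AbsGal_minus[OF \<tau>, of 1] AbsGal_1[OF \<tau>]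
        by (simp add: AbsGal_mult[OF \<tau>] AbsGal_power[OF \<tau>] y_def)
    qed
    finally have zero: "(\<Sum>k\<le>n. (-1) ^ k * \<tau> (e k) * y ^ (n - k)) = 0" .
    \<comment> \<open>\<open>\<tau> x\<close> satisfies exactly the equation with coefficients
      \<open>\<tau> (e k)\<close>; subtracting it leaves multiples of the differences
      \<open>\<tau> (e k) - e k\<close>.\<close>
    have "(\<Prod>\<sigma>\<in>RI. y - \<sigma> x) = (\<Sum>k\<le>n. (-1) ^ k * e k * y ^ (n - k)) - (\<Sum>k\<le>n. (-1) ^ k * \<tau> (e k) * y ^ (n - k))"
      using expand zero by simp
    also have "\<dots> = (\<Sum>k\<le>n. (- ((-1) ^ k) * y ^ (n - k)) * (\<tau> (e k) - e k))"
      by (simp add: algebra_simps flip: sum_subtractf)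
    also have "\<dots> \<in> P"
    proof (rule P_sum, rule P_mult[OF _ te])
      show "algebraic_int (- ((-1) ^ k) * y ^ (n - k))" for k
        using ti by (intro algebraic_int_mult algebraic_int_power algebraic_int_minus) (auto simp: y_def)
    qed
    finally have "(\<Prod>\<sigma>\<in>RI. y - \<sigma> x) \<in> P" .
    moreover have "(\<Prod>\<sigma>\<in>RI. y - \<sigma> x) - (\<Prod>\<sigma>\<in>RI. y - x) \<in> P"
    proof (rule P_prod_cong)
      fix \<sigma> assume s: "\<sigma> \<in> RI"
      show "algebraic_int (y - \<sigma> x)" "algebraic_int (y - x)"
        using ints[OF s] ti x(2) by (auto simp: y_def intro!: algebraic_int_diff)
      obtain \<psi> where "\<psi> \<in> inertia E" "\<sigma> = restrict \<psi> E" using s by (auto simp: RI_def)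
      hence "\<sigma> x - x \<in> P" using x by (auto simp: inertia_def)
      hence "0 - (\<sigma> x - x) \<in> P" by (rule P_diff[OF P_0])
      thus "y - \<sigma> x - (y - x) \<in> P" by (simp add: algebra_simps)
    qed
    ultimately have "(\<Prod>\<sigma>\<in>RI. y - \<sigma> x) - ((\<Prod>\<sigma>\<in>RI. y - \<sigma> x) - (\<Prod>\<sigma>\<in>RI. y - x)) \<in> P" by (rule P_diff)
    hence "(y - x) ^ card RI \<in> P" by simp
    thus "\<tau> x - x \<in> P" using P_power[of "y - x"] ti x(2) by (auto simp: y_def intro: algebraic_int_diff)
  qed (rule \<tau>)
  thus False using ne by (auto simp: fixI_def)
qed

text \<open>With \<open>S\<close> the set of nontrivial automorphisms, only the identity survives in this sum. When every
  \<open>a \<tau>\<close> is moved modulo \<open>P\<close> by \<open>\<tau>\<close>, the coefficient that remains is a unit at \<open>P\<close>; this is how the trace form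
  of the inertia field is seen to be perfect at \<open>l\<close>, without discriminants.\<close>

lemma trace_combination:
  assumes S: "finite S" "S \<subseteq> GalG fixI" and u: "u \<in> fixI" "algebraic_int u"
    and a: "\<And>\<sigma>. \<sigma> \<in> S \<Longrightarrow> a \<sigma> \<in> fixI \<and> algebraic_int (a \<sigma>)"
    and tr: "\<And>w. w \<in> fixI \<Longrightarrow> algebraic_int w \<Longrightarrow> l intdvd (tr fixI (w * u))"
    and w: "w \<in> fixI" "algebraic_int w"
  shows "l intdvd (\<Sum>\<rho>\<in>GalG fixI. (\<Prod>\<tau>\<in>S. \<rho> (a \<tau>) - \<tau> (a \<tau>)) * \<rho> (w * u))"
  using S a w
proof (induction S arbitrary: w rule: finite_induct)
  case empty
  thus ?case using tr[OF empty(3,4)] by (simp add: tr_def[OF fixI_abelian])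
next
  case (insert \<tau> S)
  note h = GalG_hom[OF fixI_abelian]
  define b where "b = \<tau> (a \<tau>)"
  have a\<tau>: "a \<tau> \<in> fixI" "algebraic_int (a \<tau>)" using insert.prems by auto
  have b: "algebraic_int b" unfolding b_def using insert.prems(1) by (intro GalG_algebraic_int[OF _ a\<tau>]) auto
  have "l intdvd (\<Sum>\<rho>\<in>GalG fixI. (\<Prod>\<tau>\<in>S. \<rho> (a \<tau>) - \<tau> (a \<tau>)) * \<rho> ((a \<tau> * w) * u))"
    using insert.prems(1,2) af_mult[OF fixI_abelian a\<tau>(1) insert.prems(3)] algebraic_int_mult[OF a\<tau>(2) insert.prems(4)]
    by (intro insert.IH) auto
  moreover have "l intdvd (b * (\<Sum>\<rho>\<in>GalG fixI. (\<Prod>\<tau>\<in>S. \<rho> (a \<tau>) - \<tau> (a \<tau>)) * \<rho> (w * u)))"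
    by (rule intdvd_mult[OF b], rule insert.IH) (use insert.prems in auto)
  ultimately have "l intdvd ((\<Sum>\<rho>\<in>GalG fixI. (\<Prod>\<tau>\<in>S. \<rho> (a \<tau>) - \<tau> (a \<tau>)) * \<rho> ((a \<tau> * w) * u))
       - b * (\<Sum>\<rho>\<in>GalG fixI. (\<Prod>\<tau>\<in>S. \<rho> (a \<tau>) - \<tau> (a \<tau>)) * \<rho> (w * u)))" by (rule intdvd_diff)
  also have "(\<Sum>\<rho>\<in>GalG fixI. (\<Prod>\<tau>\<in>S. \<rho> (a \<tau>) - \<tau> (a \<tau>)) * \<rho> ((a \<tau> * w) * u))
       - b * (\<Sum>\<rho>\<in>GalG fixI. (\<Prod>\<tau>\<in>S. \<rho> (a \<tau>) - \<tau> (a \<tau>)) * \<rho> (w * u))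
     = (\<Sum>\<rho>\<in>GalG fixI. (\<Prod>\<tau>\<in>insert \<tau> S. \<rho> (a \<tau>) - \<tau> (a \<tau>)) * \<rho> (w * u))"
    unfolding sum_distrib_left sum_subtractf[symmetric]
  proof (rule sum.cong[OF refl])
    fix \<rho> assume r: "\<rho> \<in> GalG fixI"
    have wu: "w * u \<in> fixI" using insert.prems u by (intro af_mult[OF fixI_abelian])
    have "\<rho> ((a \<tau> * w) * u) = \<rho> (a \<tau>) * \<rho> (w * u)"
      using h(2)[OF r a\<tau>(1) wu] by (simp add: mult.assoc)
    thus "(\<Prod>\<tau>\<in>S. \<rho> (a \<tau>) - \<tau> (a \<tau>)) * \<rho> ((a \<tau> * w) * u) - b * ((\<Prod>\<tau>\<in>S. \<rho> (a \<tau>) - \<tau> (a \<tau>)) * \<rho> (w * u))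
      = (\<Prod>\<tau>\<in>insert \<tau> S. \<rho> (a \<tau>) - \<tau> (a \<tau>)) * \<rho> (w * u)"
      using insert.hyps by (simp add: b_def algebra_simps)
  qed
  finally show ?case .
qed

text \<open>\<open>trace_combination\<close> gives divisibility only after multiplication by
  \<open>c\<close>, which avoids the one prime \<open>P\<close> but perhaps not the other primes
  over \<open>l\<close>. The factor is removed by a trace: for suitable \<open>w\<close> the trace
  of \<open>w * c\<close> is a rational integer prime to \<open>l\<close>, and each of its terms
  becomes divisible by \<open>l\<close> when multiplied by \<open>u\<close>.\<close>

lemma unramified_trace:
  assumes u: "u \<in> fixI" "algebraic_int u"
    and tr: "\<And>w. w \<in> fixI \<Longrightarrow> algebraic_int w \<Longrightarrow> l intdvd (tr fixI (w * u))"
  shows "l intdvd u"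
proof -
  note F = fixI_abelian
  define \<iota> where "\<iota> = restrict (\<lambda>x. x) fixI"
  define S where "S = GalG fixI - {\<iota>}"
  have \<iota>: "\<iota> \<in> GalG fixI" unfolding \<iota>_def by (rule GalGI[OF AbsGal_id])
  have S: "finite S" "S \<subseteq> GalG fixI" using af_finite[OF F] by (auto simp: S_def)
  have "\<exists>a. \<forall>\<sigma>\<in>S. a \<sigma> \<in> fixI \<and> algebraic_int (a \<sigma>) \<and> \<sigma> (a \<sigma>) - a \<sigma> \<notin> P"
  proof (rule bchoice, rule ballI)
    fix \<sigma> assume s: "\<sigma> \<in> S"
    then obtain \<psi> where p: "\<psi> \<in> AbsGal" "\<sigma> = restrict \<psi> fixI" using S by (auto elim: GalGE)
    have "\<exists>x\<in>fixI. \<psi> x \<noteq> x"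
    proof (rule ccontr)
      assume "\<not> ?thesis"
      hence "\<sigma> = \<iota>" unfolding p(2) \<iota>_def by (intro restrict_ext) auto
      thus False using s by (simp add: S_def)
    qed
    then obtain x where "x \<in> fixI" "\<psi> x \<noteq> x" by blast
    from fixI_moved[OF p(1) this] obtain a where "a \<in> fixI" "algebraic_int a" "\<psi> a - a \<notin> P" by blast
    thus "\<exists>a. a \<in> fixI \<and> algebraic_int a \<and> \<sigma> a - a \<notin> P" using p(2) by (intro exI[of _ a]) auto
  qed
  then obtain a where a: "\<And>\<sigma>. \<sigma> \<in> S \<Longrightarrow> a \<sigma> \<in> fixI \<and> algebraic_int (a \<sigma>)" "\<And>\<sigma>. \<sigma> \<in> S \<Longrightarrow> \<sigma> (a \<sigma>) - a \<sigma> \<notin> P"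
    by blast
  define c where "c = (\<Prod>\<tau>\<in>S. a \<tau> - \<tau> (a \<tau>))"
  have ci: "algebraic_int (a \<tau> - \<tau> (a \<tau>))" if "\<tau> \<in> S" for \<tau>
    using a(1)[OF that] GalG_algebraic_int[of \<tau> fixI "a \<tau>"] S that by (intro algebraic_int_diff) auto
  have c_int: "algebraic_int c" unfolding c_def using ci by (rule algebraic_int_prod)
  have c_mem: "c \<in> fixI" unfolding c_def
  proof (rule af_prod[OF F])
    fix \<tau> assume "\<tau> \<in> S"
    thus "a \<tau> - \<tau> (a \<tau>) \<in> fixI" using a(1) af_GalG_mem[OF F, of \<tau> "a \<tau>"] S by (intro af_diff[OF F]) auto
  qed
  have cP: "c \<notin> P"
  proof
    assume "c \<in> P"
    hence "\<exists>\<tau>\<in>S. a \<tau> - \<tau> (a \<tau>) \<in> P"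
      unfolding c_def using S(1) ci by (intro P_prod) auto
    then obtain \<tau> where t: "\<tau> \<in> S" "a \<tau> - \<tau> (a \<tau>) \<in> P" by auto
    have "0 - (a \<tau> - \<tau> (a \<tau>)) \<in> P" by (rule P_diff[OF P_0 t(2)])
    thus False using a(2)[OF t(1)] by simp
  qed
  have key: "l intdvd (c * v)"
    if v: "v \<in> fixI" "algebraic_int v" "\<And>w. w \<in> fixI \<Longrightarrow> algebraic_int w \<Longrightarrow> l intdvd (tr fixI (w * v))" for v
  proof -
    have "l intdvd (\<Sum>\<rho>\<in>GalG fixI. (\<Prod>\<tau>\<in>S. \<rho> (a \<tau>) - \<tau> (a \<tau>)) * \<rho> (1 * v))"
      by (rule trace_combination[OF S v(1,2) a(1) v(3) af_1[OF F] algebraic_int_1])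
    also have "(\<Sum>\<rho>\<in>GalG fixI. (\<Prod>\<tau>\<in>S. \<rho> (a \<tau>) - \<tau> (a \<tau>)) * \<rho> (1 * v))
        = (\<Prod>\<tau>\<in>S. \<iota> (a \<tau>) - \<tau> (a \<tau>)) * \<iota> (1 * v)
          + (\<Sum>\<rho>\<in>S. (\<Prod>\<tau>\<in>S. \<rho> (a \<tau>) - \<tau> (a \<tau>)) * \<rho> (1 * v))"
      unfolding S_def using af_finite[OF F] \<iota> by (rule sum.remove)
    also have "(\<Sum>\<rho>\<in>S. (\<Prod>\<tau>\<in>S. \<rho> (a \<tau>) - \<tau> (a \<tau>)) * \<rho> (1 * v)) = 0"
      by (rule sum.neutral) (use S(1) in \<open>auto intro!: bexI\<close>)
    also have "(\<Prod>\<tau>\<in>S. \<iota> (a \<tau>) - \<tau> (a \<tau>)) = c"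
      unfolding c_def \<iota>_def using a(1) by (intro prod.cong) auto
    finally show ?thesis using v(1) by (simp add: \<iota>_def)
  qed
  \<comment> \<open>If all these traces were divisible by \<open>l\<close>, then \<open>c\<close>
    itself could be inserted for \<open>v\<close> in \<open>key\<close>, and \<open>c * c\<close>
    would lie in \<open>P\<close>.\<close>
  have "\<exists>w\<in>fixI. algebraic_int w \<and> \<not> l intdvd (tr fixI (w * c))"
  proof (rule ccontr)
    assume "\<not> ?thesis"
    hence "l intdvd (c * c)" using key[OF c_mem c_int] by blast
    hence "c * c \<in> P" by (rule P_intdvd)
    thus False using P_prime[OF c_int c_int] cP by blast
  qed
  then obtain w where w: "w \<in> fixI" "algebraic_int w" "\<not> l intdvd (tr fixI (w * c))" by blast
  have wc: "w * c \<in> fixI" "algebraic_int (w * c)" using w c_mem c_int af_mult[OF F] by auto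
  obtain k where k: "tr fixI (w * c) = of_int k" using tr_Ints[OF F wc] by (auto elim: Ints_cases)
  have "\<not> int l dvd k" using w(3) intdvd_of_int k by auto
  hence cop: "Rings.coprime k (int l)" using l by (subst coprime_commute, intro prime_imp_coprime) auto
  have "l intdvd (of_int k * u)"
  proof -
    have "of_int k * u = (\<Sum>\<rho>\<in>GalG fixI. \<rho> w * (\<rho> c * u))"
      unfolding k[symmetric] tr_def[OF F] sum_distrib_right
      using GalG_hom(2)[OF F _ w(1) c_mem] by (intro sum.cong refl) (simp add: mult.assoc)
    also have "l intdvd \<dots>"
    proof (rule intdvd_sum, rule intdvd_mult)
      fix \<rho> assume r: "\<rho> \<in> GalG fixI"
      show "algebraic_int (\<rho> w)" by (rule GalG_algebraic_int[OF r w(1,2)])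
      obtain \<phi> where \<phi>: "\<phi> \<in> AbsGal" "\<rho> = restrict \<phi> fixI" using GalGE[OF r] by blast
      obtain \<psi> where \<psi>: "\<psi> \<in> AbsGal" "\<And>x. x \<in> fixI \<Longrightarrow> \<phi> (\<psi> x) = x" using af_inverse[OF F \<phi>(1)] by metis
      have \<psi>u: "\<psi> u \<in> fixI" "algebraic_int (\<psi> u)" using af_stable[OF F \<psi>(1) u(1)] AbsGal_algebraic_int[OF \<psi>(1) u(2)] by auto
      \<comment> \<open>The assumption on \<open>u\<close> is stable under conjugation, so
        \<open>key\<close> also applies to \<open>\<psi> u\<close>; then \<open>\<phi>\<close> turns
        \<open>c * \<psi> u\<close> into \<open>\<rho> c * u\<close>.\<close>
      have "l intdvd (c * \<psi> u)"
      proof (rule key[OF \<psi>u])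
        fix v assume v: "v \<in> fixI" "algebraic_int v"
        have "tr fixI (v * \<psi> u) = tr fixI (\<phi> (v * \<psi> u))"
          using tr_AbsGal[OF F \<phi>(1)] af_mult[OF F v(1) \<psi>u(1)] by simp
        also have "\<phi> (v * \<psi> u) = \<phi> v * u"
          using AbsGal_mult[OF \<phi>(1)] af_algebraic[OF F] v(1) \<psi>u(1) \<psi>(2)[OF u(1)] by simp
        finally show "l intdvd (tr fixI (v * \<psi> u))"
          using tr[OF af_stable[OF F \<phi>(1) v(1)] AbsGal_algebraic_int[OF \<phi>(1) v(2)]] by simp
      qed
      moreover have alg: "algebraic c" "algebraic (\<psi> u)" using c_int \<psi>u(2) by auto
      ultimately have "l intdvd (\<phi> (c * \<psi> u))" by (intro intdvd_AbsGal[OF \<phi>(1)] algebraic_mult) auto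
      thus "l intdvd (\<rho> c * u)" using \<phi>(2) c_mem \<psi>(2)[OF u(1)] AbsGal_mult[OF \<phi>(1) alg] by simp
    qed
    finally show ?thesis .
  qed
  moreover have "l > 0" using l prime_gt_0_nat by blast
  ultimately show ?thesis using intdvd_coprime[OF cop u(2)] by blast
qed

text \<open>In the inertia field, lying in all primes over \<open>l\<close> amounts to divisibility
  by \<open>l\<close>: the traces of the integral multiples of \<open>u\<close> are rational
  integers in \<open>P\<close>, hence divisible by \<open>l\<close>, and the trace criterion
  applies.\<close>

lemma unramified_radical:
  assumes u: "u \<in> fixI" "algebraic_int u" and P: "\<And>\<tau>. \<tau> \<in> AbsGal \<Longrightarrow> \<tau> u \<in> P"
  shows "l intdvd u"
proof (rule unramified_trace[OF u])
  note F = fixI_abelian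
  fix w assume w: "w \<in> fixI" "algebraic_int w"
  have wu: "w * u \<in> fixI" "algebraic_int (w * u)" using w u af_mult[OF F] by auto
  obtain k where k: "tr fixI (w * u) = of_int k" using tr_Ints[OF F wu] by (auto elim: Ints_cases)
  have "tr fixI (w * u) \<in> P"
    unfolding tr_def[OF F]
  proof (rule P_sum)
    fix \<sigma> assume s: "\<sigma> \<in> GalG fixI"
    then obtain \<tau> where "\<tau> \<in> AbsGal" "\<sigma> = restrict \<tau> fixI" by (rule GalGE)
    hence "\<sigma> u \<in> P" using P u(1) by simp
    thus "\<sigma> (w * u) \<in> P"
      using GalG_hom(2)[OF F s w(1) u(1)] P_mult[OF GalG_algebraic_int[OF s w]] by simp
  qed
  hence "int l dvd k" using P_of_int k by simp
  thus "l intdvd (tr fixI (w * u))" using intdvd_of_int k by simp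
qed

end

end

section \<open>Tame inertia and the size of conjugates\<close>

text \<open>The product of the conjugates is a nonzero rational integer, so they cannot all be
  smaller than 1 in absolute value.\<close>

lemma exists_conjugate_ge_1:
  assumes E: "abelian_field E" and t: "t \<in> E" "algebraic_int t" "t \<noteq> 0"
  shows "\<exists>\<tau>\<in>AbsGal. norm (\<tau> t) \<ge> 1"
proof (rule ccontr)
  assume "\<not> ?thesis"
  hence lt: "norm (\<tau> t) < 1" if "\<tau> \<in> AbsGal" for \<tau> using that by force
  define G where "G = GalG E"
  have fG: "finite G" unfolding G_def by (rule af_finite[OF E])
  have "{A. A \<subseteq> G \<and> card A = card G} = {G}" using card_subset_eq[OF fG] by auto
  hence N: "esym G (card G) t = (\<Prod>\<sigma>\<in>G. \<sigma> t)" by (simp add: esym_def[OF E])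
  have mem: "esym G (card G) t \<in> E" unfolding G_def by (rule esym_mem[OF E subset_refl t(1)])
  have "esym G (card G) t \<in> \<rat>"
  proof (rule AbsGal_fixed_imp_Rats[OF af_algebraic[OF E mem]])
    fix \<phi> assume "\<phi> \<in> AbsGal"
    thus "\<phi> (esym G (card G) t) = esym G (card G) t"
      unfolding G_def by (intro AbsGal_esym[OF E subset_refl _ t(1)] af_bij[OF E])
  qed
  moreover have "algebraic_int (esym G (card G) t)"
    unfolding G_def by (rule esym_algebraic_int[OF E subset_refl t(1,2)])
  ultimately have "esym G (card G) t \<in> \<int>" by (intro rational_algebraic_int_is_int)
  then obtain k where k: "(\<Prod>\<sigma>\<in>G. \<sigma> t) = of_int k" unfolding N by (auto elim: Ints_cases)
  have st: "\<sigma> t \<noteq> 0 \<and> norm (\<sigma> t) < 1" if s: "\<sigma> \<in> G" for \<sigma>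
  proof -
    obtain \<phi> where "\<phi> \<in> AbsGal" "\<sigma> = restrict \<phi> E" using GalGE[OF s[unfolded G_def]] by blast
    thus ?thesis using lt AbsGal_eq_0_iff[of \<phi> t] af_algebraic[OF E t(1)] t by simp
  qed
  have "(\<Prod>\<sigma>\<in>G. \<sigma> t) \<noteq> 0" using st fG by simp
  hence "k \<noteq> 0" using k by auto
  hence "norm (of_int k :: complex) \<ge> 1" by simp
  moreover have "norm (\<Prod>\<sigma>\<in>G. \<sigma> t) < 1"
  proof -
    obtain i where i: "i \<in> G" using GalGI[OF AbsGal_id, of E] by (auto simp: G_def)
    have "(\<Prod>\<sigma>\<in>G. norm (\<sigma> t)) < (\<Prod>\<sigma>\<in>G. 1)"
      using st i fG by (intro prod_mono_strict[of i]) (auto simp: less_imp_le)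
    thus ?thesis by (simp add: prod_norm)
  qed
  ultimately show False using k by simp
qed

text \<open>The condition \<open>l intdvd w ^ q\<close> says that w / l^(1/q) is an algebraic
  integer; in this form no root of \<open>l\<close> has to be chosen. Divided by \<open>l\<close>,
  the mixed terms of the binomial expansion have integral \<open>q\<close>-th powers.\<close>

lemma intdvd_power_add:
  assumes l: "l > 0" and q: "q > 0" and w: "algebraic_int w" "l intdvd w ^ q" and v: "algebraic_int v" "l intdvd v ^ q"
  shows "l intdvd (w + v) ^ q"
proof -
  have "l intdvd (w ^ k * v ^ (q - k))" if k: "k \<le> q" for k
  proof -
    have "(w ^ k * v ^ (q - k) / of_nat l) ^ q = (w ^ q / of_nat l) ^ k * (v ^ q / of_nat l) ^ (q - k)"
    proof -
      have "(of_nat l :: complex) ^ q = of_nat l ^ k * of_nat l ^ (q - k)" using k by (simp flip: power_add)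
      thus ?thesis by (simp add: power_divide power_mult_distrib mult.commute flip: power_mult)
    qed
    moreover have "algebraic_int ((w ^ q / of_nat l) ^ k * (v ^ q / of_nat l) ^ (q - k))"
      using w(2) v(2) unfolding divides_int_def by (intro algebraic_int_mult algebraic_int_power)
    ultimately show ?thesis unfolding divides_int_def using algebraic_int_powerD q by metis
  qed
  hence "l intdvd (\<Sum>k\<le>q. of_nat (q choose k) * (w ^ k * v ^ (q - k)))"
    by (intro intdvd_sum intdvd_mult[OF algebraic_int_of_nat]) auto
  thus ?thesis by (simp add: binomial_ring mult.assoc)
qed

lemma intdvd_power_sum:
  assumes l: "l > 0" and q: "q > 0" and f: "\<And>i. i \<in> I \<Longrightarrow> algebraic_int (f i) \<and> l intdvd (f i) ^ q"
  shows "algebraic_int (sum f I) \<and> l intdvd (sum f I) ^ q"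
  using f
proof (induction I rule: infinite_finite_induct)
  case (insert i I)
  thus ?case using intdvd_power_add[OF l q] by (auto intro: algebraic_int_add)
qed (use q in \<open>auto simp: intdvd_0 zero_power\<close>)

context
  fixes l q :: nat and P E :: "complex set"
  assumes l: "Factorial_Ring.prime l" and P: "alg_prime P" and lP: "of_nat l \<in> P"
    and q: "q > 0" and cop: "Rings.coprime l q"
    and E: "abelian_field E" and muE: "mu q \<subseteq> E"
    and ex: "\<And>\<phi> x. \<phi> \<in> AbsGal \<Longrightarrow> (\<And>z. z \<in> mu q \<Longrightarrow> \<phi> z = z) \<Longrightarrow> x \<in> E \<Longrightarrow> (\<phi> ^^ q) x = x"
begin

text \<open>For a nontrivial root of unity \<open>w\<close>, the number \<open>q\<close> is a sum of
  terms \<open>1 - w ^ k\<close>, all multiples of \<open>w - 1\<close>; but \<open>q\<close> is not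
  in \<open>P\<close>, being prime to \<open>l\<close>.\<close>

lemma mu_minus_1_notin_P:
  assumes "w \<in> mu q" "w - 1 \<in> P"
  shows "w = 1"
proof (rule ccontr)
  assume ne: "w \<noteq> 1"
  have wi: "algebraic_int w" using mu_algebraic_int[OF q assms(1)] .
  have "of_nat q = (\<Sum>k<q. 1 - w ^ k)" using mu_geometric[OF q assms(1) ne] by (simp add: sum_subtractf)
  also have "\<dots> = (\<Sum>k<q. (- (\<Sum>i<k. w ^ i)) * (w - 1))"
    by (intro sum.cong refl) (simp add: one_diff_power_eq algebra_simps)
  also have "\<dots> \<in> P"
    by (intro P_sum[OF l P lP] P_mult[OF l P lP] assms(2) algebraic_int_minus algebraic_int_sum algebraic_int_power wi)
  finally have "of_int (int q) \<in> P" by simp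
  hence "int l dvd int q" using P_of_int[OF l P lP] by blast
  hence "l dvd q" by simp
  hence "l dvd 1" using cop by (metis coprime_common_divisor dvd_refl)
  thus False using l by simp
qed

text \<open>Distinct \<open>q\<close>-th roots of unity remain distinct modulo \<open>P\<close>,
  while inertia acts trivially modulo \<open>P\<close>.\<close>

lemma inertia_fixes_mu:
  assumes \<iota>: "\<iota> \<in> inertia P E" and z: "z \<in> mu q"
  shows "\<iota> z = z"
proof -
  have g: "\<iota> \<in> AbsGal" using \<iota> by (simp add: inertia_def[OF l P lP])
  have zi: "algebraic_int z" using mu_algebraic_int[OF q z] .
  have "\<iota> z - z \<in> P" using \<iota> z muE zi by (auto simp: inertia_def[OF l P lP])
  hence "z ^ (q - 1) * (\<iota> z - z) \<in> P" by (intro P_mult[OF l P lP] algebraic_int_power zi)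
  also have zz: "z ^ (q - 1) * z = 1" using z q by (simp add: mu_def power_eq_if mult.commute)
  hence "z ^ (q - 1) * (\<iota> z - z) = z ^ (q - 1) * \<iota> z - 1" by (simp add: algebra_simps)
  finally have "z ^ (q - 1) * \<iota> z - 1 \<in> P" .
  moreover have "z ^ (q - 1) * \<iota> z \<in> mu q"
    using AbsGal_mu[OF q g z] z by (simp add: mu_def power_mult_distrib) (metis mult.commute power_mult power_one)
  ultimately have "z ^ (q - 1) * \<iota> z = 1" using mu_minus_1_notin_P by blast
  hence "z ^ (q - 1) * \<iota> z = z ^ (q - 1) * z" using zz by simp
  moreover have "z ^ (q - 1) \<noteq> 0" using zz by auto
  ultimately show ?thesis using mult_left_cancel by blast
qed

text \<open>Lagrange resolvents, one automorphism of \<open>A\<close> at a time: \<open>x\<close> is a \<open>1 / q\<close> multiple of a sum of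
  elements on which a further automorphism acts by a \<open>q\<close>-th root of unity. For an \<open>x\<close> on which all of
  inertia acts in this way, \<open>x ^ q\<close> is fixed by inertia and its conjugates lie in \<open>P\<close>, unless
  inertia fixes \<open>x\<close>.\<close>

lemma tame_aux:
  assumes A: "finite A" "A \<subseteq> RI P E" and \<phi>: "\<phi> \<in> inertia P E"
    and x: "x \<in> E" "algebraic_int x" and hom: "\<And>\<sigma>. \<sigma> \<in> RI P E - A \<Longrightarrow> \<exists>w\<in>mu q. \<sigma> x = w * x"
  shows "l intdvd (of_nat q ^ card A * (\<phi> x - x)) ^ q"
  using A x hom
proof (induction A arbitrary: x rule: finite_induct)
  case empty
  have in_gal: "\<iota> \<in> AbsGal" if "\<iota> \<in> inertia P E" for \<iota> using that by (simp add: inertia_def[OF l P lP])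
  have hom: "\<exists>w\<in>mu q. \<iota> x = w * x" if "\<iota> \<in> inertia P E" for \<iota>
  proof -
    have "restrict \<iota> E \<in> RI P E - {}" using that by (auto simp: RI_def[OF l P lP E])
    from empty.prems(4)[OF this] show ?thesis using empty.prems(2) by simp
  qed
  obtain w where w: "w \<in> mu q" "\<phi> x = w * x" using hom[OF \<phi>] by blast
  show ?case
  proof (cases "\<phi> x = x")
    case True
    thus ?thesis using q by (simp add: intdvd_0 zero_power)
  next
    case False
    have w1: "w \<noteq> 1" using False w by auto
    have wi: "algebraic_int w" using mu_algebraic_int[OF q w(1)] .
    have xq: "x ^ q \<in> fixI P E"
      unfolding fixI_def[OF l P lP E]
    proof (intro CollectI conjI ballI)
      show "x ^ q \<in> E" using af_power[OF E empty.prems(2)] .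
      fix \<iota> assume i: "\<iota> \<in> inertia P E"
      obtain v where v: "v \<in> mu q" "\<iota> x = v * x" using hom[OF i] by blast
      have "\<iota> (x ^ q) = (v * x) ^ q" using AbsGal_power[OF in_gal[OF i]] v(2) empty.prems(3) by auto
      thus "\<iota> (x ^ q) = x ^ q" using v(1) by (simp add: mu_def power_mult_distrib)
    qed
    have "l intdvd x ^ q"
    proof (rule unramified_radical[OF l P lP E xq algebraic_int_power[OF empty.prems(3)]])
      fix \<tau> assume t: "\<tau> \<in> AbsGal"
      have tx: "\<tau> x \<in> E" "algebraic_int (\<tau> x)"
        using af_stable[OF E t empty.prems(2)] AbsGal_algebraic_int[OF t empty.prems(3)] by auto
      \<comment> \<open>Commutativity carries the eigenvector relation over to the conjugate
        \<open>\<tau> x\<close>, so that a congruence at the one prime \<open>P\<close> decides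
        about every conjugate.\<close>
      have "\<phi> (\<tau> x) = \<tau> (\<phi> x)" by (rule af_comm[OF E in_gal[OF \<phi>] t empty.prems(2)])
      also have "\<dots> = \<tau> w * \<tau> x" using AbsGal_mult[OF t] wi empty.prems(3) w(2) by auto
      finally have "\<phi> (\<tau> x) - \<tau> x = (\<tau> w - 1) * \<tau> x" by (simp add: algebra_simps)
      moreover have "\<phi> (\<tau> x) - \<tau> x \<in> P" using \<phi> tx by (simp add: inertia_def[OF l P lP])
      moreover have twi: "algebraic_int (\<tau> w - 1)" using AbsGal_algebraic_int[OF t wi] by (intro algebraic_int_diff) auto
      ultimately have "\<tau> w - 1 \<in> P \<or> \<tau> x \<in> P" using P_prime[OF l P lP twi tx(2)] by simp
      moreover have "\<tau> w - 1 \<notin> P"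
      proof
        assume "\<tau> w - 1 \<in> P"
        hence "\<tau> w = 1" using mu_minus_1_notin_P[OF AbsGal_mu[OF q t w(1)]] by blast
        hence "\<tau> w = \<tau> 1" using AbsGal_1[OF t] by simp
        hence "w = 1" using AbsGal_eq_iff[OF t, of w 1] wi by auto
        thus False using w1 by simp
      qed
      ultimately have "\<tau> x \<in> P" by blast
      hence "\<tau> x ^ (q - 1) * \<tau> x \<in> P" using tx(2) by (intro P_mult[OF l P lP] algebraic_int_power)
      moreover have "\<tau> x ^ (q - 1) * \<tau> x = \<tau> (x ^ q)"
        using power_minus_mult[OF q, of "\<tau> x"] AbsGal_power[OF t algebraic_int_imp_algebraic[OF empty.prems(3)], of q] by simp
      ultimately show "\<tau> (x ^ q) \<in> P" by simp
    qed
    hence "l intdvd ((w - 1) ^ q * x ^ q)"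
      using wi by (intro intdvd_mult algebraic_int_power algebraic_int_diff) auto
    also have "(w - 1) ^ q * x ^ q = (of_nat q ^ card {} * (\<phi> x - x)) ^ q"
      using w(2) by (simp add: algebra_simps flip: power_mult_distrib)
    finally show ?thesis .
  qed
next
  case (insert \<sigma>0 A)
  have in_gal: "\<iota> \<in> AbsGal" if "\<iota> \<in> inertia P E" for \<iota> using that by (simp add: inertia_def[OF l P lP])
  obtain \<iota> where i: "\<iota> \<in> inertia P E" "\<sigma>0 = restrict \<iota> E"
    using insert.prems(1) by (auto simp: RI_def[OF l P lP E])
  note g = in_gal[OF i(1)]
  note gn = AbsGal_funpow[OF g]
  have xa: "algebraic x" using insert.prems(3) by blast
  define d where "d = (\<lambda>k. (\<iota> ^^ k) x)"
  have d_E: "d k \<in> E" and d_int: "algebraic_int (d k)" for k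
    using af_stable[OF E gn insert.prems(2)] AbsGal_algebraic_int[OF gn insert.prems(3)] by (auto simp: d_def)
  have dS: "\<iota> (d k) = d (Suc k)" for k by (simp add: d_def)
  have d0: "d 0 = x" and dq: "d q = x"
    using ex[OF g inertia_fixes_mu[OF i(1)] insert.prems(2)] by (auto simp: d_def)
  define y where "y = (\<lambda>w. \<Sum>k<q. w ^ k * d k)"
  have wE: "w ^ k \<in> E" "algebraic_int (w ^ k)" if "w \<in> mu q" for w k
    using muE that af_power[OF E] mu_algebraic_int[OF q that] by (auto intro: algebraic_int_power)
  have y_E: "y w \<in> E" if "w \<in> mu q" for w
    unfolding y_def by (rule af_sum[OF E], rule af_mult[OF E wE(1)[OF that] d_E])
  have y_int: "algebraic_int (y w)" if "w \<in> mu q" for w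
    unfolding y_def by (rule algebraic_int_sum, rule algebraic_int_mult[OF wE(2)[OF that] d_int])
  have \<rho>y: "\<rho> (y w) = (\<Sum>k<q. w ^ k * \<rho> (d k))" if r: "\<rho> \<in> inertia P E" and w: "w \<in> mu q" for \<rho> w
  proof -
    note rg = in_gal[OF r]
    have wa: "algebraic (w ^ k)" "algebraic (d k)" for k using wE(2)[OF w] d_int by auto
    have "\<rho> (y w) = (\<Sum>k<q. \<rho> (w ^ k * d k))" unfolding y_def using wa by (intro AbsGal_sum[OF rg] algebraic_mult)
    also have "\<dots> = (\<Sum>k<q. w ^ k * \<rho> (d k))"
      using wa(1)[of 1] by (intro sum.cong refl) (simp add: AbsGal_mult[OF rg wa] AbsGal_power[OF rg] inertia_fixes_mu[OF r w])
    finally show ?thesis .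
  qed
  have hom_y: "\<exists>v\<in>mu q. \<sigma> (y w) = v * y w" if s: "\<sigma> \<in> RI P E - A" and w: "w \<in> mu q" for \<sigma> w
  proof -
    obtain \<rho> where r: "\<rho> \<in> inertia P E" "\<sigma> = restrict \<rho> E" using s by (auto simp: RI_def[OF l P lP E])
    have sy: "\<sigma> (y w) = \<rho> (y w)" using r(2) y_E[OF w] by simp
    show ?thesis
    proof (cases "\<sigma> = \<sigma>0")
      case True
      have eq: "restrict \<rho> E = restrict \<iota> E" using True r(2) i(2) by simp
      have "\<rho> (d k) = d (Suc k)" for k
        using fun_cong[OF eq, of "d k"] d_E dS by simp
      \<comment> \<open>A cyclic shift of the sum, since \<open>d q = d 0\<close> and
        \<open>w ^ q = 1\<close>. The resolvent is therefore an eigenvector, with the inverse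
        \<open>w ^ (q - 1)\<close> of \<open>w\<close> as eigenvalue.\<close>
      hence "w * \<rho> (y w) = (\<Sum>k<q. w ^ Suc k * d (Suc k))"
        unfolding \<rho>y[OF r(1) w] by (simp add: sum_distrib_left mult.assoc)
      also have "\<dots> = (\<Sum>k<q. w ^ k * d k)"
      proof -
        have "(\<Sum>k<Suc q. w ^ k * d k) = w ^ 0 * d 0 + (\<Sum>k<q. w ^ Suc k * d (Suc k))" by (rule sum.lessThan_Suc_shift)
        moreover have "(\<Sum>k<Suc q. w ^ k * d k) = (\<Sum>k<q. w ^ k * d k) + w ^ q * d q" by simp
        ultimately show ?thesis using w d0 dq by (simp add: mu_def)
      qed
      finally have "w ^ (q - 1) * (w * \<rho> (y w)) = w ^ (q - 1) * y w" by (simp add: y_def)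
      moreover have "w ^ (q - 1) * w = 1" using w q by (simp add: mu_def power_eq_if mult.commute)
      ultimately have "\<rho> (y w) = w ^ (q - 1) * y w" by (metis mult.assoc mult_1)
      moreover have "w ^ (q - 1) \<in> mu q" using w by (simp add: mu_def) (metis mult.commute power_mult power_one)
      ultimately show ?thesis using sy by auto
    next
      case False
      \<comment> \<open>Elements that act on \<open>x\<close> by a root of unity act on its
        resolvents in the same way, because \<open>\<iota>\<close> commutes with them and fixes that
        root of unity. So treating a further element spoils nothing.\<close>
      hence "\<sigma> \<in> RI P E - insert \<sigma>0 A" using s by auto
      then obtain v where v: "v \<in> mu q" "\<sigma> x = v * x" using insert.prems(4) by blast
      have vi: "algebraic v" using mu_algebraic_int[OF q v(1)] by blast
      have rx: "\<rho> x = v * x" using v(2) r(2) insert.prems(2) by simp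
      have "\<rho> (d k) = v * d k" for k
      proof -
        have fv: "(\<iota> ^^ n) v = v" for n using inertia_fixes_mu[OF i(1) v(1)] by (induction n) auto
        have "\<rho> (d k) = (\<iota> ^^ k) (\<rho> x)" unfolding d_def by (rule af_comm[OF E in_gal[OF r(1)] gn insert.prems(2)])
        also have "\<dots> = v * d k" unfolding rx using AbsGal_mult[OF gn vi xa] fv by (simp add: d_def)
        finally show ?thesis .
      qed
      hence "\<rho> (y w) = v * y w" unfolding \<rho>y[OF r(1) w] by (simp add: y_def sum_distrib_left mult_ac)
      thus ?thesis using v(1) sy by auto
    qed
  qed
  have each: "algebraic_int (of_nat q ^ card A * (\<phi> (y w) - y w)) \<and> l intdvd (of_nat q ^ card A * (\<phi> (y w) - y w)) ^ q"
    if w: "w \<in> mu q" for w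
  proof
    show "algebraic_int (of_nat q ^ card A * (\<phi> (y w) - y w))"
      using AbsGal_algebraic_int[OF in_gal[OF \<phi>] y_int[OF w]] y_int[OF w]
      by (intro algebraic_int_mult algebraic_int_power algebraic_int_diff) auto
    show "l intdvd (of_nat q ^ card A * (\<phi> (y w) - y w)) ^ q"
    proof (rule insert.IH[OF _ y_E[OF w] y_int[OF w]])
      show "A \<subseteq> RI P E" using insert.prems(1) by simp
      show "\<exists>v\<in>mu q. \<sigma> (y w) = v * y w" if "\<sigma> \<in> RI P E - A" for \<sigma> by (rule hom_y[OF that w])
    qed
  qed
  have l0: "l > 0" using l prime_gt_0_nat by blast
  have "l intdvd (\<Sum>w\<in>mu q. of_nat q ^ card A * (\<phi> (y w) - y w)) ^ q"
    by (rule conjunct2[OF intdvd_power_sum[OF l0 q]]) (rule each)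
  also have "(\<Sum>w\<in>mu q. of_nat q ^ card A * (\<phi> (y w) - y w)) = of_nat q ^ card A * ((\<Sum>w\<in>mu q. \<phi> (y w)) - (\<Sum>w\<in>mu q. y w))"
    by (simp add: sum_distrib_left sum_subtractf right_diff_distrib)
  also have "(\<Sum>w\<in>mu q. \<phi> (y w)) = \<phi> (\<Sum>w\<in>mu q. y w)"
    using y_int by (intro AbsGal_sum[OF in_gal[OF \<phi>], symmetric]) auto
  also have sy: "(\<Sum>w\<in>mu q. y w) = of_nat q * x"
  proof -
    have "(\<Sum>w\<in>mu q. y w) = (\<Sum>k<q. d k * (\<Sum>w\<in>mu q. w ^ k))"
      unfolding y_def by (subst sum.swap) (simp add: sum_distrib_left mult.commute)
    also have "\<dots> = (\<Sum>k<q. if k = 0 then d 0 * of_nat q else 0)"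
      using mu_sum_power[OF q] mu_card[OF q] by (intro sum.cong) auto
    also have "\<dots> = of_nat q * x" using q d0 by simp
    finally show ?thesis .
  qed
  also have "\<phi> (of_nat q * x) = of_nat q * \<phi> x"
    using AbsGal_mult[OF in_gal[OF \<phi>] _ xa, of "of_nat q"] AbsGal_of_nat[OF in_gal[OF \<phi>]] by simp
  also have "of_nat q ^ card A * (of_nat q * \<phi> x - of_nat q * x) = of_nat q ^ card (insert \<sigma>0 A) * (\<phi> x - x)"
    using insert.hyps by (simp add: algebra_simps)
  finally show ?case .
qed

lemma tame:
  assumes \<phi>: "\<phi> \<in> inertia P E" and x: "x \<in> E" "algebraic_int x"
  shows "l intdvd (\<phi> x - x) ^ q"
proof -
  have g: "\<phi> \<in> AbsGal" using \<phi> by (simp add: inertia_def[OF l P lP])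
  define r where "r = card (RI P E)"
  have "l intdvd (of_nat q ^ r * (\<phi> x - x)) ^ q"
    unfolding r_def by (rule tame_aux[OF RI_finite[OF l P lP E] subset_refl \<phi> x]) auto
  also have "(of_nat q ^ r * (\<phi> x - x)) ^ q = of_int (int (q ^ (r * q))) * (\<phi> x - x) ^ q"
    by (simp add: power_mult_distrib power_mult)
  finally have "l intdvd of_int (int (q ^ (r * q))) * (\<phi> x - x) ^ q" .
  moreover have "algebraic_int ((\<phi> x - x) ^ q)"
    using AbsGal_algebraic_int[OF g x(2)] x(2) by (intro algebraic_int_power algebraic_int_diff)
  moreover have "Rings.coprime (int (q ^ (r * q))) (int l)"
    using cop by (simp add: coprime_commute)
  moreover have "l > 0" using l prime_gt_0_nat by blast
  ultimately show ?thesis using intdvd_coprime by blast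
qed

text \<open>The nonzero algebraic integer \<open>(\<phi> x - x) ^ q / l\<close> has a conjugate of
  absolute value at least 1, and every conjugate of \<open>\<phi> x - x\<close> is at most
  \<open>2 * N\<close>.\<close>

lemma inertia_house:
  assumes \<phi>: "\<phi> \<in> inertia P E" and x: "x \<in> E" "algebraic_int x" and ne: "\<phi> x \<noteq> x"
    and N: "\<And>\<psi>. \<psi> \<in> AbsGal \<Longrightarrow> norm (\<psi> x) \<le> N"
  shows "real l \<le> (2 * N) ^ q"
proof -
  have g: "\<phi> \<in> AbsGal" using \<phi> by (simp add: inertia_def[OF l P lP])
  have l0: "l > 0" using l prime_gt_0_nat by blast
  define t where "t = (\<phi> x - x) ^ q / of_nat l"
  have dE: "\<phi> x - x \<in> E" using af_diff[OF E af_stable[OF E g x(1)] x(1)] .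
  have da: "algebraic (\<phi> x - x)" using af_algebraic[OF E dE] .
  have "t \<in> E" unfolding t_def by (rule af_divide[OF E af_power[OF E dE] af_of_nat[OF E]])
  moreover have "algebraic_int t" using tame[OF \<phi> x] by (simp add: t_def divides_int_def)
  moreover have "t \<noteq> 0" using ne l0 by (simp add: t_def)
  ultimately obtain \<tau> where \<tau>: "\<tau> \<in> AbsGal" "norm (\<tau> t) \<ge> 1" using exists_conjugate_ge_1[OF E] by blast
  have xa: "algebraic x" using x(2) by blast
  have "\<tau> t = (\<tau> (\<phi> x) - \<tau> x) ^ q / of_nat l"
    unfolding t_def using da xa AbsGal_algebraic[OF g xa]
    by (simp add: AbsGal_divide[OF \<tau>(1)] AbsGal_power[OF \<tau>(1)] AbsGal_of_nat[OF \<tau>(1)] AbsGal_diff[OF \<tau>(1)] algebraic_power)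
  hence nt: "norm (\<tau> t) = norm (\<tau> (\<phi> x) - \<tau> x) ^ q / real l" by (simp add: norm_divide norm_power)
  have "real l \<le> real l * norm (\<tau> t)" using \<tau>(2) by (simp add: mult_le_cancel_left1)
  also have "\<dots> = norm (\<tau> (\<phi> x) - \<tau> x) ^ q" using nt l0 by simp
  also have "\<dots> \<le> (2 * N) ^ q"
  proof (rule power_mono)
    have "norm (\<tau> (\<phi> x) - \<tau> x) \<le> norm (\<tau> (\<phi> x)) + norm (\<tau> x)" by (rule norm_triangle_ineq4)
    also have "\<dots> \<le> N + N" using N[OF AbsGal_comp[OF \<tau>(1) g]] N[OF \<tau>(1)] by simp
    finally show "norm (\<tau> (\<phi> x) - \<tau> x) \<le> 2 * N" by simp
  qed simp
  finally show ?thesis .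
qed

end

section \<open>Finiteness for boundedly many ramified primes\<close>

text \<open>Transitivity of the trace. \<open>w\<close> is the relative trace of \<open>b\<close>,
  the sum over the automorphisms of \<open>F\<close> that are trivial on \<open>E\<close>. This
  transports conditions on trace duals from a field to a larger one.\<close>

lemma trace_tower:
  assumes E: "abelian_field E" and F: "abelian_field F" and sub: "E \<subseteq> F"
    and u: "u \<in> E" and b: "b \<in> F" "algebraic_int b"
  shows "\<exists>w. w \<in> E \<and> algebraic_int w \<and> tr F (u * b) = tr E (u * w)"
proof -
  define K where "K = {\<sigma>\<in>GalG F. \<forall>x\<in>E. \<sigma> x = x}"
  define w where "w = (\<Sum>\<sigma>\<in>K. \<sigma> b)"
  have fK: "finite K" using af_finite[OF F] by (simp add: K_def)
  have w_int: "algebraic_int w"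
    unfolding w_def by (rule algebraic_int_sum, rule GalG_algebraic_int[OF _ b]) (simp add: K_def)
  have w_F: "w \<in> F" unfolding w_def by (rule af_sum[OF F], rule af_GalG_mem[OF F _ b(1)]) (simp add: K_def)
  have sb: "algebraic (\<sigma> b)" if "\<sigma> \<in> GalG F" for \<sigma>
    using GalG_algebraic_int[OF that b] by blast
  \<comment> \<open>The extensions to \<open>F\<close> of the restriction of \<open>\<phi>\<close>
    to \<open>E\<close> form a coset of \<open>K\<close>. The left-hand side depends only on that
    restriction, and this also places \<open>w\<close> in \<open>E\<close>.\<close>
  have fiber: "(\<Sum>\<sigma>\<in>{\<sigma>\<in>GalG F. restrict \<sigma> E = restrict \<phi> E}. \<sigma> b) = \<phi> w" if \<phi>: "\<phi> \<in> AbsGal" for \<phi>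
  proof -
    define L where "L = (\<lambda>\<sigma>. restrict (\<lambda>x. \<phi> (\<sigma> x)) F)"
    have bij: "bij_betw L (GalG F) (GalG F)" unfolding L_def by (rule af_bij[OF F \<phi>])
    have iff: "L \<sigma> \<in> {\<sigma>\<in>GalG F. restrict \<sigma> E = restrict \<phi> E} \<longleftrightarrow> \<sigma> \<in> K" if s: "\<sigma> \<in> GalG F" for \<sigma>
    proof -
      have "L \<sigma> \<in> GalG F" using bij s by (auto simp: bij_betw_def)
      moreover have "restrict (L \<sigma>) E = restrict \<phi> E \<longleftrightarrow> (\<forall>x\<in>E. \<phi> (\<sigma> x) = \<phi> x)"
        using sub by (auto simp: L_def restrict_def fun_eq_iff)
      moreover have "\<phi> (\<sigma> x) = \<phi> x \<longleftrightarrow> \<sigma> x = x" if x: "x \<in> E" for x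
        using AbsGal_eq_iff[OF \<phi> GalG_algebraic[OF s subsetD[OF sub x] af_algebraic[OF E x]] af_algebraic[OF E x]] .
      ultimately show ?thesis using s by (simp add: K_def)
    qed
    have "bij_betw L K {\<sigma>\<in>GalG F. restrict \<sigma> E = restrict \<phi> E}"
    proof (rule bij_betw_subset[OF bij])
      show "K \<subseteq> GalG F" by (auto simp: K_def)
      show "L ` K = {\<sigma>\<in>GalG F. restrict \<sigma> E = restrict \<phi> E}"
      proof
        show "L ` K \<subseteq> {\<sigma>\<in>GalG F. restrict \<sigma> E = restrict \<phi> E}" using iff by (auto simp: K_def)
        show "{\<sigma>\<in>GalG F. restrict \<sigma> E = restrict \<phi> E} \<subseteq> L ` K"
        proof
          fix \<tau> assume t: "\<tau> \<in> {\<sigma>\<in>GalG F. restrict \<sigma> E = restrict \<phi> E}"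
          then obtain \<sigma> where s: "\<sigma> \<in> GalG F" "\<tau> = L \<sigma>" using bij by (auto simp: bij_betw_def)
          thus "\<tau> \<in> L ` K" using iff[OF s(1)] t by blast
        qed
      qed
    qed
    from sum.reindex_bij_betw[OF this, of "\<lambda>\<sigma>. \<sigma> b"]
    have "(\<Sum>\<sigma>\<in>{\<sigma>\<in>GalG F. restrict \<sigma> E = restrict \<phi> E}. \<sigma> b) = (\<Sum>\<sigma>\<in>K. \<phi> (\<sigma> b))"
      using b(1) by (simp add: L_def)
    also have "\<dots> = \<phi> w" unfolding w_def using sb by (intro AbsGal_sum[OF \<phi>, symmetric]) (simp add: K_def)
    finally show ?thesis .
  qed
  have w_E: "w \<in> E"
  proof -
    have "w \<in> qfield E"
    proof (rule qfieldI)
      show "algebraic w" using w_int by blast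
      fix \<phi> \<psi> assume h: "\<phi> \<in> AbsGal" "\<psi> \<in> AbsGal" "\<And>y. y \<in> E \<Longrightarrow> \<phi> y = \<psi> y"
      hence "restrict \<phi> E = restrict \<psi> E" by (intro restrict_ext)
      thus "\<phi> w = \<psi> w" using fiber[OF h(1)] fiber[OF h(2)] by simp
    qed
    thus ?thesis using af_qfield[OF E] by simp
  qed
  have "tr F (u * b) = (\<Sum>\<sigma>\<in>GalG F. \<sigma> u * \<sigma> b)"
    unfolding tr_def[OF F] using GalG_hom(2)[OF F _ subsetD[OF sub u] b(1)] by (intro sum.cong) auto
  also have "\<dots> = (\<Sum>\<rho>\<in>GalG E. \<Sum>\<sigma>\<in>{\<sigma>\<in>GalG F. restrict \<sigma> E = \<rho>}. \<sigma> u * \<sigma> b)"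
  proof (rule sum.group[symmetric])
    show "finite (GalG F)" "finite (GalG E)" using af_finite E F by auto
    show "(\<lambda>\<sigma>. restrict \<sigma> E) ` GalG F \<subseteq> GalG E"
    proof
      fix \<rho> assume "\<rho> \<in> (\<lambda>\<sigma>. restrict \<sigma> E) ` GalG F"
      then obtain \<phi> where "\<phi> \<in> AbsGal" "\<rho> = restrict (restrict \<phi> F) E" by (auto simp: GalG_def)
      moreover have "restrict (restrict \<phi> F) E = restrict \<phi> E" using sub by (auto simp: restrict_def fun_eq_iff)
      ultimately show "\<rho> \<in> GalG E" using GalGI by simp
    qed
  qed
  also have "\<dots> = (\<Sum>\<rho>\<in>GalG E. \<rho> (u * w))"
  proof (rule sum.cong[OF refl])
    fix \<rho> assume r: "\<rho> \<in> GalG E"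
    obtain \<phi> where \<phi>: "\<phi> \<in> AbsGal" "\<rho> = restrict \<phi> E" using GalGE[OF r] by blast
    have "(\<Sum>\<sigma>\<in>{\<sigma>\<in>GalG F. restrict \<sigma> E = \<rho>}. \<sigma> u * \<sigma> b) = (\<Sum>\<sigma>\<in>{\<sigma>\<in>GalG F. restrict \<sigma> E = \<rho>}. \<phi> u * \<sigma> b)"
    proof (rule sum.cong[OF refl])
      fix \<sigma> assume "\<sigma> \<in> {\<sigma>\<in>GalG F. restrict \<sigma> E = \<rho>}"
      hence e: "restrict \<sigma> E = restrict \<phi> E" using \<phi>(2) by simp
      show "\<sigma> u * \<sigma> b = \<phi> u * \<sigma> b" using fun_cong[OF e, of u] u by simp
    qed
    also have "\<dots> = \<phi> u * \<phi> w" unfolding \<phi>(2) using fiber[OF \<phi>(1)] by (simp add: sum_distrib_left[symmetric])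
    also have "\<dots> = \<rho> (u * w)"
      using \<phi> u w_E AbsGal_mult[OF \<phi>(1) af_algebraic[OF E u] af_algebraic[OF E w_E]] af_mult[OF E u w_E] by simp
    finally show "(\<Sum>\<sigma>\<in>{\<sigma>\<in>GalG F. restrict \<sigma> E = \<rho>}. \<sigma> u * \<sigma> b) = \<rho> (u * w)" .
  qed
  finally have "tr F (u * b) = tr E (u * w)" by (simp add: tr_def[OF E])
  thus ?thesis using w_E w_int by blast
qed

text \<open>The different is bounded in terms of the degree alone, even at wildly ramified primes: every
  elementary symmetric function of the conjugates of \<open>u\<close>, multiplied by the degree, is a sum of
  traces of multiples of \<open>u\<close>.\<close>

lemma codifferent_bound:
  assumes E: "abelian_field E" and u: "u \<in> E" "algebraic_int u" and l: "Factorial_Ring.prime l"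
    and tr: "\<And>w. w \<in> E \<Longrightarrow> algebraic_int w \<Longrightarrow> l ^ (2 * card (GalG E)) intdvd tr E (u * w)"
  shows "l intdvd u"
proof -
  define G where "G = GalG E"
  define n where "n = card G"
  have fG: "finite G" unfolding G_def by (rule af_finite[OF E])
  have n0: "n > 0" using fG GalGI[OF AbsGal_id, of E] by (auto simp: n_def G_def card_gt_0_iff)
  \<comment> \<open>One factor \<open>l ^ n\<close> pays for the division by the degree
    \<open>n\<close>, whose multiplicity at \<open>l\<close> is at most \<open>n\<close>; the other
    provides the powers \<open>l ^ k\<close> with \<open>k \<le> n\<close> in the symmetric
    functions.\<close>
  define M where "M = l ^ (2 * n)"
  define f where "f = (\<lambda>A :: (complex \<Rightarrow> complex) set. \<Prod>\<sigma>\<in>A. \<sigma> u)"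
  have su: "\<sigma> u \<in> E" "algebraic_int (\<sigma> u)" if "\<sigma> \<in> G" for \<sigma>
    using af_GalG_mem[OF E _ u(1)] GalG_algebraic_int[OF _ u] that by (auto simp: G_def)
  have fE: "f A \<in> E" "algebraic_int (f A)" if "A \<subseteq> G" for A
    unfolding f_def by (rule af_prod[OF E], use su that in blast) (rule algebraic_int_prod, use su that in blast)
  \<comment> \<open>Up to conjugation, which the trace does not see, a nonempty product of
    conjugates of \<open>u\<close> is an integral multiple of \<open>u\<close>.\<close>
  have divA: "M intdvd tr E (f A)" if A: "A \<subseteq> G" "A \<noteq> {}" for A
  proof -
    obtain \<sigma> where s: "\<sigma> \<in> A" using A by blast
    obtain \<phi> where \<phi>: "\<phi> \<in> AbsGal" "\<sigma> = restrict \<phi> E" using GalGE[of \<sigma> E] s A by (auto simp: G_def)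
    obtain \<psi> where \<psi>: "\<psi> \<in> AbsGal" "\<And>x. x \<in> E \<Longrightarrow> \<psi> (\<phi> x) = x" using af_inverse[OF E \<phi>(1)] by metis
    define r where "r = f (A - {\<sigma>})"
    have r: "r \<in> E" "algebraic_int r" using fE[of "A - {\<sigma>}"] A by (auto simp: r_def)
    have "f A = \<phi> u * r"
      using prod.remove[OF finite_subset[OF A(1) fG] s, of "\<lambda>\<sigma>. \<sigma> u"] \<phi>(2) u(1) by (simp add: f_def r_def)
    hence "\<psi> (f A) = \<psi> (\<phi> u) * \<psi> r"
      using AbsGal_mult[OF \<psi>(1) af_algebraic[OF E af_stable[OF E \<phi>(1) u(1)]] af_algebraic[OF E r(1)]] by simp
    hence "\<psi> (f A) = u * \<psi> r" using \<psi>(2)[OF u(1)] by simp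
    moreover have "tr E (\<psi> (f A)) = tr E (f A)" by (rule tr_AbsGal[OF E \<psi>(1) fE(1)[OF A(1)]])
    moreover have "M intdvd tr E (u * \<psi> r)"
      using tr[OF af_stable[OF E \<psi>(1) r(1)] AbsGal_algebraic_int[OF \<psi>(1) r(2)]] by (simp add: M_def n_def G_def)
    ultimately show ?thesis by simp
  qed
  have esum: "\<exists>m::int. esym G k u = of_int m \<and> (k \<noteq> 0 \<longrightarrow> int l ^ k dvd m)" if k: "k \<le> n" for k
  proof -
    define e where "e = esym G k u"
    have e_def': "e = (\<Sum>A | A \<subseteq> G \<and> card A = k. f A)" by (simp add: e_def esym_def[OF E] f_def)
    have eE: "e \<in> E" unfolding e_def G_def by (rule esym_mem[OF E subset_refl u(1)])
    have fixed: "\<phi> e = e" if "\<phi> \<in> AbsGal" for \<phi>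
      unfolding e_def G_def by (rule AbsGal_esym[OF E subset_refl that u(1) af_bij[OF E that]])
    have "e \<in> \<rat>" by (rule AbsGal_fixed_imp_Rats[OF af_algebraic[OF E eE]]) (rule fixed)
    moreover have "algebraic_int e" unfolding e_def G_def by (rule esym_algebraic_int[OF E subset_refl u])
    ultimately have "e \<in> \<int>" by (intro rational_algebraic_int_is_int)
    then obtain m where m: "e = of_int m" by (auto elim: Ints_cases)
    have "int l ^ k dvd m" if k0: "k \<noteq> 0"
    proof -
      have "tr E e = (\<Sum>A | A \<subseteq> G \<and> card A = k. tr E (f A))"
        unfolding e_def' using fE by (intro tr_sum[OF E]) auto
      also have "M intdvd \<dots>" using k0 by (intro intdvd_sum divA) auto
      also have "tr E e = (\<Sum>\<sigma>\<in>G. e)"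
        unfolding tr_def[OF E] G_def by (rule sum.cong[OF refl], rule GalG_Rats[OF E _ \<open>e \<in> \<rat>\<close>])
      also have "\<dots> = of_nat n * e" by (simp add: n_def)
      finally have "M intdvd of_int (int n * m)" by (simp add: m)
      hence "of_int (int n * m) / of_nat M \<in> (\<int> :: complex set)"
        unfolding divides_int_def by (intro rational_algebraic_int_is_int) auto
      then obtain j where j: "of_int (int n * m) / of_nat M = (of_int j :: complex)" by (auto elim: Ints_cases)
      have "M > 0" using l by (simp add: M_def prime_gt_0_nat)
      hence "(of_int (int n * m) :: complex) = of_int (int M * j)" using j by (simp add: field_simps)
      hence nm: "int n * m = int M * j" by (simp only: of_int_eq_iff)
      have "\<not> is_unit l" using l by (metis not_prime_unit)
      then obtain b where b: "n = l ^ multiplicity l n * b" "\<not> l dvd b"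
        using multiplicity_decompose'[of n l] n0 by auto
      define a where "a = multiplicity l n"
      have "a < l ^ a" using power_gt_expt[of l a] prime_gt_1_nat[OF l] by simp
      also have "l ^ a \<le> n" unfolding a_def using n0 by (intro dvd_imp_le multiplicity_dvd)
      finally have an: "a \<le> n" by simp
      have "int l ^ (2 * n) = int l ^ a * int l ^ (2 * n - a)" using an by (simp flip: power_add)
      moreover have "int n = int l ^ a * int b" using b(1) by (simp add: a_def flip: of_nat_power of_nat_mult)
      ultimately have "int l ^ a * (int b * m) = int l ^ a * (int l ^ (2 * n - a) * j)"
        using nm by (simp add: M_def mult.assoc)
      hence "int b * m = int l ^ (2 * n - a) * j" using prime_gt_0_nat[OF l] by simp
      hence d: "int l ^ (2 * n - a) dvd int b * m" by simp
      have "Rings.coprime l b" using l b(2) by (rule prime_imp_coprime)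
      hence "Rings.coprime (int l ^ (2 * n - a)) (int b)" by simp
      hence "int l ^ (2 * n - a) dvd m" using d by (simp add: coprime_dvd_mult_right_iff)
      moreover have "int l ^ k dvd int l ^ (2 * n - a)" using an k by (intro le_imp_power_dvd) simp
      ultimately show ?thesis by (rule dvd_trans[rotated])
    qed
    thus ?thesis using m e_def by (intro exI[of _ m]) auto
  qed
  have "\<forall>k. \<exists>y. k \<le> n \<longrightarrow> esym G k u = of_int (int l ^ k * y)"
  proof
    fix k
    show "\<exists>y. k \<le> n \<longrightarrow> esym G k u = of_int (int l ^ k * y)"
    proof (cases "k \<le> n")
      case True
      obtain m where m: "esym G k u = of_int m" "k \<noteq> 0 \<longrightarrow> int l ^ k dvd m" using esum[OF True] by blast
      hence "int l ^ k dvd m" by (cases "k = 0") auto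
      thus ?thesis using m(1) by (auto elim!: dvdE)
    qed simp
  qed
  from choice[OF this] obtain m where m: "\<And>k. k \<le> n \<Longrightarrow> esym G k u = of_int (int l ^ k * m k)" by blast
  define L where "L = (of_nat l :: complex)"
  have L: "L \<noteq> 0" using prime_gt_0_nat[OF l] by (simp add: L_def)
  have "{A. A \<subseteq> G \<and> card A = 0} = {{}}" using finite_subset[OF _ fG] by auto
  hence e0: "esym G 0 u = 1" by (simp add: esym_def[OF E])
  have "(\<Prod>\<sigma>\<in>G. u - \<sigma> u) = 0"
  proof (rule prod_zero[OF fG])
    show "\<exists>\<sigma>\<in>G. u - \<sigma> u = 0"
      using GalGI[OF AbsGal_id, of E] u(1) by (intro bexI[of _ "restrict (\<lambda>x. x) E"]) (auto simp: G_def)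
  qed
  \<comment> \<open>Division of the characteristic equation of \<open>u\<close> by
    \<open>l ^ n\<close> gives a monic equation for u / l, integral because \<open>l ^ k\<close>
    divides the \<open>k\<close>-th symmetric function.\<close>
  hence "0 = (\<Sum>k\<le>n. (-1) ^ k * esym G k u * u ^ (n - k)) / L ^ n"
    using prod_diff_esym[OF E fG, of u u] by (simp add: n_def)
  also have "\<dots> = (\<Sum>k\<le>n. (-1) ^ k * (esym G k u / L ^ k) * (u / L) ^ (n - k))"
    unfolding sum_divide_distrib
  proof (rule sum.cong[OF refl])
    fix k assume "k \<in> {..n}"
    hence "L ^ n = L ^ k * L ^ (n - k)" by (simp flip: power_add)
    thus "(-1) ^ k * esym G k u * u ^ (n - k) / L ^ n = (-1) ^ k * (esym G k u / L ^ k) * (u / L) ^ (n - k)"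
      by (simp add: power_divide)
  qed
  also have "\<dots> = (\<Sum>i\<le>n. (-1) ^ (n - i) * (esym G (n - i) u / L ^ (n - i)) * (u / L) ^ i)"
    by (rule sum.reindex_bij_witness[where i = "\<lambda>i. n - i" and j = "\<lambda>i. n - i"]) auto
  also have "\<dots> = (u / L) ^ n + (\<Sum>i<n. (-1) ^ (n - i) * (esym G (n - i) u / L ^ (n - i)) * (u / L) ^ i)"
    using e0 by (simp flip: lessThan_Suc_atMost)
  also have "(\<Sum>i<n. (-1) ^ (n - i) * (esym G (n - i) u / L ^ (n - i)) * (u / L) ^ i)
      = - (\<Sum>i<n. of_int (- ((-1) ^ (n - i) * m (n - i))) * (u / L) ^ i)"
    unfolding sum_negf[symmetric]
  proof (rule sum.cong[OF refl])
    fix i assume "i \<in> {..<n}"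
    have "esym G (n - i) u / L ^ (n - i) = of_int (m (n - i))"
      using m[of "n - i"] L by (simp add: L_def)
    thus "(-1) ^ (n - i) * (esym G (n - i) u / L ^ (n - i)) * (u / L) ^ i
      = - (of_int (- ((-1) ^ (n - i) * m (n - i))) * (u / L) ^ i)" by simp
  qed
  finally have "(u / L) ^ n = (\<Sum>i<n. of_int (- ((-1) ^ (n - i) * m (n - i))) * (u / L) ^ i)" by simp
  hence "algebraic_int (u / L)" by (rule algebraic_int_powI)
  thus ?thesis by (simp add: divides_int_def L_def)
qed

section \<open>Geometry of numbers for the trace form\<close>

context
  fixes E assumes E: "abelian_field E" and real: "E \<subseteq> \<real>"
begin

text \<open>The trace form, positive definite because all conjugates of elements of \<open>E\<close>
  are real.\<close>

definition ip :: "complex \<Rightarrow> complex \<Rightarrow> real" where "ip x y = Re (tr E (x * y))"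

lemma ip_tr: assumes "x \<in> E" "y \<in> E" shows "of_real (ip x y) = tr E (x * y)"
proof -
  have "tr E (x * y) \<in> \<real>"
    using tr_Rats[OF E af_mult[OF E assms]] by (auto elim!: Rats_cases')
  thus ?thesis by (simp add: ip_def)
qed

lemma ip_Rats: "x \<in> E \<Longrightarrow> y \<in> E \<Longrightarrow> ip x y \<in> \<rat>"
proof -
  assume "x \<in> E" "y \<in> E"
  then obtain a b :: int where "b \<noteq> 0" "tr E (x * y) = of_int a / of_int b"
    using tr_Rats[OF E af_mult[OF E]] by (metis Rats_cases' less_irrefl)
  hence "tr E (x * y) = of_real (of_int a / of_int b)" by simp
  hence "ip x y = of_int a / of_int b" unfolding ip_def by (simp only: Re_complex_of_real)
  thus ?thesis by simp
qed

lemma ip_commute: "ip x y = ip y x" by (simp add: ip_def mult.commute)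

lemma ip_diff: "x \<in> E \<Longrightarrow> y \<in> E \<Longrightarrow> z \<in> E \<Longrightarrow> ip (x - y) z = ip x z - ip y z"
  using tr_diff[OF E af_mult[OF E] af_mult[OF E], of x z y z] by (simp add: ip_def left_diff_distrib)

lemma of_real_Rats: "r \<in> \<rat> \<Longrightarrow> (of_real r :: complex) \<in> \<rat>"
  by (auto elim!: Rats_cases')

lemma of_real_mem: "r \<in> \<rat> \<Longrightarrow> of_real r \<in> E"
  using af_Rats[OF E of_real_Rats] .

lemma ip_scale: "r \<in> \<rat> \<Longrightarrow> x \<in> E \<Longrightarrow> y \<in> E \<Longrightarrow> ip (of_real r * x) y = r * ip x y"
  using tr_scale[OF E of_real_Rats af_mult[OF E], of r x y] by (simp add: ip_def mult.assoc)

lemma ip_square: "x \<in> E \<Longrightarrow> ip x x = (\<Sum>\<sigma>\<in>GalG E. (norm (\<sigma> x))\<^sup>2)"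
proof -
  assume x: "x \<in> E"
  have "\<sigma> (x * x) = of_real ((norm (\<sigma> x))\<^sup>2)" if s: "\<sigma> \<in> GalG E" for \<sigma>
  proof -
    have "\<sigma> x \<in> \<real>" using subsetD[OF real af_GalG_mem[OF E s x]] .
    hence "\<sigma> x * \<sigma> x = of_real ((norm (\<sigma> x))\<^sup>2)" by (auto elim!: Reals_cases simp: power2_eq_square simp flip: of_real_mult)
    thus ?thesis using GalG_hom(2)[OF E s x x] by simp
  qed
  hence "tr E (x * x) = of_real (\<Sum>\<sigma>\<in>GalG E. (norm (\<sigma> x))\<^sup>2)" by (simp add: tr_def[OF E])
  thus ?thesis by (simp add: ip_def)
qed

lemma norm_le_ip:
  assumes x: "x \<in> E" and \<phi>: "\<phi> \<in> AbsGal"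
  shows "(norm (\<phi> x))\<^sup>2 \<le> ip x x"
proof -
  have "(norm (restrict \<phi> E x))\<^sup>2 \<le> (\<Sum>\<sigma>\<in>GalG E. (norm (\<sigma> x))\<^sup>2)"
    using member_le_sum[OF GalGI[OF \<phi>], of E "\<lambda>\<sigma>. (norm (\<sigma> x))\<^sup>2"] af_finite[OF E] by simp
  thus ?thesis using ip_square[OF x] x by simp
qed

lemma ip_pos: "x \<in> E \<Longrightarrow> x \<noteq> 0 \<Longrightarrow> ip x x > 0"
  by (rule less_le_trans[OF _ norm_le_ip[OF _ AbsGal_id, of x]]) auto

lemma ip_0: "x \<in> E \<Longrightarrow> ip 0 x = 0" using ip_diff[of x x x] by simp

lemma ip_Ints: "x \<in> E \<Longrightarrow> y \<in> E \<Longrightarrow> algebraic_int x \<Longrightarrow> algebraic_int y \<Longrightarrow> ip x y \<in> \<int>"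
proof -
  assume h: "x \<in> E" "y \<in> E" "algebraic_int x" "algebraic_int y"
  have "tr E (x * y) \<in> \<int>" using tr_Ints[OF E af_mult[OF E h(1,2)]] h(3,4) by (simp add: algebraic_int_mult)
  thus ?thesis by (auto elim!: Ints_cases simp: ip_def)
qed

lemma orthogonal_card_le:
  assumes B: "finite B" "B \<subseteq> E" "0 \<notin> B" "\<And>x y. x \<in> B \<Longrightarrow> y \<in> B \<Longrightarrow> x \<noteq> y \<Longrightarrow> ip x y = 0"
  shows "card B \<le> card (GalG E)"
proof -
  obtain u where u: "bij_betw u {..<card B} B" using ex_bij_betw_nat_finite[OF B(1)] by (auto simp: atLeast0LessThan)
  have uB: "u i \<in> B" if "i < card B" for i using u that by (auto simp: bij_betw_def)
  show ?thesis
  proof (rule artin_bound[OF af_algebraic[OF E] af_finite[OF E]])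
    show "u i \<in> E" if "i < card B" for i using uB[OF that] B(2) by blast
    show "rat_independent (card B) u"
      unfolding rat_independent_def
    proof (intro allI impI)
      fix c :: "nat \<Rightarrow> complex" and j
      assume c: "\<forall>i<card B. c i \<in> \<rat>" "(\<Sum>i<card B. c i * u i) = 0" and j: "j < card B"
      have uE: "u i \<in> E" if "i < card B" for i using uB[OF that] B(2) by blast
      have "0 = tr E (u j * (\<Sum>i<card B. c i * u i))" using c(2) tr_0[OF E] by simp
      also have "\<dots> = (\<Sum>i<card B. tr E (u j * (c i * u i)))"
        unfolding sum_distrib_left using c(1) j by (intro tr_sum[OF E] af_mult[OF E uE[OF j] af_mult[OF E af_Rats[OF E] uE]]) auto
      also have "\<dots> = (\<Sum>i<card B. c i * of_real (ip (u j) (u i)))"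
      proof (rule sum.cong[OF refl])
        fix i assume i: "i \<in> {..<card B}"
        have e: "u j * (c i * u i) = c i * (u j * u i)" by (simp add: mult_ac)
        show "tr E (u j * (c i * u i)) = c i * of_real (ip (u j) (u i))"
          unfolding e using tr_scale[OF E _ af_mult[OF E uE[OF j] uE]] c(1) i ip_tr[OF uE[OF j] uE] by simp
      qed
      also have "\<dots> = (\<Sum>i<card B. if i = j then c j * of_real (ip (u j) (u j)) else 0)"
      proof (rule sum.cong[OF refl])
        fix i assume i: "i \<in> {..<card B}"
        have "u j \<noteq> u i" if "i \<noteq> j" using inj_onD[OF bij_betw_imp_inj_on[OF u], of j i] i j that by auto
        hence "ip (u j) (u i) = 0" if "i \<noteq> j" using B(4)[OF uB[OF j] uB] i that by auto
        thus "c i * of_real (ip (u j) (u i)) = (if i = j then c j * of_real (ip (u j) (u j)) else 0)" by auto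
      qed
      also have "\<dots> = c j * of_real (ip (u j) (u j))" using j by simp
      finally show "c j = 0" using ip_pos[OF uE[OF j]] uB[OF j] B(3) by force
    qed
  qed
qed

text \<open>A transference bound: a lattice whose shortest vector is long has a short dual vector. The
  shortest vector is split off by orthogonal projection; \<open>B\<close> collects the vectors split off so
  far, and their number is bounded by the degree.\<close>

lemma transference:
  assumes "finite B" "B \<subseteq> E" "0 \<notin> B" "\<And>x y. x \<in> B \<Longrightarrow> y \<in> B \<Longrightarrow> x \<noteq> y \<Longrightarrow> ip x y = 0"
    and "card B + m = card (GalG E)"
    and "W \<subseteq> E" "\<And>x y. x \<in> W \<Longrightarrow> y \<in> W \<Longrightarrow> x - y \<in> W" "\<And>r x. r \<in> \<rat> \<Longrightarrow> x \<in> W \<Longrightarrow> of_real r * x \<in> W"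
    and "L \<subseteq> W" "\<And>x y. x \<in> L \<Longrightarrow> y \<in> L \<Longrightarrow> x - y \<in> L" "x0 \<in> L" "x0 \<noteq> 0"
    and "\<And>x b. x \<in> L \<Longrightarrow> b \<in> B \<Longrightarrow> ip x b = 0"
    and "d > (0::nat)" "\<And>x y. x \<in> L \<Longrightarrow> y \<in> L \<Longrightarrow> of_nat d * ip x y \<in> \<int>"
  shows "\<exists>x y. x \<in> L \<and> x \<noteq> 0 \<and> y \<in> W \<and> y \<noteq> 0 \<and> (\<forall>z\<in>L. ip y z \<in> \<int>) \<and> ip x x * ip y y \<le> 2 ^ m"
  using assms
proof (induction m arbitrary: B W L x0 d)
  case (0 B W L x0 d)
  have x0E: "x0 \<in> E" using 0 by blast
  have "x0 \<notin> B" using 0(13)[OF 0(11), of x0] ip_pos[OF x0E 0(12)] by auto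
  \<comment> \<open>\<open>B\<close> has already as many elements as an orthogonal system can have,
    so there is no room for a nonzero \<open>x0\<close> orthogonal to it.\<close>
  have "card (insert x0 B) \<le> card (GalG E)"
  proof (rule orthogonal_card_le)
    show "ip x y = 0" if "x \<in> insert x0 B" "y \<in> insert x0 B" "x \<noteq> y" for x y
      using that 0(4) 0(13)[OF 0(11)] ip_commute by (metis insertE)
  qed (use 0 x0E in auto)
  thus ?case using 0(1,5) \<open>x0 \<notin> B\<close> by simp
next
  case (Suc m B W L x0 d)
  note LE = subset_trans[OF Suc.prems(9) Suc.prems(6)]
  have LE': "x \<in> E" if "x \<in> L" for x using LE that by blast
  \<comment> \<open>The minimum is attained because \<open>d\<close> clears the denominators of the
    form on \<open>L\<close>.\<close>
  obtain b where b: "b \<in> L" "b \<noteq> 0" and bmin: "\<And>x. x \<in> L \<Longrightarrow> x \<noteq> 0 \<Longrightarrow> ip b b \<le> ip x x"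
  proof -
    have ex: "x0 \<in> L \<and> x0 \<noteq> 0" using Suc.prems(11,12) by simp
    obtain b where b: "b \<in> L" "b \<noteq> 0" and mn: "\<And>x. x \<in> L \<and> x \<noteq> 0 \<Longrightarrow> nat \<lfloor>of_nat d * ip b b\<rfloor> \<le> nat \<lfloor>of_nat d * ip x x\<rfloor>"
      using ex_has_least_nat[of "\<lambda>x. x \<in> L \<and> x \<noteq> 0" x0 "\<lambda>x. nat \<lfloor>of_nat d * ip x x\<rfloor>", OF ex] by blast
    have "ip b b \<le> ip x x" if x: "x \<in> L" "x \<noteq> 0" for x
    proof -
      obtain i where i: "of_nat d * ip b b = of_int i" using Suc.prems(15)[OF b(1) b(1)] by (auto elim: Ints_cases)
      obtain j where j: "of_nat d * ip x x = of_int j" using Suc.prems(15)[OF x(1) x(1)] by (auto elim: Ints_cases)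
      have "of_nat d * ip b b > 0" "of_nat d * ip x x > 0" using ip_pos LE' b x Suc.prems(14) by simp_all
      hence "i > 0" "j > 0" using i j by simp_all
      hence "i \<le> j" using mn[of x] x i j by simp
      hence "of_nat d * ip b b \<le> of_nat d * ip x x" using i j by simp
      thus ?thesis using Suc.prems(14) by simp
    qed
    with b that show thesis by blast
  qed
  have bE: "b \<in> E" using LE' b by blast
  have bW: "b \<in> W" using Suc.prems(9) b by blast
  define \<beta> where "\<beta> = ip b b"
  have \<beta>: "\<beta> > 0" "\<beta> \<in> \<rat>" using ip_pos[OF bE b(2)] ip_Rats[OF bE bE] by (auto simp: \<beta>_def)
  define c where "c = (\<lambda>z. ip z b / \<beta>)"
  have cR: "c z \<in> \<rat>" if "z \<in> E" for z using ip_Rats[OF that bE] \<beta> by (simp add: c_def)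
  define pr where "pr = (\<lambda>z. z - of_real (c z) * b)"
  have prE: "pr z \<in> E" if "z \<in> E" for z
    unfolding pr_def by (rule af_diff[OF E that af_mult[OF E of_real_mem[OF cR[OF that]] bE]])
  have prW: "pr z \<in> W" if "z \<in> W" for z
    unfolding pr_def using Suc.prems(6) that bW by (intro Suc.prems(7,8) cR) auto
  have zero: "0 \<in> L" using Suc.prems(10)[OF b(1) b(1)] by simp
  have Lneg: "- x \<in> L" if "x \<in> L" for x using Suc.prems(10)[OF zero that] by simp
  have Ladd: "x + y \<in> L" if "x \<in> L" "y \<in> L" for x y using Suc.prems(10)[OF that(1) Lneg[OF that(2)]] by simp
  have Lnat: "of_nat k * x \<in> L" if "x \<in> L" for k x
    using that by (induction k) (auto simp: zero Ladd distrib_right)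
  have Lint: "of_int k * x \<in> L" if "x \<in> L" for k x
    using Lnat[OF that] Lneg by (cases k rule: int_cases2) auto
  have ipbr: "ip (of_real r * b) z = r * ip b z" if "r \<in> \<rat>" "z \<in> E" for r z using ip_scale that bE by simp
  have rbE: "of_real r * b \<in> E" if "r \<in> \<rat>" for r using af_mult[OF E of_real_mem[OF that] bE] .
  have ippr: "ip (pr z) w = ip z w - c z * ip b w" if "z \<in> E" "w \<in> E" for z w
    unfolding pr_def using ip_diff[OF that(1) rbE[OF cR[OF that(1)]] that(2)] ipbr[OF cR[OF that(1)] that(2)] by simp
  have prb: "ip (pr z) b = 0" if "z \<in> E" for z
    using ippr[OF that bE] \<beta> by (simp add: c_def \<beta>_def)
  have shift: "ip (z - of_int k * b) (z - of_int k * b) = ip (pr z) (pr z) + (c z - of_int k)\<^sup>2 * \<beta>" if z: "z \<in> E" for z k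
  proof -
    define r where "r = c z - of_int k"
    have rR: "r \<in> \<rat>" using cR[OF z] by (simp add: r_def)
    define x where "x = z - of_int k * b"
    have xE: "x \<in> E" unfolding x_def by (rule af_diff[OF E z af_mult[OF E af_of_int[OF E] bE]])
    have px: "pr z = x - of_real r * b" by (simp add: pr_def x_def r_def algebra_simps)
    have xb: "ip x b = r * \<beta>"
    proof -
      have "ip (pr z) b = ip x b - r * ip b b" unfolding px using ip_diff[OF xE rbE[OF rR] bE] ipbr[OF rR bE] by simp
      thus ?thesis using prb[OF z] by (simp add: \<beta>_def)
    qed
    have "ip (pr z) (pr z) = ip x (pr z) - r * ip b (pr z)"
      using ip_diff[OF xE rbE[OF rR] prE[OF z]] ipbr[OF rR prE[OF z]] px by simp
    also have "ip b (pr z) = 0" using prb[OF z] ip_commute by simp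
    also have "ip x (pr z) = ip x x - r * ip b x"
      using ip_diff[OF xE rbE[OF rR] xE] ipbr[OF rR xE] px ip_commute[of x "pr z"] by simp
    also have "ip b x = r * \<beta>" using xb ip_commute by simp
    finally show ?thesis unfolding x_def[symmetric] r_def[symmetric] by (simp add: power2_eq_square algebra_simps)
  qed
  show ?case
  proof (cases "\<forall>z\<in>L. pr z = 0")
    case True
    \<comment> \<open>Here \<open>L\<close> has rank one and consists of the integer multiples of
      its shortest vector \<open>b\<close>: the remainder after subtracting the floor multiple would
      be shorter than \<open>b\<close>. The dual vector is then explicit.\<close>
    define y where "y = of_real (1 / \<beta>) * b"
    have \<beta>R: "1 / \<beta> \<in> \<rat>" using \<beta> by simp
    have yW: "y \<in> W" unfolding y_def by (rule Suc.prems(8)[OF \<beta>R bW])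
    have "ip y z \<in> \<int>" if z: "z \<in> L" for z
    proof -
      define k where "k = \<lfloor>c z\<rfloor>"
      have zb: "z - of_int k * b \<in> L" using Suc.prems(10)[OF z Lint[OF b(1)]] .
      have pz: "pr z = 0" using True z by simp
      have "ip (z - of_int k * b) (z - of_int k * b) = (c z - of_int k)\<^sup>2 * \<beta>"
        using shift[OF LE'[OF z], of k] pz ip_0[OF af_0[OF E]] by simp
      also have "\<dots> < 1 * \<beta>"
      proof (rule mult_strict_right_mono[OF _ \<beta>(1)])
        have "0 \<le> c z - of_int k" "c z - of_int k < 1" unfolding k_def by linarith+
        thus "(c z - of_int k)\<^sup>2 < 1" by (simp add: abs_square_less_1)
      qed
      finally have "ip (z - of_int k * b) (z - of_int k * b) < ip b b" by (simp add: \<beta>_def)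
      hence "z - of_int k * b = 0" using bmin[OF zb] by (meson not_le)
      hence z': "z = of_real (of_int k) * b" by simp
      have "ip z b = of_int k * \<beta>" unfolding z' \<beta>_def by (rule ipbr[OF _ bE]) simp
      hence "ip y z = of_int k" unfolding y_def using ipbr[OF \<beta>R LE'[OF z]] ip_commute[of b z] \<beta> by simp
      thus ?thesis by simp
    qed
    moreover have "ip b b * ip y y \<le> 2 ^ Suc m"
    proof -
      have yE: "y \<in> E" using yW Suc.prems(6) by blast
      have "ip y y = 1 / \<beta> * ip b y" unfolding y_def[of] using ipbr[OF \<beta>R yE] y_def by simp
      also have "ip b y = 1 / \<beta> * \<beta>" using ipbr[OF \<beta>R bE] ip_commute[of b y] by (simp add: y_def \<beta>_def)
      finally have "ip b b * ip y y = 1" using \<beta> by (simp add: \<beta>_def[symmetric])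
      also have "1 \<le> (2 :: real) ^ Suc m" by (rule one_le_power) simp
      finally show ?thesis .
    qed
    moreover have "y \<noteq> 0" using \<beta> b by (simp add: y_def)
    ultimately show ?thesis using b yW by blast
  next
    case False
    then obtain z0 where z0: "z0 \<in> L" "pr z0 \<noteq> 0" by blast
    define W' where "W' = {w\<in>W. ip w b = 0}"
    have WE: "w \<in> E" if "w \<in> W" for w using Suc.prems(6) that by blast
    have bB: "b \<notin> B" using Suc.prems(13)[OF b(1), of b] \<beta> by (auto simp: \<beta>_def)
    have prdiff: "pr x - pr y = pr (x - y)" if "x \<in> E" "y \<in> E" for x y
    proof -
      have "c (x - y) = c x - c y" using ip_diff[OF that bE] by (simp add: c_def diff_divide_distrib)
      show ?thesis unfolding pr_def \<open>c (x - y) = c x - c y\<close> by (simp add: algebra_simps)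
    qed
    obtain Bn where Bn: "of_nat d * \<beta> = of_int Bn" using Suc.prems(15)[OF b(1) b(1)] by (auto elim: Ints_cases simp: \<beta>_def)
    have "of_nat d * \<beta> > 0" using \<beta> Suc.prems(14) by simp
    hence Bn0: "Bn > 0" using Bn by simp
    \<comment> \<open>The form on projections is \<open>ip u v - ip v b / \<beta> * ip u b\<close>;
      the extra factor \<open>Bn\<close>, which is \<open>of_nat d * \<beta>\<close>, clears the new
      denominator.\<close>
    define d' where "d' = d * nat Bn"
    have "\<exists>x y. x \<in> pr ` L \<and> x \<noteq> 0 \<and> y \<in> W' \<and> y \<noteq> 0 \<and> (\<forall>z\<in>pr ` L. ip y z \<in> \<int>) \<and> ip x x * ip y y \<le> 2 ^ m"
    proof (rule Suc.IH[of "insert b B" W' "pr ` L" "pr z0" d'])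
      show "finite (insert b B)" "insert b B \<subseteq> E" "0 \<notin> insert b B" using Suc.prems(1-3) bE b by auto
      show "ip x y = 0" if "x \<in> insert b B" "y \<in> insert b B" "x \<noteq> y" for x y
        using that Suc.prems(4) Suc.prems(13)[OF b(1)] ip_commute by (metis insertE)
      show "card (insert b B) + m = card (GalG E)" using Suc.prems(1,5) bB by simp
      show "W' \<subseteq> E" using Suc.prems(6) by (auto simp: W'_def)
      show "x - y \<in> W'" if "x \<in> W'" "y \<in> W'" for x y
        using that Suc.prems(7) ip_diff[OF WE WE bE] by (auto simp: W'_def)
      show "of_real r * x \<in> W'" if "r \<in> \<rat>" "x \<in> W'" for r x
        using that Suc.prems(8) ip_scale[OF that(1) WE bE] by (auto simp: W'_def)
      show "pr ` L \<subseteq> W'" using prW Suc.prems(9) prb LE' by (auto simp: W'_def)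
      show "x - y \<in> pr ` L" if xy: "x \<in> pr ` L" "y \<in> pr ` L" for x y
      proof -
        obtain u v where "u \<in> L" "v \<in> L" "x = pr u" "y = pr v" using xy by blast
        thus ?thesis using prdiff[OF LE' LE'] Suc.prems(10) by auto
      qed
      show "pr z0 \<in> pr ` L" "pr z0 \<noteq> 0" using z0 by auto
      show "ip x w = 0" if xw: "x \<in> pr ` L" "w \<in> insert b B" for x w
      proof -
        obtain u where u: "u \<in> L" "x = pr u" using xw by blast
        show ?thesis
        proof (cases "w = b")
          case True thus ?thesis using prb[OF LE'[OF u(1)]] u by simp
        next
          case False
          hence "w \<in> B" using xw by simp
          thus ?thesis using ippr[OF LE'[OF u(1)], of w] Suc.prems(2) Suc.prems(13)[OF u(1)] Suc.prems(13)[OF b(1)] u by auto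
        qed
      qed
      show "d' > 0" using Suc.prems(14) Bn0 by (simp add: d'_def)
      show "of_nat d' * ip x y \<in> \<int>" if xy: "x \<in> pr ` L" "y \<in> pr ` L" for x y
      proof -
        obtain u v where uv: "u \<in> L" "v \<in> L" "x = pr u" "y = pr v" using xy by blast
        have uE: "u \<in> E" and vE: "v \<in> E" using LE' uv by auto
        obtain i where i: "of_nat d * ip u b = of_int i" using Suc.prems(15)[OF uv(1) b(1)] by (auto elim: Ints_cases)
        obtain j where j: "of_nat d * ip v b = of_int j" using Suc.prems(15)[OF uv(2) b(1)] by (auto elim: Ints_cases)
        obtain k where k: "of_nat d * ip u v = of_int k" using Suc.prems(15)[OF uv(1,2)] by (auto elim: Ints_cases)
        have "ip x y = ip u (pr v) - c u * ip b (pr v)" unfolding uv(3,4) by (rule ippr[OF uE prE[OF vE]])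
        also have "ip b (pr v) = 0" using prb[OF vE] ip_commute by simp
        also have "ip u (pr v) = ip v u - c v * ip b u" using ippr[OF vE uE] ip_commute by simp
        finally have "ip x y = ip u v - ip v b / \<beta> * ip u b" by (simp add: c_def ip_commute)
        hence "of_nat d' * ip x y = of_nat d' * (ip u v - ip v b / \<beta> * ip u b)" by (simp only:)
        also have "\<dots> = of_int Bn * (of_nat d * ip u v) - of_nat d * of_int Bn * (ip v b / \<beta> * ip u b)"
          using Bn0 by (simp add: d'_def algebra_simps)
        also have "of_nat d * of_int Bn * (ip v b / \<beta> * ip u b) = (of_nat d * ip v b) * (of_nat d * ip u b)"
          unfolding Bn[symmetric] using \<beta> by simp
        finally have "of_nat d' * ip x y = of_int (Bn * k - j * i)" using i j k by simp
        thus ?thesis by (metis Ints_of_int)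
      qed
    qed
    then obtain x' y where x': "x' \<in> pr ` L" "x' \<noteq> 0" and y: "y \<in> W'" "y \<noteq> 0" "\<forall>z\<in>pr ` L. ip y z \<in> \<int>"
      and xy: "ip x' x' * ip y y \<le> 2 ^ m" by blast
    obtain u where u: "u \<in> L" "x' = pr u" using x' by blast
    have uE: "u \<in> E" using LE' u by blast
    have yE: "y \<in> E" and yb: "ip y b = 0" and yW: "y \<in> W" using y(1) WE by (auto simp: W'_def)
    \<comment> \<open>Rounding gives a lift \<open>x\<close> of \<open>x'\<close> to
      \<open>L\<close> with \<open>ip x x\<close> larger than \<open>ip x' x'\<close> by at most
      \<open>\<beta> / 4\<close>, while \<open>\<beta> \<le> ip x x\<close> by minimality of
      \<open>b\<close>. So undoing one projection costs at most a factor 2, and \<open>2 ^ m\<close>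
      accumulates.\<close>
    define k where "k = round (c u)"
    define x where "x = u - of_int k * b"
    have xL: "x \<in> L" unfolding x_def by (rule Suc.prems(10)[OF u(1) Lint[OF b(1)]])
    have "\<bar>c u - of_int k\<bar> \<le> 1 / 2" unfolding k_def using of_int_round_abs_le[of "c u"] by (simp add: abs_minus_commute)
    hence "(c u - of_int k)\<^sup>2 \<le> (1 / 2)\<^sup>2" by (subst abs_le_square_iff[symmetric]) simp
    hence q: "(c u - of_int k)\<^sup>2 * \<beta> \<le> \<beta> / 4" using mult_right_mono[of _ _ \<beta>] \<beta>(1) by (fastforce simp: power2_eq_square)
    have xx: "ip x x = ip x' x' + (c u - of_int k)\<^sup>2 * \<beta>" unfolding x_def u(2) by (rule shift[OF uE])
    have x'pos: "ip x' x' > 0" using ip_pos[OF prE[OF uE]] x'(2) u(2) by simp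
    have xne: "x \<noteq> 0"
    proof
      assume "x = 0"
      hence "ip x x = 0" using ip_0[OF af_0[OF E]] by simp
      moreover have "(c u - of_int k)\<^sup>2 * \<beta> \<ge> 0" using \<beta>(1) by simp
      ultimately show False using xx x'pos by linarith
    qed
    have "\<beta> \<le> ip x x" using bmin[OF xL xne] by (simp add: \<beta>_def)
    hence "ip x x \<le> 2 * ip x' x'" using xx q x'pos by linarith
    hence "ip x x * ip y y \<le> 2 * (ip x' x' * ip y y)" using ip_pos[OF yE y(2)] by (simp add: mult_right_mono)
    hence fin: "ip x x * ip y y \<le> 2 ^ Suc m" using xy by simp
    \<comment> \<open>Since \<open>y\<close> is orthogonal to \<open>b\<close>, it pairs with
      \<open>z\<close> as with the projection of \<open>z\<close>.\<close>
    have "ip y z \<in> \<int>" if z: "z \<in> L" for z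
    proof -
      have "ip (pr z) y = ip z y - c z * ip b y" by (rule ippr[OF LE'[OF z] yE])
      hence "ip y z = ip y (pr z)" using yb ip_commute by simp
      thus ?thesis using y(3) z by simp
    qed
    thus ?thesis using xL xne yW y(2) fin by blast
  qed
qed

end

section \<open>Denominators of the trace dual\<close>

lemma dvd_prime_power_prod:
  fixes m l0 c :: nat
  assumes m: "m > 0" and bd: "\<And>l. Factorial_Ring.prime l \<Longrightarrow> l dvd m \<Longrightarrow> l \<le> l0 \<and> \<not> l ^ c dvd m"
  shows "m dvd (\<Prod>l | Factorial_Ring.prime l \<and> l \<le> l0. l ^ c)" (is "m dvd ?Q")
proof (rule multiplicity_le_imp_dvd)
  show "m \<noteq> 0" using m by simp
  fix l :: nat assume l: "Factorial_Ring.prime l"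
  have fin: "finite {l. Factorial_Ring.prime l \<and> l \<le> l0}" by (rule finite_subset[of _ "{..l0}"]) auto
  have Q0: "?Q \<noteq> 0" using fin by (auto dest: prime_gt_0_nat)
  have nu: "\<not> is_unit l" using l by (metis not_prime_unit)
  show "multiplicity l m \<le> multiplicity l ?Q"
  proof (cases "l dvd m")
    case True
    have "\<not> c \<le> multiplicity l m"
      using bd[OF l True] power_dvd_iff_le_multiplicity[of m l c] m nu by simp
    moreover have "l ^ c dvd ?Q" using bd[OF l True] l fin by (intro dvd_prodI) auto
    hence "c \<le> multiplicity l ?Q" using power_dvd_iff_le_multiplicity[of ?Q l c] Q0 nu by simp
    ultimately show ?thesis by simp
  qed (simp add: not_dvd_imp_multiplicity_0)
qed

text \<open>The dual of the ring of integers under the trace form has no denominators at primes above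
  \<open>l0\<close>.\<close>

definition unramified_above :: "nat \<Rightarrow> complex set \<Rightarrow> bool" where
  "unramified_above l0 E \<longleftrightarrow> (\<forall>l u. Factorial_Ring.prime l \<longrightarrow> l > l0 \<longrightarrow> u \<in> E \<longrightarrow> algebraic_int u \<longrightarrow>
     (\<forall>w. w \<in> E \<longrightarrow> algebraic_int w \<longrightarrow> l intdvd tr E (u * w)) \<longrightarrow> l intdvd u)"

text \<open>A common denominator for trace duals that depends on no field: in degree at most
  \<open>N\<close>, \<open>codifferent_bound\<close> excludes the exponent \<open>2 * N\<close> at
  every prime, and primes above \<open>l0\<close> are excluded by
  \<open>unramified_above\<close>.\<close>

definition ram_bound :: "nat \<Rightarrow> nat \<Rightarrow> nat" where
  "ram_bound l0 N = (\<Prod>l | Factorial_Ring.prime l \<and> l \<le> l0. l ^ (2 * N))"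

lemma ram_bound_pos: "ram_bound l0 N > 0"
  unfolding ram_bound_def by (intro prod_pos) (auto dest: prime_gt_0_nat)

text \<open>For the least denominator \<open>m\<close> of \<open>y\<close>, no prime divisor
  \<open>l\<close> of \<open>m\<close> divides the integer \<open>m * y\<close>, although
  \<open>m\<close> divides the traces of all its integral multiples. Hence \<open>l\<close> is at
  most \<open>l0\<close>, and \<open>codifferent_bound\<close> limits its exponent in
  \<open>m\<close>.\<close>

lemma dual_denominator:
  assumes E: "abelian_field E" and ur: "unramified_above l0 E" and N: "card (GalG E) \<le> N"
    and y: "y \<in> E" and dual: "\<And>z. z \<in> E \<Longrightarrow> algebraic_int z \<Longrightarrow> algebraic_int (tr E (y * z))"
  shows "algebraic_int (of_nat (ram_bound l0 N) * y)"
proof -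
  obtain m0 :: nat where m0: "m0 > 0" "algebraic_int (of_nat m0 * y)"
    using algebraic_imp_multiple_algebraic_int[OF af_algebraic[OF E y]] by blast
  obtain m where m: "m > 0" "algebraic_int (of_nat m * y)"
    and mn: "\<And>k. k > 0 \<and> algebraic_int (of_nat k * y) \<Longrightarrow> m \<le> k"
    using ex_has_least_nat[of "\<lambda>k. k > 0 \<and> algebraic_int (of_nat k * y)" m0 "\<lambda>k. k"] m0 by blast
  have scale: "tr E ((of_nat m * y) * w) = of_nat m * tr E (y * w)" if "w \<in> E" for w
    using tr_scale[OF E _ af_mult[OF E y that], of "of_nat m"] by (simp add: mult.assoc)
  have uE: "of_nat m * y \<in> E" by (rule af_mult[OF E af_of_nat[OF E] y])
  have "m dvd ram_bound l0 N"
    unfolding ram_bound_def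
  proof (rule dvd_prime_power_prod[OF m(1)])
    fix l assume l: "Factorial_Ring.prime l" "l dvd m"
    obtain k where k: "m = l * k" using l(2) by (auto elim: dvdE)
    have k0: "k > 0" "k < m" using k m(1) prime_gt_1_nat[OF l(1)] by auto
    have nd: "\<not> l intdvd of_nat m * y"
    proof
      assume "l intdvd of_nat m * y"
      moreover have "of_nat m * y / of_nat l = of_nat k * y" using prime_gt_0_nat[OF l(1)] by (simp add: k)
      ultimately have "algebraic_int (of_nat k * y)" by (simp add: divides_int_def)
      thus False using mn[of k] k0 by simp
    qed
    have dv: "d intdvd tr E ((of_nat m * y) * w)" if d: "d dvd m" and w: "w \<in> E" "algebraic_int w" for d w
      using intdvd_mult[OF dual[OF w] intdvd_of_int[of d "int m"]] d scale[OF w(1)] by (simp add: mult.commute)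
    show "l \<le> l0 \<and> \<not> l ^ (2 * N) dvd m"
    proof (rule ccontr)
      assume "\<not> (l \<le> l0 \<and> \<not> l ^ (2 * N) dvd m)"
      then consider "l > l0" | "l ^ (2 * N) dvd m" by linarith
      thus False
      proof cases
        case 1
        have "l intdvd of_nat m * y"
          using ur[unfolded unramified_above_def, rule_format, OF l(1) 1 uE m(2)] dv[OF l(2)] by simp
        thus False using nd by simp
      next
        case 2
        have "l ^ (2 * card (GalG E)) dvd l ^ (2 * N)" using N by (intro le_imp_power_dvd) simp
        hence d: "l ^ (2 * card (GalG E)) dvd m" using 2 by (rule dvd_trans)
        have "l intdvd of_nat m * y" by (rule codifferent_bound[OF E uE m(2) l(1)]) (rule dv[OF d])
        thus False using nd by simp
      qed
    qed
  qed
  then obtain k where "ram_bound l0 N = m * k" by (auto elim: dvdE)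
  hence "of_nat (ram_bound l0 N) * y = of_nat k * (of_nat m * y)" by simp
  thus ?thesis using algebraic_int_mult[OF algebraic_int_of_nat m(2), of k] by (simp only:)
qed

text \<open>The transference bound is applied to the integers of relative trace zero for \<open>g\<close>, all of which
  except \<open>0\<close> are moved by \<open>g\<close>; their dual has denominators dividing \<open>q * ram_bound l0 N\<close>.\<close>

lemma small_moved:
  assumes E: "abelian_field E" and R: "E \<subseteq> \<real>" and g: "g \<in> AbsGal" and q: "q > 0"
    and ex: "\<And>x. x \<in> E \<Longrightarrow> (g ^^ q) x = x" and ur: "unramified_above l0 E"
    and moved: "x1 \<in> E" "g x1 \<noteq> x1" and N: "card (GalG E) \<le> N"
  shows "\<exists>x\<in>E. algebraic_int x \<and> g x \<noteq> x \<and>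
    (\<forall>\<phi>\<in>AbsGal. (norm (\<phi> x))\<^sup>2 \<le> 2 ^ N * (of_nat (ram_bound l0 N * q))\<^sup>2)"
proof -
  \<comment> \<open>An integer multiple of the relative trace to the fixed field of
    \<open>g\<close>: the order of \<open>g\<close> on \<open>E\<close> divides \<open>q\<close> but
    may be smaller.\<close>
  define T where "T = (\<lambda>z. \<Sum>k<q. (g ^^ k) z)"
  define L where "L = {x\<in>E. algebraic_int x \<and> T x = 0}"
  define W where "W = {x\<in>E. T x = 0}"
  define D where "D = ram_bound l0 N"
  note alg = af_algebraic[OF E]
  have gk: "(g ^^ k) \<in> AbsGal" for k by (rule AbsGal_funpow[OF g])
  have gkE: "(g ^^ k) z \<in> E" if "z \<in> E" for k z by (rule af_stable[OF E gk that])
  have TE: "T z \<in> E" if "z \<in> E" for z unfolding T_def by (rule af_sum[OF E gkE[OF that]])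
  have T_int: "algebraic_int (T z)" if "algebraic_int z" for z
    unfolding T_def by (rule algebraic_int_sum, rule AbsGal_algebraic_int[OF gk that])
  have gT: "g (T z) = T z" if z: "z \<in> E" for z
  proof -
    have "g (T z) = (\<Sum>k<q. g ((g ^^ k) z))"
      unfolding T_def by (rule AbsGal_sum[OF g], rule alg[OF gkE[OF z]])
    hence "g (T z) + z = (\<Sum>k<Suc q. (g ^^ k) z)"
      by (simp add: sum.lessThan_Suc_shift del: sum.lessThan_Suc)
    also have "\<dots> = T z + z" using ex[OF z] by (simp add: T_def)
    finally show ?thesis by simp
  qed
  have fixpow: "(g ^^ k) z = z" if "g z = z" for k z using that by (induction k) auto
  have Tfix: "T z = of_nat q * z" if "g z = z" for z using fixpow[OF that] by (simp add: T_def)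
  have Tdiff: "T (x - y) = T x - T y" if "x \<in> E" "y \<in> E" for x y
    unfolding T_def using AbsGal_diff[OF gk alg[OF that(1)] alg[OF that(2)]] by (simp add: sum_subtractf)
  have Tmult: "T (c * z) = c * T z" if c: "g c = c" "c \<in> E" and z: "z \<in> E" for c z
    unfolding T_def using AbsGal_mult[OF gk alg[OF c(2)] alg[OF z]] fixpow[OF c(1)] by (simp add: sum_distrib_left)
  have Tg: "T (g z) = T z" if z: "z \<in> E" for z
  proof -
    have "T (g z) = g (T z)"
      unfolding T_def using AbsGal_sum[OF g, of "{..<q}" "\<lambda>k. (g ^^ k) z"] alg[OF gkE[OF z]]
      by (simp add: funpow_swap1)
    thus ?thesis using gT[OF z] by simp
  qed
  have trT: "tr E (T v) = (\<Sum>k<q. tr E ((g ^^ k) v))" if "v \<in> E" for v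
    unfolding T_def by (rule tr_sum[OF E gkE[OF that]])
  obtain n :: nat where n: "n > 0" "algebraic_int (of_nat n * x1)"
    using algebraic_imp_multiple_algebraic_int[OF alg[OF moved(1)]] by blast
  define x2 where "x2 = of_nat n * x1"
  have x2E: "x2 \<in> E" unfolding x2_def by (rule af_mult[OF E af_of_nat[OF E] moved(1)])
  have gx2: "g x2 = of_nat n * g x1"
    unfolding x2_def by (subst AbsGal_mult[OF g _ alg[OF moved(1)]]) (simp_all add: AbsGal_of_nat[OF g])
  \<comment> \<open>A difference of this form has relative trace zero, so \<open>L\<close> is
    nonzero.\<close>
  define x0 where "x0 = g x2 - x2"
  have x0: "x0 \<in> L" "x0 \<noteq> 0"
  proof -
    have gx2E: "g x2 \<in> E" by (rule af_stable[OF E g x2E])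
    have "algebraic_int x0" unfolding x0_def
      by (rule algebraic_int_diff[OF AbsGal_algebraic_int[OF g]]) (use n in \<open>simp_all add: x2_def\<close>)
    moreover have "T x0 = 0" unfolding x0_def using Tdiff[OF gx2E x2E] Tg[OF x2E] by simp
    moreover have "x0 \<in> E" unfolding x0_def by (rule af_diff[OF E gx2E x2E])
    ultimately show "x0 \<in> L" by (simp add: L_def)
    have "g x2 \<noteq> x2" unfolding gx2 using moved(2) n(1) by (simp add: x2_def)
    thus "x0 \<noteq> 0" by (simp add: x0_def)
  qed
  have LE: "x \<in> E" if "x \<in> L" for x using that by (simp add: L_def)
  \<comment> \<open>No vector has been split off yet, so the constant is 2 to the full
    degree.\<close>
  have "\<exists>x y. x \<in> L \<and> x \<noteq> 0 \<and> y \<in> W \<and> y \<noteq> 0 \<and> (\<forall>z\<in>L. ip E y z \<in> \<int>) \<and> ip E x x * ip E y y \<le> 2 ^ card (GalG E)"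
  proof (rule transference[OF E R, where B = "{}" and d = 1])
    show "W \<subseteq> E" by (auto simp: W_def)
    show "x - y \<in> W" if "x \<in> W" "y \<in> W" for x y
      using that Tdiff[of x y] af_diff[OF E, of x y] by (simp add: W_def)
    show "of_real r * x \<in> W" if r: "r \<in> \<rat>" and x: "x \<in> W" for r x
    proof -
      have rE: "of_real r \<in> E" by (rule of_real_mem[OF E R r])
      have gr: "g (of_real r) = of_real r" by (rule AbsGal_Rats[OF g of_real_Rats[OF E R r]])
      have xE: "x \<in> E" using x by (simp add: W_def)
      show ?thesis using Tmult[OF gr rE xE] af_mult[OF E rE xE] x by (simp add: W_def)
    qed
    show "L \<subseteq> W" by (auto simp: L_def W_def)
    show "x - y \<in> L" if "x \<in> L" "y \<in> L" for x y
      using that Tdiff[of x y] af_diff[OF E, of x y] algebraic_int_diff[of x y] by (simp add: L_def)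
    show "x0 \<in> L" "x0 \<noteq> 0" using x0 by auto
    show "of_nat 1 * ip E x y \<in> \<int>" if "x \<in> L" "y \<in> L" for x y
      using that ip_Ints[OF E R, of x y] by (simp add: L_def)
  qed simp_all
  then obtain x y where x: "x \<in> L" "x \<noteq> 0" and y: "y \<in> W" "y \<noteq> 0" and yL: "\<And>z. z \<in> L \<Longrightarrow> ip E y z \<in> \<int>"
    and xy: "ip E x x * ip E y y \<le> 2 ^ card (GalG E)" by blast
  have xE: "x \<in> E" using x by (simp add: L_def)
  have yE: "y \<in> E" using y by (simp add: W_def)
  \<comment> \<open>An arbitrary integer \<open>z\<close> need not lie in \<open>L\<close>, but
    \<open>of_nat q * z - T z\<close> does, and \<open>T z\<close> is orthogonal to
    \<open>y\<close>; this is the origin of the factor \<open>q\<close>.\<close>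
  define y' where "y' = of_nat q * y"
  have y'E: "y' \<in> E" unfolding y'_def by (rule af_mult[OF E af_of_nat[OF E] yE])
  have dual: "algebraic_int (tr E (y' * z))" if z: "z \<in> E" "algebraic_int z" for z
  proof -
    note Tz = TE[OF z(1)] gT[OF z(1)]
    have qE: "of_nat q * z \<in> E" by (rule af_mult[OF E af_of_nat[OF E] z(1)])
    have gq: "g (of_nat q) = of_nat q" by (rule AbsGal_of_nat[OF g])
    define w where "w = of_nat q * z - T z"
    have wE: "w \<in> E" unfolding w_def by (rule af_diff[OF E qE Tz(1)])
    have "T w = 0"
      unfolding w_def using Tdiff[OF qE Tz(1)] Tmult[OF gq af_of_nat[OF E] z(1)] Tfix[OF Tz(2)] by simp
    moreover have "algebraic_int w" unfolding w_def
      by (rule algebraic_int_diff[OF algebraic_int_mult[OF algebraic_int_of_nat z(2)] T_int[OF z(2)]])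
    ultimately have "ip E y w \<in> \<int>" using wE by (intro yL) (simp add: L_def)
    hence yw: "tr E (y * w) \<in> \<int>" using ip_tr[OF E R yE wE] by (auto elim!: Ints_cases simp: of_real_of_int_eq dest: sym)
    have yT: "y * T z \<in> E" by (rule af_mult[OF E yE Tz(1)])
    have "of_nat q * tr E (y * T z) = (\<Sum>k<q. tr E ((g ^^ k) (y * T z)))"
      using tr_AbsGal[OF E gk yT] by simp
    also have "\<dots> = tr E (T (y * T z))"
      by (rule trT[OF yT, symmetric])
    also have "T (y * T z) = 0" using Tmult[OF Tz(2,1) yE] y(1) by (simp add: W_def mult.commute)
    finally have yT0: "tr E (y * T z) = 0" using q tr_0[OF E] by simp
    have "y' * z = y * w + y * T z" by (simp add: y'_def w_def algebra_simps)
    hence "tr E (y' * z) = tr E (y * w)" using tr_add[OF E af_mult[OF E yE wE] yT] yT0 by simp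
    thus ?thesis using yw by (auto elim: Ints_cases)
  qed
  define v where "v = of_nat D * y'"
  have v_int: "algebraic_int v" unfolding v_def D_def by (rule dual_denominator[OF E ur N y'E dual])
  have vE: "v \<in> E" unfolding v_def by (rule af_mult[OF E af_of_nat[OF E] y'E])
  have D0: "D > 0" using ram_bound_pos by (simp add: D_def)
  define s where "s = real (D * q)"
  have s: "s \<in> \<rat>" "s > 0" using D0 q by (simp_all add: s_def)
  have vs: "v = of_real s * y" by (simp add: v_def y'_def s_def)
  have v0: "v \<noteq> 0" unfolding vs using s y by simp
  \<comment> \<open>The multiple \<open>v\<close> of the dual vector \<open>y\<close> is a nonzero
    algebraic integer, so \<open>y\<close> cannot be too short; by transference \<open>x\<close>
    cannot be too long.\<close>
  have "ip E v v \<in> \<int>" by (rule ip_Ints[OF E R vE vE v_int v_int])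
  then obtain i where i: "ip E v v = of_int i" by (auto elim: Ints_cases)
  have "ip E v v > 0" by (rule ip_pos[OF E R vE v0])
  hence "ip E v v \<ge> 1" using i by simp
  moreover have "ip E v v = s\<^sup>2 * ip E y y"
  proof -
    have "ip E v v = s * ip E y v" unfolding vs(1)[THEN arg_cong, of "\<lambda>t. ip E t v"] by (rule ip_scale[OF E R s(1) yE vE])
    also have "ip E y v = ip E v y" by (rule ip_commute[OF E R])
    also have "ip E v y = s * ip E y y" unfolding vs by (rule ip_scale[OF E R s(1) yE yE])
    finally show ?thesis by (simp add: power2_eq_square)
  qed
  ultimately have s1: "s\<^sup>2 * ip E y y \<ge> 1" by simp
  have xpos: "ip E x x > 0" by (rule ip_pos[OF E R xE x(2)])
  have "ip E x x \<le> ip E x x * (s\<^sup>2 * ip E y y)" using s1 xpos by simp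
  also have "\<dots> = s\<^sup>2 * (ip E x x * ip E y y)" by simp
  also have "\<dots> \<le> s\<^sup>2 * 2 ^ N"
    using order_trans[OF xy power_increasing[OF N]] by (intro mult_left_mono) simp_all
  finally have bound: "ip E x x \<le> 2 ^ N * s\<^sup>2" by (simp add: mult.commute)
  have "g x \<noteq> x"
  proof
    assume "g x = x"
    hence "of_nat q * x = 0" using Tfix x(1) by (simp add: L_def)
    thus False using q x(2) by simp
  qed
  moreover have "(norm (\<phi> x))\<^sup>2 \<le> 2 ^ N * s\<^sup>2" if "\<phi> \<in> AbsGal" for \<phi>
    using norm_le_ip[OF E R xE that] bound by linarith
  ultimately show ?thesis using x(1) by (auto simp: L_def s_def D_def)
qed

text \<open>By the relative trace, the traces from \<open>F\<close> of the integral multiples of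
  \<open>u\<close> are traces from \<open>E\<close> of such multiples, so the criterion in
  \<open>F\<close> applies.\<close>

lemma unramified_above_sub:
  assumes F: "abelian_field F" and E: "abelian_field E" and sub: "E \<subseteq> F" and ur: "unramified_above l0 F"
  shows "unramified_above l0 E"
  unfolding unramified_above_def
proof (intro allI impI)
  fix l u assume l: "Factorial_Ring.prime l" "l > l0" and u: "u \<in> E" "algebraic_int u"
    and h: "\<forall>w. w \<in> E \<longrightarrow> algebraic_int w \<longrightarrow> l intdvd tr E (u * w)"
  have "l intdvd tr F (u * b)" if b: "b \<in> F" "algebraic_int b" for b
  proof -
    obtain w where "w \<in> E" "algebraic_int w" "tr F (u * b) = tr E (u * w)"
      using trace_tower[OF E F sub u(1) b] by blast
    thus ?thesis using h by simp
  qed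
  thus "l intdvd u"
    using ur[unfolded unramified_above_def, rule_format, OF l subsetD[OF sub u(1)] u(2)] by simp
qed

section \<open>Subfields of bounded degree on which an automorphism acts\<close>

lemma fixed_subfield:
  assumes E: "abelian_field E" and a: "a \<in> AbsGal"
  shows "abelian_field {x\<in>E. a x = x}"
proof -
  have "qfield {x\<in>E. a x = x} = {x\<in>E. a x = x}"
  proof
    show "qfield {x\<in>E. a x = x} \<subseteq> {x\<in>E. a x = x}"
    proof
      fix x assume x: "x \<in> qfield {x\<in>E. a x = x}"
      have "x \<in> E" using abelian_field_sub(2)[OF E, of "{x\<in>E. a x = x}"] x by auto
      moreover have "a x = x" by (rule qfieldD[OF x a AbsGal_id]) simp
      ultimately show "x \<in> {x\<in>E. a x = x}" by simp
    qed
    show "{x\<in>E. a x = x} \<subseteq> qfield {x\<in>E. a x = x}"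
    proof
      fix x assume x: "x \<in> {x\<in>E. a x = x}"
      hence "x \<in> E" by simp
      from qfield_base[OF x af_algebraic[OF E this]] show "x \<in> qfield {x\<in>E. a x = x}" .
    qed
  qed
  thus ?thesis using abelian_field_sub(1)[OF E, of "{x\<in>E. a x = x}"] by simp
qed

lemma fixed_subfield_card:
  assumes E: "abelian_field E" and a: "a \<in> AbsGal" and e: "e \<in> E" "a e \<noteq> e"
  shows "card (GalG {x\<in>E. a x = x}) < card (GalG E)"
proof -
  define F where "F = {x\<in>E. a x = x}"
  define r where "r = (\<lambda>\<sigma>. restrict \<sigma> F :: complex \<Rightarrow> complex)"
  have rr: "r (restrict \<phi> E) = restrict \<phi> F" for \<phi> by (auto simp: r_def F_def restrict_def fun_eq_iff)
  have aG: "restrict a E \<in> GalG E" and iG: "restrict (\<lambda>x. x) E \<in> GalG E" using GalGI a AbsGal_id by auto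
  have ne: "restrict a E \<noteq> restrict (\<lambda>x. x) E" 
  proof
    assume "restrict a E = restrict (\<lambda>x. x) E"
    hence "restrict a E e = restrict (\<lambda>x. x) E e" by (rule fun_cong)
    thus False using e by simp
  qed
  have eq: "r (restrict a E) = r (restrict (\<lambda>x. x) E)" unfolding rr by (intro restrict_ext) (simp add: F_def)
  have "GalG F \<subseteq> r ` (GalG E - {restrict a E})"
  proof
    fix \<sigma> assume "\<sigma> \<in> GalG F"
    then obtain \<phi> where \<phi>: "\<phi> \<in> AbsGal" "\<sigma> = r (restrict \<phi> E)" unfolding rr by (erule GalGE)
    show "\<sigma> \<in> r ` (GalG E - {restrict a E})"
    proof (cases "restrict \<phi> E = restrict a E")
      case True
      thus ?thesis using \<phi>(2) eq iG ne by auto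
    next
      case False
      thus ?thesis using \<phi> GalGI[OF \<phi>(1), of E] by auto
    qed
  qed
  hence "card (GalG F) \<le> card (GalG E - {restrict a E})"
    using af_finite[OF E] by (intro surj_card_le) auto
  also have "\<dots> < card (GalG E)" by (rule card_Diff1_less[OF af_finite[OF E] aG])
  finally show ?thesis by (simp add: F_def)
qed

text \<open>The Galois correspondence for the cyclic group generated by \<open>a\<close>. A sum over
  the powers of \<open>a\<close> is fixed by \<open>a\<close>, hence by \<open>g\<close>, so the
  powers of \<open>a\<close> and their compositions with \<open>g\<close> have the same sum on
  \<open>E\<close>. By independence of automorphisms the identity occurs on both sides, so
  \<open>g\<close> is inverse to a power of \<open>a\<close>.\<close>

lemma fixed_by_power_fixed:
  assumes E: "abelian_field E" and a: "a \<in> AbsGal" and g: "g \<in> AbsGal" and q: "q > 0"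
    and ex: "\<And>x. x \<in> E \<Longrightarrow> (a ^^ q) x = x"
    and fx: "\<And>x. x \<in> E \<Longrightarrow> a x = x \<Longrightarrow> g x = x"
  shows "\<exists>k. \<forall>x\<in>E. (a ^^ k) x = g x"
proof -
  note alg = af_algebraic[OF E]
  have ak: "(a ^^ k) \<in> AbsGal" for k by (rule AbsGal_funpow[OF a])
  have akE: "(a ^^ k) z \<in> E" if "z \<in> E" for k z by (rule af_stable[OF E ak that])
  have gE: "g z \<in> E" if "z \<in> E" for z by (rule af_stable[OF E g that])
  define A where "A = (\<lambda>k. restrict (a ^^ k) E)"
  define B where "B = (\<lambda>k. restrict (\<lambda>x. g ((a ^^ k) x)) E)"
  \<comment> \<open>The difference of the multiplicities of \<open>\<sigma>\<close> in the two sums.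
    Repetitions occur when the order of \<open>a\<close> is smaller than \<open>q\<close>; the
    positive multiplicity of the identity stays nonzero in the complex numbers.\<close>
  define c where "c = (\<lambda>\<sigma>. (\<Sum>k<q. if A k = \<sigma> then 1 else 0) - (\<Sum>k<q. if B k = \<sigma> then 1 else (0::complex)))"
  have AG: "A k \<in> GalG E" for k unfolding A_def by (rule GalGI[OF ak])
  have BG: "B k \<in> GalG E" for k unfolding B_def by (rule GalGI[OF AbsGal_comp[OF g ak]])
  have sm: "(\<Sum>k<q. g ((a ^^ k) y)) = (\<Sum>k<q. (a ^^ k) y)" if y: "y \<in> E" for y
  proof -
    define t where "t = (\<Sum>k<q. (a ^^ k) y)"
    have "t \<in> E" unfolding t_def by (rule af_sum[OF E akE[OF y]])
    moreover have "a t = t"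
    proof -
      have "a t = (\<Sum>k<q. a ((a ^^ k) y))"
        unfolding t_def by (rule AbsGal_sum[OF a], rule alg[OF akE[OF y]])
      hence "a t + y = (\<Sum>k<Suc q. (a ^^ k) y)"
        by (simp add: sum.lessThan_Suc_shift del: sum.lessThan_Suc)
      also have "\<dots> = t + y" using ex[OF y] by (simp add: t_def)
      finally show ?thesis by simp
    qed
    ultimately have "g t = t" by (rule fx)
    moreover have "g t = (\<Sum>k<q. g ((a ^^ k) y))"
      unfolding t_def by (rule AbsGal_sum[OF g], rule alg[OF akE[OF y]])
    ultimately show ?thesis by (simp add: t_def)
  qed
  have "c (A 0) = 0"
  proof (rule dedekind_independence[where A = "GalG E" and E = E and c = c])
    show "1 \<in> E" by (rule af_1[OF E])
    show "x * y \<in> E" if "x \<in> E" "y \<in> E" for x y by (rule af_mult[OF E that])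
    show "algebraic x" if "x \<in> E" for x by (rule alg[OF that])
    show "finite (GalG E)" "GalG E \<subseteq> GalG E" "A 0 \<in> GalG E" using af_finite[OF E] AG by auto
    fix y assume y: "y \<in> E"
    have one: "(\<Sum>\<sigma>\<in>GalG E. (\<Sum>k<q. if C k = \<sigma> then 1 else 0) * \<sigma> y) = (\<Sum>k<q. C k y)"
      if C: "\<And>k. C k \<in> GalG E" for C :: "nat \<Rightarrow> complex \<Rightarrow> complex"
    proof -
      have "(\<Sum>\<sigma>\<in>GalG E. (\<Sum>k<q. if C k = \<sigma> then 1 else 0) * \<sigma> y)
          = (\<Sum>\<sigma>\<in>GalG E. \<Sum>k<q. if C k = \<sigma> then \<sigma> y else 0)"
        unfolding sum_distrib_right by (intro sum.cong) auto
      also have "\<dots> = (\<Sum>k<q. \<Sum>\<sigma>\<in>GalG E. if C k = \<sigma> then \<sigma> y else 0)" by (rule sum.swap)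
      also have "\<dots> = (\<Sum>k<q. C k y)" using C af_finite[OF E] by (intro sum.cong) auto
      finally show ?thesis .
    qed
    have "(\<Sum>\<sigma>\<in>GalG E. c \<sigma> * \<sigma> y) = (\<Sum>k<q. A k y) - (\<Sum>k<q. B k y)"
      unfolding c_def left_diff_distrib sum_subtractf one[of A, OF AG] one[of B, OF BG] ..
    also have "\<dots> = 0" using sm[OF y] y by (simp add: A_def B_def)
    finally show "(\<Sum>\<sigma>\<in>GalG E. c \<sigma> * \<sigma> y) = 0" .
  qed
  hence "(\<Sum>k<q. if A k = A 0 then 1 else 0) = (\<Sum>k<q. if B k = A 0 then 1 else (0::complex))"
    by (simp add: c_def)
  moreover have "(\<Sum>k<q. if A k = A 0 then 1 else (0::complex)) \<noteq> 0"
  proof -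
    have "card {k\<in>{..<q}. A k = A 0} \<noteq> 0" using q by (auto simp: card_eq_0_iff)
    moreover have "(\<Sum>k<q. if A k = A 0 then 1 else (0::complex)) = of_nat (card {k\<in>{..<q}. A k = A 0})"
      by (simp add: sum.If_cases Int_def)
    ultimately show ?thesis by simp
  qed
  ultimately have "(\<Sum>k<q. if B k = A 0 then 1 else (0::complex)) \<noteq> 0" by simp
  then obtain k where k: "k \<in> {..<q}" "(if B k = A 0 then 1 else (0::complex)) \<noteq> 0"
    by (rule sum.not_neutral_contains_not_neutral)
  hence k: "k < q" "B k = A 0" by (auto split: if_splits)
  have gk: "g ((a ^^ k) x) = x" if "x \<in> E" for x using fun_cong[OF k(2), of x] that by (simp add: A_def B_def)
  have "(a ^^ (q - k)) x = g x" if x: "x \<in> E" for x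
  proof -
    have "(a ^^ (q - k)) x = g ((a ^^ k) ((a ^^ (q - k)) x))" by (rule gk[OF akE[OF x], symmetric])
    also have "(a ^^ k) ((a ^^ (q - k)) x) = x" using ex[OF x] k(1) by (simp flip: comp_apply[of "a ^^ k"] funpow_add)
    finally show ?thesis .
  qed
  thus ?thesis by blast
qed

text \<open>In a minimal subfield on which \<open>g\<close> acts nontrivially, \<open>g\<close> is a power of every nontrivial
  automorphism, which bounds the degree of the subfield.\<close>

lemma minimal_moved:
  assumes E: "abelian_field E" and g: "g \<in> AbsGal" and moved: "x0 \<in> E" "g x0 \<noteq> x0" and q: "q > 0"
    and ex: "\<And>\<phi> x. \<phi> \<in> AbsGal \<Longrightarrow> x \<in> E \<Longrightarrow> (\<phi> ^^ q) x = x"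
  shows "\<exists>F x. abelian_field F \<and> F \<subseteq> E \<and> x \<in> F \<and> g x \<noteq> x \<and>
    (\<forall>a y. a \<in> AbsGal \<longrightarrow> y \<in> F \<longrightarrow> a y \<noteq> y \<longrightarrow> (\<exists>k. \<forall>x\<in>F. (a ^^ k) x = g x))"
proof -
  define good where "good = (\<lambda>F. abelian_field F \<and> F \<subseteq> E \<and> (\<exists>x\<in>F. g x \<noteq> x))"
  have "good E" using E moved by (auto simp: good_def)
  then obtain F where F: "good F" and mn: "\<And>F'. good F' \<Longrightarrow> card (GalG F) \<le> card (GalG F')"
    using ex_has_least_nat[of good E "\<lambda>F. card (GalG F)"] by blast
  have aF: "abelian_field F" and FE: "F \<subseteq> E" using F by (auto simp: good_def)
  obtain x where x: "x \<in> F" "g x \<noteq> x" using F by (auto simp: good_def)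
  have "\<exists>k. \<forall>x\<in>F. (a ^^ k) x = g x" if a: "a \<in> AbsGal" and y: "y \<in> F" "a y \<noteq> y" for a y
  proof (rule fixed_by_power_fixed[OF aF a g q])
    show "(a ^^ q) x = x" if "x \<in> F" for x by (rule ex[OF a subsetD[OF FE that]])
    have "\<not> good {x\<in>F. a x = x}" using mn[of "{x\<in>F. a x = x}"] fixed_subfield_card[OF aF a y] by linarith
    hence "\<forall>x\<in>{x\<in>F. a x = x}. g x = x"
      using fixed_subfield[OF aF a] FE by (auto simp: good_def)
    thus "g x = x" if "x \<in> F" "a x = x" for x using that by simp
  qed
  thus ?thesis using aF FE x by blast
qed

text \<open>Elements with trivial \<open>p\<close>-th power are powers of \<open>g\<close>, so there
  are at most \<open>q\<close> of them. Every \<open>p\<close>-th power is such an element, because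
  \<open>q\<close> divides \<open>p * p\<close>; and two elements with the same \<open>p\<close>-th
  power differ by such an element. Counting both choices gives \<open>q * q\<close>.\<close>

lemma card_le_square:
  assumes p: "Factorial_Ring.prime p" and q: "q = p \<or> q = p\<^sup>2" and F: "abelian_field F"
    and g: "g \<in> AbsGal" and x: "x \<in> F" "g x \<noteq> x"
    and ex: "\<And>\<phi> x. \<phi> \<in> AbsGal \<Longrightarrow> x \<in> F \<Longrightarrow> (\<phi> ^^ q) x = x"
    and cyc: "\<And>a y. a \<in> AbsGal \<Longrightarrow> y \<in> F \<Longrightarrow> a y \<noteq> y \<Longrightarrow> \<exists>k. \<forall>x\<in>F. (a ^^ k) x = g x"
  shows "card (GalG F) \<le> q * q"
proof -
  have ak: "(a ^^ k) \<in> AbsGal" if "a \<in> AbsGal" for a k by (rule AbsGal_funpow[OF that])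
  have akE: "(a ^^ k) z \<in> F" if "a \<in> AbsGal" "z \<in> F" for a k z by (rule af_stable[OF F ak[OF that(1)] that(2)])
  have period: "(a ^^ (k mod n)) x = (a ^^ k) x"
    if h: "\<And>x. x \<in> F \<Longrightarrow> (a ^^ n) x = x" and x: "x \<in> F" for a k n x
  proof -
    have "((a ^^ n) ^^ j) x = x" for j using h[OF x] by (induction j) auto
    hence "(a ^^ (n * (k div n))) x = x" by (simp add: funpow_mult)
    hence "(a ^^ (k mod n)) ((a ^^ (n * (k div n))) x) = (a ^^ (k mod n)) x" by simp
    thus ?thesis by (simp flip: comp_apply[of "a ^^ (k mod n)"] funpow_add)
  qed
  have q0: "q > 0" using p q prime_gt_0_nat by auto
  have pp: "(a ^^ (p * p)) x = x" if "a \<in> AbsGal" "x \<in> F" for a x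
  proof -
    have "q dvd p * p" using q by (auto simp: power2_eq_square)
    hence "p * p mod q = 0" by simp
    thus ?thesis using period[of q a x "p * p", OF ex[OF that(1)] that(2)] by simp
  qed
  have tors: "\<exists>j<q. \<forall>x\<in>F. a x = (g ^^ j) x" if a: "a \<in> AbsGal" and ap: "\<And>x. x \<in> F \<Longrightarrow> (a ^^ p) x = x" for a
  proof (cases "\<forall>y\<in>F. a y = y")
    case True
    thus ?thesis using q0 by (intro exI[of _ 0]) auto
  next
    case False
    then obtain y where y: "y \<in> F" "a y \<noteq> y" by blast
    obtain k where k: "\<And>x. x \<in> F \<Longrightarrow> (a ^^ k) x = g x" using cyc[OF a y] by blast
    \<comment> \<open>Otherwise \<open>g\<close>, being the \<open>k\<close>-th power of
      \<open>a\<close>, would fix \<open>x\<close>. So \<open>k\<close> is invertible modulo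
      \<open>p\<close>, and \<open>a\<close> is in turn a power of \<open>g\<close>.\<close>
    have "\<not> p dvd k"
    proof
      assume "p dvd k"
      hence "(a ^^ (k mod p)) x = x" by simp
      thus False using period[of p a x k, OF ap x(1)] k[OF x(1)] x(2) by simp
    qed
    hence "Rings.coprime k p" using prime_imp_coprime[OF p] by (simp add: coprime_commute)
    then obtain k' where k': "[k * k' = Suc 0] (mod p)" using cong_solve_coprime_nat[of k p] by blast
    have gpow: "(g ^^ j) x = (a ^^ (k * j)) x" if "x \<in> F" for j x
      using that
    proof (induction j arbitrary: x)
      case (Suc j)
      have "(g ^^ Suc j) x = (g ^^ j) (g x)" by (simp add: funpow_swap1)
      also have "g x = (a ^^ k) x" using k[OF Suc.prems] by simp
      also have "(g ^^ j) ((a ^^ k) x) = (a ^^ (k * j)) ((a ^^ k) x)" by (rule Suc.IH[OF akE[OF a Suc.prems]])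
      also have "\<dots> = (a ^^ (k * Suc j)) x"
        by (simp add: add.commute flip: comp_apply[of "a ^^ (k * j)"] funpow_add)
      finally show ?case .
    qed simp
    have "a x = (g ^^ (k' mod q)) x" if x: "x \<in> F" for x
    proof -
      have "(g ^^ (k' mod q)) x = (g ^^ k') x" by (rule period[OF ex[OF g] x])
      also have "\<dots> = (a ^^ (k * k')) x" by (rule gpow[OF x])
      also have "\<dots> = (a ^^ (k * k' mod p)) x" by (rule period[OF ap x, symmetric])
      also have "k * k' mod p = 1" using k' prime_gt_1_nat[OF p] by (simp add: cong_def)
      finally show ?thesis by simp
    qed
    thus ?thesis using q0 by (intro exI[of _ "k' mod q"]) auto
  qed
  have comp_pow: "((\<lambda>x. a (b x)) ^^ n) x = (a ^^ n) ((b ^^ n) x)"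
    if ab: "a \<in> AbsGal" "b \<in> AbsGal" and x: "x \<in> F" for a b n x
  proof (induction n)
    case (Suc n)
    have "((\<lambda>x. a (b x)) ^^ Suc n) x = a (b ((a ^^ n) ((b ^^ n) x)))" by (simp add: Suc.IH)
    also have "b ((a ^^ n) ((b ^^ n) x)) = (a ^^ n) (b ((b ^^ n) x))"
      by (rule af_comm[OF F ab(2) ak[OF ab(1)] akE[OF ab(2) x]])
    finally show ?case by simp
  qed simp
  define root where "root = (\<lambda>i b. b \<in> AbsGal \<and> (\<forall>x\<in>F. (b ^^ p) x = (g ^^ i) x))"
  define s where "s = (\<lambda>i. SOME b. root i b)"
  have "GalG F \<subseteq> (\<lambda>(i, j). restrict (\<lambda>x. s i ((g ^^ j) x)) F) ` ({..<q} \<times> {..<q})"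
  proof
    fix \<sigma> assume "\<sigma> \<in> GalG F"
    then obtain a where a: "a \<in> AbsGal" and \<sigma>: "\<sigma> = restrict a F" by (erule GalGE)
    obtain i where i: "i < q" "\<And>x. x \<in> F \<Longrightarrow> (a ^^ p) x = (g ^^ i) x"
      using tors[OF ak[OF a, of p]] pp[OF a] by (auto simp: funpow_mult)
    have "root i a" using a i(2) by (simp add: root_def)
    hence "root i (s i)" unfolding s_def using someI[of "root i" a] by simp
    hence b: "s i \<in> AbsGal" "\<And>x. x \<in> F \<Longrightarrow> (s i ^^ p) x = (g ^^ i) x" by (auto simp: root_def)
    \<comment> \<open>The inverse of the chosen \<open>p\<close>-th root \<open>s i\<close>, written
      as a power of it; composed with \<open>a\<close> it has trivial \<open>p\<close>-th
      power.\<close>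
    define b' where "b' = (s i ^^ (p * p - 1))"
    have pp1: "p * p = Suc (p * p - 1)" using prime_gt_0_nat[OF p] by simp
    have b'G: "b' \<in> AbsGal" unfolding b'_def by (rule ak[OF b(1)])
    have sb': "s i (b' x) = x" if "x \<in> F" for x
      using pp[OF b(1) that] by (subst (asm) pp1) (simp add: b'_def)
    have cG: "(\<lambda>x. a (b' x)) \<in> AbsGal" by (rule AbsGal_comp[OF a b'G])
    have "((\<lambda>x. a (b' x)) ^^ p) x = x" if x: "x \<in> F" for x
    proof -
      have "((\<lambda>x. a (b' x)) ^^ p) x = (a ^^ p) ((b' ^^ p) x)" by (rule comp_pow[OF a b'G x])
      also have "\<dots> = (g ^^ i) ((b' ^^ p) x)" by (rule i(2)[OF akE[OF b'G x]])
      also have "\<dots> = (s i ^^ p) ((b' ^^ p) x)" by (rule b(2)[OF akE[OF b'G x], symmetric])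
      also have "\<dots> = ((\<lambda>x. s i (b' x)) ^^ p) x" by (rule comp_pow[OF b(1) b'G x, symmetric])
      also have "\<dots> = x"
      proof -
        have "((\<lambda>x. s i (b' x)) ^^ n) x = x" for n by (induction n) (simp_all add: sb'[OF x])
        thus ?thesis .
      qed
      finally show ?thesis .
    qed
    then obtain j where j: "j < q" "\<And>x. x \<in> F \<Longrightarrow> a (b' x) = (g ^^ j) x" using tors[OF cG] by blast
    have "a x = s i ((g ^^ j) x)" if x: "x \<in> F" for x
    proof -
      have "s i ((g ^^ j) x) = s i (a (b' x))" using j(2)[OF x] by simp
      also have "\<dots> = a (s i (b' x))" by (rule af_comm[OF F b(1) a af_stable[OF F b'G x]])
      finally show ?thesis using sb'[OF x] by simp
    qed
    hence "\<sigma> = restrict (\<lambda>x. s i ((g ^^ j) x)) F" unfolding \<sigma> by (intro restrict_ext)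
    thus "\<sigma> \<in> (\<lambda>(i, j). restrict (\<lambda>x. s i ((g ^^ j) x)) F) ` ({..<q} \<times> {..<q})"
      using i(1) j(1) by force
  qed
  hence "card (GalG F) \<le> card ({..<q} \<times> {..<q})" by (rule surj_card_le[rotated]) simp
  thus ?thesis by simp
qed

section \<open>Finitely many witnesses for all automorphisms\<close>

text \<open>Algebraic integers of bounded degree and bounded coefficients; the set is finite and
  refers to no field.\<close>

definition bounded_roots :: "nat \<Rightarrow> int \<Rightarrow> complex set" where
  "bounded_roots N M = {x. \<exists>n\<le>N. \<exists>c. (\<forall>k<n. \<bar>c k\<bar> \<le> M) \<and> x ^ n = (\<Sum>k<n. of_int (c k) * x ^ k)}"

lemma bounded_roots_algebraic_int: "x \<in> bounded_roots N M \<Longrightarrow> algebraic_int x"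
  unfolding bounded_roots_def by (auto intro: algebraic_int_powI)

lemma finite_bounded_roots: "finite (bounded_roots N M)"
proof -
  define Z where "Z = (\<lambda>n (c :: nat \<Rightarrow> int). {x :: complex. x ^ n = (\<Sum>k<n. of_int (c k) * x ^ k)})"
  have "finite (Z n c)" for n c
  proof -
    define f :: "complex poly" where
      "f = Polynomial.monom 1 n - (\<Sum>k<n. Polynomial.monom (of_int (c k)) k)"
    have "Polynomial.coeff f n = 1" by (simp add: f_def Polynomial.coeff_sum)
    hence "f \<noteq> 0" by auto
    moreover have "Z n c = {x. poly f x = 0}" by (simp add: Z_def f_def poly_monom poly_sum)
    ultimately show ?thesis using poly_roots_finite by simp
  qed
  moreover have "bounded_roots N M \<subseteq> (\<Union>n\<in>{..N}. \<Union>c\<in>PiE {..<n} (\<lambda>_. {-M..M}). Z n c)"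
  proof
    fix x assume "x \<in> bounded_roots N M"
    then obtain n c where nc: "n \<le> N" "\<And>k. k < n \<Longrightarrow> \<bar>c k\<bar> \<le> M" "x ^ n = (\<Sum>k<n. of_int (c k) * x ^ k)"
      by (auto simp: bounded_roots_def)
    have "restrict c {..<n} \<in> PiE {..<n} (\<lambda>_. {-M..M})" using nc(2) by fastforce
    moreover have "x \<in> Z n (restrict c {..<n})" using nc(3) by (simp add: Z_def)
    ultimately show "x \<in> (\<Union>n\<in>{..N}. \<Union>c\<in>PiE {..<n} (\<lambda>_. {-M..M}). Z n c)" using nc(1) by blast
  qed
  moreover have "finite (\<Union>n\<in>{..N}. \<Union>c\<in>PiE {..<n} (\<lambda>_. {-M..M}). Z n c)"
    using calculation(1) by (intro finite_UN_I finite_PiE) auto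
  ultimately show ?thesis by (metis finite_subset)
qed

text \<open>The coefficients of the characteristic polynomial are integers, each a sum of at most
  \<open>2 ^ N\<close> products of at most \<open>N\<close> conjugates.\<close>

lemma bounded_rootsI:
  assumes E: "abelian_field E" and x: "x \<in> E" "algebraic_int x" and N: "card (GalG E) \<le> N"
    and R: "R \<ge> 1" "\<And>\<phi>. \<phi> \<in> AbsGal \<Longrightarrow> norm (\<phi> x) \<le> R"
  shows "x \<in> bounded_roots N \<lfloor>2 ^ N * R ^ N\<rfloor>"
proof -
  define G where "G = GalG E"
  define n where "n = card G"
  have fG: "finite G" unfolding G_def by (rule af_finite[OF E])
  have sb: "norm (\<sigma> x) \<le> R" if "\<sigma> \<in> G" for \<sigma>
    using that R(2) x(1) by (auto simp: G_def elim!: GalGE)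
  have "\<forall>k. \<exists>m. esym G k x = of_int m"
  proof
    fix k
    have e: "esym G k x \<in> E" unfolding G_def by (rule esym_mem[OF E subset_refl x(1)])
    have fixed: "\<phi> (esym G k x) = esym G k x" if "\<phi> \<in> AbsGal" for \<phi>
      unfolding G_def by (rule AbsGal_esym[OF E subset_refl that x(1) af_bij[OF E that]])
    have "esym G k x \<in> \<rat>" by (rule AbsGal_fixed_imp_Rats[OF af_algebraic[OF E e]]) (rule fixed)
    moreover have "algebraic_int (esym G k x)" unfolding G_def by (rule esym_algebraic_int[OF E subset_refl x])
    ultimately have "esym G k x \<in> \<int>" by (intro rational_algebraic_int_is_int)
    thus "\<exists>m. esym G k x = of_int m" by (auto elim: Ints_cases)
  qed
  from choice[OF this] obtain m where m: "\<And>k. esym G k x = of_int (m k)" by blast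
  have mb: "\<bar>m k\<bar> \<le> \<lfloor>2 ^ N * R ^ N\<rfloor>" if k: "k \<le> n" for k
  proof -
    have "norm (esym G k x) \<le> (\<Sum>A | A \<subseteq> G \<and> card A = k. norm (\<Prod>\<sigma>\<in>A. \<sigma> x))"
      unfolding esym_def[OF E] by (rule norm_sum)
    also have "\<dots> \<le> (\<Sum>A | A \<subseteq> G \<and> card A = k. R ^ k)"
    proof (rule sum_mono)
      fix A assume A: "A \<in> {A. A \<subseteq> G \<and> card A = k}"
      have "(\<Prod>\<sigma>\<in>A. norm (\<sigma> x)) \<le> R ^ k"
        using A sb R(1) by (intro prod_le_power) auto
      thus "norm (\<Prod>\<sigma>\<in>A. \<sigma> x) \<le> R ^ k" by (simp add: prod_norm)
    qed
    also have "\<dots> = real (card {A. A \<subseteq> G \<and> card A = k}) * R ^ k" by simp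
    also have "\<dots> \<le> 2 ^ N * R ^ N"
    proof (rule mult_mono)
      have "card {A. A \<subseteq> G \<and> card A = k} \<le> card (Pow G)" using fG by (intro card_mono) auto
      also have "\<dots> = 2 ^ n" using fG by (simp add: card_Pow n_def)
      also have "\<dots> \<le> 2 ^ N" using N by (intro power_increasing) (auto simp: n_def G_def)
      finally show "real (card {A. A \<subseteq> G \<and> card A = k}) \<le> 2 ^ N"
        by (metis of_nat_le_iff of_nat_numeral of_nat_power)
      show "R ^ k \<le> R ^ N" using k N R(1) by (intro power_increasing) (auto simp: n_def G_def)
    qed (use R(1) in auto)
    finally have "real_of_int \<bar>m k\<bar> \<le> 2 ^ N * R ^ N" by (simp add: m)
    thus ?thesis by (simp add: le_floor_iff)
  qed
  have "{A. A \<subseteq> G \<and> card A = 0} = {{}}" using finite_subset[OF _ fG] by auto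
  hence e0: "esym G 0 x = 1" by (simp add: esym_def[OF E])
  have "(\<Prod>\<sigma>\<in>G. x - \<sigma> x) = 0"
  proof (rule prod_zero[OF fG])
    show "\<exists>\<sigma>\<in>G. x - \<sigma> x = 0"
      using GalGI[OF AbsGal_id, of E] x(1) by (intro bexI[of _ "restrict (\<lambda>x. x) E"]) (auto simp: G_def)
  qed
  hence "0 = (\<Sum>k\<le>n. (-1) ^ k * esym G k x * x ^ (n - k))"
    using prod_diff_esym[OF E fG, of x x] by (simp add: n_def)
  also have "\<dots> = (\<Sum>i\<le>n. (-1) ^ (n - i) * esym G (n - i) x * x ^ i)"
    by (rule sum.reindex_bij_witness[where i = "\<lambda>i. n - i" and j = "\<lambda>i. n - i"]) auto
  also have "\<dots> = x ^ n + (\<Sum>i<n. (-1) ^ (n - i) * esym G (n - i) x * x ^ i)"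
    using e0 by (simp flip: lessThan_Suc_atMost)
  also have "(\<Sum>i<n. (-1) ^ (n - i) * esym G (n - i) x * x ^ i)
      = - (\<Sum>i<n. of_int (- ((-1) ^ (n - i) * m (n - i))) * x ^ i)"
    unfolding sum_negf[symmetric] by (rule sum.cong[OF refl]) (simp add: m)
  finally have "x ^ n = (\<Sum>i<n. of_int (- ((-1) ^ (n - i) * m (n - i))) * x ^ i)" by simp
  moreover have "\<forall>k<n. \<bar>- ((-1) ^ (n - k) * m (n - k))\<bar> \<le> \<lfloor>2 ^ N * R ^ N\<rfloor>"
    using mb by (simp add: abs_mult)
  moreover have "n \<le> N" using N by (simp add: n_def G_def)
  ultimately show ?thesis
    unfolding bounded_roots_def mem_Collect_eq by (intro exI[of _ n] conjI exI[of _ "\<lambda>i. - ((-1) ^ (n - i) * m (n - i))"])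
qed

text \<open>The bound of \<open>small_moved\<close> inserted into \<open>bounded_rootsI\<close>,
  coarsened to depend on \<open>l0\<close> and \<open>N\<close> alone: the square root of
  \<open>2 ^ N\<close> is replaced by \<open>2 ^ N\<close> and the factor \<open>q\<close> by
  \<open>N\<close>.\<close>

definition witnesses :: "nat \<Rightarrow> nat \<Rightarrow> complex set" where
  "witnesses l0 N = bounded_roots N \<lfloor>2 ^ N * (2 ^ N * real (ram_bound l0 N * N)) ^ N\<rfloor>"

text \<open>The search takes place in a subfield of degree at most \<open>q * q\<close>, so the
  bound on the moved integer is independent of the degree of \<open>E\<close>.\<close>

lemma witness_moved:
  assumes p: "Factorial_Ring.prime p" and q: "q = p \<or> q = p\<^sup>2" and E: "abelian_field E" and R: "E \<subseteq> \<real>"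
    and ex: "\<And>\<phi> x. \<phi> \<in> AbsGal \<Longrightarrow> x \<in> E \<Longrightarrow> (\<phi> ^^ q) x = x"
    and ur: "unramified_above l0 E" and g: "g \<in> AbsGal" and moved: "x0 \<in> E" "g x0 \<noteq> x0"
  shows "\<exists>x\<in>E \<inter> witnesses l0 (q * q). g x \<noteq> x"
proof -
  have q0: "q > 0" by (rule q_pos[OF p q])
  obtain F y where F: "abelian_field F" and FE: "F \<subseteq> E" and y: "y \<in> F" "g y \<noteq> y"
    and cyc: "\<forall>a y. a \<in> AbsGal \<longrightarrow> y \<in> F \<longrightarrow> a y \<noteq> y \<longrightarrow> (\<exists>k. \<forall>x\<in>F. (a ^^ k) x = g x)"
    using minimal_moved[OF E g moved q0 ex] by blast
  have exF: "(\<phi> ^^ q) x = x" if "\<phi> \<in> AbsGal" "x \<in> F" for \<phi> x by (rule ex[OF that(1) subsetD[OF FE that(2)]])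
  have cF: "card (GalG F) \<le> q * q"
    by (rule card_le_square[OF p q F g y]) (use exF cyc in \<open>simp_all\<close>)
  define D where "D = real (ram_bound l0 (q * q) * q)"
  have D1: "D \<ge> 1"
  proof -
    have "ram_bound l0 (q * q) * q > 0" using ram_bound_pos q0 by simp
    hence "ram_bound l0 (q * q) * q \<ge> 1" by linarith
    thus ?thesis unfolding D_def by (metis of_nat_1 of_nat_le_iff)
  qed
  obtain x where x: "x \<in> F" "algebraic_int x" "g x \<noteq> x"
    and xb: "\<And>\<phi>. \<phi> \<in> AbsGal \<Longrightarrow> (norm (\<phi> x))\<^sup>2 \<le> 2 ^ (q * q) * D\<^sup>2"
    using small_moved[OF F subset_trans[OF FE R] g q0 exF[OF g] unramified_above_sub[OF E F FE ur] y cF]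
    by (auto simp: D_def)
  have "x \<in> witnesses l0 (q * q)"
    unfolding witnesses_def
  proof (rule bounded_rootsI[OF F x(1,2) cF])
    define R' where "R' = 2 ^ (q * q) * real (ram_bound l0 (q * q) * (q * q))"
    have DR: "2 ^ (q * q) * D \<le> R'"
    proof -
      have "D \<le> real (ram_bound l0 (q * q) * (q * q))" unfolding D_def of_nat_le_iff using q0 by simp
      thus ?thesis by (simp add: R'_def)
    qed
    have one: "(1 :: real) \<le> 2 ^ (q * q)" by (rule one_le_power) simp
    have "1 * 1 \<le> 2 ^ (q * q) * D" using one D1 by (intro mult_mono) auto
    thus "R' \<ge> 1" using DR by simp
    fix \<phi> assume \<phi>: "\<phi> \<in> AbsGal"
    have "(norm (\<phi> x))\<^sup>2 \<le> 2 ^ (q * q) * D\<^sup>2" by (rule xb[OF \<phi>])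
    also have "\<dots> \<le> (2 ^ (q * q))\<^sup>2 * D\<^sup>2"
      using one by (intro mult_right_mono self_le_power) auto
    also have "\<dots> = (2 ^ (q * q) * D)\<^sup>2" by (simp add: power_mult_distrib)
    finally have "norm (\<phi> x) \<le> 2 ^ (q * q) * D" by (rule power2_le_imp_le) (use D1 in simp)
    thus "norm (\<phi> x) \<le> R'" using DR by linarith
  qed
  thus ?thesis using x FE by blast
qed

text \<open>The substitute for Hermite's theorem: a nontrivial quotient of two automorphisms moves a
  witness in \<open>E\<close>, so restriction to a finite set that does not depend on
  \<open>E\<close> is injective, and the degree is bounded without any prior bound on it.\<close>

lemma GalG_card_le_witnesses:
  assumes p: "Factorial_Ring.prime p" and q: "q = p \<or> q = p\<^sup>2" and E: "abelian_field E" and R: "E \<subseteq> \<real>"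
    and ex: "\<And>\<phi> x. \<phi> \<in> AbsGal \<Longrightarrow> x \<in> E \<Longrightarrow> (\<phi> ^^ q) x = x"
    and ur: "unramified_above l0 E"
  shows "card (GalG E) \<le> card (GalG (witnesses l0 (q * q)))"
proof -
  define Y where "Y = witnesses l0 (q * q)"
  have fY: "finite (GalG Y)"
    unfolding Y_def witnesses_def using bounded_roots_algebraic_int
    by (intro GalG_finite_set finite_bounded_roots) blast
  have rr: "restrict (restrict \<phi> E) (E \<inter> Y) = restrict \<phi> (E \<inter> Y)" for \<phi> :: "complex \<Rightarrow> complex"
    by (auto simp: restrict_def fun_eq_iff)
  have inj: "inj_on (\<lambda>\<sigma>. restrict \<sigma> (E \<inter> Y)) (GalG E)"
  proof (rule inj_onI)
    fix \<sigma> \<tau> assume s: "\<sigma> \<in> GalG E" "\<tau> \<in> GalG E" and eq: "restrict \<sigma> (E \<inter> Y) = restrict \<tau> (E \<inter> Y)"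
    obtain \<phi> where \<phi>: "\<phi> \<in> AbsGal" "\<sigma> = restrict \<phi> E" using GalGE[OF s(1)] by blast
    obtain \<psi> where \<psi>: "\<psi> \<in> AbsGal" "\<tau> = restrict \<psi> E" using GalGE[OF s(2)] by blast
    obtain \<psi>' where \<psi>': "\<psi>' \<in> AbsGal" and inv: "\<And>x. x \<in> E \<Longrightarrow> \<psi> (\<psi>' x) = x" "\<And>x. x \<in> E \<Longrightarrow> \<psi>' (\<psi> x) = x"
      using af_inverse[OF E \<psi>(1)] by metis
    show "\<sigma> = \<tau>"
    proof (rule ccontr)
      assume "\<sigma> \<noteq> \<tau>"
      then obtain x where x: "x \<in> E" "\<phi> x \<noteq> \<psi> x" unfolding \<phi>(2) \<psi>(2) by (metis restrict_ext)
      have "\<psi>' (\<phi> x) \<noteq> x"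
      proof
        assume "\<psi>' (\<phi> x) = x"
        hence "\<psi> (\<psi>' (\<phi> x)) = \<psi> x" by simp
        thus False using inv(1)[OF af_stable[OF E \<phi>(1) x(1)]] x(2) by simp
      qed
      then obtain z where z: "z \<in> E \<inter> Y" "\<psi>' (\<phi> z) \<noteq> z"
        using witness_moved[OF p q E R ex ur AbsGal_comp[OF \<psi>' \<phi>(1)] x(1)] by (auto simp: Y_def)
      have "\<phi> z = \<psi> z" using fun_cong[OF eq, of z] z(1) by (simp add: \<phi>(2) \<psi>(2))
      thus False using z inv(2)[of z] by simp
    qed
  qed
  have im: "(\<lambda>\<sigma>. restrict \<sigma> (E \<inter> Y)) ` GalG E \<subseteq> GalG (E \<inter> Y)"
  proof
    fix \<rho> assume "\<rho> \<in> (\<lambda>\<sigma>. restrict \<sigma> (E \<inter> Y)) ` GalG E"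
    then obtain \<phi> where "\<phi> \<in> AbsGal" "\<rho> = restrict \<phi> (E \<inter> Y)" by (auto elim!: GalGE simp: rr)
    thus "\<rho> \<in> GalG (E \<inter> Y)" using GalGI by simp
  qed
  have s: "finite (GalG (E \<inter> Y)) \<and> card (GalG (E \<inter> Y)) \<le> card (GalG Y)"
    by (rule GalG_subset_card[OF _ fY]) simp
  hence "card (GalG E) \<le> card (GalG (E \<inter> Y))" using card_inj_on_le[OF inj im] by simp
  thus ?thesis using s by (simp add: Y_def)
qed

section \<open>The part of the compositum fixed by inertia\<close>

text \<open>A single finite \<open>S\<close> suffices for membership, since inertia for a larger
  compositum is smaller and still fixes \<open>x\<close>. For the same reason finitely many members
  lie in one common inertia field.\<close>

definition unramified_part :: "nat \<Rightarrow> complex set \<Rightarrow> complex set" where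
  "unramified_part q P = {x. \<exists>S. finite S \<and> S \<subseteq> TRG q \<and> x \<in> comp_field q S \<and>
     (\<forall>\<phi>\<in>inertia P (comp_field q S). \<phi> x = x)}"

lemma unramified_part_finite:
  assumes p: "Factorial_Ring.prime p" and q: "q = p \<or> q = p\<^sup>2"
    and l: "Factorial_Ring.prime l" and P: "alg_prime P" and lP: "of_nat l \<in> P"
    and A: "finite A" "A \<subseteq> unramified_part q P"
  shows "\<exists>S. finite S \<and> S \<subseteq> TRG q \<and> A \<subseteq> fixI P (comp_field q S)"
  using A
proof (induction A rule: finite_induct)
  case empty
  show ?case by (intro exI[of _ "{}"]) auto
next
  case (insert a A)
  note mono = comp_field_mono[OF p q] and abel = comp_field_abelian[OF p q]
  obtain S where S: "finite S" "S \<subseteq> TRG q" "A \<subseteq> fixI P (comp_field q S)" using insert by auto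
  obtain T where T: "finite T" "T \<subseteq> TRG q" "a \<in> comp_field q T"
    and aT: "\<And>\<phi>. \<phi> \<in> inertia P (comp_field q T) \<Longrightarrow> \<phi> a = a"
    using insert.prems by (auto simp: unramified_part_def)
  have ST: "finite (S \<union> T)" "S \<union> T \<subseteq> TRG q" using S T by auto
  have "x \<in> fixI P (comp_field q (S \<union> T))" if x: "x \<in> insert a A" for x
  proof (cases "x = a")
    case True
    have "x \<in> comp_field q (S \<union> T)" using subsetD[OF mono[of T "S \<union> T"] T(3)] True by simp
    moreover have "\<phi> x = x" if "\<phi> \<in> inertia P (comp_field q (S \<union> T))" for \<phi>
      using aT[OF subsetD[OF inertia_mono[OF l P lP mono[of T "S \<union> T"]] that]] True by simp
    ultimately show ?thesis by (simp add: fixI_def[OF l P lP abel[OF ST]])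
  next
    case False
    hence x': "x \<in> comp_field q S" "\<And>\<phi>. \<phi> \<in> inertia P (comp_field q S) \<Longrightarrow> \<phi> x = x"
      using x S(3) by (auto simp: fixI_def[OF l P lP abel[OF S(1,2)]])
    have "x \<in> comp_field q (S \<union> T)" using subsetD[OF mono[of S "S \<union> T"] x'(1)] by simp
    moreover have "\<phi> x = x" if "\<phi> \<in> inertia P (comp_field q (S \<union> T))" for \<phi>
      using x'(2)[OF subsetD[OF inertia_mono[OF l P lP mono[of S "S \<union> T"]] that]] by simp
    ultimately show ?thesis by (simp add: fixI_def[OF l P lP abel[OF ST]])
  qed
  thus ?case using ST by blast
qed

text \<open>Otherwise any finitely many elements of \<open>K\<close> generate a field unramified
  above \<open>l0\<close>, whose degree is at most the number \<open>N\<close> of embeddings of the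
  witnesses; but \<open>K\<close> contains \<open>Suc N\<close> independent elements.\<close>

lemma ramified_prime_exists:
  assumes p: "Factorial_Ring.prime p" and q: "q = p \<or> q = p\<^sup>2"
    and K: "subfield K complex_ring" "K \<subseteq> totally_real_galois_compositum q"
      "\<not> ring.finite_dimension complex_ring \<rat> K"
    and P: "\<And>l. Factorial_Ring.prime l \<Longrightarrow> alg_prime (P l) \<and> of_nat l \<in> P l"
  shows "\<exists>l. Factorial_Ring.prime l \<and> l > l0 \<and> \<not> K \<subseteq> unramified_part q (P l)"
proof (rule ccontr)
  assume contra: "\<not> ?thesis"
  define N where "N = card (GalG (witnesses l0 (q * q)))"
  obtain u where u: "rat_independent (Suc N) u" "\<And>i. i < Suc N \<Longrightarrow> u i \<in> K"
    using infinite_dimension_independent[OF K(1,3), of "Suc N"] by blast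
  define A where "A = u ` {..<Suc N}"
  have A: "finite A" "A \<subseteq> K" using u(2) by (auto simp: A_def)
  obtain S where S: "finite S" "S \<subseteq> TRG q" and AS: "A \<subseteq> qfield (\<Union>S)"
    using compositum_cover_finite[OF p q A(1) subset_trans[OF A(2) K(2)]] by blast
  define E where "E = qfield A"
  note CF = comp_field_abelian[OF p q S]
  have AC: "A \<subseteq> comp_field q S" by (rule subset_trans[OF AS Union_field_subset[OF p q S]])
  have E: "abelian_field E" unfolding E_def by (rule abelian_field_sub(1)[OF CF AC])
  have AE: "A \<subseteq> E"
  proof
    fix x assume x: "x \<in> A"
    show "x \<in> E" unfolding E_def by (rule qfield_base[OF x af_algebraic[OF CF subsetD[OF AC x]]])
  qed
  have ES: "E \<subseteq> qfield (\<Union>S)" unfolding E_def by (rule qfield_least[OF AS])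
  have R: "E \<subseteq> \<real>"
  proof
    fix x assume "x \<in> E"
    thus "x \<in> \<real>" using Union_field_real[OF p q S] ES by blast
  qed
  have ex: "(\<phi> ^^ q) x = x" if \<phi>: "\<phi> \<in> AbsGal" and x: "x \<in> E" for \<phi> x
  proof (rule qfieldD[OF subsetD[OF ES x] AbsGal_funpow[OF \<phi>] AbsGal_id])
    fix y assume "y \<in> \<Union>S"
    then obtain F where F: "F \<in> TRG q" "y \<in> F" using S(2) by blast
    show "(\<phi> ^^ q) y = y" by (rule TRG_exponent[OF p q F(1) \<phi> F(2)])
  qed
  have ur: "unramified_above l0 E"
    unfolding unramified_above_def
  proof (intro allI impI)
    fix l v assume l: "Factorial_Ring.prime l" "l > l0" and v: "v \<in> E" "algebraic_int v"
      and h: "\<forall>w. w \<in> E \<longrightarrow> algebraic_int w \<longrightarrow> l intdvd tr E (v * w)"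
    have Pl: "alg_prime (P l)" "of_nat l \<in> P l" using P[OF l(1)] by auto
    have "A \<subseteq> unramified_part q (P l)" using contra l A(2) by blast
    then obtain T where T: "finite T" "T \<subseteq> TRG q" "A \<subseteq> fixI (P l) (comp_field q T)"
      using unramified_part_finite[OF p q l(1) Pl A(1)] by blast
    define I where "I = fixI (P l) (comp_field q T)"
    note CT = comp_field_abelian[OF p q T(1,2)]
    have I: "abelian_field I" unfolding I_def by (rule fixI_abelian[OF l(1) Pl CT])
    have EI: "E \<subseteq> I"
      using qfield_least[of A I] af_qfield[OF I] T(3) by (simp add: E_def I_def)
    \<comment> \<open>\<open>E\<close> lies in an inertia field, whose trace form is perfect at
      \<open>l\<close>; the relative trace carries the hypothesis from \<open>E\<close> up to that
      field.\<close>
    show "l intdvd v"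
    proof (rule unramified_trace[OF l(1) Pl CT], unfold I_def[symmetric])
      show "v \<in> I" using EI v by blast
      show "algebraic_int v" by (rule v(2))
      fix w assume w: "w \<in> I" "algebraic_int w"
      obtain w' where "w' \<in> E" "algebraic_int w'" "tr I (v * w) = tr E (v * w')"
        using trace_tower[OF E I EI v(1) w] by blast
      thus "l intdvd tr I (w * v)" using h by (simp add: mult.commute[of w v])
    qed
  qed
  have "Suc N \<le> card (GalG E)"
  proof (rule artin_bound[OF af_algebraic[OF E] af_finite[OF E] u(1)])
    show "u i \<in> E" if "i < Suc N" for i using AE that by (auto simp: A_def)
  qed
  also have "\<dots> \<le> N" unfolding N_def by (rule GalG_card_le_witnesses[OF p q E R ex ur])
  finally show False by simp
qed

section \<open>Quadratic lattices\<close>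

lemma totally_positive_iff:
  "totally_positive x \<longleftrightarrow> algebraic x \<and> (\<forall>\<phi>\<in>AbsGal. \<phi> x \<in> \<real> \<and> 0 < Re (\<phi> x))"
  unfolding totally_positive_def using conjugates_eq_orbit[of x] by auto

lemma house_bound:
  assumes "finite A" "\<And>x. x \<in> A \<Longrightarrow> algebraic x"
  shows "\<exists>n::nat. \<forall>x\<in>A. \<forall>\<phi>\<in>AbsGal. norm (\<phi> x) \<le> real n"
proof -
  define c where "c = Max (insert 0 (norm ` (\<Union>x\<in>A. conjugates x)))"
  have fin: "finite (insert 0 (norm ` (\<Union>x\<in>A. conjugates x)))"
    using assms finite_conjugates by blast
  have "norm (\<phi> x) \<le> real (nat \<lceil>c\<rceil>)" if "x \<in> A" "\<phi> \<in> AbsGal" for x \<phi>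
  proof -
    have "norm (\<phi> x) \<in> insert 0 (norm ` (\<Union>x\<in>A. conjugates x))"
      using that AbsGal_in_conjugates[OF assms(2)[OF that(1)] that(2)] by blast
    hence "norm (\<phi> x) \<le> c" unfolding c_def using fin by (intro Max_ge)
    thus ?thesis by linarith
  qed
  thus ?thesis by blast
qed

text \<open>Used contrapositively: clearing a denominator or adding an integer does not lead from
  outside the unramified part into it.\<close>

lemma unramified_part_affine:
  assumes p: "Factorial_Ring.prime p" and q: "q = p \<or> q = p\<^sup>2"
    and l: "Factorial_Ring.prime l" and P: "alg_prime P" and lP: "of_nat l \<in> P"
    and x: "of_nat n * x + of_int t \<in> unramified_part q P" and n: "n > (0::nat)"
  shows "x \<in> unramified_part q P"
proof -
  obtain S where S: "finite S" "S \<subseteq> TRG q" and y: "of_nat n * x + of_int t \<in> comp_field q S"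
    and fx: "\<And>\<phi>. \<phi> \<in> inertia P (comp_field q S) \<Longrightarrow> \<phi> (of_nat n * x + of_int t) = of_nat n * x + of_int t"
    using x by (auto simp: unramified_part_def)
  note E = comp_field_abelian[OF p q S]
  have e: "x = (of_nat n * x + of_int t - of_int t) / of_nat n" using n by simp
  have xE: "x \<in> comp_field q S"
    by (subst e) (rule af_divide[OF E af_diff[OF E y af_of_int[OF E]] af_of_nat[OF E]])
  have "\<phi> x = x" if h: "\<phi> \<in> inertia P (comp_field q S)" for \<phi>
  proof -
    have g: "\<phi> \<in> AbsGal" using h by (simp add: inertia_def[OF l P lP])
    have "\<phi> (of_nat n * x + of_int t) = of_nat n * \<phi> x + of_int t"
      using AbsGal_add[OF g, of "of_nat n * x" "of_int t"] AbsGal_mult[OF g, of "of_nat n" x]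
        af_algebraic[OF E xE] AbsGal_of_nat[OF g] AbsGal_of_int[OF g] algebraic_mult[of "of_nat n" x] by simp
    thus ?thesis using fx[OF h] n by simp
  qed
  thus ?thesis using S xE by (auto simp: unramified_part_def)
qed

lemma unramified_part_house:
  assumes p: "Factorial_Ring.prime p" and q: "q = p \<or> q = p\<^sup>2"
    and l: "Factorial_Ring.prime l" "l > q" and P: "alg_prime P" and lP: "of_nat l \<in> P"
    and x: "x \<in> totally_real_galois_compositum q" "algebraic_int x" "x \<notin> unramified_part q P"
    and N: "\<And>\<phi>. \<phi> \<in> AbsGal \<Longrightarrow> norm (\<phi> x) \<le> N"
  shows "real l \<le> (2 * N) ^ q"
proof -
  have q0: "q > 0" by (rule q_pos[OF p q])
  \<comment> \<open>A prime above \<open>q\<close> does not divide it, so that inertia is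
    tame.\<close>
  have "\<not> l dvd q" using l(2) q0 by (auto dest: dvd_imp_le)
  hence cop: "Rings.coprime l q" using l(1) by (metis prime_imp_coprime)
  obtain S where S: "finite S" "S \<subseteq> TRG q" "x \<in> qfield (\<Union>S)"
    using compositum_cover[OF p q x(1)] by blast
  note E = comp_field_abelian[OF p q S(1,2)]
  have xE: "x \<in> comp_field q S" using Union_field_subset[OF p q S(1,2)] S(3) by blast
  obtain \<phi> where \<phi>: "\<phi> \<in> inertia P (comp_field q S)" "\<phi> x \<noteq> x"
    using x(3) S xE by (auto simp: unramified_part_def)
  show ?thesis
  proof (rule inertia_house[OF l(1) P lP q0 cop E comp_field_mu[OF p q S(1,2)] _ \<phi>(1) xE x(2) \<phi>(2)])
    show "(\<psi> ^^ q) y = y"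
      if "\<psi> \<in> AbsGal" "\<And>z. z \<in> mu q \<Longrightarrow> \<psi> z = z" "y \<in> comp_field q S" for \<psi> y
      by (rule comp_field_exponent[OF p q S(1,2) that])
    show "norm (\<psi> x) \<le> N" if "\<psi> \<in> AbsGal" for \<psi> by (rule N[OF that])
  qed
qed

section \<open>The bilinear form on the lattice\<close>

context
  fixes K :: "complex set" and V :: "(complex, 'v) module" and \<Lambda> Q
  assumes K: "subfield K complex_ring" and lat: "integral_lattice K V \<Lambda> Q"
begin

text \<open>Twice the polar form: without the division by 2, the values on the lattice are algebraic
  integers.\<close>

definition bform :: "'v \<Rightarrow> 'v \<Rightarrow> complex" where
  "bform v w = Q (v \<oplus>\<^bsub>V\<^esub> w) - Q v - Q w"

lemma lattice_module: "module (complex_ring_on (ring_of_integers K)) V"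
  and lattice_subset: "\<Lambda> \<subseteq> carrier V"
  and lattice_add: "v \<in> \<Lambda> \<Longrightarrow> w \<in> \<Lambda> \<Longrightarrow> v \<oplus>\<^bsub>V\<^esub> w \<in> \<Lambda>"
  and lattice_smult: "c \<in> ring_of_integers K \<Longrightarrow> v \<in> \<Lambda> \<Longrightarrow> c \<odot>\<^bsub>V\<^esub> v \<in> \<Lambda>"
proof -
  have s: "LinearCombinations.submodule (complex_ring_on (ring_of_integers K)) \<Lambda> V"
    using lat by (simp add: integral_lattice_def quadratic_lattice_def integer_lattice_def)
  show "module (complex_ring_on (ring_of_integers K)) V" by (rule LinearCombinations.submodule.module[OF s])
  show "\<Lambda> \<subseteq> carrier V" by (rule LinearCombinations.submodule.subset[OF s])
  show "v \<in> \<Lambda> \<Longrightarrow> w \<in> \<Lambda> \<Longrightarrow> v \<oplus>\<^bsub>V\<^esub> w \<in> \<Lambda>" by (rule LinearCombinations.submodule.m_closed[OF s])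
  show "c \<in> ring_of_integers K \<Longrightarrow> v \<in> \<Lambda> \<Longrightarrow> c \<odot>\<^bsub>V\<^esub> v \<in> \<Lambda>"
    using LinearCombinations.submodule.smult_closed[OF s, of c v] by simp
qed

lemma Q_int: "v \<in> \<Lambda> \<Longrightarrow> Q v \<in> ring_of_integers K"
  using lat by (auto simp: integral_lattice_def)

lemma of_int_integers: "of_int n \<in> ring_of_integers K"
  using subfield_of_int[OF K] by (simp add: ring_of_integers_def)

lemma Q_smult: "a \<in> K \<Longrightarrow> v \<in> carrier V \<Longrightarrow> Q (a \<odot>\<^bsub>V\<^esub> v) = a\<^sup>2 * Q v"
  using lat by (simp add: integral_lattice_def quadratic_lattice_def quadratic_map_def)

lemma bform_add: "u \<in> carrier V \<Longrightarrow> v \<in> carrier V \<Longrightarrow> w \<in> carrier V \<Longrightarrow>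
    bform (u \<oplus>\<^bsub>V\<^esub> v) w = bform u w + bform v w"
  and bform_smult: "a \<in> K \<Longrightarrow> v \<in> carrier V \<Longrightarrow> w \<in> carrier V \<Longrightarrow> bform (a \<odot>\<^bsub>V\<^esub> v) w = a * bform v w"
proof -
  have b: "bform v w = 2 * polar_form V Q v w" for v w by (simp add: bform_def polar_form_def)
  have B: "bilinear_form K V (polar_form V Q)"
    using lat by (simp add: integral_lattice_def quadratic_lattice_def quadratic_map_def)
  show "u \<in> carrier V \<Longrightarrow> v \<in> carrier V \<Longrightarrow> w \<in> carrier V \<Longrightarrow>
    bform (u \<oplus>\<^bsub>V\<^esub> v) w = bform u w + bform v w"
    using B by (simp add: b bilinear_form_def)
  show "a \<in> K \<Longrightarrow> v \<in> carrier V \<Longrightarrow> w \<in> carrier V \<Longrightarrow> bform (a \<odot>\<^bsub>V\<^esub> v) w = a * bform v w"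
    using B by (simp add: b bilinear_form_def)
qed

lemma bform_commute: assumes "v \<in> carrier V" "w \<in> carrier V" shows "bform v w = bform w v"
proof -
  interpret module "complex_ring_on (ring_of_integers K)" V by (rule lattice_module)
  show ?thesis using M.add.m_comm[OF assms] by (simp add: bform_def)
qed

lemma bform_zero: assumes "w \<in> carrier V" shows "bform \<zero>\<^bsub>V\<^esub> w = 0"
proof -
  interpret module "complex_ring_on (ring_of_integers K)" V by (rule lattice_module)
  show ?thesis using bform_add[of "\<zero>\<^bsub>V\<^esub>" "\<zero>\<^bsub>V\<^esub>" w] assms by simp
qed

lemma Q_zero: "Q \<zero>\<^bsub>V\<^esub> = 0"
proof -
  interpret module "complex_ring_on (ring_of_integers K)" V by (rule lattice_module)
  show ?thesis using bform_zero[of "\<zero>\<^bsub>V\<^esub>"] by (simp add: bform_def)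
qed

lemma bform_diag: assumes v: "v \<in> carrier V" shows "bform v v = 2 * Q v"
proof -
  interpret module "complex_ring_on (ring_of_integers K)" V by (rule lattice_module)
  have one: "1 \<in> ring_of_integers K" using of_int_integers[of 1] by simp
  have "2 \<odot>\<^bsub>V\<^esub> v = v \<oplus>\<^bsub>V\<^esub> v"
    using smult_l_distr[of 1 1 v] smult_one[OF v] one v by (simp add: class_ring_simps)
  hence "Q (v \<oplus>\<^bsub>V\<^esub> v) = 2\<^sup>2 * Q v" using Q_smult[of 2 v] subfield_of_int[OF K, of 2] v by simp
  thus ?thesis by (simp add: bform_def)
qed

lemma bform_int: "v \<in> \<Lambda> \<Longrightarrow> w \<in> \<Lambda> \<Longrightarrow> bform v w \<in> ring_of_integers K"
  using Q_int[OF lattice_add, of v w] Q_int[of v] Q_int[of w] subfield_closed[OF K]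
  by (simp add: bform_def ring_of_integers_def algebraic_int_diff)

text \<open>Nonnegativity of the conjugates of these values will bound \<open>bform v w\<close>, in
  place of the Cauchy-Schwarz inequality.\<close>

lemma Q_pencil:
  assumes v: "v \<in> \<Lambda>" and w: "w \<in> \<Lambda>"
  shows "\<exists>x\<in>\<Lambda>. Q x = Q v + of_int n * bform v w + (of_int n)\<^sup>2 * Q w"
proof -
  interpret module "complex_ring_on (ring_of_integers K)" V by (rule lattice_module)
  have c: "v \<in> carrier V" "w \<in> carrier V" using v w lattice_subset by auto
  have nw: "of_int n \<odot>\<^bsub>V\<^esub> w \<in> \<Lambda>" by (rule lattice_smult[OF of_int_integers w])
  have c': "of_int n \<odot>\<^bsub>V\<^esub> w \<in> carrier V" using nw lattice_subset by auto
  have "bform v (of_int n \<odot>\<^bsub>V\<^esub> w) = of_int n * bform v w"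
    unfolding bform_commute[OF c(1) c'] bform_commute[OF c] by (rule bform_smult[OF subfield_of_int[OF K] c(2,1)])
  moreover have "Q (of_int n \<odot>\<^bsub>V\<^esub> w) = (of_int n)\<^sup>2 * Q w" by (rule Q_smult[OF subfield_of_int[OF K] c(2)])
  moreover have "Q (v \<oplus>\<^bsub>V\<^esub> of_int n \<odot>\<^bsub>V\<^esub> w) = Q v + bform v (of_int n \<odot>\<^bsub>V\<^esub> w) + Q (of_int n \<odot>\<^bsub>V\<^esub> w)"
    by (simp add: bform_def)
  ultimately show ?thesis using lattice_add[OF v nw] by auto
qed

lemma bform_lincomb:
  assumes "finite A" "A \<subseteq> carrier V" "a \<in> A \<rightarrow> ring_of_integers K" "w \<in> carrier V"
  shows "bform (\<Oplus>\<^bsub>V\<^esub>s\<in>A. a s \<odot>\<^bsub>V\<^esub> s) w = (\<Sum>s\<in>A. a s * bform s w)"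
proof -
  interpret module "complex_ring_on (ring_of_integers K)" V by (rule lattice_module)
  show ?thesis
    using assms
  proof (induction A rule: finite_induct)
    case empty
    thus ?case by (simp add: bform_zero)
  next
    case (insert s A)
    have f: "a t \<odot>\<^bsub>V\<^esub> t \<in> carrier V" if "t \<in> insert s A" for t
      using insert.prems that by (intro smult_closed) auto
    have "(\<Oplus>\<^bsub>V\<^esub>s\<in>insert s A. a s \<odot>\<^bsub>V\<^esub> s) = a s \<odot>\<^bsub>V\<^esub> s \<oplus>\<^bsub>V\<^esub> (\<Oplus>\<^bsub>V\<^esub>s\<in>A. a s \<odot>\<^bsub>V\<^esub> s)"
      using insert.hyps f by (intro M.finsum_insert) auto
    moreover have "(\<Oplus>\<^bsub>V\<^esub>s\<in>A. a s \<odot>\<^bsub>V\<^esub> s) \<in> carrier V" using f by (intro M.finsum_closed) auto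
    moreover have "bform (a s \<odot>\<^bsub>V\<^esub> s) w = a s * bform s w"
      using insert.prems by (intro bform_smult) (auto simp: ring_of_integers_def)
    ultimately show ?case using insert bform_add[OF f[of s], of "\<Oplus>\<^bsub>V\<^esub>s\<in>A. a s \<odot>\<^bsub>V\<^esub> s" w] by simp
  qed
qed

lemma lattice_generators:
  obtains S where "finite S" "S \<subseteq> \<Lambda>"
    "\<And>v. v \<in> \<Lambda> \<Longrightarrow> \<exists>a A. A \<subseteq> S \<and> a \<in> A \<rightarrow> ring_of_integers K \<and> v = (\<Oplus>\<^bsub>V\<^esub>s\<in>A. a s \<odot>\<^bsub>V\<^esub> s)"
proof -
  obtain S where S: "finite S" "S \<subseteq> \<Lambda>"
    "\<Lambda> = LinearCombinations.module.span (complex_ring_on (ring_of_integers K)) V S"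
    using lat by (auto simp: integral_lattice_def quadratic_lattice_def integer_lattice_def)
  show thesis
  proof (rule that[OF S(1,2)])
    fix v assume "v \<in> \<Lambda>"
    hence "v \<in> LinearCombinations.module.span (complex_ring_on (ring_of_integers K)) V S" using S(3) by simp
    thus "\<exists>a A. A \<subseteq> S \<and> a \<in> A \<rightarrow> ring_of_integers K \<and> v = (\<Oplus>\<^bsub>V\<^esub>s\<in>A. a s \<odot>\<^bsub>V\<^esub> s)"
      unfolding LinearCombinations.module.span_def[OF lattice_module] LinearCombinations.module.lincomb_def[OF lattice_module]
      by auto
  qed
qed

end

lemma compositum_real:
  assumes p: "Factorial_Ring.prime p" and q: "q = p \<or> q = p\<^sup>2"
    and x: "x \<in> totally_real_galois_compositum q" and \<phi>: "\<phi> \<in> AbsGal"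
  shows "\<phi> x \<in> \<real>"
proof -
  obtain S where S: "finite S" "S \<subseteq> TRG q" "x \<in> qfield (\<Union>S)" using compositum_cover[OF p q x] by blast
  have "cnj (\<phi> x) = \<phi> x"
  proof (rule qfieldD[OF S(3) AbsGal_comp[OF AbsGal_cnj \<phi>] \<phi>])
    fix y assume "y \<in> \<Union>S"
    then obtain F where F: "F \<in> TRG q" "y \<in> F" using S(2) by blast
    have "\<phi> y \<in> \<real>" by (rule TRG_real[OF p q F(1) TRG_stable[OF p q F(1) \<phi> F(2)]])
    thus "cnj (\<phi> y) = \<phi> y" by (simp add: Reals_cnj_iff)
  qed
  thus ?thesis by (simp add: Reals_cnj_iff)
qed

text \<open>An automorphism that fixes the Gram matrix \<open>g\<close> and the inner products \<open>b\<close> of a vector with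
  the generators fixes the norm of that vector, although it may move its coordinates \<open>a\<close>.\<close>

lemma AbsGal_fixes_norm:
  assumes \<phi>: "\<phi> \<in> AbsGal" and a: "\<And>s. s \<in> A \<Longrightarrow> algebraic (a s)"
    and g: "\<And>s t. s \<in> A \<Longrightarrow> t \<in> A \<Longrightarrow> algebraic (g s t) \<and> \<phi> (g s t) = g s t \<and> g s t = g t s"
    and b: "\<And>s. s \<in> A \<Longrightarrow> algebraic (b s) \<and> \<phi> (b s) = b s \<and> b s = (\<Sum>t\<in>A. a t * g t s)"
  shows "\<phi> (\<Sum>s\<in>A. a s * b s) = (\<Sum>s\<in>A. a s * b s)"
proof -
  have ba: "algebraic (b s)" if "s \<in> A" for s using b[OF that] by blast
  have "\<phi> (\<Sum>s\<in>A. a s * b s) = (\<Sum>s\<in>A. \<phi> (a s * b s))"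
    by (rule AbsGal_sum[OF \<phi>], rule algebraic_mult[OF a ba])
  also have "\<dots> = (\<Sum>s\<in>A. \<phi> (a s) * (\<Sum>t\<in>A. a t * g t s))"
  proof (rule sum.cong[OF refl])
    fix s assume s: "s \<in> A"
    have "\<phi> (a s * b s) = \<phi> (a s) * \<phi> (b s)" by (rule AbsGal_mult[OF \<phi> a[OF s] ba[OF s]])
    also have "\<phi> (b s) = (\<Sum>t\<in>A. a t * g t s)" using b[OF s] by metis
    finally show "\<phi> (a s * b s) = \<phi> (a s) * (\<Sum>t\<in>A. a t * g t s)" .
  qed
  \<comment> \<open>The sum is now the Gram pairing of \<open>a\<close> with its image under
    \<open>\<phi>\<close>. By symmetry it can be regrouped so that \<open>\<phi>\<close> acts on an
    inner product, which it fixes.\<close>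
  also have "\<dots> = (\<Sum>t\<in>A. a t * (\<Sum>s\<in>A. \<phi> (a s) * g t s))"
    unfolding sum_distrib_left by (subst sum.swap) (simp add: mult_ac)
  also have "\<dots> = (\<Sum>t\<in>A. a t * b t)"
  proof (rule sum.cong[OF refl])
    fix t assume t: "t \<in> A"
    have "(\<Sum>s\<in>A. \<phi> (a s) * g t s) = (\<Sum>s\<in>A. \<phi> (a s * g s t))"
    proof (rule sum.cong[OF refl])
      fix s assume s: "s \<in> A"
      show "\<phi> (a s) * g t s = \<phi> (a s * g s t)"
        using AbsGal_mult[OF \<phi> a[OF s], of "g s t"] g[OF s t] by metis
    qed
    also have "\<dots> = \<phi> (\<Sum>s\<in>A. a s * g s t)"
      by (rule AbsGal_sum[OF \<phi>, symmetric], rule algebraic_mult) (use a g t in auto)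
    also have "(\<Sum>s\<in>A. a s * g s t) = b t" using b[OF t] by simp
    also have "\<phi> (b t) = b t" using b[OF t] by blast
    finally show "a t * (\<Sum>s\<in>A. \<phi> (a s) * g t s) = a t * b t" by simp
  qed
  finally show ?thesis .
qed

theorem theorem1p1:
  fixes p q :: nat and K :: "complex set"
  assumes "Factorial_Ring.prime p"
    and "q = p \<or> q = p\<^sup>2"
    and "subfield K complex_ring"
    and "\<rat> \<subseteq> K"
    and "K \<subseteq> totally_real_galois_compositum q"
    and "\<not> ring.finite_dimension complex_ring \<rat> K"
  shows "\<not> (\<exists>(V :: (complex, 'v) module) \<Lambda> Q. universal_lattice K V \<Lambda> Q)"
proof
  note p = assms(1) and q = assms(2) and K = assms(3) and KC = assms(5)
  assume "\<exists>(V :: (complex, 'v) module) \<Lambda> Q. universal_lattice K V \<Lambda> Q"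
  then obtain V :: "(complex, 'v) module" and \<Lambda> Q where
    univ: "universal_lattice K V \<Lambda> Q" by blast
  hence lat: "integral_lattice K V \<Lambda> Q"
    and pos: "\<And>v. v \<in> \<Lambda> \<Longrightarrow> v \<noteq> \<zero>\<^bsub>V\<^esub> \<Longrightarrow> totally_positive (Q v)"
    and rep: "\<And>d. d \<in> ring_of_integers K \<Longrightarrow> totally_positive d \<Longrightarrow> \<exists>v\<in>\<Lambda>. Q v = d"
    by (auto simp: universal_lattice_def positive_definite_lattice_def)
  define B where "B = bform V Q"
  have OK: "x \<in> K" "algebraic_int x" if "x \<in> ring_of_integers K" for x
    using that by (auto simp: ring_of_integers_def)
  have Kreal: "\<phi> x \<in> \<real>" if "x \<in> K" "\<phi> \<in> AbsGal" for x \<phi>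
    by (rule compositum_real[OF p q subsetD[OF KC that(1)] that(2)])
  have Kalg: "algebraic x" if "x \<in> K" for x
    using compositum_cover[OF p q subsetD[OF KC that]] qfield_algebraic by blast
  have Qnn: "Re (\<phi> (Q v)) \<ge> 0" if "v \<in> \<Lambda>" "\<phi> \<in> AbsGal" for v \<phi>
  proof (cases "v = \<zero>\<^bsub>V\<^esub>")
    case True
    thus ?thesis using Q_zero[OF K lat] AbsGal_0[OF that(2)] by simp
  next
    case False
    thus ?thesis using pos[OF that(1)] that(2) by (force simp: totally_positive_iff)
  qed
  obtain S where S: "finite S" "S \<subseteq> \<Lambda>"
    and gen: "\<And>v. v \<in> \<Lambda> \<Longrightarrow> \<exists>a A. A \<subseteq> S \<and> a \<in> A \<rightarrow> ring_of_integers K \<and> v = (\<Oplus>\<^bsub>V\<^esub>s\<in>A. a s \<odot>\<^bsub>V\<^esub> s)"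
    using lattice_generators[OF K lat] by metis
  have BO: "B v w \<in> ring_of_integers K" if "v \<in> \<Lambda>" "w \<in> \<Lambda>" for v w
    unfolding B_def by (rule bform_int[OF K lat that])
  have QO: "Q v \<in> ring_of_integers K" if "v \<in> \<Lambda>" for v by (rule Q_int[OF K lat that])
  define D0 where "D0 = Q ` S \<union> (\<lambda>(s, t). B s t) ` (S \<times> S)"
  have "finite D0" using S(1) by (simp add: D0_def)
  moreover have "algebraic x" if "x \<in> D0" for x
  proof -
    have "x \<in> ring_of_integers K" using that subsetD[OF S(2)] QO BO by (auto simp: D0_def)
    thus ?thesis by (rule Kalg[OF OK(1)])
  qed
  ultimately have "\<exists>C::nat. \<forall>x\<in>D0. \<forall>\<phi>\<in>AbsGal. norm (\<phi> x) \<le> C" by (rule house_bound)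
  then obtain C :: nat where C: "\<forall>x\<in>D0. \<forall>\<phi>\<in>AbsGal. norm (\<phi> x) \<le> C" ..
  have CQ: "norm (\<phi> (Q s)) \<le> C" if "s \<in> S" "\<phi> \<in> AbsGal" for s \<phi> using C that by (auto simp: D0_def)
  have CB: "norm (\<phi> (B s t)) \<le> C" if "s \<in> S" "t \<in> S" "\<phi> \<in> AbsGal" for s t \<phi>
    using C that by (auto simp: D0_def)
  \<comment> \<open>The summand 6 accounts for the factor 64 in \<open>kC\<close>, and the rest is
    \<open>C < 2 ^ C\<close>.\<close>
  define k0 where "k0 = C + 6"
  have "\<forall>l. \<exists>P. Factorial_Ring.prime l \<longrightarrow> alg_prime P \<and> of_nat l \<in> P"
    using alg_prime_exists prime_gt_1_nat by blast
  from choice[OF this] obtain P where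
    P: "\<And>l. Factorial_Ring.prime l \<Longrightarrow> alg_prime (P l) \<and> of_nat l \<in> P l" by blast
  \<comment> \<open>An integer of \<open>K\<close> outside the unramified part with conjugates at
    most \<open>2 ^ k\<close> forces \<open>l \<le> (2 * 2 ^ k) ^ q\<close>; this choice of
    \<open>l\<close> therefore excludes \<open>k \<le> k0\<close>. The summand \<open>q\<close>
    keeps inertia tame.\<close>
  obtain l where l: "Factorial_Ring.prime l" "l > q + (2 * 2 ^ k0) ^ q" and KU: "\<not> K \<subseteq> unramified_part q (P l)"
    using ramified_prime_exists[OF p q K KC assms(6) P] by blast
  define U where "U = unramified_part q (P l)"
  have Pl: "alg_prime (P l)" "of_nat l \<in> P l" using P[OF l(1)] by auto
  \<comment> \<open>Sizes are measured on the discrete scale of powers of 2, so that a least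
    \<open>k\<close> exists; being minimal up to a factor 2 is enough.\<close>
  define good where "good = (\<lambda>k::nat. \<exists>\<alpha>\<in>ring_of_integers K. totally_positive \<alpha> \<and> \<alpha> \<notin> U \<and>
    (\<forall>\<phi>\<in>AbsGal. norm (\<phi> \<alpha>) \<le> 2 ^ k))"
  \<comment> \<open>Translation by a natural number above all conjugates produces total positivity
    at the cost of a factor 2 in size; by \<open>affine\<close> it does not lead into
    \<open>U\<close>.\<close>
  have shift: "\<exists>\<alpha>. \<alpha> = y + of_nat n \<and> \<alpha> \<in> ring_of_integers K \<and> totally_positive \<alpha> \<and>
      (\<forall>\<phi>\<in>AbsGal. norm (\<phi> \<alpha>) \<le> 2 * real n)"
    if y: "y \<in> ring_of_integers K" and n: "\<forall>\<phi>\<in>AbsGal. norm (\<phi> y) < real n" for y n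
  proof -
    have yK: "y \<in> K" "algebraic_int y" using OK[OF y] by auto
    have "y + of_nat n \<in> ring_of_integers K"
      using yK subfield_closed(3)[OF K yK(1) subfield_of_nat[OF K, of n]]
      by (simp add: ring_of_integers_def algebraic_int_add)
    moreover have \<phi>y: "\<phi> (y + of_nat n) = \<phi> y + of_nat n" if "\<phi> \<in> AbsGal" for \<phi>
      using AbsGal_add[OF that Kalg[OF yK(1)], of "of_nat n"] AbsGal_of_nat[OF that] by simp
    moreover have "totally_positive (y + of_nat n)"
      unfolding totally_positive_iff
    proof (intro conjI ballI)
      show "algebraic (y + of_nat n)" using Kalg OK(1) calculation(1) by blast
      fix \<phi> assume \<phi>: "\<phi> \<in> AbsGal"
      show "\<phi> (y + of_nat n) \<in> \<real>" unfolding \<phi>y[OF \<phi>] using Kreal[OF yK(1) \<phi>] by simp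
      have "\<bar>Re (\<phi> y)\<bar> < real n" using abs_Re_le_cmod[of "\<phi> y"] bspec[OF n \<phi>] by linarith
      thus "0 < Re (\<phi> (y + of_nat n))" unfolding \<phi>y[OF \<phi>] by simp
    qed
    moreover have "norm (\<phi> (y + of_nat n)) \<le> 2 * real n" if \<phi>: "\<phi> \<in> AbsGal" for \<phi>
      unfolding \<phi>y[OF \<phi>] using norm_triangle_ineq[of "\<phi> y" "of_nat n"] bspec[OF n \<phi>] by simp
    ultimately show ?thesis by blast
  qed
  have affine: "x \<in> U" if "of_nat m * x + of_nat n \<in> U" "m > 0" for x m n
    using unramified_part_affine[OF p q l(1) Pl, of m x "int n"] that by (simp add: U_def)
  have "\<exists>k. good k"
  proof -
    obtain x where x: "x \<in> K" "x \<notin> U" using KU by (auto simp: U_def)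
    obtain m :: nat where m: "m > 0" "algebraic_int (of_nat m * x)"
      using algebraic_imp_multiple_algebraic_int[OF Kalg[OF x(1)]] by blast
    have y: "of_nat m * x \<in> ring_of_integers K"
      using m(2) subfield_closed(4)[OF K subfield_of_nat[OF K] x(1)] by (simp add: ring_of_integers_def)
    obtain n :: nat where n: "\<forall>\<phi>\<in>AbsGal. norm (\<phi> (of_nat m * x)) \<le> real n"
      using house_bound[of "{of_nat m * x}"] Kalg[OF OK(1)[OF y]] by auto
    hence n': "\<forall>\<phi>\<in>AbsGal. norm (\<phi> (of_nat m * x)) < real (Suc n)" by force
    obtain \<alpha> where \<alpha>: "\<alpha> = of_nat m * x + of_nat (Suc n)" "\<alpha> \<in> ring_of_integers K" "totally_positive \<alpha>"
      "\<forall>\<phi>\<in>AbsGal. norm (\<phi> \<alpha>) \<le> 2 * real (Suc n)"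
      using shift[OF y n'] by blast
    have "\<alpha> \<notin> U" using affine[of m x "Suc n"] m(1) x(2) \<alpha>(1) by auto
    moreover have "2 * real (Suc n) \<le> 2 ^ (2 * Suc n)"
      using of_nat_less_two_power[of "2 * Suc n", where 'a = real] by simp
    ultimately have "good (2 * Suc n)" unfolding good_def using \<alpha> by (meson order_trans)
    thus ?thesis by blast
  qed
  then obtain k where k: "good k" and kmin: "\<And>j. j < k \<Longrightarrow> \<not> good j"
    using exists_least_iff[of good] by blast
  obtain \<alpha> where \<alpha>: "\<alpha> \<in> ring_of_integers K" "totally_positive \<alpha>" "\<alpha> \<notin> U"
    and \<alpha>k: "\<And>\<phi>. \<phi> \<in> AbsGal \<Longrightarrow> norm (\<phi> \<alpha>) \<le> 2 ^ k" using k by (auto simp: good_def)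
  have kk0: "k > k0"
  proof (rule ccontr)
    assume "\<not> k > k0"
    hence "(2 * 2 ^ k :: real) ^ q \<le> (2 * 2 ^ k0) ^ q"
      by (intro power_mono mult_left_mono power_increasing) auto
    moreover have "real l \<le> (2 * 2 ^ k) ^ q"
      using l(2) KC OK[OF \<alpha>(1)] \<alpha>(3) \<alpha>k
      by (intro unramified_part_house[OF p q l(1) _ Pl, of \<alpha>]) (auto simp: U_def)
    ultimately have "real l \<le> (2 * 2 ^ k0) ^ q" by linarith
    also have "\<dots> = real ((2 * 2 ^ k0) ^ q)" by simp
    finally have "l \<le> (2 * 2 ^ k0) ^ q" by (simp only: of_nat_le_iff)
    thus False using l(2) by simp
  qed
  have kC: "64 * real C < 2 ^ k"
  proof -
    have "64 * real C < 64 * 2 ^ C" using of_nat_less_two_power[of C, where 'a = real] by simp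
    also have "\<dots> = 2 ^ k0" by (simp add: k0_def power_add)
    also have "\<dots> \<le> 2 ^ k" using kk0 by (intro power_increasing) auto
    finally show ?thesis .
  qed
  have k2: "k = Suc (Suc (k - 2))" using kk0 by (simp add: k0_def)
  \<comment> \<open>An integer this small outside \<open>U\<close> could be translated by
    \<open>2 ^ (k - 2)\<close> to a totally positive one of size at most \<open>2 ^ (k - 1)\<close>,
    against the minimality of \<open>k\<close>. Hence the threshold
    \<open>2 ^ k / 4\<close>.\<close>
  have small: "\<beta> \<in> U" if \<beta>: "\<beta> \<in> ring_of_integers K" "\<And>\<phi>. \<phi> \<in> AbsGal \<Longrightarrow> norm (\<phi> \<beta>) < 2 ^ k / 4" for \<beta>
  proof (rule ccontr)
    assume nU: "\<beta> \<notin> U"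
    define n :: nat where "n = 2 ^ (k - 2)"
    have n4: "real n = 2 ^ k / 4" unfolding n_def by (subst (2) k2) simp
    have "\<forall>\<phi>\<in>AbsGal. norm (\<phi> \<beta>) < real n" unfolding n4 using \<beta>(2) by blast
    then obtain \<gamma> where \<gamma>: "\<gamma> = \<beta> + of_nat n" "\<gamma> \<in> ring_of_integers K" "totally_positive \<gamma>"
      "\<forall>\<phi>\<in>AbsGal. norm (\<phi> \<gamma>) \<le> 2 * real n"
      using shift[OF \<beta>(1)] by blast
    have "\<gamma> \<notin> U" using affine[of 1 \<beta> n] nU \<gamma>(1) by auto
    moreover have "2 * real n = 2 ^ (k - 1)" unfolding n_def by (subst (2) k2) simp
    ultimately have "good (k - 1)" unfolding good_def using \<gamma> by auto
    thus False using kmin[of "k - 1"] kk0 by simp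
  qed
  obtain v where v: "v \<in> \<Lambda>" "Q v = \<alpha>" using rep[OF \<alpha>(1,2)] by blast
  have bU: "B v s \<in> U" if s: "s \<in> S" for s
  proof (rule small)
    have s\<Lambda>: "s \<in> \<Lambda>" using s S(2) by blast
    show b: "B v s \<in> ring_of_integers K" by (rule BO[OF v(1) s\<Lambda>])
    fix \<phi> assume \<phi>: "\<phi> \<in> AbsGal"
    have "Re (\<phi> \<alpha>) + of_int n * Re (\<phi> (B v s)) + (of_int n)\<^sup>2 * Re (\<phi> (Q s)) \<ge> 0" for n :: int
    proof -
      obtain x where x: "x \<in> \<Lambda>" "Q x = \<alpha> + of_int n * B v s + (of_int n)\<^sup>2 * Q s"
        using Q_pencil[OF K lat v(1) s\<Lambda>, of n] v(2) by (auto simp: B_def)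
      note alg = Kalg[OF OK(1)[OF \<alpha>(1)]] Kalg[OF OK(1)[OF b]] Kalg[OF OK(1)[OF QO[OF s\<Lambda>]]]
      have an: "algebraic (of_int n * B v s)" "algebraic ((of_int n)\<^sup>2 * Q s)"
        using alg by (simp_all add: algebraic_mult algebraic_power)
      have "\<phi> (Q x) = \<phi> \<alpha> + \<phi> (of_int n * B v s) + \<phi> ((of_int n)\<^sup>2 * Q s)"
        unfolding x(2) using AbsGal_add[OF \<phi>] alg an algebraic_add by simp
      also have "\<phi> (of_int n * B v s) = of_int n * \<phi> (B v s)"
        using AbsGal_mult[OF \<phi> _ alg(2), of "of_int n"] AbsGal_of_int[OF \<phi>] by simp
      also have "\<phi> ((of_int n)\<^sup>2 * Q s) = of_int (n\<^sup>2) * \<phi> (Q s)"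
        using AbsGal_mult[OF \<phi> _ alg(3), of "of_int (n\<^sup>2)"] AbsGal_of_int[OF \<phi>, of "n\<^sup>2"]
          algebraic_power[of "of_int n" 2] by simp
      finally show ?thesis using Qnn[OF x(1) \<phi>] by simp
    qed
    \<comment> \<open>Both signs bound the absolute value by 2^k / 8 + 8 C, and 8 C is below 2^k / 8
      by \<open>kC\<close>; the total stays under the threshold 2^k / 4 of
      \<open>small\<close>.\<close>
    from this[of 8] this[of "-8"]
    have "8 * \<bar>Re (\<phi> (B v s))\<bar> \<le> Re (\<phi> \<alpha>) + 64 * Re (\<phi> (Q s))" by simp
    moreover have "Re (\<phi> \<alpha>) \<le> 2 ^ k" using complex_Re_le_cmod[of "\<phi> \<alpha>"] \<alpha>k[OF \<phi>] by linarith
    moreover have "Re (\<phi> (Q s)) \<le> C" using complex_Re_le_cmod[of "\<phi> (Q s)"] CQ[OF s \<phi>] by linarith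
    moreover have "norm (\<phi> (B v s)) = \<bar>Re (\<phi> (B v s))\<bar>"
      using Kreal[OF OK(1)[OF b] \<phi>] by (auto elim: Reals_cases)
    ultimately show "norm (\<phi> (B v s)) < 2 ^ k / 4" using kC by linarith
  qed
  have gU: "B s t \<in> U" if st: "s \<in> S" "t \<in> S" for s t
  proof (rule small)
    show "B s t \<in> ring_of_integers K" using st S(2) by (intro BO) auto
    show "norm (\<phi> (B s t)) < 2 ^ k / 4" if \<phi>: "\<phi> \<in> AbsGal" for \<phi>
      using CB[OF st \<phi>] kC by linarith
  qed
  obtain a A where A: "A \<subseteq> S" "a \<in> A \<rightarrow> ring_of_integers K" and va: "v = (\<Oplus>\<^bsub>V\<^esub>s\<in>A. a s \<odot>\<^bsub>V\<^esub> s)"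
    using gen[OF v(1)] by blast
  have fA: "finite A" using A(1) S(1) by (rule finite_subset)
  have car: "\<Lambda> \<subseteq> carrier V" by (rule lattice_subset[OF K lat])
  have vc: "v \<in> carrier V" using v(1) car by blast
  have Ac: "A \<subseteq> carrier V" using A(1) S(2) car by blast
  have lin: "B v w = (\<Sum>s\<in>A. a s * B s w)" if "w \<in> carrier V" for w
    using bform_lincomb[OF K lat fA Ac A(2) that] by (simp add: B_def va[symmetric])
  have sym: "B x y = B y x" if "x \<in> carrier V" "y \<in> carrier V" for x y
    unfolding B_def by (rule bform_commute[OF K lat that])
  have \<alpha>2: "2 * \<alpha> = (\<Sum>s\<in>A. a s * B v s)"
  proof -
    have "2 * \<alpha> = B v v" using bform_diag[OF K lat vc] v(2) by (simp add: B_def)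
    also have "\<dots> = (\<Sum>s\<in>A. a s * B s v)" by (rule lin[OF vc])
    also have "\<dots> = (\<Sum>s\<in>A. a s * B v s)" using sym[OF vc] Ac by (intro sum.cong) auto
    finally show ?thesis .
  qed
  define D where "D = B v ` A \<union> (\<lambda>(s, t). B s t) ` (A \<times> A)"
  have D: "finite D" "D \<subseteq> unramified_part q (P l)"
    using fA bU gU A(1) by (auto simp: D_def U_def[symmetric])
  obtain S1 where S1: "finite S1" "S1 \<subseteq> TRG q" "D \<subseteq> fixI (P l) (comp_field q S1)"
    using unramified_part_finite[OF p q l(1) Pl D] by blast
  obtain S2 where S2: "finite S2" "S2 \<subseteq> TRG q" "\<alpha> \<in> qfield (\<Union>S2)"
    using compositum_cover[OF p q subsetD[OF KC OK(1)[OF \<alpha>(1)]]] by blast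
  \<comment> \<open>\<open>\<alpha>\<close> may need a larger compositum than the inner products do;
    inertia for the union is also inertia for \<open>S1\<close>, so it still fixes them.\<close>
  note mono = comp_field_mono[OF p q, of _ "S1 \<union> S2"]
  have \<alpha>E: "\<alpha> \<in> comp_field q (S1 \<union> S2)"
    using Union_field_subset[OF p q S2(1,2)] S2(3) mono[of S2] by blast
  have "\<phi> \<alpha> = \<alpha>" if \<phi>: "\<phi> \<in> inertia (P l) (comp_field q (S1 \<union> S2))" for \<phi>
  proof -
    have \<phi>g: "\<phi> \<in> AbsGal" using \<phi> by (simp add: inertia_def[OF l(1) Pl])
    have "\<phi> \<in> inertia (P l) (comp_field q S1)" using inertia_mono[OF l(1) Pl mono[of S1]] \<phi> by auto
    hence fx: "\<phi> x = x" if "x \<in> D" for x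
      using subsetD[OF S1(3) that] by (simp add: fixI_def[OF l(1) Pl comp_field_abelian[OF p q S1(1,2)]])
    have DK: "algebraic x" if "x \<in> D" for x
    proof -
      have "x \<in> ring_of_integers K" using that subsetD[OF subset_trans[OF A(1) S(2)]] v(1) BO by (auto simp: D_def)
      thus ?thesis by (rule Kalg[OF OK(1)])
    qed
    have "\<phi> (\<Sum>s\<in>A. a s * B v s) = (\<Sum>s\<in>A. a s * B v s)"
    proof (rule AbsGal_fixes_norm[OF \<phi>g])
      show "algebraic (a s)" if "s \<in> A" for s using A(2) that Kalg OK(1) by (auto simp: Pi_iff)
      show "algebraic (B s t) \<and> \<phi> (B s t) = B s t \<and> B s t = B t s" if "s \<in> A" "t \<in> A" for s t
      proof -
        have "B s t \<in> D" using that by (auto simp: D_def)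
        thus ?thesis using fx DK sym Ac that by blast
      qed
      show "algebraic (B v s) \<and> \<phi> (B v s) = B v s \<and> B v s = (\<Sum>t\<in>A. a t * B t s)" if "s \<in> A" for s
      proof -
        have "B v s \<in> D" using that by (auto simp: D_def)
        thus ?thesis using fx DK lin Ac that by blast
      qed
    qed
    hence "\<phi> (2 * \<alpha>) = 2 * \<alpha>" by (simp only: \<alpha>2)
    thus ?thesis
      using AbsGal_mult[OF \<phi>g _ Kalg[OF OK(1)[OF \<alpha>(1)]], of "of_int 2"] AbsGal_of_int[OF \<phi>g, of 2] by simp
  qed
  hence "\<alpha> \<in> U" using S1 S2 \<alpha>E by (auto simp: U_def unramified_part_def)
  thus False using \<alpha>(3) by simp
qed

end
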